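(* For $r\in\{5,6\}$ let $\mathds{T}_r$ be the $r$-graph on $[2r-1]$ with edges $\{1,\dots,r-1,r\}$, $\{1,\dots,r-1,r+1\}$, $\{r,r+1,\dots,2r-1\}$. There exist constants $N_0$ and $c>0$ such that for all integers $n\ge N_0$ and all integers $t\in[0,cn]$ we have \[ \mathrm{EX}(n,(t+1)\mathds{T}_r)=\{K_t^r\bowtie\mathds{W}_r(n-t)\}. \]
   Context: $\mathds{W}_5$ is the unique $5$-graph on $11$ vertices in which every $4$-set of vertices lies in exactly one edge; $\mathds{W}_6$ is the unique $6$-graph on $12$ vertices in which every $5$-set lies in exactly one edge. For an $r$-graph $W$ on vertex set $[k]$, a $W$-construction on a set $V$ is an $r$-graph obtained from a partition $V=V_1\cup\dots\cup V_k$ by taking as edges all $r$-subsets $X$ of $V$ that meet $r$ distinct parts $V_{i_1},\dots,V_{i_r}$ with $\{i_1,\dots,i_r\}\in W$. $\mathds{W}_r(n)$ denotes the $n$-vertex $\mathds{W}_r$-construction with the maximum number of edges. $K_t^r$ is the complete $r$-graph on $t$ vertices; for $r$-graphs on disjoint vertex sets, $\mathcal{G}\bowtie\mathcal{H}$ consists of the edges of both plus all $r$-subsets meeting both vertex sets. $\mathrm{EX}(n,(t+1)F)$ is the set (up to isomorphism) of $n$-vertex $r$-graphs not containing $t+1$ pairwise vertex-disjoint copies of $F$ with the maximum number of edges among such. *)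

theory Defs
  imports Complex_Main "HOL-Library.Disjoint_Sets"
begin

datatype 'a hypergraph = Hypergraph (verts: "'a set") (edges: "'a set set")

definition is_rgraph :: "nat \<Rightarrow> 'a hypergraph \<Rightarrow> bool" where
  "is_rgraph r G \<longleftrightarrow>
     finite (verts G) \<and> (\<forall>X \<in> edges G. X \<subseteq> verts G \<and> card X = r)"

definition hg_iso :: "'a hypergraph \<Rightarrow> 'b hypergraph \<Rightarrow> bool" where
  "hg_iso G H \<longleftrightarrow>
     (\<exists>f. bij_betw f (verts G) (verts H) \<and> (\<lambda>X. f ` X) ` edges G = edges H)"

text \<open>The isomorphism type of an \<open>r\<close>-graph, represented by all its copies with vertices
  in \<open>nat\<close>.  Only well-formed copies are admitted, since \<open>hg_iso\<close> says nothing sensible about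
  hypergraphs having edges that leave the vertex set.\<close>

definition iso_class :: "nat \<Rightarrow> 'a hypergraph \<Rightarrow> nat hypergraph set" where
  "iso_class r G = {H. is_rgraph r H \<and> hg_iso G H}"

definition is_copy :: "('a \<Rightarrow> 'b) \<Rightarrow> 'a hypergraph \<Rightarrow> 'b hypergraph \<Rightarrow> bool" where
  "is_copy f F G \<longleftrightarrow>
     inj_on f (verts F) \<and> f ` verts F \<subseteq> verts G \<and> (\<forall>X \<in> edges F. f ` X \<in> edges G)"

definition has_disjoint_copies :: "nat \<Rightarrow> 'a hypergraph \<Rightarrow> 'b hypergraph \<Rightarrow> bool" where
  "has_disjoint_copies k F G \<longleftrightarrow>
     (\<exists>f. (\<forall>i<k. is_copy (f i) F G) \<and> disjoint_family_on (\<lambda>i. f i ` verts F) {..<k})"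

definition disjoint_copies_free ::
    "nat \<Rightarrow> nat \<Rightarrow> nat \<Rightarrow> 'a hypergraph \<Rightarrow> nat hypergraph set" where
  "disjoint_copies_free r n k F =
     {G. is_rgraph r G \<and> card (verts G) = n \<and> \<not> has_disjoint_copies k F G}"

text \<open>\<open>Extremal r n k F\<close> is the set of isomorphism types of \<open>n\<close>-vertex \<open>r\<close>-graphs that are extremal
  for \<open>k\<close> pairwise vertex-disjoint copies of \<open>F\<close>.\<close>

definition Extremal :: "nat \<Rightarrow> nat \<Rightarrow> nat \<Rightarrow> 'a hypergraph \<Rightarrow> nat hypergraph set set" where
  "Extremal r n k F = iso_class r `
     {G \<in> disjoint_copies_free r n k F.
        \<forall>H \<in> disjoint_copies_free r n k F. card (edges H) \<le> card (edges G)}"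

definition complete_rgraph :: "nat \<Rightarrow> nat \<Rightarrow> nat hypergraph" where
  "complete_rgraph r t = Hypergraph {1..t} {X. X \<subseteq> {1..t} \<and> card X = r}"

text \<open>The vertex sets are made disjoint by passing to the sum type.\<close>

definition join :: "nat \<Rightarrow> 'a hypergraph \<Rightarrow> 'b hypergraph \<Rightarrow> ('a + 'b) hypergraph" where
  "join r G H = Hypergraph (verts G <+> verts H)
     ((\<lambda>X. Inl ` X) ` edges G \<union> (\<lambda>X. Inr ` X) ` edges H \<union>
      {X. X \<subseteq> verts G <+> verts H \<and> card X = r \<and>
          X \<inter> Inl ` verts G \<noteq> {} \<and> X \<inter> Inr ` verts H \<noteq> {}})"

definition is_steiner_system :: "nat \<Rightarrow> nat \<Rightarrow> nat \<Rightarrow> nat hypergraph \<Rightarrow> bool" where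
  "is_steiner_system s r k G \<longleftrightarrow>
     is_rgraph r G \<and> verts G = {1..k} \<and>
     (\<forall>S. S \<subseteq> {1..k} \<and> card S = s \<longrightarrow> (\<exists>!X. X \<in> edges G \<and> S \<subseteq> X))"

text \<open>These Steiner systems exist and are unique only up to isomorphism (Witt), so
  a representative with vertex set \<open>{1..k}\<close> is chosen.\<close>

definition W5 :: "nat hypergraph" where
  "W5 = (SOME G. is_steiner_system 4 5 11 G)"

definition W6 :: "nat hypergraph" where
  "W6 = (SOME G. is_steiner_system 5 6 12 G)"

text \<open>Only the values at \<open>r = 5\<close> and \<open>r = 6\<close> are meaningful.\<close>

definition W :: "nat \<Rightarrow> nat hypergraph" where
  "W r = (if r = 5 then W5 else W6)"

text \<open>Empty parts are allowed.  As edges of the pattern \<open>A\<close> have \<open>r\<close> elements, an edge of the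
  construction contains exactly one vertex from each part that it meets.\<close>

definition is_construction :: "nat \<Rightarrow> 'b hypergraph \<Rightarrow> 'a hypergraph \<Rightarrow> bool" where
  "is_construction r A G \<longleftrightarrow>
     (\<exists>P. disjoint_family_on P (verts A) \<and> (\<Union>i \<in> verts A. P i) = verts G \<and>
        edges G = {X. X \<subseteq> verts G \<and> card X = r \<and>
                      {i \<in> verts A. X \<inter> P i \<noteq> {}} \<in> edges A})"

definition is_max_construction :: "nat \<Rightarrow> 'b hypergraph \<Rightarrow> nat \<Rightarrow> nat hypergraph \<Rightarrow> bool" where
  "is_max_construction r A n G \<longleftrightarrow>
     verts G = {1..n} \<and> is_construction r A G \<and>
     (\<forall>H :: nat hypergraph. verts H = {1..n} \<and> is_construction r A H \<longrightarrow>
        card (edges H) \<le> card (edges G))"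

text \<open>The choice is immaterial: the isomorphism type of the maximum construction is unique
  in the range where the theorem applies, and this is part of what the theorem asserts.\<close>

definition W_max :: "nat \<Rightarrow> nat \<Rightarrow> nat hypergraph" where
  "W_max r n = (SOME G. is_max_construction r (W r) n G)"

definition T :: "nat \<Rightarrow> nat hypergraph" where
  "T r = Hypergraph {1..2 * r - 1}
     {{1..r}, insert (r + 1) {1..r - 1}, {r..2 * r - 1}}"

end

theory Submission
 imports Defs
begin

text \<open>Symmetrisation and a KKT argument reduce a triangle-free \<open>r\<close>-graph with nearly \<open>lam0 n^r\<close> edges to a
 weighted partial Steiner system, whose Lagrangian is shown by Maclaurin-type inequalities to be near the maximum
 only for the Witt design with nearly uniform weights. This gives stability; counting bad against missing
 edges then makes every extremal triangle-free graph a balanced blow-up, unique up to isomorphism because the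
 design is homogeneous on the sets of enlarged parts. For \<open>t + 1\<close> disjoint copies, if no vertex could be
 removed to lower \<open>t\<close>, then all degrees would be about \<open>kap n^(r-1)\<close>, too small since
 \<open>(2r - 1) kap < 1/(r-1)!\<close>.\<close>

text \<open>Maclaurin's inequality alone does not single out the Witt designs. A stationary
  weighting of a partial Steiner system on m points has value at most about binom(m, r-1) / (r m^r),
  which exceeds the target at m = 7, ..., 10 for r = 5 and at m = 13, 14 for r = 6. Two further
  facts remove these sizes: an (r+1)-set contains at most one edge, and divisibility forces some
  (r-1)-sets to lie in no edge. Symmetrisation destroys the graph it starts from, so it proves
  stability only if its steps can be undone. It is run inside the class of dense graphs far from
  every blow-up: a clone close to a blow-up is, by the local analysis, twice as close, and undoing
  one cloning step loses less than that. So the class is closed under cloning that keeps the edge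
  count. Missing edges outnumber bad ones only by a factor 1 + O(1/r). The gain comes from the fact
  that most missing edges have a face contained in no bad edge. In the final step (2r-1) kap (r-1)!
  is about 0.44 for r = 5 and 0.35 for r = 6; the bound 1/2 leaves room for all error terms.\<close>

abbreviation rcard :: "'a set => real" where "rcard A \<equiv> real (card A)"

section \<open>Counting\<close>

lemma double_count:
 assumes "finite A" "finite B"
 shows "(\<Sum>a\<in>A. card {b \<in> B. R a b}) = (\<Sum>b\<in>B. card {a \<in> A. R a b})"
proof -
 have "(\<Sum>a\<in>A. card {b \<in> B. R a b}) = (\<Sum>a\<in>A. \<Sum>b\<in>B. if R a b then 1 else 0)"
  using assms by (intro sum.cong refl) (simp add: sum.If_cases Int_def)
 also have "... = (\<Sum>b\<in>B. \<Sum>a\<in>A. if R a b then 1 else 0)" by (rule sum.swap)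
 also have "... = (\<Sum>b\<in>B. card {a \<in> A. R a b})"
  using assms by (intro sum.cong refl) (simp add: sum.If_cases Int_def)
 finally show ?thesis .
qed

lemma card_sets_between:
 assumes "finite V" "Y \<subseteq> V" "card Y \<le> s"
 shows "card {X. Y \<subseteq> X \<and> X \<subseteq> V \<and> card X = s} = (card V - card Y) choose (s - card Y)"
proof -
 have fY: "finite Y" using assms finite_subset by blast
 have "bij_betw (\<lambda>X. X - Y) {X. Y \<subseteq> X \<and> X \<subseteq> V \<and> card X = s} {Z. Z \<subseteq> V - Y \<and> card Z = s - card Y}"
 proof (rule bij_betw_byWitness[where f' = "\<lambda>Z. Z \<union> Y"])
  show "\<forall>a\<in>{X. Y \<subseteq> X \<and> X \<subseteq> V \<and> card X = s}. a - Y \<union> Y = a" by auto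
  show "\<forall>a'\<in>{Z. Z \<subseteq> V - Y \<and> card Z = s - card Y}. a' \<union> Y - Y = a'" by auto
  show "(\<lambda>X. X - Y) ` {X. Y \<subseteq> X \<and> X \<subseteq> V \<and> card X = s} \<subseteq> {Z. Z \<subseteq> V - Y \<and> card Z = s - card Y}"
   using fY by (auto simp: card_Diff_subset)
  show "(\<lambda>Z. Z \<union> Y) ` {Z. Z \<subseteq> V - Y \<and> card Z = s - card Y} \<subseteq> {X. Y \<subseteq> X \<and> X \<subseteq> V \<and> card X = s}"
  proof safe
   fix Z assume Z: "Z \<subseteq> V - Y" "card Z = s - card Y"
   have "finite Z" using Z assms finite_subset by blast
   moreover have "Z \<inter> Y = {}" using Z by auto
   ultimately show "card (Z \<union> Y) = s" using Z fY assms by (simp add: card_Un_disjoint)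
  qed (use assms in auto)
 qed
 then have "card {X. Y \<subseteq> X \<and> X \<subseteq> V \<and> card X = s} = card {Z. Z \<subseteq> V - Y \<and> card Z = s - card Y}"
  by (rule bij_betw_same_card)
 also have "... = card (V - Y) choose (s - card Y)" using assms by (intro n_subsets) auto
 finally show ?thesis using fY assms by (simp add: card_Diff_subset)
qed

lemma binomial_le_pow': "n choose s \<le> n ^ s" by (cases "s \<le> n") (auto intro: binomial_le_pow simp: binomial_eq_0)

lemma card_supersets_le:
 assumes "finite V" "finite Y"
 shows "card {X. X \<subseteq> V \<and> card X = s \<and> Y \<subseteq> X} \<le> card V ^ (s - card Y)"
proof (cases "Y \<subseteq> V \<and> card Y \<le> s")
 case True
 have "{X. X \<subseteq> V \<and> card X = s \<and> Y \<subseteq> X} = {X. Y \<subseteq> X \<and> X \<subseteq> V \<and> card X = s}" by auto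
 then have "card {X. X \<subseteq> V \<and> card X = s \<and> Y \<subseteq> X} = (card V - card Y) choose (s - card Y)"
  using card_sets_between[of V Y s] assms True by simp
 also have "... \<le> (card V - card Y) ^ (s - card Y)" by (rule binomial_le_pow')
 also have "... \<le> card V ^ (s - card Y)" by (intro power_mono) auto
 finally show ?thesis .
next
 case False
 have e: "{X. X \<subseteq> V \<and> card X = s \<and> Y \<subseteq> X} = {}"
 proof (rule ccontr)
  assume "{X. X \<subseteq> V \<and> card X = s \<and> Y \<subseteq> X} \<noteq> {}"
  then obtain X where X: "X \<subseteq> V" "card X = s" "Y \<subseteq> X" by auto
  then have "card Y \<le> s" using card_mono[of X Y] assms finite_subset by blast
  then show False using X False by auto
 qed
 show ?thesis unfolding e by simp
qed

text \<open>Induction on \<open>J\<close>, splitting off the one element of \<open>S\<close> mapped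
  to the new index. A set as large as its image is mapped injectively, so the sets counted are the
  transversals of the fibres over \<open>J\<close>.\<close>

lemma card_transversals:
 assumes "finite A" "finite J"
 shows "card {S. S \<subseteq> A \<and> card S = card J \<and> f ` S = J} = (\<Prod>j\<in>J. card {a \<in> A. f a = j})"
 using assms(2)
proof (induction J rule: finite_induct)
 case empty
 have "{S. S \<subseteq> A \<and> card S = card ({}::'b set) \<and> f ` S = {}} = {{}}" by auto
 then show ?case by simp
next
 case (insert j J)
 let ?T = "\<lambda>J. {S. S \<subseteq> A \<and> card S = card J \<and> f ` S = J}"
 have fT: "finite (?T J)" using assms(1) by (auto intro: finite_subset[of _ "Pow A"])
 have "bij_betw (\<lambda>(a, S). insert a S) ({a \<in> A. f a = j} \<times> ?T J) (?T (insert j J))"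
 proof (rule bij_betwI')
  fix x y assume x: "x \<in> {a \<in> A. f a = j} \<times> ?T J" and y: "y \<in> {a \<in> A. f a = j} \<times> ?T J"
  obtain a S where xa: "x = (a, S)" by force
  obtain b R where yb: "y = (b, R)" by force
  have "\<forall>v\<in>S. f v \<noteq> j" "\<forall>v\<in>R. f v \<noteq> j" "f a = j" "f b = j"
   using x y xa yb insert.hyps(2) by (blast, blast, simp_all)
  then have e: "S = {v \<in> insert a S. f v \<noteq> j}" "R = {v \<in> insert b R. f v \<noteq> j}"
   "{a} = {v \<in> insert a S. f v = j}" "{b} = {v \<in> insert b R. f v = j}" by auto
  show "((case x of (a, S) => insert a S) = (case y of (a, S) => insert a S)) = (x = y)"
  proof
   assume "(case x of (a, S) => insert a S) = (case y of (a, S) => insert a S)"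
   then have q: "insert a S = insert b R" using xa yb by simp
   have "S = R" using e(1,2) unfolding q by simp
   moreover have "{a} = {b}" using e(3,4) unfolding q by simp
   ultimately show "x = y" using xa yb by simp
  qed simp
 next
  fix x assume x: "x \<in> {a \<in> A. f a = j} \<times> ?T J"
  obtain a S where xa: "x = (a, S)" by force
  have S: "S \<subseteq> A" "card S = card J" "f ` S = J" "a \<in> A" "f a = j" using x xa by auto
  then have "a \<notin> S" "finite S" using insert.hyps assms(1) finite_subset by auto
  then show "(case x of (a, S) => insert a S) \<in> ?T (insert j J)" using xa S insert.hyps by auto
 next
  fix X assume "X \<in> ?T (insert j J)"
  then have X: "X \<subseteq> A" "card X = card (insert j J)" "f ` X = insert j J" by auto
  have fX: "finite X" using X assms(1) finite_subset by blast
  have inj: "inj_on f X" using X fX by (intro eq_card_imp_inj_on) auto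
  obtain a where a: "a \<in> X" "f a = j" using X by (metis imageE insertI1)
  have "f ` (X - {a}) = J" using inj a X insert.hyps by (subst inj_on_image_set_diff[of f X]) auto
  moreover have "card (X - {a}) = card J" using a fX X insert.hyps by simp
  ultimately have "(a, X - {a}) \<in> {a \<in> A. f a = j} \<times> ?T J" using a X by auto
  moreover have "X = (case (a, X - {a}) of (a, S) => insert a S)" using a by auto
  ultimately show "\<exists>x\<in>{a \<in> A. f a = j} \<times> ?T J. X = (case x of (a, S) => insert a S)" by blast
 qed
 then have "card (?T (insert j J)) = card ({a \<in> A. f a = j} \<times> ?T J)" by (rule bij_betw_same_card[symmetric])
 also have "... = card {a \<in> A. f a = j} * (\<Prod>j\<in>J. card {a \<in> A. f a = j})"
  using insert.IH by (simp add: card_cartesian_product)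
 finally show ?case using insert.hyps by simp
qed

section \<open>Steiner systems\<close>

text \<open>A Steiner system with parameters (r-1, r, k). Points and blocks are plain sets because
  derived designs and the patterns produced by symmetrisation are instances too.\<close>

locale steiner =
 fixes r k :: nat and I :: "'i set" and Bk :: "'i set set"
 assumes finI: "finite I" and cardI: "card I = k" and r3: "3 \<le> r" and rk: "r + 2 \<le> k"
  and blk: "\<And>B. B \<in> Bk ==> B \<subseteq> I \<and> card B = r"
  and uniq: "\<And>S. S \<subseteq> I ==> card S = r - 1 ==> \<exists>!B. B \<in> Bk \<and> S \<subseteq> B"
begin

lemma pow_r1: "x ^ (r - 1) = x * x ^ (r - 2)" and pow_r: "x ^ r = x * x ^ (r - 1)" for x :: real
proof -
 have "r - 1 = Suc (r - 2)" "r = Suc (r - 1)" using r3 by simp_all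
 then show "x ^ (r - 1) = x * x ^ (r - 2)" "x ^ r = x * x ^ (r - 1)" by (metis power_Suc)+
qed

lemma finBk: "finite Bk" by (rule finite_subset[of _ "Pow I"]) (use blk finI in auto)

lemma blk_fin: "B \<in> Bk ==> finite B" using blk finI finite_subset by blast

lemma blk_ex: "S \<subseteq> I ==> card S = r - 1 ==> \<exists>B\<in>Bk. S \<subseteq> B" using uniq[of S] by blast

lemma blk_eq: "S \<subseteq> B ==> S \<subseteq> B' ==> B \<in> Bk ==> B' \<in> Bk ==> card S = r - 1 ==> B = B'"
 using uniq[of S] blk[of B] by blast

text \<open>Count pairs of an (r-1)-set \<open>S\<close> above \<open>Y\<close> and a block above
  \<open>S\<close> in two ways: each \<open>S\<close> lies in one block, and a block through
  \<open>Y\<close> contains \<open>r - card Y\<close> of the sets \<open>S\<close>.\<close>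

lemma blk_through:
 assumes "Y \<subseteq> I" "card Y \<le> r - 1"
 shows "(r - card Y) * card {B \<in> Bk. Y \<subseteq> B} = (k - card Y) choose (r - 1 - card Y)"
proof -
 let ?S = "{S. Y \<subseteq> S \<and> S \<subseteq> I \<and> card S = r - 1}"
 have fS: "finite ?S" by (rule finite_subset[of _ "Pow I"]) (use finI in auto)
 have fB: "finite {B \<in> Bk. Y \<subseteq> B}" using finBk by auto
 have "card {B \<in> {B \<in> Bk. Y \<subseteq> B}. S \<subseteq> B} = 1" if "S \<in> ?S" for S
 proof -
  obtain B where B: "B \<in> Bk" "S \<subseteq> B" using blk_ex[of S] \<open>S \<in> ?S\<close> by auto
  have "B' = B" if "B' \<in> Bk" "S \<subseteq> B'" for B' using blk_eq[of S B' B] that B \<open>S \<in> ?S\<close> by simp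
  then have "{B \<in> {B \<in> Bk. Y \<subseteq> B}. S \<subseteq> B} \<subseteq> {B}" by blast
  moreover have "{B} \<subseteq> {B \<in> {B \<in> Bk. Y \<subseteq> B}. S \<subseteq> B}" using B \<open>S \<in> ?S\<close> by blast
  ultimately have "{B \<in> {B \<in> Bk. Y \<subseteq> B}. S \<subseteq> B} = {B}" by (rule equalityI)
  then show ?thesis by simp
 qed
 then have "card ?S = (\<Sum>S\<in>?S. card {B \<in> {B \<in> Bk. Y \<subseteq> B}. S \<subseteq> B})" by simp
 also have "... = (\<Sum>B\<in>{B \<in> Bk. Y \<subseteq> B}. card {S \<in> ?S. S \<subseteq> B})"
  by (rule double_count[OF fS fB])
 also have "... = (\<Sum>B\<in>{B \<in> Bk. Y \<subseteq> B}. r - card Y)"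
 proof (rule sum.cong[OF refl])
  fix B assume B: "B \<in> {B \<in> Bk. Y \<subseteq> B}"
  have e: "{S \<in> ?S. S \<subseteq> B} = {S. Y \<subseteq> S \<and> S \<subseteq> B \<and> card S = r - 1}" using B blk[of B] by auto
  have "card {S \<in> ?S. S \<subseteq> B} = (card B - card Y) choose (r - 1 - card Y)"
   unfolding e using B blk_fin assms by (intro card_sets_between) auto
  also have "... = (r - card Y) choose (r - 1 - card Y)" using B blk by auto
  also have "... = r - card Y" using r3 assms(2) binomial_symmetric[of "r - 1 - card Y" "r - card Y"] by simp
  finally show "card {S \<in> ?S. S \<subseteq> B} = r - card Y" .
 qed
 also have "... = (r - card Y) * card {B \<in> Bk. Y \<subseteq> B}" by simp
 finally show ?thesis using card_sets_between[OF finI assms] cardI by simp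
qed

abbreviation ik :: real where "ik \<equiv> 1 / real k"

abbreviation hk :: real where "hk \<equiv> 1 / (2 * real k)"

text \<open>With all parts of size \<open>n / k\<close>, \<open>ovl * ik ^ (r - 1)\<close> is the
  degree density allowed to a vertex whose link avoids two parts: (r-2)-sets in the other
  \<open>k - 2\<close> parts, each extended by one part's worth of vertices, every link set being
  counted \<open>r - 1\<close> times.\<close>

abbreviation ovl :: real where "ovl \<equiv> real ((k - 2) choose (r - 2)) / real (r - 1)"

text \<open>The number of blocks through \<open>j\<close> points; for \<open>j \<le> r - 1\<close>
  the division is exact (\<open>bn_mult\<close>).\<close>

definition bn :: "nat => nat" where
 "bn j = ((k - j) choose (r - 1 - j)) div (r - j)"

abbreviation b2 :: real where "b2 \<equiv> real (bn 2)"

lemma bn_through: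
 assumes "Y \<subseteq> I" "card Y \<le> r - 1"
 shows "card {B \<in> Bk. Y \<subseteq> B} = bn (card Y)"
proof -
 have "r - card Y \<noteq> 0" using assms(2) r3 by linarith
 then show ?thesis using blk_through[OF assms] unfolding bn_def by (metis nonzero_mult_div_cancel_left)
qed

lemma bn_mult:
 assumes "j \<le> r - 1"
 shows "(r - j) * bn j = (k - j) choose (r - 1 - j)"
proof -
 have "j \<le> card I" using assms cardI rk by simp
 then obtain Y where "Y \<subseteq> I" "card Y = j" by (meson obtain_subset_with_card_n)
 then show ?thesis using blk_through[of Y] bn_through[of Y] assms by simp
qed

lemma bn_pos: "j \<le> r - 1 ==> 0 < bn j"
proof -
 assume "j \<le> r - 1"
 then have "(r - j) * bn j \<noteq> 0" using bn_mult[of j] rk by (simp add: zero_less_binomial_iff flip: neq0_conv)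
 then show ?thesis by simp
qed

lemma card_Bk: "card Bk = bn 0" using bn_through[of "{}"] by simp

lemma r_card_Bk: "r * card Bk = k * bn 1"
proof -
 have "(\<Sum>i\<in>I. card {B \<in> Bk. i \<in> B}) = (\<Sum>B\<in>Bk. card {i \<in> I. i \<in> B})"
  by (rule double_count[OF finI finBk])
 moreover have "card {B \<in> Bk. i \<in> B} = bn 1" if "i \<in> I" for i using bn_through[of "{i}"] that r3 by simp
 moreover have "card {i \<in> I. i \<in> B} = r" if "B \<in> Bk" for B
 proof -
  have "{i \<in> I. i \<in> B} = B" using blk[OF that] by auto
  then show ?thesis using blk[OF that] by simp
 qed
 ultimately show ?thesis using cardI by simp
qed

text \<open>The value of the design's Lagrange polynomial at uniform weights, hence the edge density
  of balanced blow-ups relative to \<open>n^r\<close>; \<open>kap\<close> is the matching degree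
  density relative to \<open>n^(r-1)\<close>.\<close>

definition lam0 :: real where "lam0 = rcard Bk / real k ^ r"

definition kap :: real where "kap = real r * lam0"

lemma kap_eq: "kap = real (bn 1) / real k ^ (r - 1)"
proof -
 have "real r * rcard Bk = real k * real (bn 1)" using r_card_Bk by (metis of_nat_mult)
 moreover have "real k ^ r = real k * real k ^ (r - 1)" using r3 by (cases r) auto
 moreover have "real k > 0" using rk by simp
 ultimately show ?thesis by (simp add: kap_def lam0_def field_simps)
qed

lemma lam0_pos: "lam0 > 0" using bn_pos[of 0] card_Bk rk by (simp add: lam0_def)

lemma kap_pos: "kap > 0" using lam0_pos r3 by (simp add: kap_def)

end

section \<open>Elementary symmetric functions\<close>

definition esym :: "('a => real) => 'a set => nat => real" where
 "esym x C k = (\<Sum>S | S \<subseteq> C \<and> card S = k. \<Prod>i\<in>S. x i)"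

lemma fin_sub: "finite C ==> finite {S. S \<subseteq> C \<and> Q S}" by (rule finite_subset[of _ "Pow C"]) auto

lemma esym_0: "finite C ==> esym x C 0 = 1"
proof -
 assume f: "finite C"
 have "{S. S \<subseteq> C \<and> card S = 0} = {{}}" using f finite_subset by fastforce
 then show ?thesis by (simp add: esym_def)
qed

lemma esym_empty: "esym x {} (Suc k) = 0"
proof -
 have e: "{S. S \<subseteq> {} \<and> card S = Suc k} = {}" by auto
 show ?thesis unfolding esym_def e by simp
qed

lemma esym_insert:
 assumes "finite C" "a \<notin> C"
 shows "esym x (insert a C) (Suc k) = esym x C (Suc k) + x a * esym x C k"
proof -
 let ?A = "{S. S \<subseteq> C \<and> card S = Suc k}" and ?B = "{S. S \<subseteq> C \<and> card S = k}"
 have "{S. S \<subseteq> insert a C \<and> card S = Suc k} = ?A \<union> insert a ` ?B"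
 proof (intro equalityI subsetI)
  fix S assume S: "S \<in> {S. S \<subseteq> insert a C \<and> card S = Suc k}"
  show "S \<in> ?A \<union> insert a ` ?B"
  proof (cases "a \<in> S")
   case True
   then have "S - {a} \<in> ?B" using S finite_subset[of S "insert a C"] assms by auto
   moreover have "S = insert a (S - {a})" using True by auto
   ultimately show ?thesis by blast
  qed (use S in auto)
 next
  fix S assume "S \<in> ?A \<union> insert a ` ?B"
  then show "S \<in> {S. S \<subseteq> insert a C \<and> card S = Suc k}"
  proof
   assume "S \<in> insert a ` ?B"
   then obtain R where R: "R \<subseteq> C" "card R = k" "S = insert a R" by auto
   then have "finite R" "a \<notin> R" using assms finite_subset by auto
   then show ?thesis using R by auto
  qed auto
 qed
 moreover have "?A \<inter> insert a ` ?B = {}" using assms by auto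
 moreover have "inj_on (insert a) ?B" using assms by (auto simp: inj_on_def)
 moreover have "(\<Prod>i\<in>insert a S. x i) = x a * (\<Prod>i\<in>S. x i)" if "S \<in> ?B" for S
  using that assms finite_subset[of S C] by (subst prod.insert) auto
 ultimately show ?thesis using fin_sub[OF assms(1)] by (simp add: esym_def sum.union_disjoint sum.reindex sum_distrib_left)
qed

lemma esym_nonneg: "(\<And>i. i \<in> C ==> 0 \<le> x i) ==> 0 \<le> esym x C k"
 unfolding esym_def by (intro sum_nonneg prod_nonneg) auto

lemma esym_mono:
 assumes "finite C" "D \<subseteq> C" "\<And>i. i \<in> C ==> 0 \<le> x i"
 shows "esym x D k \<le> esym x C k" unfolding esym_def using assms by (intro sum_mono2 fin_sub) (auto intro!: prod_nonneg)

text \<open>Euler's identity for homogeneous polynomials; the partial derivative in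
  \<open>x i\<close> is the symmetric polynomial of lower degree in the other variables.\<close>

lemma esym_deriv:
 assumes "finite C"
 shows "real (Suc k) * esym x C (Suc k) = (\<Sum>i\<in>C. x i * esym x (C - {i}) k)" using assms
proof (induction C arbitrary: k rule: finite_induct)
 case empty
 then show ?case by (simp add: esym_empty)
next
 case (insert a C)
 have d: "insert a C - {i} = insert a (C - {i})" if "i \<in> C" for i using that insert by auto
 have a: "insert a C - {a} = C" using insert by auto
 have s: "(\<Sum>i\<in>insert a C. x i * esym x (insert a C - {i}) k)
   = x a * esym x C k + (\<Sum>i\<in>C. x i * esym x (insert a (C - {i})) k)" using insert a d by simp
 show ?case
 proof (cases k)
  case 0
  have "(\<Sum>i\<in>C. x i * esym x (insert a (C - {i})) 0) = (\<Sum>i\<in>C. x i * esym x (C - {i}) 0)"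
   using insert by (intro sum.cong) (auto simp: esym_0)
  then show ?thesis using s insert.IH[of 0] esym_insert[OF insert.hyps, of x 0] 0 by (simp add: algebra_simps)
 next
  case (Suc j)
  have "(\<Sum>i\<in>C. x i * esym x (insert a (C - {i})) k)
   = (\<Sum>i\<in>C. x i * esym x (C - {i}) (Suc j)) + x a * (\<Sum>i\<in>C. x i * esym x (C - {i}) j)"
   unfolding Suc sum_distrib_left sum.distrib[symmetric]
   using insert by (intro sum.cong refl) (simp add: esym_insert algebra_simps)
  also have "... = real (Suc k) * esym x C (Suc k) + x a * (real k * esym x C k)"
   using insert.IH[of j] insert.IH[of k] Suc by simp
  finally show ?thesis using s esym_insert[OF insert.hyps, of x k] by (simp add: algebra_simps)
 qed
qed

text \<open>Convexity: the left side is the tangent of the power function at \<open>y\<close>,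
  evaluated at \<open>A\<close>.\<close>

lemma power_tangent:
 fixes A y :: real
 assumes "0 \<le> A" "0 \<le> y"
 shows "real (Suc k) * A * y ^ k - real k * y ^ Suc k \<le> A ^ Suc k"
proof (induction k)
 case (Suc k)
 have "0 \<le> (A - y) * (A ^ Suc k - y ^ Suc k)"
  using assms by (cases "A \<le> y") (auto intro!: mult_nonneg_nonneg mult_nonpos_nonpos power_mono simp del: power_Suc)
 then have 1: "A ^ Suc (Suc k) \<ge> A * y ^ Suc k + y * A ^ Suc k - y * y ^ Suc k" by (simp add: algebra_simps)
 have "y * (real (Suc k) * A * y ^ k - real k * y ^ Suc k) \<le> y * A ^ Suc k" using Suc assms by (intro mult_left_mono)
 with 1 show ?case by (simp add: algebra_simps)
qed simp

text \<open>Induction on the number of variables. With the old mean \<open>y\<close> and the new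
  mean \<open>A\<close>, the recursion \<open>esym_insert\<close> reduces the claim to the tangent
  inequality at \<open>y\<close>.\<close>

lemma maclaurin:
 assumes "finite C" "\<And>i. i \<in> C ==> 0 \<le> x i"
 shows "esym x C k \<le> real (card C choose k) * ((\<Sum>i\<in>C. x i) / card C) ^ k" using assms
proof (induction C arbitrary: k rule: finite_induct)
 case empty
 then show ?case by (cases k) (auto simp: esym_0 esym_empty)
next
 case (insert a C)
 show ?case
 proof (cases k)
  case 0
  then show ?thesis using insert by (simp add: esym_0)
 next
  case (Suc j)
  define m where "m = card C"
  define s where "s = (\<Sum>i\<in>C. x i)"
  define y where "y = s / m"
  define A where "A = (s + x a) / Suc m"
  have nn: "0 \<le> s" "0 \<le> x a" unfolding s_def using insert by (auto intro: sum_nonneg)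
  have y0: "0 \<le> y" "0 \<le> A" using nn by (auto simp: y_def A_def)
  have sy: "s = m * y" using insert.hyps by (cases "C = {}") (auto simp: y_def m_def s_def)
  have xa: "x a = Suc m * A - m * y" using sy by (simp add: A_def)
  have IH: "esym x C i \<le> real (m choose i) * y ^ i" for i
   using insert.IH insert.prems unfolding m_def y_def s_def by simp
  have 1: "esym x (insert a C) (Suc j) \<le> real (m choose Suc j) * y ^ Suc j + x a * (real (m choose j) * y ^ j)"
   unfolding esym_insert[OF insert.hyps] by (intro add_mono[OF IH] mult_left_mono[OF IH] nn)
  have b1: "Suc j * (Suc m choose Suc j) = Suc m * (m choose j)" by (rule Suc_times_binomial)
  have b2: "(m choose Suc j) + (m choose j) = Suc m choose Suc j" by simp
  define b c where "b = real (Suc m choose Suc j)" and "c = real (m choose j)"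
  have c: "real (Suc m) * c = real (Suc j) * b" "real (m choose Suc j) = b - c"
   using b1 b2 unfolding b_def c_def by (metis of_nat_mult, simp)
  \<comment> \<open>Pascal's rule and absorption collapse the binomials to the single factor
    \<open>b\<close>, leaving the tangent expression.\<close>
  have "real (m choose Suc j) * y ^ Suc j + x a * (c * y ^ j)
   = (b - c) * y ^ Suc j + (real (Suc m) * c) * A * y ^ j - (real (Suc m) * c - c) * y ^ Suc j"
   unfolding xa c(2) by (simp add: algebra_simps)
  also have "... = b * (real (Suc j) * A * y ^ j - real j * y ^ Suc j)" unfolding c(1) by (simp add: algebra_simps)
  also have "... \<le> b * A ^ Suc j" using power_tangent[OF y0(2,1)] by (intro mult_left_mono) (auto simp: b_def)
  finally show ?thesis
   using 1 insert.hyps by (simp add: Suc A_def m_def s_def b_def c_def add.commute del: binomial_Suc_Suc power_Suc)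
 qed
qed

lemma esym_step:
 assumes "finite C" "\<And>i. i \<in> C ==> 0 \<le> x i" "(\<Sum>i\<in>C. x i) = 1"
 shows "real (Suc k) * esym x C (Suc k) \<le> esym x C k"
proof -
 have "(\<Sum>i\<in>C. x i * esym x (C - {i}) k) \<le> (\<Sum>i\<in>C. x i * esym x C k)"
  using assms by (intro sum_mono mult_left_mono esym_mono) auto
 also have "... = esym x C k" using assms by (simp flip: sum_distrib_right)
 finally show ?thesis using esym_deriv[OF assms(1)] by simp
qed

text \<open>\<open>esym_deriv\<close> combined with Maclaurin for the variables other than
  \<open>x i\<close>, whose sum is \<open>1 - x i\<close>. Unlike Maclaurin for all of
  \<open>C\<close>, the bound still sees the individual weights, so a quadratic tangent bound can
  extract their variance.\<close>

lemma esym_variance: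
 assumes "finite C" "\<And>i. i \<in> C ==> 0 \<le> x i" "(\<Sum>i\<in>C. x i) = 1"
 shows "real (Suc k) * esym x C (Suc k)
  \<le> real ((card C - 1) choose k) / real (card C - 1) ^ k * (\<Sum>i\<in>C. x i * (1 - x i) ^ k)"
proof -
 have "esym x (C - {i}) k \<le> real ((card C - 1) choose k) / real (card C - 1) ^ k * (1 - x i) ^ k" if "i \<in> C" for i
 proof -
  have "(\<Sum>j\<in>C - {i}. x j) = 1 - x i" using assms that by (simp add: sum_diff1)
  then show ?thesis using maclaurin[of "C - {i}" x k] assms that by (simp add: power_divide)
 qed
 then have "(\<Sum>i\<in>C. x i * esym x (C - {i}) k)
   \<le> (\<Sum>i\<in>C. x i * (real ((card C - 1) choose k) / real (card C - 1) ^ k * (1 - x i) ^ k))"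
  using assms by (intro sum_mono mult_left_mono) auto
 then show ?thesis unfolding esym_deriv[OF assms(1)] by (simp add: sum_distrib_left sum_divide_distrib mult_ac)
qed

text \<open>Newton's identities, with all degrees up to four carried through one induction. They
  serve the nine-point case below, where the variance bound is too weak.\<close>

lemma newton4:
 fixes x :: "'a => real"
 assumes "finite C"
 defines "p \<equiv> \<lambda>j. \<Sum>i\<in>C. x i ^ j"
 shows "24 * esym x C 4 = p 1 ^ 4 - 6 * p 1 ^ 2 * p 2 + 8 * p 1 * p 3 + 3 * p 2 ^ 2 - 6 * p 4"
proof -
 have "esym x C (Suc 0) = (\<Sum>i\<in>C. x i ^ 1)
  \<and> 2 * esym x C (Suc (Suc 0)) = (\<Sum>i\<in>C. x i ^ 1)^2 - (\<Sum>i\<in>C. x i ^ 2)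
  \<and> 6 * esym x C (Suc (Suc (Suc 0))) = (\<Sum>i\<in>C. x i ^ 1)^3 - 3 * (\<Sum>i\<in>C. x i ^ 1) * (\<Sum>i\<in>C. x i ^ 2) + 2 * (\<Sum>i\<in>C. x i ^ 3)
  \<and> 24 * esym x C (Suc (Suc (Suc (Suc 0)))) = (\<Sum>i\<in>C. x i ^ 1) ^ 4 - 6 * (\<Sum>i\<in>C. x i ^ 1) ^ 2 * (\<Sum>i\<in>C. x i ^ 2)
   + 8 * (\<Sum>i\<in>C. x i ^ 1) * (\<Sum>i\<in>C. x i ^ 3) + 3 * (\<Sum>i\<in>C. x i ^ 2) ^ 2 - 6 * (\<Sum>i\<in>C. x i ^ 4)"
  using assms(1)
 proof (induction C rule: finite_induct)
  case empty
  show ?case by (simp add: esym_empty)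
 next
  case (insert a C)
  define q1 q2 q3 q4 where q: "q1 = (\<Sum>i\<in>C. x i ^ 1)" "q2 = (\<Sum>i\<in>C. x i ^ 2)" "q3 = (\<Sum>i\<in>C. x i ^ 3)" "q4 = (\<Sum>i\<in>C. x i ^ 4)"
  define e1 e2 e3 e4 where e: "e1 = esym x C (Suc 0)" "e2 = esym x C (Suc (Suc 0))"
   "e3 = esym x C (Suc (Suc (Suc 0)))" "e4 = esym x C (Suc (Suc (Suc (Suc 0))))"
  have IH: "e1 = q1" "2 * e2 = q1^2 - q2" "6 * e3 = q1^3 - 3 * q1 * q2 + 2 * q3"
   "24 * e4 = q1 ^ 4 - 6 * q1 ^ 2 * q2 + 8 * q1 * q3 + 3 * q2 ^ 2 - 6 * q4" using insert.IH unfolding q e by auto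
  have S: "(\<Sum>i\<in>insert a C. x i ^ 1) = x a + q1" "(\<Sum>i\<in>insert a C. x i ^ 2) = x a ^ 2 + q2"
   "(\<Sum>i\<in>insert a C. x i ^ 3) = x a ^ 3 + q3" "(\<Sum>i\<in>insert a C. x i ^ 4) = x a ^ 4 + q4"
   using insert.hyps q by auto
  have E: "esym x (insert a C) (Suc 0) = e1 + x a" "esym x (insert a C) (Suc (Suc 0)) = e2 + x a * e1"
   "esym x (insert a C) (Suc (Suc (Suc 0))) = e3 + x a * e2"
   "esym x (insert a C) (Suc (Suc (Suc (Suc 0)))) = e4 + x a * e3" using insert.hyps by (simp_all add: esym_insert esym_0 e)
  have "24 * (e4 + x a * e3) = 24 * e4 + 4 * x a * (6 * e3)" "6 * (e3 + x a * e2) = 6 * e3 + 3 * x a * (2 * e2)"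
   "2 * (e2 + x a * e1) = 2 * e2 + 2 * x a * e1" by (simp_all add: algebra_simps)
  then show ?case unfolding S E IH by (simp add: algebra_simps power2_eq_square power3_eq_cube power4_eq_xxxx)
 qed
 then show ?thesis unfolding p_def by (simp add: numeral_eq_Suc)
qed

section \<open>Lagrangians of partial Steiner systems\<close>

lemma sum_incidence:
 assumes "finite C" "finite P" "\<And>e. e \<in> P ==> e \<subseteq> C"
 shows "(\<Sum>i\<in>C. \<Sum>e | e \<in> P \<and> i \<in> e. h i e) = (\<Sum>e\<in>P. \<Sum>i\<in>e. (h i e :: real))"
proof -
 have "(\<Sum>i\<in>C. \<Sum>e | e \<in> P \<and> i \<in> e. h i e) = (\<Sum>e\<in>P. \<Sum>i | i \<in> C \<and> i \<in> e. h i e)"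
  using assms by (intro sum.swap_restrict)
 moreover have "{i. i \<in> C \<and> i \<in> e} = e" if "e \<in> P" for e using assms(3)[OF that] by auto
 ultimately show ?thesis by simp
qed

text \<open>A weighted partial Steiner system satisfying the Lagrange conditions up to an error
  \<open>d\<close>: at an exact critical point of the simplex with positive weights every partial
  derivative is \<open>r\<close> times the value. Symmetrised graphs on \<open>n\<close> vertices
  satisfy this with \<open>d = 1 / n\<close>.\<close>

locale kkt =
 fixes r :: nat and C :: "'a set" and P :: "'a set set" and x :: "'a => real" and d :: real
 assumes finC: "finite C" and r3: "3 \<le> r"
  and edge: "\<And>e. e \<in> P ==> e \<subseteq> C \<and> card e = r"
  and partial: "\<And>e e' S. e \<in> P ==> e' \<in> P ==> S \<subseteq> e ==> S \<subseteq> e' ==> card S = r - 1 ==> e = e'"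
  and x0: "\<And>i. i \<in> C ==> 0 < x i" and sum1: "(\<Sum>i\<in>C. x i) = 1"
  and kkt: "\<And>i. i \<in> C ==>
   \<bar>(\<Sum>e | e \<in> P \<and> i \<in> e. \<Prod>j\<in>e - {i}. x j) - real r * (\<Sum>e\<in>P. \<Prod>j\<in>e. x j)\<bar> \<le> d"
begin

definition lam :: real where "lam = (\<Sum>e\<in>P. \<Prod>j\<in>e. x j)"
definition dl :: "'a => real" where "dl i = (\<Sum>e | e \<in> P \<and> i \<in> e. \<Prod>j\<in>e - {i}. x j)"
text \<open>The shadow of the edges; \<open>ms\<close> is its complement among the (r-1)-sets and
  \<open>mw\<close> the weight of that complement. A partial system with \<open>ms\<close> empty is
  a Steiner system.\<close>

definition sh :: "'a set set" where "sh = {S. S \<subseteq> C \<and> card S = r - 1 \<and> (\<exists>e\<in>P. S \<subseteq> e)}"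
definition ms :: "'a set set" where "ms = {S. S \<subseteq> C \<and> card S = r - 1 \<and> \<not> (\<exists>e\<in>P. S \<subseteq> e)}"
definition mw :: real where "mw = (\<Sum>S\<in>ms. \<Prod>i\<in>S. x i)"

lemma finP: "finite P" by (rule finite_subset[of _ "Pow C"]) (use edge finC in auto)

lemma fin_edge: "e \<in> P ==> finite e" using edge finC finite_subset by blast

lemma xn: "i \<in> C ==> 0 \<le> x i" using x0 less_imp_le by blast

lemma prod_nn: "S \<subseteq> C ==> 0 \<le> (\<Prod>i\<in>S. x i)" using xn by (intro prod_nonneg) auto

lemma fin_ms: "finite ms" "finite sh" unfolding ms_def sh_def using finC by (auto intro: fin_sub)

lemma dl_le: "i \<in> C ==> dl i \<le> real r * lam + d" and dl_ge: "i \<in> C ==> real r * lam - d \<le> dl i"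
 using kkt[of i] by (auto simp: dl_def lam_def abs_le_iff)

text \<open>Removing a point from an edge is injective on incident pairs, because an (r-1)-set lies
  in at most one edge; the image is the shadow.\<close>

lemma sum_dl: "(\<Sum>i\<in>C. dl i) = esym x C (r - 1) - mw"
proof -
 let ?Q = "SIGMA i:C. {e \<in> P. i \<in> e}"
 have inj: "inj_on (\<lambda>(i, e). e - {i}) ?Q"
 proof (rule inj_onI, clarsimp)
  fix i e i' e' assume a: "i \<in> C" "e \<in> P" "i \<in> e" "i' \<in> C" "e' \<in> P" "i' \<in> e'" "e - {i} = e' - {i'}"
  have "card (e - {i}) = r - 1" using a edge fin_edge by (simp add: card_Diff_singleton)
  then have "e = e'" using partial[of e e' "e - {i}"] a by blast
  then show "i = i' \<and> e = e'" using a by auto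
 qed
 have img: "(\<lambda>(i, e). e - {i}) ` ?Q = sh"
 proof (intro equalityI subsetI)
  fix S assume "S \<in> (\<lambda>(i, e). e - {i}) ` ?Q"
  then obtain i e where "e \<in> P" "i \<in> e" "S = e - {i}" by auto
  then show "S \<in> sh" using edge[of e] fin_edge[of e] by (auto simp: sh_def card_Diff_singleton)
 next
  fix S assume "S \<in> sh"
  then obtain e where e: "S \<subseteq> C" "card S = r - 1" "e \<in> P" "S \<subseteq> e" by (auto simp: sh_def)
  have "finite S" using e fin_edge finite_subset by blast
  then have "card (e - S) = 1" using e edge[of e] r3 by (simp add: card_Diff_subset)
  then obtain i where "e - S = {i}" by (auto simp: card_1_singleton_iff)
  then have "i \<in> e" "S = e - {i}" using e by auto
  then show "S \<in> (\<lambda>(i, e). e - {i}) ` ?Q" using e edge[of e] by force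
 qed
 have "(\<Sum>i\<in>C. dl i) = (\<Sum>(i, e)\<in>?Q. \<Prod>j\<in>e - {i}. x j)"
  unfolding dl_def using finC finP by (subst sum.Sigma) auto
 also have "... = (\<Sum>S\<in>sh. \<Prod>j\<in>S. x j)"
  unfolding img[symmetric] by (subst sum.reindex[OF inj]) (simp add: case_prod_unfold)
 also have "... = esym x C (r - 1) - mw"
 proof -
  have "{S. S \<subseteq> C \<and> card S = r - 1} = sh \<union> ms" "sh \<inter> ms = {}" by (auto simp: sh_def ms_def)
  then show ?thesis unfolding esym_def mw_def by (simp add: sum.union_disjoint fin_ms)
 qed
 finally show ?thesis .
qed

text \<open>The sum of the Lagrange conditions over all points. Maclaurin bounds
  \<open>esym x C (r - 1)\<close> from above, so a large \<open>lam\<close> restricts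
  \<open>card C\<close> and leaves little room for \<open>mw\<close>.\<close>

lemma main_bound: "rcard C * (real r * lam - d) \<le> esym x C (r - 1) - mw"
 using sum_mono[of C "\<lambda>_. real r * lam - d" dl] dl_ge sum_dl by (simp add: mult.commute)

lemma x_dl: "x i * dl i = (\<Sum>e | e \<in> P \<and> i \<in> e. \<Prod>j\<in>e. x j)" unfolding dl_def sum_distrib_left
 by (intro sum.cong refl) (auto simp: fin_edge prod.remove)

lemma x_dl_le: "i \<in> C ==> x i * dl i \<le> lam"
 unfolding x_dl lam_def using finP edge by (intro sum_mono2) (auto intro!: prod_nn)

lemma sum_sq_dl: "(\<Sum>i\<in>C. x i ^ 2 * dl i) = (\<Sum>e\<in>P. (\<Prod>j\<in>e. x j) * (\<Sum>i\<in>e. x i))"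
proof -
 have "x i ^ 2 * dl i = (\<Sum>e | e \<in> P \<and> i \<in> e. x i * (\<Prod>j\<in>e. x j))" for i
  unfolding sum_distrib_left[symmetric] x_dl[symmetric] by (simp add: power2_eq_square mult.assoc)
 then show ?thesis using sum_incidence[OF finC finP, of "\<lambda>i e. x i * (\<Prod>j\<in>e. x j)"] edge
  by (simp add: sum_distrib_right mult.commute)
qed

text \<open>Two edges inside a common \<open>(r + 1)\<close>-set would share \<open>r - 1\<close> points.\<close>

lemma sixset: "(\<Sum>e\<in>P. (\<Prod>j\<in>e. x j) * (1 - (\<Sum>i\<in>e. x i))) \<le> esym x C (Suc r)"
proof -
 let ?Q = "SIGMA e:P. C - e"
 have card1: "card (insert v e) = Suc r" if "e \<in> P" "v \<in> C - e" for e v using that edge fin_edge by simp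
 have inj: "inj_on (\<lambda>(e, v). insert v e) ?Q"
 proof (rule inj_onI, clarsimp)
  fix e v e' v' assume a: "e \<in> P" "v \<in> C" "v \<notin> e" "e' \<in> P" "v' \<in> C" "v' \<notin> e'" "insert v e = insert v' e'"
  have "e = e'"
  proof (rule ccontr)
   assume ne: "e \<noteq> e'"
   then have "v' \<in> e" using a by (metis insertE insertI1 insert_eq_iff)
   then have "card (e - {v'}) = r - 1" using a edge fin_edge by (simp add: card_Diff_singleton)
   moreover have "e - {v'} \<subseteq> e'" using a by auto
   ultimately show False using partial[of e e' "e - {v'}"] a ne by auto
  qed
  then show "e = e' \<and> v = v'" using a by auto
 qed
 have "(\<Sum>e\<in>P. (\<Prod>j\<in>e. x j) * (1 - (\<Sum>i\<in>e. x i))) = (\<Sum>e\<in>P. \<Sum>v\<in>C - e. \<Prod>j\<in>insert v e. x j)"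
 proof (rule sum.cong[OF refl])
  fix e assume e: "e \<in> P"
  have "1 - (\<Sum>i\<in>e. x i) = (\<Sum>v\<in>C - e. x v)" using sum1 edge[OF e] finC by (simp add: sum_diff finite_subset)
  moreover have "(\<Prod>j\<in>insert v e. x j) = (\<Prod>j\<in>e. x j) * x v" if "v \<in> C - e" for v
   using that fin_edge[OF e] by (simp add: mult.commute)
  ultimately show "(\<Prod>j\<in>e. x j) * (1 - (\<Sum>i\<in>e. x i)) = (\<Sum>v\<in>C - e. \<Prod>j\<in>insert v e. x j)"
   by (simp add: sum_distrib_left)
 qed
 also have "... = (\<Sum>(e, v)\<in>?Q. \<Prod>j\<in>insert v e. x j)" using finC finP by (subst sum.Sigma) auto
 also have "... = (\<Sum>S\<in>(\<lambda>(e, v). insert v e) ` ?Q. \<Prod>j\<in>S. x j)"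
  by (subst sum.reindex[OF inj]) (simp add: case_prod_unfold)
 also have "... \<le> esym x C (Suc r)" unfolding esym_def
 proof (rule sum_mono2)
  show "finite {S. S \<subseteq> C \<and> card S = Suc r}" using finC by (rule fin_sub)
  show "(\<lambda>(e, v). insert v e) ` ?Q \<subseteq> {S. S \<subseteq> C \<and> card S = Suc r}"
  proof clarify
   fix e v assume "e \<in> P" "v \<in> C" "v \<notin> e"
   then show "insert v e \<subseteq> C \<and> card (insert v e) = Suc r" using edge[of e] card1[of e v] by blast
  qed
 qed (auto intro!: prod_nn)
 finally show ?thesis .
qed

text \<open>In \<open>sixset\<close> the points inside edges contribute the sum of
  \<open>x i ^ 2 * dl i\<close>, which the Lagrange conditions control. The result is a strong upper
  bound on \<open>lam\<close> for few points with small square sum.\<close>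

lemma sixset': "lam - (real r * lam + d) * (\<Sum>i\<in>C. x i ^ 2) \<le> esym x C (Suc r)"
proof -
 have "(\<Sum>i\<in>C. x i ^ 2 * dl i) \<le> (\<Sum>i\<in>C. x i ^ 2 * (real r * lam + d))"
  using dl_le by (intro sum_mono mult_left_mono) auto
 moreover have "(\<Sum>e\<in>P. (\<Prod>j\<in>e. x j) * (1 - (\<Sum>i\<in>e. x i))) = lam - (\<Sum>i\<in>C. x i ^ 2 * dl i)"
  unfolding sum_sq_dl lam_def by (simp add: right_diff_distrib sum_subtractf)
 ultimately show ?thesis using sixset by (simp add: sum_distrib_left mult.commute)
qed

text \<open>If every (r-1)-set above \<open>Y\<close> were covered, the double count of
  \<open>blk_through\<close> would apply above \<open>Y\<close> and force the divisibility.\<close>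

lemma missing_ex:
 assumes "Y \<subseteq> C" "card Y \<le> r - 1"
  and "\<not> (r - card Y) dvd ((card C - card Y) choose (r - 1 - card Y))"
 shows "\<exists>S\<in>ms. Y \<subseteq> S"
proof (rule ccontr)
 assume none: "\<not> (\<exists>S\<in>ms. Y \<subseteq> S)"
 let ?S = "{S. Y \<subseteq> S \<and> S \<subseteq> C \<and> card S = r - 1}"
 have fS: "finite ?S" by (rule finite_subset[of _ "Pow C"]) (use finC in auto)
 have fB: "finite {e \<in> P. Y \<subseteq> e}" using finP by auto
 have "card {e \<in> {e \<in> P. Y \<subseteq> e}. S \<subseteq> e} = 1" if S: "S \<in> ?S" for S
 proof -
  obtain B where B: "B \<in> P" "S \<subseteq> B" using S none by (auto simp: ms_def)
  have "B' = B" if "B' \<in> P" "S \<subseteq> B'" for B' using partial[of B' B S] that B S by simp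
  then have "{e \<in> {e \<in> P. Y \<subseteq> e}. S \<subseteq> e} \<subseteq> {B}" by blast
  moreover have "{B} \<subseteq> {e \<in> {e \<in> P. Y \<subseteq> e}. S \<subseteq> e}" using B S by blast
  ultimately have "{e \<in> {e \<in> P. Y \<subseteq> e}. S \<subseteq> e} = {B}" by (rule equalityI)
  then show ?thesis by simp
 qed
 then have "card ?S = (\<Sum>S\<in>?S. card {e \<in> {e \<in> P. Y \<subseteq> e}. S \<subseteq> e})" by simp
 also have "... = (\<Sum>e\<in>{e \<in> P. Y \<subseteq> e}. card {S \<in> ?S. S \<subseteq> e})"
  by (rule double_count[OF fS fB])
 also have "... = (\<Sum>e\<in>{e \<in> P. Y \<subseteq> e}. r - card Y)"
 proof (rule sum.cong[OF refl])
  fix B assume B: "B \<in> {e \<in> P. Y \<subseteq> e}"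
  have e: "{S \<in> ?S. S \<subseteq> B} = {S. Y \<subseteq> S \<and> S \<subseteq> B \<and> card S = r - 1}" using B edge[of B] by blast
  have "card {S \<in> ?S. S \<subseteq> B} = (card B - card Y) choose (r - 1 - card Y)"
   unfolding e using B fin_edge assms by (intro card_sets_between) auto
  also have "... = (r - card Y) choose (r - 1 - card Y)" using B edge by auto
  also have "... = r - card Y" using r3 assms(2) binomial_symmetric[of "r - 1 - card Y" "r - card Y"] by simp
  finally show "card {S \<in> ?S. S \<subseteq> B} = r - card Y" .
 qed
 finally have "card ?S = (r - card Y) * card {e \<in> P. Y \<subseteq> e}" by simp
 then show False using card_sets_between[OF finC assms(1,2)] assms(3) by (metis dvd_triv_left)
qed

text \<open>Charge each \<open>s\<close>-set to an uncovered (r-1)-set above it: every additional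
  point weighs at least \<open>\<mu>\<close>, and an (r-1)-set is charged by at most
  \<open>(r - 1) choose s\<close> subsets.\<close>

lemma missing_weight:
 assumes ex: "\<And>Y. Y \<subseteq> C ==> card Y = s ==> \<exists>S\<in>ms. Y \<subseteq> S"
  and mu: "0 \<le> \<mu>" "\<And>i. i \<in> C ==> \<mu> \<le> x i"
 shows "\<mu> ^ (r - 1 - s) * esym x C s \<le> real ((r - 1) choose s) * mw"
proof -
 let ?Y = "{Y. Y \<subseteq> C \<and> card Y = s}"
 have fY: "finite ?Y" using finC by (rule fin_sub)
 have "\<mu> ^ (r - 1 - s) * (\<Prod>i\<in>Y. x i) \<le> (\<Sum>S | S \<in> ms \<and> Y \<subseteq> S. \<Prod>i\<in>S. x i)" if Y: "Y \<in> ?Y" for Y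
 proof -
  obtain S where S: "S \<in> ms" "Y \<subseteq> S" using ex Y by blast
  have SC: "S \<subseteq> C" "card S = r - 1" using S by (auto simp: ms_def)
  have fS: "finite S" using SC finC finite_subset by blast
  then have fYY: "finite Y" using S finite_subset by blast
  have "\<mu> ^ (r - 1 - s) = (\<Prod>i\<in>S - Y. \<mu>)" using S SC Y fYY by (simp add: card_Diff_subset)
  also have "... \<le> (\<Prod>i\<in>S - Y. x i)" using mu SC by (intro prod_mono) auto
  finally have "\<mu> ^ (r - 1 - s) * (\<Prod>i\<in>Y. x i) \<le> (\<Prod>i\<in>S - Y. x i) * (\<Prod>i\<in>Y. x i)"
   using Y by (intro mult_right_mono prod_nn) auto
  also have "... = (\<Prod>i\<in>S. x i)" using S fS by (simp add: prod.subset_diff[symmetric])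
  also have "... \<le> (\<Sum>S | S \<in> ms \<and> Y \<subseteq> S. \<Prod>i\<in>S. x i)"
  proof (rule member_le_sum)
   show "S \<in> {S. S \<in> ms \<and> Y \<subseteq> S}" using S by simp
   show "finite {S. S \<in> ms \<and> Y \<subseteq> S}" using fin_ms by simp
  qed (auto intro!: prod_nn simp: ms_def)
  finally show ?thesis .
 qed
 then have "(\<Sum>Y\<in>?Y. \<mu> ^ (r - 1 - s) * (\<Prod>i\<in>Y. x i)) \<le> (\<Sum>Y\<in>?Y. \<Sum>S | S \<in> ms \<and> Y \<subseteq> S. \<Prod>i\<in>S. x i)"
  by (rule sum_mono)
 also have "... = (\<Sum>S\<in>ms. \<Sum>Y | Y \<in> ?Y \<and> Y \<subseteq> S. \<Prod>i\<in>S. x i)"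
  using fY fin_ms by (intro sum.swap_restrict) auto
 also have "... = (\<Sum>S\<in>ms. real ((r - 1) choose s) * (\<Prod>i\<in>S. x i))"
 proof (rule sum.cong[OF refl])
  fix S assume S: "S \<in> ms"
  then have "{Y. Y \<in> ?Y \<and> Y \<subseteq> S} = {Y. Y \<subseteq> S \<and> card Y = s}" by (auto simp: ms_def)
  moreover have "finite S" "card S = r - 1" using S finC finite_subset by (auto simp: ms_def)
  ultimately show "(\<Sum>Y | Y \<in> ?Y \<and> Y \<subseteq> S. \<Prod>i\<in>S. x i) = real ((r - 1) choose s) * (\<Prod>i\<in>S. x i)"
   using n_subsets[of S s] by simp
 qed
 finally show ?thesis unfolding esym_def mw_def sum_distrib_left .
qed

text \<open>The edges at \<open>i\<close> contribute \<open>x i * dl i\<close> to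
  \<open>lam\<close>, and \<open>dl i\<close> is about \<open>r * lam\<close>, so no weight is much
  above \<open>1 / r \<le> 1/5\<close>; the margin up to \<open>21/100\<close> absorbs
  \<open>d\<close>.\<close>

lemma cap:
 assumes "0 < lam" "100 * d \<le> lam" "5 \<le> r" "i \<in> C"
 shows "x i \<le> 21/100"
proof (rule ccontr)
 assume n: "\<not> x i \<le> 21/100"
 have "5 * lam - d \<le> real r * lam - d" using assms by (intro diff_right_mono mult_right_mono) auto
 also have "... \<le> dl i" using dl_ge assms by blast
 finally have "21/100 * (5 * lam - d) \<le> x i * dl i" using n assms dl_ge[OF assms(4)] by (intro mult_mono) auto
 also have "... \<le> lam" by (rule x_dl_le[OF assms(4)])
 finally show False using assms(1,2) by simp
qed

lemma mw_nonneg: "0 \<le> mw" unfolding mw_def by (intro sum_nonneg prod_nn) (auto simp: ms_def)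

lemma card_pos: "card C > 0" using sum1 finC by (cases "C = {}") (auto simp: card_gt_0_iff)

definition var :: real where "var = (\<Sum>i\<in>C. (x i - 1 / rcard C) ^ 2)"

lemma var_eq: "var = (\<Sum>i\<in>C. x i ^ 2) - 1 / rcard C"
proof -
 have "var = (\<Sum>i\<in>C. x i ^ 2 - 2 / rcard C * x i + (1 / rcard C) ^ 2)"
  unfolding var_def by (intro sum.cong refl) (simp add: power2_diff)
 also have "... = (\<Sum>i\<in>C. x i ^ 2) - 2 / rcard C * (\<Sum>i\<in>C. x i) + rcard C * (1 / rcard C) ^ 2"
  unfolding sum.distrib sum_subtractf by (simp add: sum_distrib_left)
 also have "... = (\<Sum>i\<in>C. x i ^ 2) - 1 / rcard C" using card_pos by (simp add: sum1 power2_eq_square)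
 finally show ?thesis .
qed

lemma var_ge: "i \<in> C ==> (x i - 1 / rcard C) ^ 2 \<le> var" unfolding var_def using finC by (intro member_le_sum) auto

text \<open>The linear term vanishes because the weights have mean
  \<open>1 / rcard C\<close>.\<close>

lemma tangent_sum:
 assumes "\<And>i. i \<in> C ==> x i * (1 - x i) ^ s \<le> A + B * (x i - 1 / rcard C) - K * (x i - 1 / rcard C) ^ 2"
 shows "(\<Sum>i\<in>C. x i * (1 - x i) ^ s) \<le> rcard C * A - K * var"
proof -
 have "(\<Sum>i\<in>C. x i * (1 - x i) ^ s) \<le> (\<Sum>i\<in>C. A + B * (x i - 1 / rcard C) - K * (x i - 1 / rcard C) ^ 2)"
  by (rule sum_mono) (rule assms)
 also have "... = rcard C * A + B * ((\<Sum>i\<in>C. x i) - rcard C * (1 / rcard C)) - K * var"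
  unfolding sum.distrib sum_subtractf sum_distrib_left[symmetric] var_def by simp
 also have "... = rcard C * A - K * var" using card_pos sum1 by simp
 finally show ?thesis .
qed

end

text \<open>Second-order coefficients in tangent bounds for \<open>x (1 - x)^3\<close> and \<open>x (1 - x)^4\<close> at \<open>a\<close>, valid for \<open>x \<le> 21/100\<close>.\<close>

abbreviation q5 :: "real => real" where "q5 a \<equiv> 237/100 - 516/100 * a + 2 * a ^ 2"

abbreviation q6 :: "real => real" where
 "q6 a \<equiv> 4 - 18 * a + 24 * a ^ 2 - 10 * a ^ 3 - (6 - 16 * a + 10 * a ^ 2) * (21/100 - a)"

text \<open>The gap between the two sides is \<open>(x - a) ^ 2\<close> times a factor that is
  visibly nonnegative for \<open>x \<le> 21/100\<close>; \<open>q5\<close> is chosen so that this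
  factorisation comes out.\<close>

lemma tangent5:
 fixes x a :: real
 assumes "x \<le> 21/100" "a \<le> 1/5"
 shows "x * (1 - x) ^ 3 \<le> a * (1 - a) ^ 3 + (1 - a) ^ 2 * (1 - 4 * a) * (x - a)
  - q5 a * (x - a) ^ 2"
proof -
 have "a * (1 - a) ^ 3 + (1 - a) ^ 2 * (1 - 4 * a) * (x - a)
  - q5 a * (x - a) ^ 2 - x * (1 - x) ^ 3
  = (x - a) ^ 2 * ((3 - 4 * a) * (21/100 - x) + (x - a) ^ 2)" by (simp add: field_simps power2_eq_square power3_eq_cube)
 moreover have "0 \<le> (x - a) ^ 2 * ((3 - 4 * a) * (21/100 - x) + (x - a) ^ 2)"
  using assms by (intro mult_nonneg_nonneg add_nonneg_nonneg) auto
 ultimately show ?thesis by linarith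
qed

lemma tangent6:
 fixes x a :: real
 assumes "x \<le> 21/100" "0 \<le> a" "a \<le> 1/5"
 shows "x * (1 - x) ^ 4 \<le> a * (1 - a) ^ 4 + (1 - a) ^ 3 * (1 - 5 * a) * (x - a)
  - q6 a * (x - a) ^ 2"
proof -
 have "a * (1 - a) ^ 4 + (1 - a) ^ 3 * (1 - 5 * a) * (x - a)
  - q6 a * (x - a) ^ 2 - x * (1 - x) ^ 4
  = (x - a) ^ 2 * ((6 - 16 * a + 10 * a ^ 2) * (21/100 - x) + (x - a) ^ 2 * (4 - 4 * a - x))"
  by (simp add: field_simps power2_eq_square power3_eq_cube power4_eq_xxxx)
 moreover have "0 \<le> 6 - 16 * a + 10 * a ^ 2"
 proof -
  have "0 \<le> (1 - a) * (6 - 10 * a)" using assms by (intro mult_nonneg_nonneg) auto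
  then show ?thesis by (simp add: algebra_simps power2_eq_square)
 qed
 then have "0 \<le> (x - a) ^ 2 * ((6 - 16 * a + 10 * a ^ 2) * (21/100 - x) + (x - a) ^ 2 * (4 - 4 * a - x))"
  using assms by (intro mult_nonneg_nonneg add_nonneg_nonneg) auto
 ultimately show ?thesis by linarith
qed

lemma choose4: "real (m choose 4) = real m * (real m - 1) * (real m - 2) * (real m - 3) / 24"
 by (simp add: binomial_gbinomial gbinomial_prod_rev numeral_eq_Suc fact_num_eq_if)

lemma choose5: "real (m choose 5) = real m * (real m - 1) * (real m - 2) * (real m - 3) * (real m - 4) / 120"
 by (simp add: binomial_gbinomial gbinomial_prod_rev numeral_eq_Suc fact_num_eq_if)

lemma choose3: "real (m choose 3) = real m * (real m - 1) * (real m - 2) / 6"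
 by (simp add: binomial_gbinomial gbinomial_prod_rev numeral_eq_Suc fact_num_eq_if)

lemma choose6: "real (m choose 6) = real m * (real m - 1) * (real m - 2) * (real m - 3) * (real m - 4) * (real m - 5) / 720"
 by (simp add: binomial_gbinomial gbinomial_prod_rev numeral_eq_Suc fact_num_eq_if)

section \<open>Number of points and weights of near-optimal partial Steiner systems\<close>

context kkt
begin

lemma min_weight:
 obtains i where "i \<in> C" "\<And>j. j \<in> C ==> x i \<le> x j"
proof -
 have "C \<noteq> {}" using card_pos by auto
 then have "Min (x ` C) \<in> x ` C" using finC by (intro Min_in) auto
 then obtain i where "i \<in> C" "x i = Min (x ` C)" by auto
 then show ?thesis using that[of i] finC by auto
qed

lemma maclaurin1: "esym x C s \<le> real (card C choose s) / rcard C ^ s"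
 using maclaurin[of C x s] finC xn sum1 by (simp add: power_divide)

lemma e4_variance:
 assumes "r = 5" "0 < lam" "100 * d \<le> lam" "5 \<le> card C"
 defines "a \<equiv> 1 / rcard C"
 shows "4 * esym x C 4 \<le> real ((card C - 1) choose 3) / real (card C - 1) ^ 3 *
  ((1 - a) ^ 3 - q5 a * var)"
proof -
 have a: "a \<le> 1/5" unfolding a_def using assms by (simp add: field_simps)
 have "(\<Sum>i\<in>C. x i * (1 - x i) ^ 3) \<le> rcard C * (a * (1 - a) ^ 3) - q5 a * var"
 proof (rule tangent_sum[where B = "(1 - a) ^ 2 * (1 - 4 * a)"])
  fix i assume "i \<in> C"
  then have "x i \<le> 21/100" using cap assms by simp
  from tangent5[OF this a]
  show "x i * (1 - x i) ^ 3 \<le> a * (1 - a) ^ 3 + (1 - a) ^ 2 * (1 - 4 * a) * (x i - 1 / rcard C)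
   - q5 a * (x i - 1 / rcard C) ^ 2" by (simp add: a_def)
 qed
 moreover have "rcard C * (a * (1 - a) ^ 3) = (1 - a) ^ 3" using assms by (simp add: a_def)
 ultimately have "real ((card C - 1) choose 3) / real (card C - 1) ^ 3 * (\<Sum>i\<in>C. x i * (1 - x i) ^ 3)
  \<le> real ((card C - 1) choose 3) / real (card C - 1) ^ 3 * ((1 - a) ^ 3 - q5 a * var)" by (intro mult_left_mono) auto
 moreover have "4 * esym x C 4 \<le> real ((card C - 1) choose 3) / real (card C - 1) ^ 3 * (\<Sum>i\<in>C. x i * (1 - x i) ^ 3)"
  using esym_variance[OF finC xn sum1, of 3] by simp
 ultimately show ?thesis by linarith
qed

lemma e5_variance:
 assumes "r = 6" "0 < lam" "100 * d \<le> lam" "5 \<le> card C"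
 defines "a \<equiv> 1 / rcard C"
 shows "5 * esym x C 5 \<le> real ((card C - 1) choose 4) / real (card C - 1) ^ 4 *
  ((1 - a) ^ 4 - q6 a * var)"
proof -
 define K where "K = 4 - 18 * a + 24 * a ^ 2 - 10 * a ^ 3 - (6 - 16 * a + 10 * a ^ 2) * (21/100 - a)"
 have a: "0 \<le> a" "a \<le> 1/5" unfolding a_def using assms by (simp_all add: field_simps)
 have "(\<Sum>i\<in>C. x i * (1 - x i) ^ 4) \<le> rcard C * (a * (1 - a) ^ 4) - K * var"
 proof (rule tangent_sum[where B = "(1 - a) ^ 3 * (1 - 5 * a)"])
  fix i assume "i \<in> C"
  then have "x i \<le> 21/100" using cap assms by simp
  from tangent6[OF this a]
  show "x i * (1 - x i) ^ 4 \<le> a * (1 - a) ^ 4 + (1 - a) ^ 3 * (1 - 5 * a) * (x i - 1 / rcard C)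
   - K * (x i - 1 / rcard C) ^ 2" unfolding K_def by (simp add: a_def)
 qed
 moreover have "rcard C * (a * (1 - a) ^ 4) = (1 - a) ^ 4" using assms by (simp add: a_def)
 ultimately have "real ((card C - 1) choose 4) / real (card C - 1) ^ 4 * (\<Sum>i\<in>C. x i * (1 - x i) ^ 4)
  \<le> real ((card C - 1) choose 4) / real (card C - 1) ^ 4 * ((1 - a) ^ 4 - K * var)" by (intro mult_left_mono) auto
 moreover have "5 * esym x C 5 \<le> real ((card C - 1) choose 4) / real (card C - 1) ^ 4 * (\<Sum>i\<in>C. x i * (1 - x i) ^ 4)"
  using esym_variance[OF finC xn sum1, of 4] by simp
 ultimately show ?thesis unfolding K_def by linarith
qed

text \<open>Common ending for seven, eight and nine points: once the square sum is at most
  \<open>b\<close>, \<open>sixset'\<close> makes nearly \<open>66/11^5 * (1 - 5 * b)\<close> a lower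
  bound for the total weight of six-sets, which Maclaurin contradicts.\<close>

lemma sixset_contra:
 assumes r: "r = 5" and d: "0 \<le> d" "d \<le> 1/10^8" and l: "66/161051 - d \<le> lam"
  and p: "(\<Sum>i\<in>C. x i ^ 2) \<le> b" "b \<le> 1/5"
  and e: "real (card C choose 6) / rcard C ^ 6 + d < (66/161051 - d) * (1 - 5 * b)"
 shows False
proof -
 let ?p = "\<Sum>i\<in>C. x i ^ 2"
 have p0: "0 \<le> ?p" by (intro sum_nonneg) auto
 have "lam - (real r * lam + d) * ?p \<le> real (card C choose 6) / rcard C ^ 6" using sixset' maclaurin1[of 6] r by simp
 moreover have "lam - (real r * lam + d) * ?p = lam * (1 - 5 * ?p) - d * ?p" using r by (simp add: algebra_simps)
 moreover have "d * ?p \<le> d * 1" using d p p0 by (intro mult_left_mono) auto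
 moreover have "(66/161051 - d) * (1 - 5 * b) \<le> lam * (1 - 5 * ?p)" using l d p by (intro mult_mono) auto
 ultimately show False using e by linarith
qed

text \<open>\<open>66/161051\<close> is \<open>66/11^5\<close>, the value of the design. The
  Maclaurin bound for four-sets leaves 7 to 11 points. With 7, 8 or 9 points the weights must be
  nearly uniform, and then the six-sets weigh too little. With 10 points, 2 does not divide 7, so
  every triple lies in an uncovered four-set.\<close>

lemma card_eleven:
 assumes r: "r = 5" and d: "0 \<le> d" "d \<le> 1/10^8" and l: "66/161051 - d \<le> lam"
 shows "card C = 11"
proof -
 define m where "m = card C"
 have lp: "0 < lam" "100 * d \<le> lam" using d l by simp_all
 have main: "real m * (5 * lam - d) \<le> esym x C 4 - mw" using main_bound r by (simp add: m_def)
 have "real m * (330/161051 - 6 * d) \<le> real m * (5 * lam - d)" using l by (intro mult_left_mono) auto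
 then have mainL: "real m * (330/161051 - 6 * d) \<le> esym x C 4 - mw" using main by linarith
 have "real m * (330/161051 - 6/10^8) \<le> real m * (330/161051 - 6 * d)" using d by (intro mult_left_mono) auto
 then have mainN: "real m * (330/161051 - 6/10^8) \<le> esym x C 4 - mw" using mainL by linarith
 have mac: "real m * (330/161051 - 6/10^8) \<le> real (m choose 4) / real m ^ 4"
  using mainN maclaurin1[of 4] mw_nonneg unfolding m_def by linarith
 have scale: "c / b * u \<le> v / b ==> 0 < b ==> c * u \<le> v" for c b u v :: real by (simp add: field_simps)
 have m1: "m \<ge> 1" using card_pos by (simp add: m_def)
 have "m \<ge> 7"
 proof (rule ccontr)
  assume "\<not> m \<ge> 7"
  then have "m = 1 \<or> m = 2 \<or> m = 3 \<or> m = 4 \<or> m = 5 \<or> m = 6" using m1 by linarith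
  then show False using mac by (auto simp: choose4)
 qed
 moreover have "m \<le> 11"
 proof (rule ccontr)
  assume "\<not> m \<le> 11"
  then have "real m \<ge> 12" by simp
  then obtain t where t: "real m = t + 12" "t \<ge> 0" by (metis add.commute diff_add_cancel diff_ge_0_iff_ge)
  have "real m * (330/161051 - 6/10^8) * real m ^ 4 \<le> real (m choose 4)" using mac m1 by (simp add: field_simps)
  then have "real m * ((330/161051 - 6/10^8) * real m ^ 4) \<le> real m * ((real m - 1) * (real m - 2) * (real m - 3) / 24)"
   unfolding choose4 by (simp add: algebra_simps)
  then have AA: "(330/161051 - 6/10^8) * real m ^ 4 \<le> (real m - 1) * (real m - 2) * (real m - 3) / 24"
   using m1 by (subst (asm) mult_le_cancel_left_pos) auto
  \<comment> \<open>In \<open>t = m - 12\<close> the difference of the two sides has only positive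
    coefficients; \<open>49175/10^6\<close> is \<open>24 * (330/161051 - 6/10^8)\<close> rounded
    down.\<close>
  let ?p = "49175/10^6 * t ^ 4 + (49175*48/10^6 - 1) * t ^ 3 + (49175*864/10^6 - 30) * t ^ 2
    + (49175*6912/10^6 - 299) * t + (49175*20736/10^6 - 990)"
  have BB: "49175/10^6/24 * real m ^ 4 \<le> (330/161051 - 6/10^8) * real m ^ 4" by (intro mult_right_mono) auto
  have "49175/10^6 * real m ^ 4 \<le> (real m - 1) * (real m - 2) * (real m - 3)"
   by (rule scale[OF order_trans[OF BB AA]]) simp
  moreover have "real m - 1 = t + 11" "real m - 2 = t + 10" "real m - 3 = t + 9" using t by simp_all
  ultimately have "49175/10^6 * (t + 12) ^ 4 \<le> (t + 11) * (t + 10) * (t + 9)" using t(1) by (simp add: add.commute)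
  moreover have "49175/10^6 * (t + 12) ^ 4 - (t + 11) * (t + 10) * (t + 9)
   = ?p" by (simp add: algebra_simps power2_eq_square power3_eq_cube power4_eq_xxxx)
  moreover have "0 < ?p" using t by (intro add_nonneg_pos add_nonneg_nonneg mult_nonneg_nonneg zero_le_power) auto
  ultimately show False by linarith
 qed
 ultimately have "m = 7 \<or> m = 8 \<or> m = 9 \<or> m = 10 \<or> m = 11" by linarith
 moreover have False if "m = 7"
 proof -
  have "4 * esym x C 4 \<le> 20/216 * ((6/7)^3 - q5 (1/7) * var)"
   using e4_variance[OF r lp] that by (simp add: m_def choose3)
  then have "var \<le> 1/100" using mainN mw_nonneg that by (simp add: power3_eq_cube power2_eq_square)
  then have "(\<Sum>i\<in>C. x i ^ 2) \<le> 1/7 + 1/100" using var_eq that by (simp add: m_def)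
  then show False using d that by (intro sixset_contra[OF r d l, of "1/7 + 1/100"]) (simp_all add: m_def choose6)
 qed
 moreover have False if "m = 8"
 proof -
  have "4 * esym x C 4 \<le> 35/343 * ((7/8)^3 - q5 (1/8) * var)"
   using e4_variance[OF r lp] that by (simp add: m_def choose3)
  then have "var \<le> 17/1000" using mainN mw_nonneg that by (simp add: power3_eq_cube power2_eq_square)
  then have "(\<Sum>i\<in>C. x i ^ 2) \<le> 1/8 + 17/1000" using var_eq that by (simp add: m_def)
  then show False using d that by (intro sixset_contra[OF r d l, of "1/8 + 17/1000"]) (simp_all add: m_def choose6)
 qed
 moreover have False if "m = 9"
 proof -
  define p where "p j = (\<Sum>i\<in>C. x i ^ j)" for j
  have p1: "p 1 = 1" using sum1 by (simp add: p_def)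
  have c9: "rcard C = 9" using that m_def by simp
  \<comment> \<open>This sum bounds the third power sum from above through the cap on the weights;
    the similar sum further down bounds the fourth from below. Together they turn Newton's identity
    into a bound in the square sum alone.\<close>
  have "0 \<le> (\<Sum>i\<in>C. (x i - 1/9) ^ 2 * (21/100 - x i))"
   using cap[OF lp] r by (intro sum_nonneg mult_nonneg_nonneg) auto
  also have "... = (\<Sum>i\<in>C. (21/100 + 2/9) * x i ^ 2 - x i ^ 3 - (42/900 + 1/81) * x i + 21/8100)"
   by (intro sum.cong refl) (simp add: field_simps power2_eq_square power3_eq_cube)
  also have "... = (21/100 + 2/9) * p 2 - p 3 - (42/900 + 1/81) * p 1 + 9 * 21/8100"
   unfolding p_def sum.distrib sum_subtractf sum_distrib_left by (simp add: c9)
  finally have 3: "p 3 \<le> (21/100 + 2/9) * p 2 - (42/900 + 1/81) + 9 * 21/8100" using p1 by simp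
  have "0 \<le> (\<Sum>i\<in>C. (x i - 1/9) ^ 2 * x i ^ 2)" by (intro sum_nonneg) auto
  also have "... = (\<Sum>i\<in>C. x i ^ 4 - 2/9 * x i ^ 3 + 1/81 * x i ^ 2)"
   by (intro sum.cong refl) (simp add: field_simps power2_eq_square power3_eq_cube power4_eq_xxxx)
  also have "... = p 4 - 2/9 * p 3 + 1/81 * p 2" unfolding p_def sum.distrib sum_subtractf sum_distrib_left by simp
  finally have 4: "p 4 \<ge> 2/9 * p 3 - 1/81 * p 2" by simp
  have N: "24 * esym x C 4 = 1 - 6 * p 2 + 8 * p 3 + 3 * p 2 ^ 2 - 6 * p 4"
   using newton4[OF finC, of x] sum1 by (simp add: p_def)
  have p2: "1/9 \<le> p 2" "p 2 \<le> 1/4"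
  proof -
   have "0 \<le> var" unfolding var_def by (intro sum_nonneg) auto
   then show "1/9 \<le> p 2" using var_eq c9 by (simp add: p_def)
   have "p 2 \<le> (\<Sum>i\<in>C. 21/100 * x i)" unfolding p_def power2_eq_square
    using cap[OF lp] r xn by (intro sum_mono mult_right_mono) auto
   also have "... = 21/100 * (\<Sum>i\<in>C. x i)" by (simp only: sum_distrib_left)
   finally show "p 2 \<le> 1/4" using sum1 by simp
  qed
  have "p 2 \<le> 119/1000"
  proof (rule ccontr)
   assume n: "\<not> p 2 \<le> 119/1000"
   \<comment> \<open>The chord of the square function over this interval makes the bound linear in
     \<open>p 2\<close>.\<close>
   have "(p 2 - 119/1000) * (p 2 - 1/4) \<le> 0" using n p2 by (intro mult_nonneg_nonpos) auto
   then have "p 2 ^ 2 \<le> 369/1000 * p 2 - 119/4000" by (simp add: field_simps power2_eq_square)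
   moreover have "24 * e \<le> 4425/10000"
    if "s \<le> 369/1000 * a - 119/4000" "24 * e = 1 - 6 * a + 8 * b + 3 * s - 6 * c"
     "b \<le> (21/100 + 2/9) * a - (42/900 + 1/81) + 9 * 21/8100" "2/9 * b - 1/81 * a \<le> c" "119/1000 \<le> a"
    for s a b c e :: real using that by (simp add: field_simps)
   ultimately have "24 * esym x C 4 \<le> 4425/10000" using N 3 4 n by (meson linear)
   then show False using mainN mw_nonneg that by simp
  qed
  then have "(\<Sum>i\<in>C. x i ^ 2) \<le> 119/1000" by (simp add: p_def)
  then show False using d that by (intro sixset_contra[OF r d l, of "119/1000"]) (simp_all add: m_def choose6)
 qed
 moreover have False if "m = 10"
 proof -
  obtain i where i: "i \<in> C" "\<And>j. j \<in> C ==> x i \<le> x j" using min_weight by blast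
  define \<mu> where "\<mu> = x i"
  have c10: "rcard C = 10" using that m_def by simp
  have mu: "0 \<le> \<mu>" "\<mu> \<le> 1/10"
  proof -
   show "0 \<le> \<mu>" using xn i by (simp add: \<mu>_def)
   have "(\<Sum>j\<in>C. \<mu>) \<le> (\<Sum>j\<in>C. x j)" using i by (intro sum_mono) (simp add: \<mu>_def)
   then show "\<mu> \<le> 1/10" using sum1 c10 by simp
  qed
  have ex: "\<exists>S\<in>ms. Y \<subseteq> S" if "Y \<subseteq> C" "card Y = 3" for Y
   using missing_ex[of Y] that r \<open>m = 10\<close> by (simp add: m_def)
  have "\<mu> ^ (r - 1 - 3) * esym x C 3 \<le> real ((r - 1) choose 3) * mw"
   using ex mu i by (intro missing_weight) (auto simp: \<mu>_def)
  then have "\<mu> * esym x C 3 \<le> 4 * mw" using r by (simp add: numeral_eq_Suc)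
  moreover have "\<mu> * (4 * esym x C 4) \<le> \<mu> * esym x C 3"
   using esym_step[OF finC xn sum1, of 3] mu by (intro mult_left_mono) auto
  ultimately have "mw \<ge> \<mu> * esym x C 4" by simp
  \<comment> \<open>A large minimum weight \<open>\<mu>\<close> makes the uncovered four-sets heavy,
    a small one makes the variance large. The combined bound stays below the required value for
    every \<open>\<mu>\<close> between 0 and \<open>1/10\<close>.\<close>
  then have A: "10 * (330/161051 - 6/10^8) \<le> (1 - \<mu>) * esym x C 4" using mainN that by (simp add: algebra_simps)
  have "4 * esym x C 4 \<le> 84/729 * ((9/10)^3 - q5 (1/10) * var)"
   using e4_variance[OF r lp] that by (simp add: m_def choose3)
  moreover have v: "(\<mu> - 1/10) ^ 2 \<le> var" using var_ge[OF i(1)] c10 by (simp add: \<mu>_def)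
  moreover have "0 \<le> var" using v by (meson order_trans zero_le_power2)
  ultimately have "esym x C 4 \<le> 21/1000 - 539/10000 * (\<mu> - 1/10) ^ 2" by (simp add: power_divide)
  then have "(1 - \<mu>) * esym x C 4 \<le> (1 - \<mu>) * (21/1000 - 539/10000 * (\<mu> - 1/10) ^ 2)"
   using mu by (intro mult_left_mono) auto
  also have "... = 20461/10^6 - 9681/10^6 * \<mu> - 6468/10^5 * \<mu> ^ 2 + 539/10^4 * \<mu> * \<mu> ^ 2"
   by (simp add: field_simps power2_eq_square)
  also have "... \<le> 20461/10^6"
  proof -
   define q where "q = \<mu> ^ 2"
   have "0 \<le> q" by (simp add: q_def)
   moreover from this have "\<mu> * q \<le> 1 * q" using mu by (intro mult_right_mono) auto
   ultimately have "539/10^4 * (\<mu> * q) \<le> 6468/10^5 * q" by simp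
   then show ?thesis using mu unfolding q_def[symmetric] by simp
  qed
  finally show False using A by simp
 qed
 ultimately show ?thesis by (auto simp: m_def)
qed

text \<open>With 11 points Maclaurin is tight, so \<open>mw\<close> and the variance are both
  \<open>O(d)\<close>; 1200 is \<open>66 / 0.05575\<close> rounded up. The variance bound keeps all
  weights above \<open>1/20\<close>, and then a single uncovered four-set would weigh
  \<open>20^(-4)\<close>, more than \<open>66 * d\<close>.\<close>

lemma near_uniform5:
 assumes r: "r = 5" and d: "0 \<le> d" "d \<le> 1/10^8" and l: "66/161051 - d \<le> lam"
 shows "ms = {}" "i \<in> C ==> (x i - 1/11) ^ 2 \<le> 1200 * d"
proof -
 have c: "card C = 11" by (rule card_eleven[OF assms])
 have lp: "0 < lam" "100 * d \<le> lam" using d l by simp_all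
 have main: "11 * (330/161051 - 6 * d) \<le> esym x C 4 - mw" using main_bound r l c by simp
 have "4 * esym x C 4 \<le> 120/1000 * ((10/11)^3 - q5 (1/11) * var)" using e4_variance[OF r lp] c by (simp add: choose3)
 moreover have v0: "0 \<le> var" unfolding var_def by (intro sum_nonneg) auto
 ultimately have 1: "mw + 5575/100000 * var \<le> 66 * d" using main by (simp add: power3_eq_cube power2_eq_square)
 have v: "(x i - 1/11) ^ 2 \<le> 1200 * d" if "i \<in> C" for i using var_ge[OF that] c 1 mw_nonneg d by simp
 then show "i \<in> C ==> (x i - 1/11) ^ 2 \<le> 1200 * d" .
 show "ms = {}"
 proof (rule ccontr)
  assume "ms \<noteq> {}"
  then obtain S where S: "S \<in> ms" by auto
  have "S \<subseteq> C" "card S = r - 1" using S by (auto simp: ms_def)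
  then have S': "S \<subseteq> C" "card S = 4" using r by simp_all
  have lo: "1/20 \<le> x i" if "i \<in> C" for i
  proof (rule ccontr)
   assume "\<not> 1/20 \<le> x i"
   then have "(1/25) ^ 2 \<le> (1/11 - x i) ^ 2" by (intro power_mono) auto
   then show False using v[OF that] d power2_commute[of "1/11" "x i"] by (simp add: power_divide)
  qed
  have "(1/20) ^ 4 = (\<Prod>i\<in>S. (1/20::real))" using S' by simp
  also have "... \<le> (\<Prod>i\<in>S. x i)" using lo S' by (intro prod_mono) auto
  also have "... \<le> mw" unfolding mw_def using S fin_ms by (intro member_le_sum) (auto intro!: prod_nn simp: ms_def)
  finally show False using 1 d v0 by (simp add: power4_eq_xxxx)
 qed
qed

text \<open>\<open>132/2985984\<close> is \<open>132/12^6\<close>. Maclaurin for five-sets leaves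
  12, 13 and 14 points. Divisibility excludes the last two: with four points fixed out of 13, 2 does
  not divide 9; with three fixed out of 14, 3 does not divide 55. The resulting uncovered five-sets
  are played off against the variance.\<close>

lemma card_twelve:
 assumes r: "r = 6" and d: "0 \<le> d" "d \<le> 1/10^9" and l: "132/2985984 - d \<le> lam"
 shows "card C = 12"
proof -
 define m where "m = card C"
 have lp: "0 < lam" "100 * d \<le> lam" using d l by simp_all
 have main: "real m * (6 * lam - d) \<le> esym x C 5 - mw" using main_bound r by (simp add: m_def)
 have "real m * (792/2985984 - 7/10^9) \<le> real m * (6 * lam - d)" using l d by (intro mult_left_mono) auto
 then have mainN: "real m * (792/2985984 - 7/10^9) \<le> esym x C 5 - mw" using main by linarith
 have mac: "real m * (792/2985984 - 7/10^9) \<le> real (m choose 5) / real m ^ 5"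
  using mainN maclaurin1[of 5] mw_nonneg unfolding m_def by linarith
 have scale: "c / b * u \<le> v / b ==> 0 < b ==> c * u \<le> v" for c b u v :: real by (simp add: field_simps)
 have m1: "m \<ge> 1" using card_pos by (simp add: m_def)
 have "m \<ge> 12"
 proof (rule ccontr)
  assume "\<not> m \<ge> 12"
  then have "m = 1 \<or> m = 2 \<or> m = 3 \<or> m = 4 \<or> m = 5 \<or> m = 6 \<or> m = 7 \<or> m = 8 \<or> m = 9 \<or> m = 10 \<or> m = 11"
   using m1 by presburger
  then show False using mac by (auto simp: choose5)
 qed
 moreover have "m \<le> 14"
 proof (rule ccontr)
  assume "\<not> m \<le> 14"
  then have "real m \<ge> 15" by simp
  then obtain t where t: "real m = t + 15" "t \<ge> 0" by (metis add.commute diff_add_cancel diff_ge_0_iff_ge)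
  have "real m * (792/2985984 - 7/10^9) * real m ^ 5 \<le> real (m choose 5)" using mac m1 by (simp add: field_simps)
  then have "real m * ((792/2985984 - 7/10^9) * real m ^ 5) \<le> real m * ((real m - 1) * (real m - 2) * (real m - 3) * (real m - 4) / 120)"
   unfolding choose5 by (simp add: algebra_simps)
  then have AA: "(792/2985984 - 7/10^9) * real m ^ 5 \<le> (real m - 1) * (real m - 2) * (real m - 3) * (real m - 4) / 120"
   using m1 by (subst (asm) mult_le_cancel_left_pos) auto
  let ?p = "31827/10^6 * t ^ 5 + (31827*75/10^6 - 1) * t ^ 4 + (31827*2250/10^6 - 50) * t ^ 3 + (31827*33750/10^6 - 935) * t ^ 2
    + (31827*253125/10^6 - 7750) * t + (31827*759375/10^6 - 24024)"
  have BB: "31827/10^6/120 * real m ^ 5 \<le> (792/2985984 - 7/10^9) * real m ^ 5" by (intro mult_right_mono) auto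
  have "31827/10^6 * real m ^ 5 \<le> (real m - 1) * (real m - 2) * (real m - 3) * (real m - 4)"
   by (rule scale[OF order_trans[OF BB AA]]) simp
  moreover have "real m - 1 = t + 14" "real m - 2 = t + 13" "real m - 3 = t + 12" "real m - 4 = t + 11" using t by simp_all
  ultimately have "31827/10^6 * (t + 15) ^ 5 \<le> (t + 14) * (t + 13) * (t + 12) * (t + 11)"
   using t(1) by (simp add: add.commute)
  moreover have "31827/10^6 * (t + 15) ^ 5 - (t + 14) * (t + 13) * (t + 12) * (t + 11)
   = ?p" by (simp add: algebra_simps power_numeral_reduce)
  moreover have "0 < ?p" using t by (intro add_nonneg_pos add_nonneg_nonneg mult_nonneg_nonneg zero_le_power) auto
  ultimately show False by linarith
 qed
 ultimately have "m = 12 \<or> m = 13 \<or> m = 14" by linarith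
 moreover have False if "m = 13 \<or> m = 14"
 proof -
  obtain i where i: "i \<in> C" "\<And>j. j \<in> C ==> x i \<le> x j" using min_weight by blast
  define \<mu> where "\<mu> = x i"
  have mu: "0 \<le> \<mu>" "rcard C * \<mu> \<le> 1"
  proof -
   show "0 \<le> \<mu>" using xn i by (simp add: \<mu>_def)
   have "(\<Sum>j\<in>C. \<mu>) \<le> (\<Sum>j\<in>C. x j)" using i by (intro sum_mono) (simp add: \<mu>_def)
   then show "rcard C * \<mu> \<le> 1" using sum1 by simp
  qed
  have st: "5 * esym x C 5 \<le> esym x C 4" "4 * esym x C 4 \<le> esym x C 3"
   using esym_step[OF finC xn sum1, of 4] esym_step[OF finC xn sum1, of 3] by simp_all
  have vg: "(\<mu> - 1 / rcard C) ^ 2 \<le> var" using var_ge[OF i(1)] by (simp add: \<mu>_def)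
  then have v0: "0 \<le> var" by (meson order_trans zero_le_power2)
  from that show False
  proof
   assume m: "m = 13"
   have ex: "\<exists>S\<in>ms. Y \<subseteq> S" if "Y \<subseteq> C" "card Y = 4" for Y
    using missing_ex[of Y] that r m by (simp add: m_def)
   have "\<mu> ^ (r - 1 - 4) * esym x C 4 \<le> real ((r - 1) choose 4) * mw"
    using ex mu i by (intro missing_weight) (auto simp: \<mu>_def)
   then have "\<mu> * esym x C 4 \<le> 5 * mw" using r by (simp add: numeral_eq_Suc)
   moreover have "\<mu> * (5 * esym x C 5) \<le> \<mu> * esym x C 4" using st mu by (intro mult_left_mono) auto
   ultimately have "mw \<ge> \<mu> * esym x C 5" by simp
   then have A: "13 * (792/2985984 - 7/10^9) \<le> (1 - \<mu>) * esym x C 5" using mainN m by (simp add: algebra_simps)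
   have "5 * esym x C 5 \<le> 495/20736 * ((12/13)^4 - q6 (1/13) * var)"
    using e5_variance[OF r lp] m by (simp add: m_def choose4)
   moreover have "(\<mu> - 1/13) ^ 2 \<le> var" using vg m by (simp add: m_def)
   moreover note v0
   ultimately have "esym x C 5 \<le> 99/28561 - 1/100 * (\<mu> - 1/13) ^ 2"
    by (simp add: power4_eq_xxxx power3_eq_cube power2_eq_square)
   then have "(1 - \<mu>) * esym x C 5 \<le> (1 - \<mu>) * (99/28561 - 1/100 * (\<mu> - 1/13) ^ 2)"
    using mu m by (intro mult_left_mono) (auto simp: m_def)
   also have "... = (99/28561 - 1/16900) - (99/28561 - 1/16900 - 1/650) * \<mu> - (1/650 + 1/100) * \<mu> ^ 2 + 1/100 * \<mu> * \<mu> ^ 2"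
    by (simp add: field_simps power2_eq_square)
   also have "... \<le> 99/28561 - 1/16900"
   proof -
    define q where "q = \<mu> ^ 2"
    have "0 \<le> q" by (simp add: q_def)
    moreover from this have "\<mu> * q \<le> 1 * q" using mu m by (intro mult_right_mono) (auto simp: m_def)
    ultimately have "1/100 * (\<mu> * q) \<le> (1/650 + 1/100) * q" by (simp add: distrib_right)
    then show ?thesis using mu unfolding q_def[symmetric] by simp
   qed
   finally show False using A by simp
  next
   assume m: "m = 14"
   have ex: "\<exists>S\<in>ms. Y \<subseteq> S" if "Y \<subseteq> C" "card Y = 3" for Y
   proof -
    have "(11::nat) choose 2 = 55" by (simp add: choose_two)
    then show ?thesis using missing_ex[of Y] that r m by (simp add: m_def)
   qed
   have "\<mu> ^ (r - 1 - 3) * esym x C 3 \<le> real ((r - 1) choose 3) * mw"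
    using ex mu i by (intro missing_weight) (auto simp: \<mu>_def)
   moreover have "(5::nat) choose 3 = 10" by (simp add: numeral_eq_Suc)
   ultimately have "\<mu> ^ 2 * esym x C 3 \<le> 10 * mw" using r by simp
   moreover have "\<mu> ^ 2 * (20 * esym x C 5) \<le> \<mu> ^ 2 * esym x C 3" using st by (intro mult_left_mono) auto
   ultimately have "mw \<ge> 2 * \<mu> ^ 2 * esym x C 5" by simp
   then have A: "14 * (792/2985984 - 7/10^9) \<le> (1 - 2 * \<mu> ^ 2) * esym x C 5"
    using mainN m by (simp add: algebra_simps)
   have "5 * esym x C 5 \<le> 715/28561 * ((13/14)^4 - q6 (1/14) * var)"
    using e5_variance[OF r lp] m by (simp add: m_def choose4)
   moreover have "(\<mu> - 1/14) ^ 2 \<le> var" using vg m by (simp add: m_def)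
   moreover note v0
   ultimately have E: "esym x C 5 \<le> 143/38416 - 1/100 * (\<mu> - 1/14) ^ 2"
    by (simp add: power4_eq_xxxx power3_eq_cube power2_eq_square)
   show False
   \<comment> \<open>A small minimum weight contradicts the variance bound, a larger one the bound
     on uncovered five-sets.\<close>
   proof (cases "\<mu> \<le> 1/28")
    case True
    then have "(1/28) ^ 2 \<le> (1/14 - \<mu>) ^ 2" by (intro power_mono) auto
    then have "esym x C 5 \<le> 143/38416 - 1/78400" using E power2_commute[of "1/14" \<mu>] by (simp add: power_divide)
    moreover have "(1 - 2 * \<mu> ^ 2) * esym x C 5 \<le> 1 * esym x C 5"
     using xn by (intro mult_right_mono esym_nonneg) auto
    ultimately show False using A by simp
   next
    case False
    then have "(1/28) ^ 2 \<le> \<mu> ^ 2" by (intro power_mono) auto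
    then have "(1 - 2 * \<mu> ^ 2) * esym x C 5 \<le> (1 - 2 * (1/28) ^ 2) * esym x C 5"
     using xn by (intro mult_right_mono esym_nonneg) auto
    also have "... \<le> (1 - 2 * (1/28) ^ 2) * (143/38416)"
    proof (rule mult_left_mono)
     have "0 \<le> 1/100 * (\<mu> - 1/14) ^ 2" by simp
     then show "esym x C 5 \<le> 143/38416" using E by linarith
    qed (simp add: power_divide)
    finally show False using A by (simp add: power2_eq_square)
   qed
  qed
 qed
 ultimately show ?thesis by (auto simp: m_def)
qed

text \<open>As for 11 points: \<open>84 / 0.009\<close> is below 10000, and an uncovered five-set
  would weigh at least \<open>20^(-5)\<close>, more than \<open>84 * d\<close>.\<close>

lemma near_uniform6:
 assumes r: "r = 6" and d: "0 \<le> d" "d \<le> 1/10^9" and l: "132/2985984 - d \<le> lam"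
 shows "ms = {}" "i \<in> C ==> (x i - 1/12) ^ 2 \<le> 10000 * d"
proof -
 have c: "card C = 12" by (rule card_twelve[OF assms])
 have lp: "0 < lam" "100 * d \<le> lam" using d l by simp_all
 have main: "12 * (792/2985984 - 7 * d) \<le> esym x C 5 - mw" using main_bound r l c by simp
 have "5 * esym x C 5 \<le> 330/14641 * ((11/12)^4 - q6 (1/12) * var)" using e5_variance[OF r lp] c by (simp add: choose4)
 moreover have v0: "0 \<le> var" unfolding var_def by (intro sum_nonneg) auto
 ultimately have 1: "mw + 9/1000 * var \<le> 84 * d" using main by (simp add: power4_eq_xxxx power3_eq_cube power2_eq_square)
 have v: "(x i - 1/12) ^ 2 \<le> 10000 * d" if "i \<in> C" for i using var_ge[OF that] c 1 mw_nonneg d by simp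
 then show "i \<in> C ==> (x i - 1/12) ^ 2 \<le> 10000 * d" .
 show "ms = {}"
 proof (rule ccontr)
  assume "ms \<noteq> {}"
  then obtain S where S: "S \<in> ms" by auto
  have "S \<subseteq> C" "card S = r - 1" using S by (auto simp: ms_def)
  then have S': "S \<subseteq> C" "card S = 5" using r by simp_all
  have lo: "1/20 \<le> x i" if "i \<in> C" for i
  proof (rule ccontr)
   assume "\<not> 1/20 \<le> x i"
   then have "(1/30) ^ 2 \<le> (1/12 - x i) ^ 2" by (intro power_mono) auto
   then show False using v[OF that] d power2_commute[of "1/12" "x i"] by (simp add: power_divide)
  qed
  have "(1/20) ^ 5 = (\<Prod>i\<in>S. (1/20::real))" using S' by simp
  also have "... \<le> (\<Prod>i\<in>S. x i)" using lo S' by (intro prod_mono) auto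
  also have "... \<le> mw" unfolding mw_def using S fin_ms by (intro member_le_sum) (auto intro!: prod_nn simp: ms_def)
  finally show False using 1 d v0 by (simp add: power_divide)
 qed
qed

end

section \<open>Local structure of triangle-free hypergraphs\<close>

text \<open>An \<open>r\<close>-graph contains a generalized triangle iff it is not \<open>tfree\<close>: the two edges sharing
 \<open>r - 1\<close> points are \<open>S \<union> {a}\<close> and \<open>S \<union> {b}\<close>, the third edge is \<open>D\<close>.\<close>

definition tfree :: "'v set set => bool" where
 "tfree E \<longleftrightarrow> (\<forall>S a b D. a \<notin> S --> b \<notin> S --> a \<noteq> b --> insert a S \<in> E --> insert b S \<in> E -->
   D \<in> E --> a \<in> D --> b \<in> D --> D \<inter> S \<noteq> {})"

lemma tfreeD:
 "tfree E ==> a \<notin> S ==> b \<notin> S ==> a \<noteq> b ==> insert a S \<in> E ==> insert b S \<in> E ==>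
  D \<in> E ==> a \<in> D ==> b \<in> D ==> D \<inter> S = {} ==> False" unfolding tfree_def by blast

lemma tfree_mono: "tfree E ==> E' \<subseteq> E ==> tfree E'" unfolding tfree_def by (meson subsetD)

definition deg :: "'v set set => 'v => nat" where
 "deg E v = card {X \<in> E. v \<in> X}"

lemma card_insert_image_le:
 assumes "finite M" "\<And>S. S \<in> F ==> a \<notin> S" "\<And>S. S \<in> F ==> insert a S \<in> M"
 shows "card F \<le> card {X \<in> M. a \<in> X}"
proof (rule card_inj_on_le[where f = "insert a"])
 show "inj_on (insert a) F" using assms(2) by (intro inj_onI) (metis insert_ident)
qed (use assms in auto)

context steiner
begin

text \<open>The blow-up of the design along the part map \<open>f\<close>. Since blocks also have
  \<open>r\<close> points, such a set meets every part at most once.\<close>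

definition Bl :: "('v => 'i) => 'v set => 'v set set" where
 "Bl f V = {X. X \<subseteq> V \<and> card X = r \<and> f ` X \<in> Bk}"

lemma Bl_fin: "finite V ==> finite (Bl f V)" by (rule finite_subset[of _ "Pow V"]) (auto simp: Bl_def)

lemma card_Bl:
 assumes "finite V"
 shows "card (Bl f V) = (\<Sum>B\<in>Bk. \<Prod>j\<in>B. card {a \<in> V. f a = j})"
proof -
 have "Bl f V = (\<Union>B\<in>Bk. {X. X \<subseteq> V \<and> card X = card B \<and> f ` X = B})"
  using blk by (auto simp: Bl_def)
 then have "card (Bl f V) = (\<Sum>B\<in>Bk. card {X. X \<subseteq> V \<and> card X = card B \<and> f ` X = B})"
  using finBk assms by (subst card_UN_disjoint[symmetric]) (auto intro: finite_subset[of _ "Pow V"])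
 also have "... = (\<Sum>B\<in>Bk. \<Prod>j\<in>B. card {a \<in> V. f a = j})"
  by (intro sum.cong refl card_transversals[OF assms] blk_fin)
 finally show ?thesis .
qed

lemma bn_extend:
 assumes "Y \<subseteq> I" "card Y \<le> r - 1"
 shows "\<exists>B\<in>Bk. Y \<subseteq> B"
proof -
 have "card {B \<in> Bk. Y \<subseteq> B} > 0" using bn_through[OF assms] bn_pos[OF assms(2)] by simp
 then show ?thesis by (auto simp: card_gt_0_iff)
qed

lemma bn_extend2:
 assumes "i \<in> I" "j \<in> I"
 shows "\<exists>B\<in>Bk. i \<in> B \<and> j \<in> B"
proof -
 have "card {i, j} \<le> 2" by (simp add: card_insert_if)
 then have "card {i, j} \<le> r - 1" using r3 by linarith
 then show ?thesis using bn_extend[of "{i, j}"] assms by auto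
qed

lemma bn_extend1: "i \<in> I ==> \<exists>B\<in>Bk. i \<in> B" using bn_extend2[of i i] by auto

text \<open>These sets form the link of a vertex placed in part \<open>i\<close>: each of the
  \<open>bn 1\<close> blocks through \<open>i\<close> contributes the transversals of its other
  \<open>r - 1\<close> parts.\<close>

lemma card_link_Bl:
 assumes "finite V" "i \<in> I" "\<And>j. j \<in> I ==> rcard {v \<in> V. f v = j} \<le> s" "0 \<le> s"
 shows "rcard {A. A \<subseteq> V \<and> card A = r - 1 \<and> i \<notin> f ` A \<and> insert i (f ` A) \<in> Bk} \<le> real (bn 1) * s ^ (r - 1)"
proof -
 let ?A = "\<lambda>B. {A. A \<subseteq> V \<and> card A = card (B - {i}) \<and> f ` A = B - {i}}"
 have c: "card (B - {i}) = r - 1" if "B \<in> Bk" "i \<in> B" for B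
  using that blk[of B] blk_fin[of B] by (simp add: card_Diff_singleton)
 have "{A. A \<subseteq> V \<and> card A = r - 1 \<and> i \<notin> f ` A \<and> insert i (f ` A) \<in> Bk} \<subseteq> (\<Union>B\<in>{B \<in> Bk. i \<in> B}. ?A B)"
 proof clarify
  fix A assume A: "A \<subseteq> V" "card A = r - 1" "i \<notin> f ` A" "insert i (f ` A) \<in> Bk"
  then have "A \<in> ?A (insert i (f ` A))" using c[of "insert i (f ` A)"] by auto
  then show "A \<in> (\<Union>B\<in>{B \<in> Bk. i \<in> B}. ?A B)" using A(4) by blast
 qed
 then have "card {A. A \<subseteq> V \<and> card A = r - 1 \<and> i \<notin> f ` A \<and> insert i (f ` A) \<in> Bk} \<le> card (\<Union>B\<in>{B \<in> Bk. i \<in> B}. ?A B)"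
  using finBk assms(1) by (intro card_mono) (auto intro: finite_subset[of _ "Pow V"])
 also have "... \<le> (\<Sum>B\<in>{B \<in> Bk. i \<in> B}. card (?A B))" using finBk by (intro card_UN_le) auto
 finally have "rcard {A. A \<subseteq> V \<and> card A = r - 1 \<and> i \<notin> f ` A \<and> insert i (f ` A) \<in> Bk}
   \<le> (\<Sum>B\<in>{B \<in> Bk. i \<in> B}. rcard (?A B))" by (simp flip: of_nat_sum)
 also have "... \<le> (\<Sum>B\<in>{B \<in> Bk. i \<in> B}. s ^ (r - 1))"
 proof (rule sum_mono)
  fix B assume B: "B \<in> {B \<in> Bk. i \<in> B}"
  have "rcard (?A B) = (\<Prod>j\<in>B - {i}. rcard {a \<in> V. f a = j})"
   using B blk_fin by (subst card_transversals[OF assms(1)]) auto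
  also have "... \<le> (\<Prod>j\<in>B - {i}. s)"
  proof (rule prod_mono)
   fix j assume "j \<in> B - {i}"
   then have "j \<in> I" using B blk[of B] by blast
   then show "0 \<le> rcard {a \<in> V. f a = j} \<and> rcard {a \<in> V. f a = j} \<le> s" using assms(3) by simp
  qed
  also have "... = s ^ (r - 1)" using c B by simp
  finally show "rcard (?A B) \<le> s ^ (r - 1)" .
 qed
 also have "... = real (bn 1) * s ^ (r - 1)" using bn_through[of "{i}"] assms(2) r3 by simp
 finally show ?thesis .
qed

end

abbreviation sups :: "nat => 'a set => 'a set => 'a set set" where
 "sups r V Y \<equiv> {X. X \<subseteq> V \<and> card X = r \<and> Y \<subseteq> X}"

text \<open>Parts have relative size between \<open>\<rho>\<close> and \<open>\<sigma>\<close>, with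
  \<open>real r\<close> to spare so that up to \<open>r\<close> vertices can be deleted;
  \<open>\<eta>\<close> is the density of missing edges tolerated at a typical vertex.
  \<open>A1\<close> keeps two typical vertices of one part out of a common edge, \<open>A2\<close>
  makes a thin pair in different parts miss \<open>\<gamma> * n^(r-2)\<close> edges, and
  \<open>A3\<close> then bounds the number of such thin partners of a typical vertex by
  \<open>\<theta> * n\<close>.\<close>

locale config = steiner r k I Bk for r k :: nat and I :: "'i set" and Bk :: "'i set set" +
 fixes V :: "'v set" and E :: "'v set set" and f :: "'v => 'i" and n :: nat and \<rho> \<sigma> \<eta> \<gamma> \<theta> :: real
 assumes finV: "finite V" and cardV: "card V = n" and n0: "0 < n"
  and edge: "\<And>X. X \<in> E ==> X \<subseteq> V \<and> card X = r" and tf: "tfree E" and fV: "f ` V \<subseteq> I"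
  and low: "\<And>i. i \<in> I ==> \<rho> * real n + real r \<le> rcard {v \<in> V. f v = i}"
  and up: "\<And>i. i \<in> I ==> rcard {v \<in> V. f v = i} \<le> \<sigma> * real n"
  and pos: "0 < \<rho>" "0 \<le> \<eta>" "0 < \<gamma>" "0 \<le> \<theta>"
  and A1: "2 * \<eta> < \<rho> ^ (r - 1)"
  and A2: "\<gamma> * real n + real (r - 1) \<le> \<rho> ^ (r - 2) * real n"
  and A3: "real r * \<eta> \<le> \<gamma> * \<theta>"
begin

definition mis :: "'v => 'v set set" where "mis v = {X \<in> Bl f V - E. v \<in> X}"
definition U :: "'v set" where "U = {v \<in> V. rcard (mis v) \<le> \<eta> * real n ^ (r - 1)}"
text \<open>A codegree of order \<open>n^(r-3)\<close>, one order below the generic one: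
  triangle-freeness forces this on two vertices with a common set in their links.\<close>

definition thin :: "'v => 'v => bool" where
 "thin a b \<longleftrightarrow> card {X \<in> E. a \<in> X \<and> b \<in> X} \<le> (r - 1) * n ^ (r - 3)"

lemma finE: "finite E" by (rule finite_subset[of _ "Pow V"]) (use edge finV in auto)

lemma fin_edge: "X \<in> E ==> finite X" using edge finV finite_subset by blast

lemma UV: "U \<subseteq> V" by (auto simp: U_def)

lemma sigma0: "0 \<le> \<sigma>"
proof -
 have "I \<noteq> {}" using cardI rk by auto
 then obtain i where "i \<in> I" by auto
 then have "0 \<le> \<sigma> * real n" using up[of i] by linarith
 then show ?thesis using n0 by (simp add: zero_le_mult_iff)
qed

lemma transversals_ge:
 assumes "J \<subseteq> I" "finite D" "card D \<le> r"
 shows "(\<rho> * real n) ^ card J \<le> rcard {S. S \<subseteq> V - D \<and> card S = card J \<and> f ` S = J}"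
proof -
 have fJ: "finite J" using assms finI finite_subset by blast
 have "(\<rho> * real n) ^ card J = (\<Prod>j\<in>J. \<rho> * real n)" by simp
 also have "... \<le> (\<Prod>j\<in>J. rcard {a \<in> V - D. f a = j})"
 proof (rule prod_mono)
  fix j assume j: "j \<in> J"
  have "{v \<in> V. f v = j} \<subseteq> {a \<in> V - D. f a = j} \<union> D" by auto
  then have "card {v \<in> V. f v = j} \<le> card ({a \<in> V - D. f a = j} \<union> D)"
   using finV assms by (intro card_mono) auto
  also have "... \<le> card {a \<in> V - D. f a = j} + r" using card_Un_le[of "{a \<in> V - D. f a = j}" D] assms by linarith
  finally have "rcard {v \<in> V. f v = j} \<le> rcard {a \<in> V - D. f a = j} + real r" by linarith
  then show "0 \<le> \<rho> * real n \<and> \<rho> * real n \<le> rcard {a \<in> V - D. f a = j}"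
   using low[of j] j assms pos by auto
 qed
 also have "... = rcard {S. S \<subseteq> V - D \<and> card S = card J \<and> f ` S = J}"
  using card_transversals[of "V - D" J f] finV fJ by simp
 finally show ?thesis .
qed

lemma fin_mis: "finite (mis v)" unfolding mis_def using Bl_fin[OF finV] by auto

text \<open>For a transversal \<open>S\<close> off \<open>D\<close> that should complete both
  vertices to blow-up edges, one of these edges is missing, otherwise they form a triangle with
  \<open>D\<close>. There are at least \<open>(\<rho> * n)^(r-1)\<close> such \<open>S\<close>, more
  than two typical vertices can miss.\<close>

lemma typical_same_part:
 assumes a: "a \<in> U" "a' \<in> U" "a \<noteq> a'" "f a = f a'" and D: "D \<in> E" "a \<in> D" "a' \<in> D"
 shows False
proof -
 have aI: "f a \<in> I" using a UV fV by auto
 obtain B where B: "B \<in> Bk" "f a \<in> B" using bn_extend1[OF aI] by blast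
 define J where "J = B - {f a}"
 have J: "J \<subseteq> I" "card J = r - 1" "insert (f a) J = B"
  using B blk[of B] blk_fin[of B] by (auto simp: J_def card_Diff_singleton)
 define SS where "SS = {S. S \<subseteq> V - D \<and> card S = card J \<and> f ` S = J}"
 have fS: "finite SS" by (rule finite_subset[of _ "Pow V"]) (use finV in "auto simp: SS_def")
 have half: "card {S \<in> SS. insert b S \<notin> E} \<le> card (mis b)" if b: "b \<in> D" "f b = f a" for b
 proof -
  have bV: "b \<in> V" using b D edge by auto
  have "card {S \<in> SS. insert b S \<notin> E} \<le> card {X \<in> mis b. b \<in> X}"
  proof (rule card_insert_image_le[OF fin_mis])
   fix S assume "S \<in> {S \<in> SS. insert b S \<notin> E}"
   then have S: "S \<subseteq> V - D" "card S = card J" "f ` S = J" "insert b S \<notin> E" by (auto simp: SS_def)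
   show "b \<notin> S" using S b by auto
   moreover have "finite S" using S finV finite_subset by blast
   ultimately have "card (insert b S) = r" using S(2) J(2) r3 by simp
   then show "insert b S \<in> mis b" using S b bV B J by (auto simp: mis_def Bl_def)
  qed
  also have "{X \<in> mis b. b \<in> X} = mis b" by (auto simp: mis_def)
  finally show ?thesis .
 qed
 have "SS \<subseteq> {S \<in> SS. insert a S \<notin> E} \<union> {S \<in> SS. insert a' S \<notin> E}"
 proof
  fix S assume S: "S \<in> SS"
  have "\<not> (insert a S \<in> E \<and> insert a' S \<in> E)"
  proof
   assume "insert a S \<in> E \<and> insert a' S \<in> E"
   moreover have "a \<notin> S" "a' \<notin> S" "D \<inter> S = {}" using S D by (auto simp: SS_def)
   ultimately show False by (intro tfreeD[OF tf, of a S a' D]) (use a(3) D in auto)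
  qed
  then have "insert a S \<notin> E \<or> insert a' S \<notin> E" by simp
  then show "S \<in> {S \<in> SS. insert a S \<notin> E} \<union> {S \<in> SS. insert a' S \<notin> E}"
   using S by (elim disjE) simp_all
 qed
 then have "card SS \<le> card ({S \<in> SS. insert a S \<notin> E} \<union> {S \<in> SS. insert a' S \<notin> E})"
  by (rule card_mono[rotated]) (simp add: fS)
 also have "... \<le> card {S \<in> SS. insert a S \<notin> E} + card {S \<in> SS. insert a' S \<notin> E}"
  by (rule card_Un_le)
 also have "... \<le> card (mis a) + card (mis a')" using half[of a] half[of a'] D a by (intro add_mono) auto
 finally have "rcard SS \<le> rcard (mis a) + rcard (mis a')" by linarith
 also have "... \<le> 2 * \<eta> * real n ^ (r - 1)" using a by (simp add: U_def)
 also have "... < \<rho> ^ (r - 1) * real n ^ (r - 1)" using A1 n0 by (intro mult_strict_right_mono) auto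
 also have "... \<le> rcard SS"
  using transversals_ge[OF J(1), of D] D edge fin_edge J(2) by (simp add: power_mult_distrib SS_def)
 finally show False by simp
qed

text \<open>An edge through \<open>a\<close> and \<open>b\<close> must meet \<open>S\<close>,
  otherwise it closes a triangle; once the common point is fixed, \<open>r - 3\<close> free vertices
  remain.\<close>

lemma thinI:
 assumes "a \<noteq> b" "a \<notin> S" "b \<notin> S" "insert a S \<in> E" "insert b S \<in> E"
 shows "thin a b"
proof -
 have fS: "finite S" using assms fin_edge by (metis finite_insert)
 have "Suc (card S) = r" using edge[OF assms(4)] assms(2) fS by simp
 then have cS: "card S = r - 1" by linarith
 have "{X \<in> E. a \<in> X \<and> b \<in> X} \<subseteq> (\<Union>s\<in>S. sups r V {a, b, s})"
 proof
  fix X assume X: "X \<in> {X \<in> E. a \<in> X \<and> b \<in> X}"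
  then have "X \<inter> S \<noteq> {}" using tfreeD[OF tf assms(2,3,1,4,5)] by blast
  then show "X \<in> (\<Union>s\<in>S. sups r V {a, b, s})" using X edge[of X] by auto
 qed
 then have "card {X \<in> E. a \<in> X \<and> b \<in> X} \<le> card (\<Union>s\<in>S. sups r V {a, b, s})"
  using fS finV by (intro card_mono) (auto intro: finite_subset[of _ "Pow V"])
 also have "... \<le> (\<Sum>s\<in>S. card (sups r V {a, b, s}))" using fS by (rule card_UN_le)
 also have "... \<le> (\<Sum>s\<in>S. n ^ (r - 3))"
 proof (rule sum_mono)
  fix s assume s: "s \<in> S"
  have "a \<noteq> s" "b \<noteq> s" using assms s by auto
  then have "card {a, b, s} = 3" using assms(1) by simp
  then show "card (sups r V {a, b, s}) \<le> n ^ (r - 3)" using card_supersets_le[OF finV, of "{a, b, s}" r] cardV by simp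
 qed
 also have "... = (r - 1) * n ^ (r - 3)" using cS by simp
 finally show ?thesis by (simp add: thin_def)
qed

text \<open>At least \<open>(\<rho> * n)^(r-2)\<close> blow-up edges pass through \<open>a\<close>
  and \<open>b\<close>, but a thin pair lies in only \<open>O(n^(r-3))\<close> edges of
  \<open>E\<close>.\<close>

lemma thin_missing:
 assumes ab: "a \<in> V" "b \<in> V" "f a \<noteq> f b" "thin a b"
 shows "\<gamma> * real n ^ (r - 2) \<le> rcard {X \<in> mis a. b \<in> X}"
proof -
 have I: "f a \<in> I" "f b \<in> I" using ab fV by auto
 obtain B where B: "B \<in> Bk" "f a \<in> B" "f b \<in> B" using bn_extend2[OF I] by blast
 define J where "J = B - {f a, f b}"
 have J: "J \<subseteq> I" "card J = r - 2" "{f a, f b} \<union> J = B"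
  using B blk[of B] blk_fin[of B] ab(3) by (auto simp: J_def card_Diff_subset)
 let ?S = "{S. S \<subseteq> V - {a, b} \<and> card S = card J \<and> f ` S = J}"
 have fS: "finite ?S" by (rule finite_subset[of _ "Pow V"]) (use finV in auto)
 let ?X = "{X \<in> Bl f V. a \<in> X \<and> b \<in> X}"
 have "card ?S \<le> card ?X"
 proof (rule card_inj_on_le[where f = "\<lambda>S. {a, b} \<union> S"])
  show "inj_on (\<lambda>S. {a, b} \<union> S) ?S" by (intro inj_onI) blast
  show "(\<lambda>S. {a, b} \<union> S) ` ?S \<subseteq> ?X"
  proof (rule image_subsetI)
   fix S assume "S \<in> ?S"
   then have S: "S \<subseteq> V - {a, b}" "card S = card J" "f ` S = J" by auto
   have "finite S" "a \<noteq> b" using S finV finite_subset ab(3) by (blast, auto)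
   then have "card ({a, b} \<union> S) = r" using S J r3 by (subst card_Un_disjoint) auto
   moreover have "f ` ({a, b} \<union> S) = B" using S J by auto
   ultimately show "{a, b} \<union> S \<in> ?X" using S ab B by (auto simp: Bl_def)
  qed
  show "finite ?X" using Bl_fin[OF finV] by auto
 qed
 also have "... \<le> card ({X \<in> mis a. b \<in> X} \<union> {X \<in> E. a \<in> X \<and> b \<in> X})"
 proof (rule card_mono)
  show "finite ({X \<in> mis a. b \<in> X} \<union> {X \<in> E. a \<in> X \<and> b \<in> X})" using fin_mis finE by simp
 qed (auto simp: mis_def)
 also have "... \<le> card {X \<in> mis a. b \<in> X} + card {X \<in> E. a \<in> X \<and> b \<in> X}" by (rule card_Un_le)
 also have "... \<le> card {X \<in> mis a. b \<in> X} + (r - 1) * n ^ (r - 3)" using ab(4) by (simp add: thin_def)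
 finally have "rcard ?S \<le> rcard {X \<in> mis a. b \<in> X} + real (r - 1) * real n ^ (r - 3)"
  by (simp flip: of_nat_power of_nat_mult of_nat_add)
 moreover have "(\<rho> * real n) ^ (r - 2) \<le> rcard ?S"
  using transversals_ge[OF J(1), of "{a, b}"] J(2) r3 ab(3) by (simp add: card_insert_if)
 moreover have "\<gamma> * real n ^ (r - 2) + real (r - 1) * real n ^ (r - 3) \<le> (\<rho> * real n) ^ (r - 2)"
 proof -
  have "r - 2 = Suc (r - 3)" using r3 by simp
  then have p: "real n ^ (r - 2) = real n * real n ^ (r - 3)" by simp
  have "(\<gamma> * real n + real (r - 1)) * real n ^ (r - 3) \<le> (\<rho> ^ (r - 2) * real n) * real n ^ (r - 3)"
   using A2 by (intro mult_right_mono) auto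
  then show ?thesis by (simp add: power_mult_distrib p algebra_simps)
 qed
 ultimately show ?thesis by linarith
qed

lemma thin_degree:
 assumes a: "a \<in> U"
 shows "rcard {b \<in> V. f b \<noteq> f a \<and> thin a b} \<le> \<theta> * real n"
proof -
 let ?N = "{b \<in> V. f b \<noteq> f a \<and> thin a b}"
 have fN: "finite ?N" using finV by auto
 have aV: "a \<in> V" using a UV by auto
 have "(\<Sum>b\<in>?N. card {X \<in> mis a. b \<in> X}) = (\<Sum>X\<in>mis a. card {b \<in> ?N. b \<in> X})"
  by (rule double_count[OF fN fin_mis])
 also have "... \<le> (\<Sum>X\<in>mis a. r)"
 proof (rule sum_mono)
  fix X assume X: "X \<in> mis a"
  then have "X \<subseteq> V" "card X = r" by (auto simp: mis_def Bl_def)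
  moreover have "card {b \<in> ?N. b \<in> X} \<le> card X"
   using finV finite_subset[of X V] \<open>X \<subseteq> V\<close> by (intro card_mono) auto
  ultimately show "card {b \<in> ?N. b \<in> X} \<le> r" by simp
 qed
 finally have "(\<Sum>b\<in>?N. rcard {X \<in> mis a. b \<in> X}) \<le> rcard (mis a) * real r"
  by (simp flip: of_nat_sum of_nat_mult)
 moreover have "rcard ?N * (\<gamma> * real n ^ (r - 2)) \<le> (\<Sum>b\<in>?N. rcard {X \<in> mis a. b \<in> X})"
  using thin_missing[of a] aV by (intro sum_bounded_below) auto
 moreover have "rcard (mis a) * real r \<le> \<eta> * real n ^ (r - 1) * real r"
  using a by (intro mult_right_mono) (auto simp: U_def)
 ultimately have "rcard ?N * (\<gamma> * real n ^ (r - 2)) \<le> real r * \<eta> * real n ^ (r - 1)" by (simp add: mult_ac)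
 also have "... \<le> \<gamma> * \<theta> * real n ^ (r - 1)" using A3 by (intro mult_right_mono) auto
 also have "... = (\<theta> * real n) * (\<gamma> * real n ^ (r - 2))"
 proof -
  have "r - 1 = Suc (r - 2)" using r3 by simp
  then show ?thesis by simp
 qed
 finally show ?thesis using pos n0 by (subst (asm) mult_le_cancel_right) auto
qed

text \<open>Fix one \<open>a\<close> in \<open>N\<close>: all other members lie in the part of
  \<open>a\<close> or are thin partners of \<open>a\<close> in other parts.\<close>

lemma thin_clique:
 assumes N: "N \<subseteq> U" "\<And>a b. a \<in> N ==> b \<in> N ==> f a \<noteq> f b ==> thin a b"
 shows "rcard N \<le> (\<sigma> + \<theta>) * real n"
proof (cases "N = {}")
 case True
 then show ?thesis using sigma0 pos by simp
next
 case False
 then obtain a where a: "a \<in> N" by auto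
 have aI: "f a \<in> I" using a N UV fV by blast
 have "N \<subseteq> {v \<in> V. f v = f a} \<union> {b \<in> V. f b \<noteq> f a \<and> thin a b}" using N UV a by fastforce
 then have "card N \<le> card ({v \<in> V. f v = f a} \<union> {b \<in> V. f b \<noteq> f a \<and> thin a b})"
  using finV by (intro card_mono) auto
 also have "... \<le> card {v \<in> V. f v = f a} + card {b \<in> V. f b \<noteq> f a \<and> thin a b}" by (rule card_Un_le)
 finally have "rcard N \<le> rcard {v \<in> V. f v = f a} + rcard {b \<in> V. f b \<noteq> f a \<and> thin a b}" by linarith
 also have "... \<le> \<sigma> * real n + \<theta> * real n" using up[OF aI] thin_degree[of a] a N by (intro add_mono) auto
 finally show ?thesis by (simp add: distrib_right)
qed

end

section \<open>Links and degrees of arbitrary vertices\<close>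

context config
begin

text \<open>The link of \<open>v\<close> inside the typical vertices. \<open>Lj v j\<close> collects
  those link sets that would also fit a vertex of part \<open>j\<close>; by the Steiner property
  every link set has such a \<open>j\<close>.\<close>

definition L :: "'v => 'v set set" where "L v = {A. v \<notin> A \<and> insert v A \<in> E \<and> A \<subseteq> U}"
definition Lj :: "'v => 'i => 'v set set" where "Lj v j = {A \<in> L v. j \<notin> f ` A \<and> insert j (f ` A) \<in> Bk}"

lemma L_props:
 assumes "A \<in> L v"
 shows "A \<subseteq> V" "finite A" "card A = r - 1" "inj_on f A" "f ` A \<subseteq> I" "card (f ` A) = r - 1"
proof -
 have e: "insert v A \<in> E" "v \<notin> A" "A \<subseteq> U" using assms by (auto simp: L_def)
 show "A \<subseteq> V" using edge[OF e(1)] by auto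
 show fA: "finite A" using fin_edge[OF e(1)] by simp
 have "Suc (card A) = r" using edge[OF e(1)] e(2) fA by simp
 then show c: "card A = r - 1" by linarith
 show i: "inj_on f A"
 proof (rule inj_onI, rule ccontr)
  fix a b assume "a \<in> A" "b \<in> A" "f a = f b" "a \<noteq> b"
  then show False using typical_same_part[of a b "insert v A"] e by auto
 qed
 show "f ` A \<subseteq> I" using \<open>A \<subseteq> V\<close> fV by auto
 show "card (f ` A) = r - 1" using c i by (simp add: card_image)
qed

lemma fin_L: "finite (L v)" by (rule finite_subset[of _ "Pow V"]) (use L_props(1) finV in auto)

lemma fin_Lj: "finite (Lj v j)" using fin_L by (simp add: Lj_def)

lemma complete_type:
 assumes "Q \<subseteq> I" "card Q = r - 1"
 obtains j where "j \<in> I" "j \<notin> Q" "insert j Q \<in> Bk"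
proof -
 obtain B where B: "B \<in> Bk" "Q \<subseteq> B" using blk_ex[OF assms] by auto
 have "finite Q" using assms finI finite_subset by blast
 then have "card (B - Q) = 1" using B assms blk[of B] r3 by (simp add: card_Diff_subset)
 then obtain j where j: "B - Q = {j}" by (auto simp: card_1_singleton_iff)
 then have "insert j Q = B" "j \<in> B" "j \<notin> Q" using B by auto
 then show ?thesis using that[of j] B blk by auto
qed

lemma L_cover: "A \<in> L v ==> \<exists>j\<in>I. A \<in> Lj v j"
 using complete_type[of "f ` A"] L_props[of A v] by (metis (no_types, lifting) Lj_def mem_Collect_eq)

lemma deg_le: "real (deg E v) \<le> rcard (L v) + rcard (V - U) * real n ^ (r - 2)"
proof -
 let ?W = "\<lambda>w. sups r V {v, w}"
 have fW: "finite (?W w)" for w by (rule finite_subset[of _ "Pow V"]) (use finV in auto)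
 have "{X \<in> E. v \<in> X} \<subseteq> insert v ` L v \<union> (\<Union>w\<in>V - U - {v}. ?W w)"
 proof
  fix X assume X: "X \<in> {X \<in> E. v \<in> X}"
  show "X \<in> insert v ` L v \<union> (\<Union>w\<in>V - U - {v}. ?W w)"
  proof (cases "X - {v} \<subseteq> U")
   case True
   have "insert v (X - {v}) = X" using X by auto
   then have "X - {v} \<in> L v" "X = insert v (X - {v})" using X True by (auto simp: L_def)
   then show ?thesis by blast
  next
   case False
   then obtain w where "w \<in> X" "w \<noteq> v" "w \<notin> U" by auto
   then have "w \<in> V - U - {v}" "X \<in> ?W w" using X edge[of X] by auto
   then show ?thesis by blast
  qed
 qed
 then have "deg E v \<le> card (insert v ` L v \<union> (\<Union>w\<in>V - U - {v}. ?W w))"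
  unfolding deg_def using fW fin_L finV by (intro card_mono) auto
 also have "... \<le> card (insert v ` L v) + card (\<Union>w\<in>V - U - {v}. ?W w)" by (rule card_Un_le)
 also have "... \<le> card (L v) + (\<Sum>w\<in>V - U - {v}. card (?W w))"
  using finV by (intro add_mono card_image_le fin_L card_UN_le) auto
 also have "... \<le> card (L v) + (\<Sum>w\<in>V - U - {v}. n ^ (r - 2))"
 proof (intro add_left_mono sum_mono)
  fix w assume "w \<in> V - U - {v}"
  then have "card {v, w} = 2" by auto
  then show "card (?W w) \<le> n ^ (r - 2)" using card_supersets_le[OF finV, of "{v, w}" r] cardV by simp
 qed
 also have "... \<le> card (L v) + card (V - U) * n ^ (r - 2)" using finV by (auto intro!: mult_right_mono card_mono)
 finally have "real (deg E v) \<le> real (card (L v) + card (V - U) * n ^ (r - 2))" by (simp only: of_nat_le_iff)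
 then show ?thesis by simp
qed

text \<open>Let \<open>j\<close> be the part of \<open>b\<close>. For \<open>A'\<close> in
  \<open>Lj v j\<close> disjoint from \<open>A\<close>, the sets \<open>insert v A'\<close>,
  \<open>insert b A'\<close> and \<open>insert v A\<close> would form a triangle, so
  \<open>insert b A'\<close> is missing; the typical vertex \<open>b\<close> has few missing edges.
  The link sets that meet \<open>A\<close> give the second term.\<close>

lemma Lj_touched:
 assumes A: "A \<in> L v" "b \<in> A"
 shows "rcard (Lj v (f b)) \<le> \<eta> * real n ^ (r - 1) + real (r - 1) * real n ^ (r - 2)"
proof -
 define F where "F = {A' \<in> Lj v (f b). A' \<inter> A = {}}"
 let ?W = "\<lambda>s. {A'. A' \<subseteq> V \<and> card A' = r - 1 \<and> {s} \<subseteq> A'}"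
 have fW: "finite (?W s)" for s by (rule finite_subset[of _ "Pow V"]) (use finV in auto)
 have fF: "finite F" using fin_Lj by (simp add: F_def)
 have bU: "b \<in> U" "b \<in> V" "v \<noteq> b" using A UV by (auto simp: L_def)
 have "Lj v (f b) \<subseteq> F \<union> (\<Union>s\<in>A. ?W s)"
 proof
  fix A' assume A': "A' \<in> Lj v (f b)"
  then have "A' \<subseteq> V" "card A' = r - 1" using L_props[of A' v] by (auto simp: Lj_def)
  then show "A' \<in> F \<union> (\<Union>s\<in>A. ?W s)" using A' by (cases "A' \<inter> A = {}") (auto simp: F_def)
 qed
 then have "card (Lj v (f b)) \<le> card (F \<union> (\<Union>s\<in>A. ?W s))"
  using fW fF L_props[OF A(1)] by (intro card_mono) auto
 also have "... \<le> card F + card (\<Union>s\<in>A. ?W s)" by (rule card_Un_le)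
 also have "... \<le> card F + (\<Sum>s\<in>A. card (?W s))" using L_props[OF A(1)] by (intro add_left_mono card_UN_le)
 also have "... \<le> card (mis b) + (\<Sum>s\<in>A. n ^ (r - 2))"
 proof (intro add_mono sum_mono)
  have "card F \<le> card {X \<in> mis b. b \<in> X}"
  proof (rule card_insert_image_le[OF fin_mis])
   fix A' assume "A' \<in> F"
   then have A': "A' \<in> L v" "f b \<notin> f ` A'" "insert (f b) (f ` A') \<in> Bk" "A' \<inter> A = {}"
    by (auto simp: F_def Lj_def)
   note p = L_props[OF A'(1)]
   have v: "v \<notin> A'" "insert v A' \<in> E" using A' by (auto simp: L_def)
   have vA: "insert v A \<in> E" using A by (auto simp: L_def)
   show b: "b \<notin> A'" using A'(2) by auto
   have "insert b A' \<notin> E"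
   proof
    assume "insert b A' \<in> E"
    then show False by (intro tfreeD[OF tf v(1) b bU(3) v(2) _ vA]) (use A A'(4) v in auto)
   qed
   moreover have "card (insert b A') = r" using p b r3 by simp
   ultimately show "insert b A' \<in> mis b" using p bU A'(3) by (auto simp: mis_def Bl_def)
  qed
  also have "{X \<in> mis b. b \<in> X} = mis b" by (auto simp: mis_def)
  finally show "card F \<le> card (mis b)" .
  fix s assume "s \<in> A"
  show "card (?W s) \<le> n ^ (r - 2)"
   using card_supersets_le[OF finV, of "{s}" "r - 1"] cardV r3 by (simp add: numeral_2_eq_2)
 qed
 also have "... = card (mis b) + (r - 1) * n ^ (r - 2)" using L_props[OF A(1)] by simp
 finally have "rcard (Lj v (f b)) \<le> rcard (mis b) + real (r - 1) * real n ^ (r - 2)"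
  by (simp flip: of_nat_power of_nat_mult of_nat_add)
 then show ?thesis using bU by (simp add: U_def)
qed

text \<open>The parts avoided by the link of \<open>v\<close>, hence the candidates for the part of
  \<open>v\<close>. Exactly one is the regular case; with none, or with two or more, the degree of
  \<open>v\<close> is too small.\<close>

definition untouched :: "'v => 'i set" where "untouched v = {j \<in> I. \<forall>A\<in>L v. j \<notin> f ` A}"

lemma card_L_le:
 assumes rn: "real r \<le> \<eta> * real n"
 shows "rcard (L v) \<le> (\<Sum>j\<in>untouched v. rcard (Lj v j)) + real k * (2 * \<eta>) * real n ^ (r - 1)"
proof -
 have sub: "untouched v \<subseteq> I" by (auto simp: untouched_def)
 have "L v \<subseteq> (\<Union>j\<in>I. Lj v j)" using L_cover by blast
 then have "card (L v) \<le> card (\<Union>j\<in>I. Lj v j)" using fin_Lj finI by (intro card_mono) auto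
 also have "... \<le> (\<Sum>j\<in>I. card (Lj v j))" by (rule card_UN_le[OF finI])
 finally have "rcard (L v) \<le> (\<Sum>j\<in>I. rcard (Lj v j))" by (simp flip: of_nat_sum)
 also have "... = (\<Sum>j\<in>I - untouched v. rcard (Lj v j)) + (\<Sum>j\<in>untouched v. rcard (Lj v j))"
  by (rule sum.subset_diff[OF sub finI])
 also have "(\<Sum>j\<in>I - untouched v. rcard (Lj v j)) \<le> (\<Sum>j\<in>I - untouched v. 2 * \<eta> * real n ^ (r - 1))"
 proof (rule sum_mono)
  fix j assume "j \<in> I - untouched v"
  then obtain A b where A: "A \<in> L v" "b \<in> A" "j = f b" by (auto simp: untouched_def)
  have "real (r - 1) * real n ^ (r - 2) \<le> real r * real n ^ (r - 2)" by (intro mult_right_mono) auto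
  also have "... \<le> \<eta> * real n * real n ^ (r - 2)" using rn by (intro mult_right_mono) auto
  also have "... = \<eta> * real n ^ (r - 1)"
  proof -
   have "r - 1 = Suc (r - 2)" using r3 by simp
   then show ?thesis by simp
  qed
  finally show "rcard (Lj v j) \<le> 2 * \<eta> * real n ^ (r - 1)" using Lj_touched[OF A(1,2)] A(3) by simp
 qed
 also have "... \<le> real k * (2 * \<eta>) * real n ^ (r - 1)"
 proof -
  have "card (I - untouched v) \<le> k" using cardI finI by (metis Diff_subset card_mono)
  then have "rcard (I - untouched v) * (2 * \<eta> * real n ^ (r - 1)) \<le> real k * (2 * \<eta> * real n ^ (r - 1))"
   using pos by (intro mult_right_mono) auto
  then show ?thesis by simp
 qed
 finally show ?thesis by simp
qed

text \<open>Double count link sets against their (r-2)-subsets \<open>R\<close>. The type of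
  \<open>R\<close> lies in the \<open>k - 2\<close> other parts, and the vertices extending
  \<open>R\<close> within the link share the (r-1)-set \<open>insert v R\<close>, so they are
  pairwise thin across parts and \<open>thin_clique\<close> bounds their number.\<close>

lemma two_untouched:
 assumes ij: "i \<in> untouched v" "j \<in> untouched v" "i \<noteq> j"
 shows "real (r - 1) * rcard (L v) \<le> real ((k - 2) choose (r - 2)) * (\<sigma> * real n) ^ (r - 2) * ((\<sigma> + \<theta>) * real n)"
proof -
 define I' where "I' = I - {i, j}"
 have I': "finite I'" "card I' = k - 2" "I' \<subseteq> I"
  using ij finI cardI by (auto simp: I'_def untouched_def card_Diff_subset)
 define QQ where "QQ = {Q. Q \<subseteq> I' \<and> card Q = r - 2}"
 define tr where "tr Q = {S. S \<subseteq> V \<and> card S = card Q \<and> f ` S = Q}" for Q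
 define RR where "RR = (\<Union>Q\<in>QQ. tr Q)"
 have fQQ: "finite QQ" by (rule finite_subset[of _ "Pow I'"]) (use I' in "auto simp: QQ_def")
 have ftr: "finite (tr Q)" for Q by (rule finite_subset[of _ "Pow V"]) (use finV in "auto simp: tr_def")
 have fRR: "finite RR" using fQQ ftr by (simp add: RR_def)
 have cRR: "rcard RR \<le> real ((k - 2) choose (r - 2)) * (\<sigma> * real n) ^ (r - 2)"
 proof -
  have "card RR \<le> (\<Sum>Q\<in>QQ. card (tr Q))" unfolding RR_def by (rule card_UN_le[OF fQQ])
  then have "rcard RR \<le> (\<Sum>Q\<in>QQ. rcard (tr Q))" by (simp flip: of_nat_sum)
  also have "... \<le> (\<Sum>Q\<in>QQ. (\<sigma> * real n) ^ (r - 2))"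
  proof (rule sum_mono)
   fix Q assume Q: "Q \<in> QQ"
   then have fQ: "finite Q" "Q \<subseteq> I" using I' finite_subset by (auto simp: QQ_def)
   have "rcard (tr Q) = (\<Prod>l\<in>Q. rcard {a \<in> V. f a = l})"
    unfolding tr_def using card_transversals[OF finV fQ(1)] by simp
   also have "... \<le> (\<Prod>l\<in>Q. \<sigma> * real n)" using fQ up by (intro prod_mono) auto
   finally show "rcard (tr Q) \<le> (\<sigma> * real n) ^ (r - 2)" using Q by (simp add: QQ_def)
  qed
  also have "... = real ((k - 2) choose (r - 2)) * (\<sigma> * real n) ^ (r - 2)"
   using n_subsets[OF I'(1), of "r - 2"] I'(2) by (simp add: QQ_def)
  finally show ?thesis .
 qed
 have "(\<Sum>A\<in>L v. card {R \<in> RR. R \<subseteq> A}) = (\<Sum>R\<in>RR. card {A \<in> L v. R \<subseteq> A})"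
  by (rule double_count[OF fin_L fRR])
 moreover have "card {R \<in> RR. R \<subseteq> A} = r - 1" if A: "A \<in> L v" for A
 proof -
  note p = L_props[OF A]
  have "{R \<in> RR. R \<subseteq> A} = {R. {} \<subseteq> R \<and> R \<subseteq> A \<and> card R = r - 2}"
  proof (intro equalityI subsetI)
   fix R assume "R \<in> {R \<in> RR. R \<subseteq> A}"
   then show "R \<in> {R. {} \<subseteq> R \<and> R \<subseteq> A \<and> card R = r - 2}" by (auto simp: RR_def QQ_def tr_def)
  next
   fix R assume R: "R \<in> {R. {} \<subseteq> R \<and> R \<subseteq> A \<and> card R = r - 2}"
   then have c: "card (f ` R) = r - 2" using p inj_on_subset[of f A R] by (simp add: card_image)
   have "i \<notin> f ` A" "j \<notin> f ` A" using ij A by (auto simp: untouched_def)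
   moreover have "f ` R \<subseteq> f ` A" using R by auto
   ultimately have "f ` R \<subseteq> I'" using p(5) unfolding I'_def by blast
   then have "f ` R \<in> QQ" "R \<in> tr (f ` R)" using R c p by (auto simp: QQ_def tr_def)
   then show "R \<in> {R \<in> RR. R \<subseteq> A}" using R by (auto simp: RR_def)
  qed
  then have "card {R \<in> RR. R \<subseteq> A} = (r - 1) choose (r - 2)"
   using card_sets_between[of A "{}" "r - 2"] p by simp
  moreover have "r - 1 = Suc (r - 2)" using r3 by simp
  ultimately show ?thesis by simp
 qed
 moreover have "rcard {A \<in> L v. R \<subseteq> A} \<le> (\<sigma> + \<theta>) * real n" if R: "R \<in> RR" for R
 proof -
  define N where "N = {a. a \<notin> R \<and> insert a R \<in> L v}"
  have "N \<subseteq> U" by (auto simp: N_def L_def)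
  have fN: "finite N" by (rule finite_subset[OF subset_trans[OF \<open>N \<subseteq> U\<close> UV] finV])
  obtain Q where "Q \<in> QQ" "R \<in> tr Q" using R by (auto simp only: RR_def UN_iff)
  then have cR: "card R = r - 2" "R \<subseteq> V" by (simp_all add: QQ_def tr_def)
  then have "finite R" using finV finite_subset by blast
  note cR = cR this
  have "{A \<in> L v. R \<subseteq> A} \<subseteq> (\<lambda>a. insert a R) ` N"
  proof
   fix A assume A: "A \<in> {A \<in> L v. R \<subseteq> A}"
   then have "card (A - R) = 1" using L_props[of A v] cR r3 by (simp add: card_Diff_subset)
   then obtain a where "A - R = {a}" by (auto simp: card_1_singleton_iff)
   then have "A = insert a R" "a \<notin> R" using A by auto
   then show "A \<in> (\<lambda>a. insert a R) ` N" using A by (auto simp: N_def)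
  qed
  then have "card {A \<in> L v. R \<subseteq> A} \<le> card N"
   using fN by (meson card_image_le card_mono finite_imageI le_trans)
  moreover have "rcard N \<le> (\<sigma> + \<theta>) * real n"
  proof (rule thin_clique[OF \<open>N \<subseteq> U\<close>])
   fix a b assume ab: "a \<in> N" "b \<in> N" "f a \<noteq> f b"
   show "thin a b" by (rule thinI[of a b "insert v R"]) (use ab in "auto simp: N_def L_def insert_commute")
  qed
  ultimately show ?thesis by linarith
 qed
 ultimately have "rcard (L v) * real (r - 1) \<le> rcard RR * ((\<sigma> + \<theta>) * real n)"
  using sum_bounded_above[of RR "\<lambda>R. rcard {A \<in> L v. R \<subseteq> A}" "(\<sigma> + \<theta>) * real n"]
  by (simp flip: of_nat_sum of_nat_mult)
 also have "... \<le> (real ((k - 2) choose (r - 2)) * (\<sigma> * real n) ^ (r - 2)) * ((\<sigma> + \<theta>) * real n)"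
  using cRR sigma0 pos by (intro mult_right_mono) auto
 finally show ?thesis by (simp add: mult.commute)
qed

definition FA :: "'i => 'v set set" where
 "FA i = {A. A \<subseteq> V \<and> card A = r - 1 \<and> i \<notin> f ` A \<and> insert i (f ` A) \<in> Bk}"

lemma card_FA: "i \<in> I ==> rcard (FA i) \<le> real (bn 1) * \<sigma> ^ (r - 1) * real n ^ (r - 1)"
 using card_link_Bl[OF finV _ up, of i] sigma0 unfolding FA_def by (simp add: power_mult_distrib mult.assoc)

text \<open>The cases are zero, one or several untouched parts. \<open>K1\<close> and
  \<open>K2\<close> make the degree low in the first and the last. With a single untouched part
  \<open>i\<close> the link is essentially inside \<open>FA i\<close>, whose size \<open>K3\<close>
  bounds; so a degree that is not low leaves few sets of \<open>FA i\<close> missing.\<close>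

lemma vertex_dichotomy:
 fixes c \<upsilon> :: real
 assumes rn: "real r \<le> \<eta> * real n"
  and u: "rcard (V - U) \<le> \<upsilon> * real n"
  and K1: "real k * (2 * \<eta>) + \<upsilon> \<le> kap - c"
  and K2: "ovl * \<sigma> ^ (r - 2) * (\<sigma> + \<theta>) + \<upsilon> \<le> kap - c"
  and K3: "real (bn 1) * \<sigma> ^ (r - 1) + real k * (2 * \<eta>) + \<upsilon> \<le> kap + c"
  and c: "0 \<le> c"
 shows "real (deg E v) \<le> (kap + c) * real n ^ (r - 1) \<and>
  (real (deg E v) \<le> (kap - c) * real n ^ (r - 1) \<or>
   (\<exists>i\<in>I. rcard {A \<in> FA i. v \<notin> A \<and> insert v A \<notin> E} \<le> 2 * c * real n ^ (r - 1)))"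
proof -
 define N where "N = real n ^ (r - 1)"
 have N0: "0 \<le> N" by (simp add: N_def)
 have r1: "r - 1 = Suc (r - 2)" using r3 by simp
 have "rcard (V - U) * real n ^ (r - 2) \<le> \<upsilon> * real n * real n ^ (r - 2)" using u by (intro mult_right_mono) auto
 also have "... = \<upsilon> * N" by (metis N_def power_Suc r1 mult.assoc)
 finally have dl: "real (deg E v) \<le> rcard (L v) + \<upsilon> * N" using deg_le[of v] by linarith
 have cl: "rcard (L v) \<le> (\<Sum>j\<in>untouched v. rcard (Lj v j)) + real k * (2 * \<eta>) * N"
  using card_L_le[OF rn] by (simp add: N_def)
 have le: "(kap - c) * N \<le> (kap + c) * N" using c N0 by (intro mult_right_mono) auto
 consider (0) "untouched v = {}" | (1) i where "untouched v = {i}"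
  | (2) i j where "i \<in> untouched v" "j \<in> untouched v" "i \<noteq> j"
  by (metis insertI1 is_singletonI' is_singleton_def)
 then show ?thesis
 proof cases
  case 0
  then have "real (deg E v) \<le> (real k * (2 * \<eta>) + \<upsilon>) * N" using dl cl by (simp add: distrib_right)
  also have "... \<le> (kap - c) * N" using K1 N0 by (intro mult_right_mono) auto
  finally show ?thesis using le by (simp add: N_def)
 next
  case 1
  have iI: "i \<in> I" using 1 by (auto simp: untouched_def)
  have d: "real (deg E v) \<le> rcard (Lj v i) + (real k * (2 * \<eta>) + \<upsilon>) * N"
   using dl cl 1 by (simp add: distrib_right)
  define M where "M = {A \<in> FA i. v \<notin> A \<and> insert v A \<notin> E}"
  have fFA: "finite (FA i)" by (rule finite_subset[of _ "Pow V"]) (use finV in "auto simp: FA_def")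
  have "Lj v i \<subseteq> FA i" using L_props[of _ v] by (auto simp: Lj_def FA_def)
  then have "Lj v i \<union> M \<subseteq> FA i" by (auto simp: M_def)
  then have "card (Lj v i \<union> M) \<le> card (FA i)" using fFA by (intro card_mono)
  moreover have "card (Lj v i \<union> M) = card (Lj v i) + card M"
  proof (rule card_Un_disjoint)
   show "finite M" using fFA by (simp add: M_def)
  qed (use fin_Lj in "auto simp: M_def Lj_def L_def")
  ultimately have s: "rcard (Lj v i) + rcard M \<le> real (bn 1) * \<sigma> ^ (r - 1) * N"
   using card_FA[OF iI] unfolding N_def by linarith
  have K3': "(real (bn 1) * \<sigma> ^ (r - 1) + real k * (2 * \<eta>) + \<upsilon>) * N \<le> (kap + c) * N"
   using K3 N0 by (intro mult_right_mono)
  have "real (deg E v) \<le> (kap + c) * N" using d s K3' by (simp add: distrib_right)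
  moreover have "rcard M \<le> 2 * c * N" if "\<not> real (deg E v) \<le> (kap - c) * N"
   using that d s K3' by (simp add: algebra_simps)
  ultimately show ?thesis using iI unfolding N_def M_def by blast
 next
  case 2
  have "real (r - 1) * rcard (L v) \<le> real ((k - 2) choose (r - 2)) * (\<sigma> ^ (r - 2) * (\<sigma> + \<theta>)) * N"
   using two_untouched[OF 2] unfolding N_def r1 by (simp add: power_mult_distrib mult_ac)
  then have "rcard (L v) \<le> ovl * \<sigma> ^ (r - 2) * (\<sigma> + \<theta>) * N" using r3 by (simp add: field_simps)
  then have "real (deg E v) \<le> (ovl * \<sigma> ^ (r - 2) * (\<sigma> + \<theta>) + \<upsilon>) * N"
   using dl by (simp add: distrib_right)
  also have "... \<le> (kap - c) * N" using K2 N0 by (intro mult_right_mono) auto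
  finally show ?thesis using le by (simp add: N_def)
 qed
qed


subsection \<open>Graphs all of whose vertices are typical\<close>

definition Bad :: "'v set set" where "Bad = E - Bl f V"
definition Mis :: "'v set set" where "Mis = Bl f V - E"
text \<open>The (r-1)-faces of bad edges. Each lies in at most about \<open>n / k\<close> bad edges
  and in at least about \<open>n / k\<close> missing ones; bad and missing edges are compared
  through them.\<close>

definition SS :: "'v set set" where "SS = {S. \<exists>b. b \<notin> S \<and> insert b S \<in> Bad}"

text \<open>At level \<open>l\<close> these are sets of \<open>r - 1 - l\<close> vertices that grow
  to members of \<open>SS\<close> in \<open>l\<close> steps, with at least
  \<open>\<zeta> * n\<close> choices in each step.\<close>

primrec heavy :: "real => nat => 'v set set" where
 "heavy \<zeta> 0 = SS"
| "heavy \<zeta> (Suc l) = {Y. Y \<subseteq> V \<and> \<zeta> * real n \<le> rcard {a \<in> V. a \<notin> Y \<and> insert a Y \<in> heavy \<zeta> l}}"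

lemma fin_Mis: "finite Mis" and fin_Bad: "finite Bad" using Bl_fin[OF finV] finE by (auto simp: Mis_def Bad_def)

lemma SS_props:
 assumes "S \<in> SS"
 shows "S \<subseteq> V" "finite S" "card S = r - 1"
proof -
 obtain b where b: "b \<notin> S" "insert b S \<in> E" using assms by (auto simp: SS_def Bad_def)
 show "S \<subseteq> V" using edge[OF b(2)] by auto
 show "finite S" using fin_edge[OF b(2)] by simp
 then have "Suc (card S) = r" using edge[OF b(2)] b(1) by simp
 then show "card S = r - 1" by linarith
qed

lemma fin_SS: "finite SS" by (rule finite_subset[of _ "Pow V"]) (use SS_props(1) finV in auto)

lemma card_faces_le:
 assumes "card X = r" "finite X"
 shows "card {S \<in> SS. S \<subseteq> X} \<le> r"
proof -
 have "card {S \<in> SS. S \<subseteq> X} \<le> card {S. {} \<subseteq> S \<and> S \<subseteq> X \<and> card S = r - 1}"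
  using SS_props(3) assms by (intro card_mono) (auto intro: finite_subset[of _ "Pow X"])
 also have "... = r choose (r - 1)" using card_sets_between[of X "{}" "r - 1"] assms by simp
 also have "... = r" using r3 binomial_symmetric[of "r - 1" r] by simp
 finally show ?thesis .
qed

context
 assumes allU: "U = V"
begin

lemma inj_edge:
 assumes "X \<in> E"
 shows "inj_on f X"
proof (rule inj_onI, rule ccontr)
 fix a b assume "a \<in> X" "b \<in> X" "f a = f b" "a \<noteq> b"
 then show False using typical_same_part[of a b X] assms edge[OF assms] allU by auto
qed

text \<open>The vertices completing a face to an edge are pairwise thin across parts, so
  \<open>thin_clique\<close> bounds their number; every bad edge has \<open>r\<close> faces.\<close>

lemma bad_le: "real r * rcard Bad \<le> rcard SS * ((\<sigma> + \<theta>) * real n)"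
proof -
 have "(\<Sum>X\<in>Bad. card {S \<in> SS. S \<subseteq> X}) = (\<Sum>S\<in>SS. card {X \<in> Bad. S \<subseteq> X})"
  by (rule double_count[OF fin_Bad fin_SS])
 moreover have "card {S \<in> SS. S \<subseteq> X} = r" if X: "X \<in> Bad" for X
 proof -
  have XE: "X \<subseteq> V" "card X = r" "finite X" using X edge[of X] fin_edge[of X] by (auto simp: Bad_def)
  have "{S \<in> SS. S \<subseteq> X} = {S. {} \<subseteq> S \<and> S \<subseteq> X \<and> card S = r - 1}"
  proof (intro equalityI subsetI)
   fix S assume S: "S \<in> {S. {} \<subseteq> S \<and> S \<subseteq> X \<and> card S = r - 1}"
   then have "card (X - S) = 1" using XE finite_subset[of S X] r3 by (simp add: card_Diff_subset)
   then obtain b where "X - S = {b}" by (auto simp: card_1_singleton_iff)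
   then have "insert b S = X" "b \<notin> S" using S by auto
   then show "S \<in> {S \<in> SS. S \<subseteq> X}" using S X by (auto simp: SS_def)
  qed (use SS_props in auto)
  then have "card {S \<in> SS. S \<subseteq> X} = r choose (r - 1)" using card_sets_between[of X "{}" "r - 1"] XE by simp
  then show ?thesis using r3 binomial_symmetric[of "r - 1" r] by simp
 qed
 moreover have "rcard {X \<in> Bad. S \<subseteq> X} \<le> (\<sigma> + \<theta>) * real n" if S: "S \<in> SS" for S
 proof -
  define N where "N = {b \<in> V. b \<notin> S \<and> insert b S \<in> E}"
  have "N \<subseteq> U" by (auto simp: N_def allU)
  have fN: "finite N" using finV by (simp add: N_def)
  have "{X \<in> Bad. S \<subseteq> X} \<subseteq> (\<lambda>b. insert b S) ` N"
  proof
   fix X assume X: "X \<in> {X \<in> Bad. S \<subseteq> X}"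
   then have XE: "X \<in> E" by (auto simp: Bad_def)
   then have "card (X - S) = 1" using X edge[OF XE] SS_props[OF S] r3 by (simp add: card_Diff_subset)
   then obtain b where "X - S = {b}" by (auto simp: card_1_singleton_iff)
   then have "X = insert b S" "b \<notin> S" using X by auto
   then show "X \<in> (\<lambda>b. insert b S) ` N" using XE edge[OF XE] by (auto simp: N_def)
  qed
  then have "card {X \<in> Bad. S \<subseteq> X} \<le> card N"
   using fN by (meson card_image_le card_mono finite_imageI le_trans)
  moreover have "rcard N \<le> (\<sigma> + \<theta>) * real n"
  proof (rule thin_clique[OF \<open>N \<subseteq> U\<close>])
   fix a b assume ab: "a \<in> N" "b \<in> N" "f a \<noteq> f b"
   show "thin a b" by (rule thinI[of a b S]) (use ab in "auto simp: N_def")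
  qed
  ultimately show ?thesis by linarith
 qed
 ultimately have "rcard Bad * real r \<le> rcard SS * ((\<sigma> + \<theta>) * real n)"
  using sum_bounded_above[of SS "\<lambda>S. rcard {X \<in> Bad. S \<subseteq> X}" "(\<sigma> + \<theta>) * real n"]
  by (simp flip: of_nat_sum of_nat_mult)
 then show ?thesis by (simp add: mult.commute)
qed

text \<open>Let the bad edge be \<open>insert b S\<close>, and let part \<open>j\<close> complete
  the type of \<open>S\<close>; then \<open>b\<close> is not in part \<open>j\<close>. A vertex of
  part \<open>j\<close> that extends \<open>S\<close> to an edge is a thin partner of
  \<open>b\<close>, so all but \<open>\<theta> * n\<close> vertices of part \<open>j\<close> yield
  missing edges.\<close>

lemma missing_at:
 assumes S: "S \<in> SS"
 shows "(\<rho> - \<theta>) * real n \<le> rcard {X \<in> Mis. S \<subseteq> X}"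
proof -
 note p = SS_props[OF S]
 obtain b where b: "b \<notin> S" "insert b S \<in> E" "insert b S \<notin> Bl f V" using S by (auto simp: SS_def Bad_def)
 have bV: "b \<in> V" using edge[OF b(2)] by auto
 have inj: "inj_on f (insert b S)" using inj_edge[OF b(2)] .
 have "card (f ` S) = r - 1" using inj p by (simp add: card_image inj_on_insert)
 moreover have "f ` S \<subseteq> I" using p fV by auto
 ultimately obtain j where j: "j \<in> I" "j \<notin> f ` S" "insert j (f ` S) \<in> Bk" using complete_type by blast
 have fbj: "f b \<noteq> j"
 proof
  assume "f b = j"
  then have "insert b S \<in> Bl f V" using j edge[OF b(2)] by (auto simp: Bl_def)
  then show False using b by simp
 qed
 define A where "A = {a \<in> V. f a = j \<and> insert a S \<notin> E}"
 have fA: "finite A" using finV by (simp add: A_def)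
 have "{v \<in> V. f v = j} \<subseteq> A \<union> {a \<in> V. f a \<noteq> f b \<and> thin b a}"
 proof
  fix a assume a: "a \<in> {v \<in> V. f v = j}"
  show "a \<in> A \<union> {a \<in> V. f a \<noteq> f b \<and> thin b a}"
  proof (cases "insert a S \<in> E")
   case True
   have "thin b a" by (rule thinI[of b a S]) (use True a b fbj j in auto)
   then show ?thesis using a fbj by auto
  qed (use a in "auto simp: A_def")
 qed
 then have "card {v \<in> V. f v = j} \<le> card (A \<union> {a \<in> V. f a \<noteq> f b \<and> thin b a})"
  using finV fA by (intro card_mono) auto
 also have "... \<le> card A + card {a \<in> V. f a \<noteq> f b \<and> thin b a}" by (rule card_Un_le)
 finally have "\<rho> * real n \<le> rcard A + \<theta> * real n" using low[OF j(1)] thin_degree[of b] bV allU by simp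
 moreover have "card A \<le> card {X \<in> Mis. S \<subseteq> X}"
 proof (rule card_inj_on_le[where f = "\<lambda>a. insert a S"])
  have "a \<notin> S" if "a \<in> A" for a using that j by (auto simp: A_def)
  then show "inj_on (\<lambda>a. insert a S) A" by (intro inj_onI) blast
  show "(\<lambda>a. insert a S) ` A \<subseteq> {X \<in> Mis. S \<subseteq> X}"
  proof (rule image_subsetI)
   fix a assume a: "a \<in> A"
   then have "a \<notin> S" using j by (auto simp: A_def)
   then have "card (insert a S) = r" using p r3 by simp
   then show "insert a S \<in> {X \<in> Mis. S \<subseteq> X}" using a j p by (auto simp: Mis_def Bl_def A_def)
  qed
  show "finite {X \<in> Mis. S \<subseteq> X}" using fin_Mis by simp
 qed
 ultimately show ?thesis by (simp add: left_diff_distrib)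
qed

lemma heavy_count:
 assumes z: "0 < \<zeta>"
 shows "l \<le> r - 1 ==> Y \<in> heavy \<zeta> l ==> Y \<subseteq> V \<and> card Y = r - 1 - l \<and>
  (\<zeta> * real n) ^ l \<le> fact l * rcard {S \<in> SS. Y \<subseteq> S}"
proof (induction l arbitrary: Y)
 case 0
 then have "{S \<in> SS. Y \<subseteq> S} \<noteq> {}" by auto
 then have "card {S \<in> SS. Y \<subseteq> S} > 0" using fin_SS by (simp add: card_gt_0_iff)
 then have "1 \<le> rcard {S \<in> SS. Y \<subseteq> S}" by linarith
 then show ?case using 0 SS_props[of Y] by simp
next
 case (Suc l)
 define N where "N = {a \<in> V. a \<notin> Y \<and> insert a Y \<in> heavy \<zeta> l}"
 have Y: "Y \<subseteq> V" "\<zeta> * real n \<le> rcard N" using Suc.prems by (auto simp: N_def)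
 have fN: "finite N" using finV by (simp add: N_def)
 have fY: "finite Y" using Y finV finite_subset by blast
 have "0 < \<zeta> * real n" using z n0 by simp
 then have "card N > 0" using Y by linarith
 then obtain a where a: "a \<in> N" by (metis card_gt_0_iff ex_in_conv)
 have IH: "card (insert a Y) = r - 1 - l" "(\<zeta> * real n) ^ l \<le> fact l * rcard {S \<in> SS. insert a Y \<subseteq> S}"
  if "a \<in> N" for a using Suc.IH[of "insert a Y"] that Suc.prems by (auto simp: N_def)
 have cY: "card Y = r - 1 - Suc l" using IH(1)[OF a] a fY by (simp add: N_def)
 let ?F = "{S \<in> SS. Y \<subseteq> S}"
 have fF: "finite ?F" using fin_SS by simp
 have "(\<Sum>a\<in>N. card {S \<in> ?F. insert a Y \<subseteq> S}) = (\<Sum>S\<in>?F. card {a \<in> N. insert a Y \<subseteq> S})"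
  by (rule double_count[OF fN fF])
 also have "... \<le> (\<Sum>S\<in>?F. Suc l)"
 proof (rule sum_mono)
  fix S assume S: "S \<in> ?F"
  then have pS: "finite S" "card S = r - 1" using SS_props by auto
  have "{a \<in> N. insert a Y \<subseteq> S} \<subseteq> S - Y" by (auto simp: N_def)
  then have "card {a \<in> N. insert a Y \<subseteq> S} \<le> card (S - Y)" using pS by (intro card_mono) auto
  also have "... = Suc l" using S pS fY cY Suc.prems(1) by (simp add: card_Diff_subset)
  finally show "card {a \<in> N. insert a Y \<subseteq> S} \<le> Suc l" .
 qed
 finally have 0: "(\<Sum>a\<in>N. card {S \<in> ?F. insert a Y \<subseteq> S}) \<le> Suc l * card ?F" by (simp add: mult.commute)
 have "{S \<in> ?F. insert a Y \<subseteq> S} = {S \<in> SS. insert a Y \<subseteq> S}" for a by auto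
 with 0 have "(\<Sum>a\<in>N. card {S \<in> SS. insert a Y \<subseteq> S}) \<le> Suc l * card ?F" by simp
 then have "real (\<Sum>a\<in>N. card {S \<in> SS. insert a Y \<subseteq> S}) \<le> real (Suc l * card ?F)"
  by (simp only: of_nat_le_iff)
 then have 1: "(\<Sum>a\<in>N. rcard {S \<in> SS. insert a Y \<subseteq> S}) \<le> real (Suc l) * rcard ?F"
  by (simp only: of_nat_sum of_nat_mult)
 have "(\<zeta> * real n) ^ Suc l \<le> rcard N * (\<zeta> * real n) ^ l" using Y z by (simp add: mult_right_mono)
 also have "... = (\<Sum>a\<in>N. (\<zeta> * real n) ^ l)" by simp
 also have "... \<le> (\<Sum>a\<in>N. fact l * rcard {S \<in> SS. insert a Y \<subseteq> S})" using IH by (intro sum_mono)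
 also have "... \<le> fact l * (real (Suc l) * rcard ?F)" using 1 by (simp flip: sum_distrib_left)
 finally show ?case using Y cY by (simp add: mult_ac)
qed

text \<open>A heavy singleton would lie in order \<open>n^(r-2)\<close> faces, each in about
  \<open>n / k\<close> missing edges, too many for a typical vertex.\<close>

lemma light_vertex:
 assumes z: "0 < \<zeta>" and K4: "fact (r - 2) * real r * \<eta> < \<zeta> ^ (r - 2) * (\<rho> - \<theta>)" and th: "\<theta> \<le> \<rho>"
 shows "{v} \<notin> heavy \<zeta> (r - 2)"
proof
 assume h: "{v} \<in> heavy \<zeta> (r - 2)"
 let ?F = "{S \<in> SS. v \<in> S}"
 have vV: "v \<in> U" and lo: "(\<zeta> * real n) ^ (r - 2) \<le> fact (r - 2) * rcard ?F"
  using heavy_count[OF z _ h] allU by auto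
 have fF: "finite ?F" using fin_SS by simp
 have "(\<Sum>S\<in>?F. card {X \<in> mis v. S \<subseteq> X}) = (\<Sum>X\<in>mis v. card {S \<in> ?F. S \<subseteq> X})"
  by (rule double_count[OF fF fin_mis])
 also have "... \<le> (\<Sum>X\<in>mis v. r)"
 proof (rule sum_mono)
  fix X assume "X \<in> mis v"
  then have "card X = r" "finite X" using finV finite_subset by (auto simp: mis_def Bl_def)
  moreover have "card {S \<in> ?F. S \<subseteq> X} \<le> card {S \<in> SS. S \<subseteq> X}"
   using fin_SS by (intro card_mono) auto
  ultimately show "card {S \<in> ?F. S \<subseteq> X} \<le> r" using card_faces_le[of X] by linarith
 qed
 finally have "(\<Sum>S\<in>?F. rcard {X \<in> mis v. S \<subseteq> X}) \<le> rcard (mis v) * real r"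
  by (simp flip: of_nat_sum of_nat_mult)
 moreover have "rcard ?F * ((\<rho> - \<theta>) * real n) \<le> (\<Sum>S\<in>?F. rcard {X \<in> mis v. S \<subseteq> X})"
 proof (rule sum_bounded_below)
  fix S assume S: "S \<in> ?F"
  then have "{X \<in> mis v. S \<subseteq> X} = {X \<in> Mis. S \<subseteq> X}" by (auto simp: mis_def Mis_def)
  then show "(\<rho> - \<theta>) * real n \<le> rcard {X \<in> mis v. S \<subseteq> X}" using missing_at S by simp
 qed
 moreover have "rcard (mis v) * real r \<le> \<eta> * real n ^ (r - 1) * real r"
  using vV by (intro mult_right_mono) (auto simp: U_def)
 ultimately have up: "rcard ?F * ((\<rho> - \<theta>) * real n) \<le> \<eta> * real n ^ (r - 1) * real r" by linarith
 have "r - 1 = Suc (r - 2)" using r3 by simp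
 then have "\<zeta> ^ (r - 2) * (\<rho> - \<theta>) * real n ^ (r - 1) = (\<zeta> * real n) ^ (r - 2) * ((\<rho> - \<theta>) * real n)"
  by (simp add: power_mult_distrib)
 also have "... \<le> fact (r - 2) * rcard ?F * ((\<rho> - \<theta>) * real n)" using lo th by (intro mult_right_mono) auto
 also have "... = fact (r - 2) * (rcard ?F * ((\<rho> - \<theta>) * real n))" by (simp only: mult.assoc)
 also have "... \<le> fact (r - 2) * (\<eta> * real n ^ (r - 1) * real r)" using up by (intro mult_left_mono) auto
 also have "... = (fact (r - 2) * real r * \<eta>) * real n ^ (r - 1)" by (simp add: mult_ac)
 also have "... < \<zeta> ^ (r - 2) * (\<rho> - \<theta>) * real n ^ (r - 1)"
  using K4 n0 by (intro mult_strict_right_mono) auto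
 finally show False by simp
qed

definition full :: "'v set set" where "full = {X \<in> Mis. \<forall>S\<subseteq>X. card S = r - 1 --> S \<in> SS}"

text \<open>A missing edge all of whose faces are bad contains a light set whose one-point extensions
 inside it are all heavy; a face around that light set leaves few choices for the last point.\<close>

lemma full_le:
 assumes z: "0 < \<zeta>" and K4: "fact (r - 2) * real r * \<eta> < \<zeta> ^ (r - 2) * (\<rho> - \<theta>)" and th: "\<theta> \<le> \<rho>"
 shows "rcard full \<le> rcard SS * (2 ^ (r - 1) * real r * \<zeta> * real n)"
proof -
 define Z where "Z Y l = {a \<in> V. a \<notin> Y \<and> insert a Y \<in> heavy \<zeta> l}" for Y l
 \<comment> \<open>\<open>G S Y l\<close> is empty unless \<open>Y\<close> is light at level
   \<open>l + 1\<close>, so it never has more than \<open>\<zeta> * n\<close> members. Each full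
   edge is shown to be of the form \<open>insert z S\<close> with a light \<open>Y\<close> inside
   its face \<open>S\<close>.\<close>
 define G where "G S Y l = (if Y \<subseteq> V \<and> Y \<notin> heavy \<zeta> (Suc l) then (\<lambda>z. insert z S) ` Z Y l else {})" for S Y l
 have fZ: "finite (Z Y l)" for Y l using finV by (simp add: Z_def)
 have cG: "rcard (G S Y l) \<le> \<zeta> * real n" for S Y l
 proof (cases "Y \<subseteq> V \<and> Y \<notin> heavy \<zeta> (Suc l)")
  case True
  then have "rcard (Z Y l) \<le> \<zeta> * real n" by (auto simp: Z_def)
  moreover have "card (G S Y l) \<le> card (Z Y l)" using True fZ by (simp add: G_def card_image_le)
  ultimately show ?thesis by linarith
 qed (use z in "auto simp: G_def")
 have fG: "finite (G S Y l)" for S Y l using fZ by (simp add: G_def)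
 have "full \<subseteq> (\<Union>S\<in>SS. \<Union>Y\<in>Pow S. \<Union>l\<in>{..<r}. G S Y l)"
 proof
  fix X assume X: "X \<in> full"
  have pX: "X \<subseteq> V" "card X = r" "finite X" using X finV finite_subset by (auto simp: full_def Mis_def Bl_def)
  define Q where "Q l \<longleftrightarrow> (\<forall>Y\<subseteq>X. card Y = r - 1 - l --> Y \<in> heavy \<zeta> l)" for l
  have "Q 0" using X by (auto simp: Q_def full_def)
  have "\<not> Q (r - 2)"
  proof
   assume q: "Q (r - 2)"
   obtain v where "v \<in> X" using pX r3 by fastforce
   then have "{v} \<in> heavy \<zeta> (r - 2)" using q r3 by (auto simp: Q_def)
   then show False using light_vertex[OF assms] by blast
  qed
  \<comment> \<open>Fullness gives \<open>Q 0\<close> and \<open>light_vertex\<close> refutes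
    \<open>Q (r - 2)\<close>, so heaviness of all subsets is lost at some level between.\<close>
  then have "\<exists>l<r - 2. Q l \<and> \<not> Q (Suc l)"
   using \<open>Q 0\<close> by (metis (no_types, lifting) dec_induct le0)
  then obtain l where l: "l < r - 2" "Q l" "\<not> Q (Suc l)" by auto
  then obtain Y where Y: "Y \<subseteq> X" "card Y = r - 1 - Suc l" "Y \<notin> heavy \<zeta> (Suc l)" by (auto simp: Q_def)
  have fY: "finite Y" using Y pX finite_subset by blast
  have "card Y < card X" using Y pX l by simp
  then have "Y \<noteq> X" by auto
  then obtain z where zz: "z \<in> X" "z \<notin> Y" using Y by auto
  have "card (insert z Y) = r - 1 - l" using zz fY Y(2) l by simp
  then have "insert z Y \<in> heavy \<zeta> l" using l(2) zz Y by (auto simp: Q_def)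
  then have "z \<in> Z Y l" using zz pX by (auto simp: Z_def)
  moreover have "X - {z} \<in> SS" using X zz pX by (auto simp: full_def)
  moreover have "Y \<in> Pow (X - {z})" using zz Y by auto
  moreover have "X = insert z (X - {z})" using zz by auto
  moreover have "Y \<subseteq> V" using Y pX by auto
  moreover have "l \<in> {..<r}" using l by simp
  ultimately show "X \<in> (\<Union>S\<in>SS. \<Union>Y\<in>Pow S. \<Union>l\<in>{..<r}. G S Y l)"
   using Y(3) unfolding G_def by (intro UN_I[of "X - {z}"] UN_I[of Y] UN_I[of l]) auto
 qed
 then have "card full \<le> card (\<Union>S\<in>SS. \<Union>Y\<in>Pow S. \<Union>l\<in>{..<r}. G S Y l)"
  using fin_SS SS_props(2) fG by (intro card_mono) auto
 also have "... \<le> (\<Sum>S\<in>SS. card (\<Union>Y\<in>Pow S. \<Union>l\<in>{..<r}. G S Y l))"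
  by (rule card_UN_le[OF fin_SS])
 also have "... \<le> (\<Sum>S\<in>SS. \<Sum>Y\<in>Pow S. card (\<Union>l\<in>{..<r}. G S Y l))"
  using SS_props(2) by (intro sum_mono card_UN_le) auto
 also have "... \<le> (\<Sum>S\<in>SS. \<Sum>Y\<in>Pow S. \<Sum>l\<in>{..<r}. card (G S Y l))"
  by (intro sum_mono card_UN_le) auto
 finally have "rcard full \<le> (\<Sum>S\<in>SS. \<Sum>Y\<in>Pow S. \<Sum>l\<in>{..<r}. rcard (G S Y l))"
  by (simp flip: of_nat_sum)
 also have "... \<le> (\<Sum>S\<in>SS. \<Sum>Y\<in>Pow S. \<Sum>l\<in>{..<r}. \<zeta> * real n)" by (intro sum_mono cG)
 also have "... = (\<Sum>S\<in>SS. 2 ^ (r - 1) * real r * \<zeta> * real n)"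
  using SS_props by (intro sum.cong refl) (simp add: card_Pow mult.assoc)
 finally show ?thesis by simp
qed

text \<open>Counting all \<open>r\<close> faces of a missing edge would only show that there are
  about as many missing as bad edges. Full missing edges are rare, so \<open>r - 1\<close> faces per
  missing edge suffice, which saves a factor of about \<open>1 - 1/r\<close>; \<open>K5\<close>
  gives up half of the saving to absorb the errors.\<close>

lemma bad_missing:
 fixes \<zeta> :: real
 assumes z: "0 < \<zeta>" and K4: "fact (r - 2) * real r * \<eta> < \<zeta> ^ (r - 2) * (\<rho> - \<theta>)" and th: "\<theta> \<le> \<rho>"
  and K5: "(\<sigma> + \<theta>) * (real r - 1) \<le> (real r - 1/2) * (\<rho> - \<theta> - 2 ^ (r - 1) * real r * \<zeta>)"
 shows "rcard Bad \<le> (1 - 1 / (2 * real r)) * rcard Mis"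
proof -
 define \<beta> where "\<beta> = \<rho> - \<theta> - 2 ^ (r - 1) * real r * \<zeta>"
 have "(\<Sum>S\<in>SS. card {X \<in> Mis. S \<subseteq> X}) = (\<Sum>X\<in>Mis. card {S \<in> SS. S \<subseteq> X})"
  by (rule double_count[OF fin_SS fin_Mis])
 also have "... \<le> (\<Sum>X\<in>Mis. (r - 1) + (if X \<in> full then 1 else 0))"
 proof (rule sum_mono)
  fix X assume X: "X \<in> Mis"
  then have pX: "card X = r" "finite X" using finV finite_subset by (auto simp: Mis_def Bl_def)
  show "card {S \<in> SS. S \<subseteq> X} \<le> (r - 1) + (if X \<in> full then 1 else 0)"
  proof (cases "X \<in> full")
   case True
   then show ?thesis using card_faces_le[OF pX] r3 by simp
  next
   case False
   then obtain R where R: "R \<subseteq> X" "card R = r - 1" "R \<notin> SS" using X by (auto simp: full_def)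
   let ?Q = "{S. {} \<subseteq> S \<and> S \<subseteq> X \<and> card S = r - 1}"
   have fQ: "finite ?Q" by (rule finite_subset[of _ "Pow X"]) (use pX in auto)
   have "card {S \<in> SS. S \<subseteq> X} \<le> card (?Q - {R})" using fQ R SS_props(3) by (intro card_mono) auto
   also have "... = card ?Q - 1" using R by (intro card_Diff_singleton) auto
   also have "card ?Q = r choose (r - 1)" using card_sets_between[of X "{}" "r - 1"] pX by simp
   also have "... = r" using r3 binomial_symmetric[of "r - 1" r] by simp
   finally show ?thesis using False by simp
  qed
 qed
 also have "... = (r - 1) * card Mis + card full"
 proof -
  have "{X \<in> Mis. X \<in> full} = full" by (auto simp: full_def)
  then show ?thesis using fin_Mis by (simp add: sum.distrib mult.commute flip: sum.inter_filter)
 qed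
 finally have "real (\<Sum>S\<in>SS. card {X \<in> Mis. S \<subseteq> X}) \<le> real ((r - 1) * card Mis + card full)"
  by (simp only: of_nat_le_iff)
 then have 1: "(\<Sum>S\<in>SS. rcard {X \<in> Mis. S \<subseteq> X}) \<le> (real r - 1) * rcard Mis + rcard full"
  using r3 by (simp add: of_nat_diff)
 have "rcard SS * ((\<rho> - \<theta>) * real n) \<le> (\<Sum>S\<in>SS. rcard {X \<in> Mis. S \<subseteq> X})"
  using missing_at by (intro sum_bounded_below) auto
 with 1 full_le[OF z K4 th] have "rcard SS * (\<beta> * real n) \<le> (real r - 1) * rcard Mis"
  unfolding \<beta>_def by (simp add: algebra_simps)
 then have 2: "(real r - 1/2) * (rcard SS * (\<beta> * real n)) \<le> (real r - 1/2) * ((real r - 1) * rcard Mis)"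
  using r3 by (intro mult_left_mono) auto
 have "(real r - 1) * (real r * rcard Bad) \<le> (real r - 1) * (rcard SS * ((\<sigma> + \<theta>) * real n))"
  using bad_le r3 by (intro mult_left_mono) auto
 also have "... = ((\<sigma> + \<theta>) * (real r - 1)) * (rcard SS * real n)" by (simp add: mult_ac)
 also have "... \<le> ((real r - 1/2) * \<beta>) * (rcard SS * real n)"
  using K5 unfolding \<beta>_def by (intro mult_right_mono) auto
 also have "... = (real r - 1/2) * (rcard SS * (\<beta> * real n))" by (simp add: mult_ac)
 also note 2
 finally have "(real r - 1) * (real r * rcard Bad) \<le> (real r - 1) * ((real r - 1/2) * rcard Mis)" by (simp add: mult_ac)
 then have "real r * rcard Bad \<le> (real r - 1/2) * rcard Mis" using r3 by (subst (asm) mult_le_cancel_left_pos) auto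
 then show ?thesis using r3 by (simp add: field_simps)
qed

end

lemma card_E_split: "rcard E = rcard (Bl f V) - rcard Mis + rcard Bad"
proof -
 have fB: "finite (Bl f V)" by (rule Bl_fin[OF finV])
 have "card (E \<inter> Bl f V \<union> Bad) = card (E \<inter> Bl f V) + card Bad"
  using finE fin_Bad by (intro card_Un_disjoint) (auto simp: Bad_def)
 moreover have "E \<inter> Bl f V \<union> Bad = E" by (auto simp: Bad_def)
 moreover have "card (E \<inter> Bl f V \<union> Mis) = card (E \<inter> Bl f V) + card Mis"
  using finE fin_Mis by (intro card_Un_disjoint) (auto simp: Mis_def)
 moreover have "E \<inter> Bl f V \<union> Mis = Bl f V" by (auto simp: Mis_def)
 ultimately show ?thesis by simp
qed

end

section \<open>Sizes of blow-ups\<close>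

lemma prod_add_expand:
 fixes q :: real
 assumes "finite B"
 shows "(\<Prod>j\<in>B. q + d j) = (\<Sum>Y\<in>Pow B. q ^ (card B - card Y) * (\<Prod>j\<in>Y. d j))"
proof -
 have "(\<Prod>j\<in>B. d j + q) = (\<Sum>Y\<in>Pow B. (\<Prod>j\<in>Y. d j) * (\<Prod>j\<in>B - Y. q))"
  by (rule prod_add[OF assms])
 also have "... = (\<Sum>Y\<in>Pow B. q ^ (card B - card Y) * (\<Prod>j\<in>Y. d j))"
  by (intro sum.cong refl) (simp add: card_Diff_subset finite_subset[OF _ assms])
 finally show ?thesis by (simp add: add.commute)
qed

lemma esym1: "finite C ==> esym x C 1 = (\<Sum>i\<in>C. x i)" using esym_deriv[of C 0 x] by (simp add: esym_0)

lemma esym2: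
 assumes "finite C"
 shows "2 * esym x C 2 = (\<Sum>i\<in>C. x i) ^ 2 - (\<Sum>i\<in>C. x i ^ 2)"
proof -
 have "2 * esym x C 2 = (\<Sum>i\<in>C. x i * esym x (C - {i}) 1)"
  using esym_deriv[OF assms, of 1 x] by (simp add: numeral_2_eq_2)
 also have "... = (\<Sum>i\<in>C. x i * ((\<Sum>j\<in>C. x j) - x i))"
 proof (rule sum.cong[OF refl])
  fix i assume i: "i \<in> C"
  have "esym x (C - {i}) 1 = (\<Sum>j\<in>C - {i}. x j)" using assms by (intro esym1) simp
  also have "... = (\<Sum>j\<in>C. x j) - x i" using assms i by (simp add: sum_diff1)
  finally show "x i * esym x (C - {i}) 1 = x i * ((\<Sum>j\<in>C. x j) - x i)" by simp
 qed
 also have "... = (\<Sum>i\<in>C. x i) ^ 2 - (\<Sum>i\<in>C. x i ^ 2)"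
  by (simp add: right_diff_distrib sum_subtractf power2_eq_square flip: sum_distrib_right)
 finally show ?thesis .
qed

lemma power_one_minus_le:
 fixes x :: real
 assumes "0 \<le> x" "x \<le> 1"
 shows "(1 - x) ^ m \<le> 1 - real m * x + real m ^ 2 * x ^ 2"
proof (induction m)
 case (Suc m)
 have "(1 - x) ^ Suc m \<le> (1 - x) * (1 - real m * x + real m ^ 2 * x ^ 2)" using Suc assms by (simp add: mult_left_mono)
 also have "... = 1 - real (Suc m) * x + (real m ^ 2 + real m) * x ^ 2 - real m ^ 2 * x ^ 3"
  by (simp add: algebra_simps power2_eq_square power3_eq_cube)
 also have "... \<le> 1 - real (Suc m) * x + (real m ^ 2 + real m) * x ^ 2" using assms by simp
 also have "... \<le> 1 - real (Suc m) * x + real (Suc m) ^ 2 * x ^ 2"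
  using assms by (intro add_left_mono mult_right_mono) (auto simp: power2_eq_square algebra_simps)
 finally show ?case .
qed simp

context steiner
begin

definition Np :: "('i => real) => real" where "Np y = (\<Sum>B\<in>Bk. \<Prod>j\<in>B. y j)"

text \<open>The terms of order at least three when \<open>Np\<close>, the edge count as a polynomial
  in the part sizes, is expanded at the constant vector \<open>q\<close>.\<close>

definition Rest :: "real => ('i => real) => real" where
 "Rest q d = (\<Sum>Y | Y \<subseteq> I \<and> 3 \<le> card Y \<and> card Y \<le> r.
   rcard {B \<in> Bk. Y \<subseteq> B} * (q ^ (r - card Y) * (\<Prod>j\<in>Y. d j)))"

lemma card_Bl_Np: "finite V ==> rcard (Bl f V) = Np (\<lambda>j. rcard {a \<in> V. f a = j})" by (simp add: card_Bl Np_def)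

text \<open>Every point lies in \<open>bn 1\<close> blocks and every pair in \<open>bn 2\<close>, so
  the terms of order one and two depend on the increments only through their sum and their square
  sum.\<close>

lemma Np_expand:
 "Np (\<lambda>j. q + d j) = rcard Bk * q ^ r + real (bn 1) * q ^ (r - 1) * (\<Sum>j\<in>I. d j)
   + b2 * q ^ (r - 2) * (((\<Sum>j\<in>I. d j) ^ 2 - (\<Sum>j\<in>I. d j ^ 2)) / 2) + Rest q d"
proof -
 let ?h = "\<lambda>Y. q ^ (r - card Y) * (\<Prod>j\<in>Y. d j)"
 let ?b = "\<lambda>Y. rcard {B \<in> Bk. Y \<subseteq> B}"
 let ?Q = "{Y. Y \<subseteq> I \<and> card Y \<le> r}"
 have fQ: "finite ?Q" by (rule finite_subset[of _ "Pow I"]) (use finI in auto)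
 have "Np (\<lambda>j. q + d j) = (\<Sum>B\<in>Bk. \<Sum>Y\<in>Pow B. ?h Y)" unfolding Np_def
 proof (rule sum.cong[OF refl])
  fix B assume "B \<in> Bk"
  then show "(\<Prod>j\<in>B. q + d j) = (\<Sum>Y\<in>Pow B. ?h Y)"
   using prod_add_expand[OF blk_fin, of B q d] blk[of B] by simp
 qed
 also have "... = (\<Sum>B\<in>Bk. \<Sum>Y | Y \<in> ?Q \<and> Y \<subseteq> B. ?h Y)"
 proof (intro sum.cong refl)
  fix B assume B: "B \<in> Bk"
  then show "Pow B = {Y. Y \<in> ?Q \<and> Y \<subseteq> B}" using blk[OF B] card_mono[OF blk_fin[OF B]] by auto
 qed
 also have "... = (\<Sum>Y\<in>?Q. \<Sum>B | B \<in> Bk \<and> Y \<subseteq> B. ?h Y)"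
  using finBk fQ by (intro sum.swap_restrict)
 also have "... = (\<Sum>Y\<in>?Q. ?b Y * ?h Y)" by simp
 also have "... = (\<Sum>Y | Y \<subseteq> I \<and> card Y = 0. ?b Y * ?h Y) + (\<Sum>Y | Y \<subseteq> I \<and> card Y = 1. ?b Y * ?h Y)
   + (\<Sum>Y | Y \<subseteq> I \<and> card Y = 2. ?b Y * ?h Y) + Rest q d"
 proof -
  have e: "?Q = (({Y. Y \<subseteq> I \<and> card Y = 0} \<union> {Y. Y \<subseteq> I \<and> card Y = 1}) \<union> {Y. Y \<subseteq> I \<and> card Y = 2})
   \<union> {Y. Y \<subseteq> I \<and> 3 \<le> card Y \<and> card Y \<le> r}" using r3 by auto
  show ?thesis unfolding e Rest_def using fin_sub[OF finI] by (subst sum.union_disjoint; (auto)?)+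
 qed
 also have "(\<Sum>Y | Y \<subseteq> I \<and> card Y = 0. ?b Y * ?h Y) = rcard Bk * q ^ r"
 proof -
  have "{Y. Y \<subseteq> I \<and> card Y = 0} = {{}}" using finI finite_subset by fastforce
  then show ?thesis by simp
 qed
 also have "(\<Sum>Y | Y \<subseteq> I \<and> card Y = 1. ?b Y * ?h Y) = real (bn 1) * q ^ (r - 1) * (\<Sum>j\<in>I. d j)"
 proof -
  have "(\<Sum>Y | Y \<subseteq> I \<and> card Y = 1. ?b Y * ?h Y) = (\<Sum>Y | Y \<subseteq> I \<and> card Y = 1. real (bn 1) * q ^ (r - 1) * (\<Prod>j\<in>Y. d j))"
   using bn_through r3 by (intro sum.cong refl) auto
  also have "... = real (bn 1) * q ^ (r - 1) * esym d I 1" unfolding esym_def by (simp only: sum_distrib_left)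
  finally show ?thesis using esym1[OF finI] by simp
 qed
 also have "(\<Sum>Y | Y \<subseteq> I \<and> card Y = 2. ?b Y * ?h Y)
   = b2 * q ^ (r - 2) * (((\<Sum>j\<in>I. d j) ^ 2 - (\<Sum>j\<in>I. d j ^ 2)) / 2)"
 proof -
  have "(\<Sum>Y | Y \<subseteq> I \<and> card Y = 2. ?b Y * ?h Y) = (\<Sum>Y | Y \<subseteq> I \<and> card Y = 2. b2 * q ^ (r - 2) * (\<Prod>j\<in>Y. d j))"
   using bn_through r3 by (intro sum.cong refl) auto
  also have "... = b2 * q ^ (r - 2) * esym d I 2" unfolding esym_def by (simp only: sum_distrib_left)
  finally show ?thesis using esym2[OF finI, of d] by simp
 qed
 finally show ?thesis .
qed

lemma Rest_le:
 assumes q: "0 < q" and e: "0 \<le> e" "e \<le> 1" and d: "\<And>j. j \<in> I ==> \<bar>d j\<bar> \<le> m" and m: "m \<le> e * q"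
 shows "\<bar>Rest q d\<bar> \<le> 2 ^ k * rcard Bk * e * q ^ (r - 2) * m ^ 2"
proof -
 let ?Q = "{Y. Y \<subseteq> I \<and> 3 \<le> card Y \<and> card Y \<le> r}"
 have "I \<noteq> {}" using cardI rk by auto
 then have m0: "0 \<le> m" using d abs_ge_zero by (meson ex_in_conv order_trans)
 have "\<bar>Rest q d\<bar> \<le> (\<Sum>Y\<in>?Q. \<bar>rcard {B \<in> Bk. Y \<subseteq> B} * (q ^ (r - card Y) * (\<Prod>j\<in>Y. d j))\<bar>)"
  unfolding Rest_def by (rule sum_abs)
 also have "... \<le> (\<Sum>Y\<in>?Q. rcard Bk * (e * q ^ (r - 2) * m ^ 2))"
 proof (rule sum_mono)
  fix Y assume Y: "Y \<in> ?Q"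
  then have fY: "finite Y" using finI finite_subset by blast
  obtain l where l: "card Y = l + 3" using Y by (metis (no_types, lifting) mem_Collect_eq le_iff_add add.commute)
  have "\<bar>\<Prod>j\<in>Y. d j\<bar> = (\<Prod>j\<in>Y. \<bar>d j\<bar>)" by (rule abs_prod)
  also have "... \<le> (\<Prod>j\<in>Y. m)" using Y d by (intro prod_mono) auto
  also have "... = m ^ 2 * m ^ (l + 1)" using l by (simp add: power2_eq_square eval_nat_numeral)
  also have "... \<le> m ^ 2 * (e * q) ^ (l + 1)" using m m0 by (intro mult_left_mono power_mono) auto
  also have "... \<le> m ^ 2 * (e * q ^ (l + 1))"
  proof -
   have "e ^ (l + 1) \<le> e" using e by (simp add: mult_left_le power_le_one)
   then show ?thesis using q unfolding power_mult_distrib by (intro mult_left_mono mult_right_mono) auto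
  qed
  finally have "q ^ (r - card Y) * \<bar>\<Prod>j\<in>Y. d j\<bar> \<le> q ^ (r - card Y) * (m ^ 2 * (e * q ^ (l + 1)))"
   using q by (intro mult_left_mono) auto
  also have "... = e * (q ^ (r - card Y) * q ^ (l + 1)) * m ^ 2" by (simp add: mult_ac)
  also have "q ^ (r - card Y) * q ^ (l + 1) = q ^ (r - 2)"
  proof -
   have "r - card Y + (l + 1) = r - 2" using Y l by auto
   then show ?thesis by (metis power_add)
  qed
  finally have 1: "\<bar>q ^ (r - card Y) * (\<Prod>j\<in>Y. d j)\<bar> \<le> e * q ^ (r - 2) * m ^ 2"
   using q by (simp add: abs_mult)
  have "card {B \<in> Bk. Y \<subseteq> B} \<le> card Bk" using finBk by (intro card_mono) auto
  then show "\<bar>rcard {B \<in> Bk. Y \<subseteq> B} * (q ^ (r - card Y) * (\<Prod>j\<in>Y. d j))\<bar> \<le> rcard Bk * (e * q ^ (r - 2) * m ^ 2)"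
   using 1 unfolding abs_mult[of "rcard {B \<in> Bk. Y \<subseteq> B}"] by (intro mult_mono) auto
 qed
 also have "... = rcard ?Q * (rcard Bk * (e * q ^ (r - 2) * m ^ 2))" by simp
 also have "... \<le> real (2 ^ k) * (rcard Bk * (e * q ^ (r - 2) * m ^ 2))"
 proof (intro mult_right_mono)
  have "card ?Q \<le> card (Pow I)" using finI by (intro card_mono) auto
  then show "rcard ?Q \<le> real (2 ^ k)" using finI cardI by (simp add: card_Pow flip: of_nat_le_iff)
 qed (use q e in auto)
 finally show ?thesis by (simp add: mult_ac)
qed

lemma k0: "0 < real k" using rk by simp

lemma lam0_q: "rcard Bk * (N / real k) ^ r = lam0 * N ^ r" by (simp add: lam0_def power_divide)

text \<open>For increments of sum zero the second-order term is
  \<open>- b2 / 2 * q ^ (r - 2)\<close> times the square sum, and \<open>sm\<close> keeps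
  \<open>Rest\<close> below half of it.\<close>

lemma Np_concave:
 assumes N: "0 < N" and s: "(\<Sum>j\<in>I. y j) = N" and e: "0 \<le> e" "e \<le> 1"
  and d: "\<And>j. j \<in> I ==> \<bar>y j - N / real k\<bar> \<le> e * (N / real k)"
  and sm: "2 ^ k * rcard Bk * e \<le> b2 / 4"
 shows "Np y \<le> lam0 * N ^ r - b2 / 4 * (N / real k) ^ (r - 2) * (\<Sum>j\<in>I. (y j - N / real k) ^ 2)"
proof -
 define q where "q = N / real k"
 define d' where "d' j = y j - q" for j
 define D where "D = (\<Sum>j\<in>I. d' j ^ 2)"
 have q: "0 < q" using N k0 by (simp add: q_def)
 have kq: "real k * q = N" using k0 by (simp add: q_def)
 have sd: "(\<Sum>j\<in>I. d' j) = 0" unfolding d'_def sum_subtractf using s cardI kq by simp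
 define m where "m = Max ((\<lambda>j. \<bar>d' j\<bar>) ` I)"
 have ne: "I \<noteq> {}" using cardI rk by auto
 then have "m \<in> (\<lambda>j. \<bar>d' j\<bar>) ` I" unfolding m_def using finI by (intro Max_in) auto
 then obtain i where i: "i \<in> I" "m = \<bar>d' i\<bar>" by auto
 have mx: "\<bar>d' j\<bar> \<le> m" if "j \<in> I" for j using that finI by (simp add: m_def)
 have "m ^ 2 = d' i ^ 2" using i by simp
 also have "... \<le> D" unfolding D_def using i finI by (intro member_le_sum) auto
 finally have mD: "m ^ 2 \<le> D" .
 have meq: "m \<le> e * q" using i d by (simp add: d'_def q_def)
 have "Np y = Np (\<lambda>j. q + d' j)" by (simp add: d'_def)
 also have "... = lam0 * N ^ r - b2 * q ^ (r - 2) * (D / 2) + Rest q d'"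
  unfolding Np_expand sd D_def[symmetric] using lam0_q[of N] by (simp add: q_def)
 also have "... \<le> lam0 * N ^ r - b2 * q ^ (r - 2) * (D / 2) + b2 / 4 * q ^ (r - 2) * D"
 proof -
  have "Rest q d' \<le> (2 ^ k * rcard Bk * e) * (q ^ (r - 2) * m ^ 2)"
   using Rest_le[OF q e _ meq, of d'] mx by (simp add: mult_ac abs_le_iff)
  also have "... \<le> b2 / 4 * (q ^ (r - 2) * D)" using sm mD q e by (intro mult_mono) auto
  finally show ?thesis by (simp add: mult_ac)
 qed
 also have "... = lam0 * N ^ r - b2 / 4 * q ^ (r - 2) * D" by (simp add: field_simps)
 finally show ?thesis by (simp add: D_def d'_def q_def)
qed

lemma Np_balanced_ge:
 assumes N: "real k \<le> N" and s: "(\<Sum>j\<in>I. y j) = N"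
  and d: "\<And>j. j \<in> I ==> \<bar>y j - N / real k\<bar> \<le> 1"
 shows "lam0 * N ^ r - (b2 * real k + 2 ^ k * rcard Bk) * N ^ (r - 2) \<le> Np y"
proof -
 define q where "q = N / real k"
 define d' where "d' j = y j - q" for j
 have q: "1 \<le> q" using N k0 by (simp add: q_def)
 have kq: "real k * q = N" using k0 by (simp add: q_def)
 have qN: "q ^ (r - 2) \<le> N ^ (r - 2)"
  using q kq rk by (intro power_mono) (auto simp flip: kq simp: mult_le_cancel_right1)
 have sd: "(\<Sum>j\<in>I. d' j) = 0" unfolding d'_def sum_subtractf using s cardI kq by simp
 have d1: "\<bar>d' j\<bar> \<le> 1" if "j \<in> I" for j using d[OF that] by (simp add: d'_def q_def)
 have "(\<Sum>j\<in>I. d' j ^ 2) \<le> (\<Sum>j\<in>I. 1)"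
 proof (rule sum_mono)
  fix j assume "j \<in> I"
  then show "d' j ^ 2 \<le> 1" using d1 by (simp add: abs_square_le_1)
 qed
 then have D: "(\<Sum>j\<in>I. d' j ^ 2) \<le> real k" using cardI by simp
 have "\<bar>Rest q d'\<bar> \<le> 2 ^ k * rcard Bk * (1 / q) * q ^ (r - 2) * 1 ^ 2" using q d1 by (intro Rest_le) auto
 also have "... \<le> 2 ^ k * rcard Bk * 1 * q ^ (r - 2) * 1 ^ 2" using q by (intro mult_right_mono mult_left_mono) auto
 finally have R: "- (2 ^ k * rcard Bk * q ^ (r - 2)) \<le> Rest q d'" by simp
 have "Np y = Np (\<lambda>j. q + d' j)" by (simp add: d'_def)
 also have "... = lam0 * N ^ r - b2 * q ^ (r - 2) * ((\<Sum>j\<in>I. d' j ^ 2) / 2) + Rest q d'"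
  unfolding Np_expand sd using lam0_q[of N] by (simp add: q_def)
 also have "... \<ge> lam0 * N ^ r - b2 * q ^ (r - 2) * real k - 2 ^ k * rcard Bk * q ^ (r - 2)"
 proof -
  have "(\<Sum>j\<in>I. d' j ^ 2) / 2 \<le> real k" using D by simp
  then have "b2 * q ^ (r - 2) * ((\<Sum>j\<in>I. d' j ^ 2) / 2) \<le> b2 * q ^ (r - 2) * real k"
   using q by (intro mult_left_mono) auto
  then show ?thesis using R by linarith
 qed
 finally have 1: "lam0 * N ^ r - (b2 * real k + 2 ^ k * rcard Bk) * q ^ (r - 2) \<le> Np y"
  by (simp add: algebra_simps)
 have "(b2 * real k + 2 ^ k * rcard Bk) * q ^ (r - 2) \<le> (b2 * real k + 2 ^ k * rcard Bk) * N ^ (r - 2)"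
  using qN by (intro mult_left_mono) auto
 then show ?thesis using 1 by linarith
qed

end

section \<open>Choice of the small parameters\<close>

lemma eventually_pos:
 fixes F :: "real => real"
 assumes "(F \<longlongrightarrow> l) (at_right 0)" "0 < l"
 shows "\<forall>\<^sub>F h in at_right 0. 0 < F h" using order_tendstoD(1)[OF assms] .

context steiner
begin

text \<open>The value of \<open>\<gamma>\<close> in both uses of \<open>config\<close>: half of a
  lower bound for \<open>\<rho> ^ (r - 2)\<close>, the other half covering the additive term of
  \<open>A2\<close>. \<open>gp h\<close> is the \<open>\<theta>\<close> that makes \<open>A3\<close>
  an equality for \<open>\<eta> = 4 * h\<close>.\<close>

definition gam :: real where "gam = hk ^ (r - 2) / 2"

abbreviation gp :: "real => real" where "gp h \<equiv> real r * (4 * h) / gam"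

lemma gam_pos: "0 < gam" using k0 by (simp add: gam_def)

text \<open>By Pascal's rule \<open>(r - 1) * bn 1\<close> exceeds
  \<open>(k - 2) choose (r - 2)\<close> by \<open>(k - 2) choose (r - 3)\<close>. This is why a
  vertex with two untouched parts has too small a degree.\<close>

lemma kap_gap: "ovl * ik ^ (r - 2) * ik < kap"
proof -
 have "(r - 1) * bn 1 = (k - 1) choose (r - 2)" using bn_mult[of 1] r3 by (simp add: numeral_2_eq_2)
 also have "... = ((k - 2) choose (r - 3)) + ((k - 2) choose (r - 2))"
 proof -
  have e: "k - 1 = Suc (k - 2)" "r - 2 = Suc (r - 3)" using rk r3 by simp_all
  show ?thesis using binomial_Suc_Suc[of "k - 2" "r - 3"] by (simp only: e)
 qed
 also have "... > (k - 2) choose (r - 2)" using rk by simp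
 finally have "real ((k - 2) choose (r - 2)) < real (r - 1) * real (bn 1)" by (simp only: of_nat_less_iff flip: of_nat_mult)
 then have "ovl < real (bn 1)" using r3 by (simp add: divide_less_eq mult.commute)
 then have "ovl * ik ^ (r - 1) < real (bn 1) * ik ^ (r - 1)" using k0 by (intro mult_strict_right_mono) auto
 moreover have "ik ^ (r - 1) = ik ^ (r - 2) * ik"
 proof -
  have "r - 1 = Suc (r - 2)" using r3 by simp
  then show ?thesis by simp
 qed
 ultimately show ?thesis by (simp add: kap_eq power_divide mult.assoc)
qed

text \<open>Apart from \<open>0 < h\<close>, every condition on \<open>h\<close> is strict at
  \<open>h = 0\<close> and continuous there, so it holds for all small \<open>h > 0\<close>.
  \<open>\<zeta>\<close> is fixed beforehand, small enough for the condition of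
  \<open>bad_missing\<close> to be strict in the limit.\<close>

lemma params_h:
 assumes c0: "0 < c0"
 obtains h \<zeta> :: real where "0 < h" "h \<le> c0" "h \<le> 1" "0 < \<zeta>"
  "8 * h < hk ^ (r - 1)" "hk \<le> ik - h"
  "fact (r - 2) * real r * (4 * h) < \<zeta> ^ (r - 2) * (ik - h - gp h)"
  "gp h \<le> ik - h"
  "(ik + h + gp h) * (real r - 1)
    \<le> (real r - 1/2) * (ik - h - gp h - 2 ^ (r - 1) * real r * \<zeta>)"
  "2 ^ k * rcard Bk * (h * real k) \<le> b2 / 4" "h * real k \<le> 1"
  "ovl * ik ^ (r - 2) * ik < kap - h" "h < kap"
proof -
 define \<zeta> where "\<zeta> = 1 / (real k * 2 ^ (r - 1) * real r * (4 * real r))"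
 have r0: "0 < real r" using r3 by simp
 have z: "0 < \<zeta>" using k0 r0 by (simp add: \<zeta>_def)
 have bk: "0 < hk" using k0 by simp
 note ti = tendsto_intros
 have nb: "at_right (0::real) \<noteq> bot" by simp
 have e1: "\<forall>\<^sub>F h in at_right 0. 0 < c0 - h"
  by (rule eventually_pos[where l = "c0 - 0"], (intro ti)) (use c0 in auto)
 have e2: "\<forall>\<^sub>F h in at_right 0. 0 < 1 - (h::real)" by (rule eventually_pos[where l = "1 - 0"], (intro ti)) auto
 have e3: "\<forall>\<^sub>F h in at_right 0. 0 < hk ^ (r - 1) - 8 * h"
  by (rule eventually_pos[where l = "hk ^ (r - 1) - 8 * 0"], (intro ti)) (use bk in auto)
 have e4: "\<forall>\<^sub>F h in at_right 0. 0 < (ik - h) - hk"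
  by (rule eventually_pos[where l = "(ik - 0) - hk"], (intro ti)) (use k0 in "auto simp: field_simps")
 have e5: "\<forall>\<^sub>F h in at_right 0. 0 < \<zeta> ^ (r - 2) * (ik - h - gp h) - fact (r - 2) * real r * (4 * h)"
  by (rule eventually_pos[where l = "\<zeta> ^ (r - 2) * (ik - 0 - real r * (4 * 0) / gam) - fact (r - 2) * real r * (4 * 0)"], (intro ti))
   (use k0 z gam_pos in auto)
 have e6: "\<forall>\<^sub>F h in at_right 0. 0 < (ik - h) - gp h"
  by (rule eventually_pos[where l = "(ik - 0) - real r * (4 * 0) / gam"], (intro ti)) (use k0 gam_pos in auto)
 have e7: "\<forall>\<^sub>F h in at_right 0. 0 < (real r - 1/2) * (ik - h - gp h - 2 ^ (r - 1) * real r * \<zeta>)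
   - (ik + h + gp h) * (real r - 1)"
 proof (rule eventually_pos)
  show "((\<lambda>h. (real r - 1/2) * (ik - h - gp h - 2 ^ (r - 1) * real r * \<zeta>)
   - (ik + h + gp h) * (real r - 1)) \<longlongrightarrow>
   (real r - 1/2) * (ik - 0 - real r * (4 * 0) / gam - 2 ^ (r - 1) * real r * \<zeta>)
   - (ik + 0 + real r * (4 * 0) / gam) * (real r - 1)) (at_right 0)" using gam_pos by (intro ti) auto
  have q: "2 ^ (r - 1) * real r * \<zeta> = ik * (1 / (4 * real r))" using r0 by (simp add: \<zeta>_def)
  have "(real r - 1/2) * (ik - 2 ^ (r - 1) * real r * \<zeta>) = ik * ((real r - 1/2) * (1 - 1 / (4 * real r)))"
   unfolding q using k0 r0 by (simp add: field_simps)
  also have "(real r - 1/2) * (1 - 1 / (4 * real r)) = (real r - 1) + (1/4 + 1 / (8 * real r))"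
   using r0 by (simp add: field_simps)
  finally have "(real r - 1/2) * (ik - 2 ^ (r - 1) * real r * \<zeta>) = ik * ((real r - 1) + (1/4 + 1 / (8 * real r)))" .
  moreover have "ik * (real r - 1) < ik * ((real r - 1) + (1/4 + 1 / (8 * real r)))"
  proof (rule mult_strict_left_mono)
   have "0 < 1 / (8 * real r)" using r0 by simp
   then show "real r - 1 < (real r - 1) + (1/4 + 1 / (8 * real r))" by linarith
  qed (use k0 in simp)
  ultimately show "0 < (real r - 1/2) * (ik - 0 - real r * (4 * 0) / gam - 2 ^ (r - 1) * real r * \<zeta>)
   - (ik + 0 + real r * (4 * 0) / gam) * (real r - 1)" by simp
 qed
 have e8: "\<forall>\<^sub>F h in at_right 0. 0 < b2 / 4 - 2 ^ k * rcard Bk * (h * real k)"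
  by (rule eventually_pos[where l = "b2 / 4 - 2 ^ k * rcard Bk * (0 * real k)"], (intro ti))
   (use bn_pos[of 2] r3 in auto)
 have e9: "\<forall>\<^sub>F h in at_right 0. 0 < 1 - h * real k"
  by (rule eventually_pos[where l = "1 - 0 * real k"], (intro ti)) auto
 have e10: "\<forall>\<^sub>F h in at_right 0. 0 < (kap - h) - ovl * ik ^ (r - 2) * ik"
  by (rule eventually_pos[where l = "(kap - 0) - ovl * ik ^ (r - 2) * ik"], (intro ti)) (use kap_gap in simp)
 have e11: "\<forall>\<^sub>F h in at_right 0. 0 < kap - h"
  by (rule eventually_pos[where l = "kap - 0"], (intro ti)) (use kap_pos in auto)
 have e0: "\<forall>\<^sub>F h in at_right (0::real). 0 < h" by (rule eventually_at_right_less)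
 from eventually_happens'[OF nb eventually_conj[OF e0 eventually_conj[OF e1 eventually_conj[OF e2 eventually_conj[OF e3 eventually_conj[OF e4 eventually_conj[OF e5 eventually_conj[OF e6 eventually_conj[OF e7 eventually_conj[OF e8 eventually_conj[OF e9 eventually_conj[OF e10 e11]]]]]]]]]]]] show ?thesis
 proof (elim exE conjE, goal_cases)
  case (1 h)
  show ?case by (rule that[of h \<zeta>]) (insert 1 z, simp_all only: diff_gt_0_iff_gt less_imp_le)
 qed
qed

text \<open>The finer scale, chosen after \<open>h\<close>: \<open>g\<close> measures the given
  partition, \<open>h\<close> the corrected one. Again all conditions other than
  \<open>0 < g\<close> are strict at \<open>g = 0\<close>.\<close>

lemma params_g:
 assumes h: "0 < h" "ovl * ik ^ (r - 2) * ik < kap - h" "h < kap"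
 obtains g :: real where "0 < g" "g \<le> 1" "hk \<le> ik - 2 * g" "2 * g < hk ^ (r - 1)"
  "real k * (2 * g) + real r * g \<le> kap - h"
  "ovl * (ik + g) ^ (r - 2) * (ik + g + real r * g / gam) + real r * g \<le> kap - h"
  "real (bn 1) * (ik + g) ^ (r - 1) + real k * (2 * g) + real r * g \<le> kap + h"
  "2 * h + (1 + real r) * g \<le> 4 * h * (1 - real r * g) ^ (r - 1)"
  "g ^ 2 + real r * g + g \<le> h" "ik + g ^ 2 + real r * g \<le> (ik + h) * (1 - real r * g)"
  "lam0 * real r ^ 2 * (real r * g) \<le> h / 2" "real r * g \<le> 1/2"
proof -
 have bk: "0 < hk" using k0 by simp
 note ti = tendsto_intros
 have nb: "at_right (0::real) \<noteq> bot" by simp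
 have e1: "\<forall>\<^sub>F g in at_right 0. 0 < 1 - (g::real)" by (rule eventually_pos[where l = "1 - 0"], (intro ti)) auto
 have e2: "\<forall>\<^sub>F g in at_right 0. 0 < (ik - 2 * g) - hk"
  by (rule eventually_pos[where l = "(ik - 2 * 0) - hk"], (intro ti)) (use k0 in "auto simp: field_simps")
 have e3: "\<forall>\<^sub>F g in at_right 0. 0 < hk ^ (r - 1) - 2 * g"
  by (rule eventually_pos[where l = "hk ^ (r - 1) - 2 * 0"], (intro ti)) (use bk in auto)
 have e4: "\<forall>\<^sub>F g in at_right 0. 0 < (kap - h) - (real k * (2 * g) + real r * g)"
  by (rule eventually_pos[where l = "(kap - h) - (real k * (2 * 0) + real r * 0)"], (intro ti)) (use h in auto)
 have e5: "\<forall>\<^sub>F g in at_right 0. 0 < (kap - h) - (ovl * (ik + g) ^ (r - 2) * (ik + g + real r * g / gam) + real r * g)"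
  by (rule eventually_pos[where l = "(kap - h) - (ovl * (ik + 0) ^ (r - 2) * (ik + 0 + real r * 0 / gam) + real r * 0)"], (intro ti))
   (use h gam_pos in auto)
 have e6: "\<forall>\<^sub>F g in at_right 0. 0 < (kap + h) - (real (bn 1) * (ik + g) ^ (r - 1) + real k * (2 * g) + real r * g)"
  by (rule eventually_pos[where l = "(kap + h) - (real (bn 1) * (ik + 0) ^ (r - 1) + real k * (2 * 0) + real r * 0)"], (intro ti))
   (use h in "auto simp: kap_eq power_divide")
 have e7: "\<forall>\<^sub>F g in at_right 0. 0 < 4 * h * (1 - real r * g) ^ (r - 1) - (2 * h + (1 + real r) * g)"
  by (rule eventually_pos[where l = "4 * h * (1 - real r * 0) ^ (r - 1) - (2 * h + (1 + real r) * 0)"], (intro ti)) (use h in auto)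
 have e8: "\<forall>\<^sub>F g in at_right 0. 0 < h - (g ^ 2 + real r * g + g)"
  by (rule eventually_pos[where l = "h - (0 ^ 2 + real r * 0 + 0)"], (intro ti)) (use h in auto)
 have e9: "\<forall>\<^sub>F g in at_right 0. 0 < (ik + h) * (1 - real r * g) - (ik + g ^ 2 + real r * g)"
  by (rule eventually_pos[where l = "(ik + h) * (1 - real r * 0) - (ik + 0 ^ 2 + real r * 0)"], (intro ti)) (use h in auto)
 have e10: "\<forall>\<^sub>F g in at_right 0. 0 < h / 2 - lam0 * real r ^ 2 * (real r * g)"
  by (rule eventually_pos[where l = "h / 2 - lam0 * real r ^ 2 * (real r * 0)"], (intro ti)) (use h in auto)
 have e11: "\<forall>\<^sub>F g in at_right 0. 0 < 1/2 - real r * g"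
  by (rule eventually_pos[where l = "1/2 - real r * 0"], (intro ti)) auto
 have e0: "\<forall>\<^sub>F g in at_right (0::real). 0 < g" by (rule eventually_at_right_less)
 from eventually_happens'[OF nb eventually_conj[OF e0 eventually_conj[OF e1 eventually_conj[OF e2 eventually_conj[OF e3 eventually_conj[OF e4 eventually_conj[OF e5 eventually_conj[OF e6 eventually_conj[OF e7 eventually_conj[OF e8 eventually_conj[OF e9 eventually_conj[OF e10 e11]]]]]]]]]]]] show ?thesis
 proof (elim exE conjE, goal_cases)
  case (1 h)
  show ?case by (rule that[of h]) (insert 1, simp_all only: diff_gt_0_iff_gt less_imp_le)
 qed
qed

end

section \<open>From an approximate partition to a precise edge bound\<close>

lemma card_diff_le:
 assumes "finite A" "finite B" "finite D" "A \<subseteq> B \<union> D" "B \<subseteq> A \<union> D"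
 shows "\<bar>rcard A - rcard B\<bar> \<le> rcard D"
proof -
 have "card A \<le> card (B \<union> D)" "card B \<le> card (A \<union> D)" using assms by (auto intro: card_mono)
 then have "card A \<le> card B + card D" "card B \<le> card A + card D"
  using card_Un_le[of B D] card_Un_le[of A D] by linarith+
 then show ?thesis by linarith
qed

definition rgr :: "nat => 'v set => 'v set set => bool" where
 "rgr r V E \<longleftrightarrow> finite V \<and> (\<forall>X\<in>E. X \<subseteq> V \<and> card X = r)"

lemma rgr_finite: "rgr r V E ==> finite E" by (rule finite_subset[of _ "Pow V"]) (auto simp: rgr_def)

context steiner
begin

definition near :: "real => 'v set => 'v set set => ('v => 'i) => bool" where
 "near e V E f \<longleftrightarrow> f ` V \<subseteq> I \<and>
   (\<forall>i\<in>I. \<bar>rcard {v \<in> V. f v = i} - rcard V / real k\<bar> \<le> e * rcard V) \<and>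
   rcard (Bl f V - E) \<le> e * rcard V ^ r"

abbreviation spread :: "real => 'v set => ('v => 'i) => bool" where
 "spread c0 V f \<equiv> \<forall>i\<in>I. \<bar>rcard {v \<in> V. f v = i} - rcard V / real k\<bar> \<le> c0 * rcard V"

text \<open>Three separate penalties below the density of a balanced blow-up: exceptional vertices,
  missing edges off these, and unequal parts.\<close>

abbreviation deficit :: "real => 'v set => 'v set set => ('v => 'i) => 'v set => bool" where
 "deficit c V E f Z \<equiv> rcard E \<le> lam0 * rcard V ^ r - c * rcard Z * rcard V ^ (r - 1)
  - c * rcard (Bl f (V - Z) - E)
  - c * rcard V ^ (r - 2) * (\<Sum>i\<in>I. (rcard {v \<in> V - Z. f v = i} - (rcard V - rcard Z) / real k) ^ 2)"

abbreviation structured :: "real => real => 'v set => 'v set set => bool" where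
 "structured c c0 V E \<equiv> (\<exists>f Z. f ` V \<subseteq> I \<and> Z \<subseteq> V \<and> deficit c V E f Z \<and>
   (Z = {} --> rcard E \<le> rcard (Bl f V) - c * rcard (Bl f V - E)) \<and>
   (Z = {} --> Bl f V \<subseteq> E --> E = Bl f V) \<and> spread c0 V f)
  \<and> (\<forall>v. real (deg E v) \<le> (kap + c0) * rcard V ^ (r - 1))"

text \<open>Two rounds of \<open>config\<close>. In the first, \<open>vertex_dichotomy\<close> finds
  for every atypical vertex a fitting part or a low degree. The second runs without the low-degree
  vertices \<open>Z\<close> and with the others moved to their parts; now all vertices are typical
  and \<open>bad_missing\<close> applies. Concavity of \<open>Np\<close> and the degree deficit of
  \<open>Z\<close> supply the remaining penalties.\<close>

lemma master:
 assumes c0: "0 < c0"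
 shows "\<exists>c>0. \<exists>e>0. \<exists>N0. \<forall>(V :: 'v set) E f0. rgr r V E --> tfree E --> N0 \<le> card V --> near e V E f0 -->
  structured c c0 V E"
proof -
 obtain h \<zeta> where h: "0 < h" "h \<le> c0" "h \<le> 1" "0 < \<zeta>"
  "8 * h < hk ^ (r - 1)" "hk \<le> ik - h"
  "fact (r - 2) * real r * (4 * h) < \<zeta> ^ (r - 2) * (ik - h - gp h)"
  "gp h \<le> ik - h"
  "(ik + h + gp h) * (real r - 1)
    \<le> (real r - 1/2) * (ik - h - gp h - 2 ^ (r - 1) * real r * \<zeta>)"
  "2 ^ k * rcard Bk * (h * real k) \<le> b2 / 4" "h * real k \<le> 1"
  and h': "ovl * ik ^ (r - 2) * ik < kap - h" "h < kap" by (rule params_h[OF c0])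
 obtain g where g: "0 < g" "g \<le> 1" "hk \<le> ik - 2 * g" "2 * g < hk ^ (r - 1)"
  "real k * (2 * g) + real r * g \<le> kap - h"
  "ovl * (ik + g) ^ (r - 2) * (ik + g + real r * g / gam) + real r * g \<le> kap - h"
  "real (bn 1) * (ik + g) ^ (r - 1) + real k * (2 * g) + real r * g \<le> kap + h"
  "2 * h + (1 + real r) * g \<le> 4 * h * (1 - real r * g) ^ (r - 1)"
  "g ^ 2 + real r * g + g \<le> h" "ik + g ^ 2 + real r * g \<le> (ik + h) * (1 - real r * g)"
  "lam0 * real r ^ 2 * (real r * g) \<le> h / 2" "real r * g \<le> 1/2" by (rule params_g[OF h(1) h'])
 \<comment> \<open>The smallest of three rates: half of the degree deficit \<open>h\<close>, the
   saving of \<open>bad_missing\<close>, and the concavity constant for at least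
   \<open>n / 2\<close> remaining vertices.\<close>
 define c where "c = min (h / 2) (min (1 / (2 * real r)) (b2 / 4 * hk ^ (r - 2)))"
 have c: "c \<le> h / 2" "c \<le> 1 / (2 * real r)" "c \<le> b2 / 4 * hk ^ (r - 2)" by (auto simp: c_def)
 have "0 < b2" using bn_pos[of 2] r3 by simp
 then have c': "0 < c" using h(1) r3 k0 by (simp add: c_def)
 define N0 where "N0 = max 1 (max (nat \<lceil>real r / g\<rceil>) (nat \<lceil>2 * real r / gam\<rceil>))"
 have N: "0 < m \<and> real r \<le> g * real m \<and> 2 * real r \<le> gam * real m" if "N0 \<le> m" for m
 proof -
  have "1 \<le> m" "nat \<lceil>real r / g\<rceil> \<le> m" "nat \<lceil>2 * real r / gam\<rceil> \<le> m" using that by (auto simp: N0_def)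
  then have "0 < m" "real r / g \<le> real m" "2 * real r / gam \<le> real m" by linarith+
  then show ?thesis using g(1) gam_pos by (simp add: field_simps)
 qed
 have g2: "0 < g ^ 2" using g by simp
 note c = c c'
 have main: "structured c c0 V E" if G: "rgr r V E" "tfree E" and nr: "near (g ^ 2) V E f0"
  and n: "0 < card V" "real r \<le> g * rcard V" "2 * real r \<le> gam * rcard V" for V :: "'v set" and E f0
 proof -
  define n where "n = card V"
  have finV: "finite V" and edge: "\<And>X. X \<in> E ==> X \<subseteq> V \<and> card X = r" using G by (auto simp: rgr_def)
  have f0: "f0 ` V \<subseteq> I" and sz0: "\<And>i. i \<in> I ==> \<bar>rcard {v \<in> V. f0 v = i} - real n / real k\<bar> \<le> g ^ 2 * real n"
   and mis0: "rcard (Bl f0 V - E) \<le> g ^ 2 * real n ^ r" using nr by (auto simp: near_def n_def)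
  have n0: "0 < n" "real r \<le> g * real n" "2 * real r \<le> gam * real n" using n by (auto simp: n_def)
  have gg: "g ^ 2 \<le> g" using g(1,2) by (simp add: power2_eq_square mult_left_le)
  have r1: "r - 1 = Suc (r - 2)" "r = Suc (r - 1)" using r3 by simp_all
  have ggn: "g ^ 2 * real n \<le> g * real n" using gg by (intro mult_right_mono) auto
  have gam2: "hk ^ (r - 2) = 2 * gam" by (simp add: gam_def)
  interpret C1: config r k I Bk V E f0 n "ik - 2 * g" "ik + g" g gam "real r * g / gam"
  proof unfold_locales
   show "(ik - 2 * g) * real n + real r \<le> rcard {v \<in> V. f0 v = i}" if "i \<in> I" for i
    using sz0[OF that] ggn n0(2) by (simp add: algebra_simps abs_le_iff)
   show "rcard {v \<in> V. f0 v = i} \<le> (ik + g) * real n" if "i \<in> I" for i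
    using sz0[OF that] ggn by (simp add: algebra_simps abs_le_iff)
   show "0 < ik - 2 * g" using g(3) k0 by (meson divide_pos_pos less_le_trans mult_pos_pos zero_less_numeral zero_less_one)
   have "hk ^ (r - 1) \<le> (ik - 2 * g) ^ (r - 1)" using g(3) by (intro power_mono) auto
   then show "2 * g < (ik - 2 * g) ^ (r - 1)" using g(4) by linarith
   have "2 * gam \<le> (ik - 2 * g) ^ (r - 2)" unfolding gam2[symmetric] using g(3) by (intro power_mono) auto
   then have "2 * gam * real n \<le> (ik - 2 * g) ^ (r - 2) * real n" by (intro mult_right_mono) auto
   moreover have "real (r - 1) \<le> gam * real n" using n0(3) r3 by simp
   ultimately show "gam * real n + real (r - 1) \<le> (ik - 2 * g) ^ (r - 2) * real n" by linarith
  qed (use finV n0 edge G f0 g gam_pos in "auto simp: n_def")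
  define U where "U = C1.U"
  have UV: "U \<subseteq> V" using C1.UV by (simp add: U_def)
  \<comment> \<open>Each atypical vertex lies in more than \<open>g * n^(r-1)\<close> of the missing
    edges, and there are at most \<open>g^2 * n^r\<close> of these; hence the choice of
    \<open>g ^ 2\<close> as closeness.\<close>
  have atyp: "rcard (V - U) \<le> real r * g * real n"
  proof -
   have fM: "finite (Bl f0 V - E)" using Bl_fin[OF finV] by simp
   have "(\<Sum>v\<in>V. card {X \<in> Bl f0 V - E. v \<in> X}) = (\<Sum>X\<in>Bl f0 V - E. card {v \<in> V. v \<in> X})"
    by (rule double_count[OF finV fM])
   also have "... = (\<Sum>X\<in>Bl f0 V - E. r)"
   proof (rule sum.cong[OF refl])
    fix X assume "X \<in> Bl f0 V - E"
    then have "{v \<in> V. v \<in> X} = X" "card X = r" by (auto simp: Bl_def)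
    then show "card {v \<in> V. v \<in> X} = r" by simp
   qed
   finally have 1: "(\<Sum>v\<in>V. rcard (C1.mis v)) = rcard (Bl f0 V - E) * real r"
    by (simp add: C1.mis_def flip: of_nat_sum of_nat_mult)
   have "rcard (V - U) * (g * real n ^ (r - 1)) \<le> (\<Sum>v\<in>V - U. rcard (C1.mis v))"
    by (intro sum_bounded_below) (auto simp: U_def C1.U_def)
   also have "... \<le> (\<Sum>v\<in>V. rcard (C1.mis v))" using finV by (intro sum_mono2) auto
   also have "... \<le> g ^ 2 * real n ^ r * real r" unfolding 1 using mis0 by (intro mult_right_mono) auto
   also have "... = (real r * g * real n) * (g * real n ^ (r - 1))" by (subst (1) r1(2)) (simp add: power2_eq_square mult_ac)
   finally show ?thesis using g(1) n0 by (subst (asm) mult_le_cancel_right) auto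
  qed
  have dich: "real (deg E v) \<le> (kap + h) * real n ^ (r - 1) \<and>
   (real (deg E v) \<le> (kap - h) * real n ^ (r - 1) \<or>
    (\<exists>i\<in>I. rcard {A \<in> C1.FA i. v \<notin> A \<and> insert v A \<notin> E} \<le> 2 * h * real n ^ (r - 1)))" for v
   using C1.vertex_dichotomy[of "real r * g" h v] n0 atyp g h by (simp add: U_def)
  define good where "good v i \<longleftrightarrow> i \<in> I \<and> rcard {A \<in> C1.FA i. v \<notin> A \<and> insert v A \<notin> E} \<le> 2 * h * real n ^ (r - 1)" for v i
  \<comment> \<open>Typical vertices keep their part; an atypical vertex moves to a part it fits, if
    there is one.\<close>
  define f where "f v = (if v \<in> U then f0 v else if \<exists>i. good v i then SOME i. good v i else f0 v)" for v
  define Z where "Z = {v \<in> V - U. \<not> (\<exists>i. good v i)}"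
  have fg: "good v (f v)" if "v \<notin> U" "\<exists>i. good v i" for v
   using that someI_ex[of "good v"] by (simp add: f_def)
  have fU: "f v = f0 v" if "v \<in> U" for v using that by (simp add: f_def)
  have fI: "f ` V \<subseteq> I"
  proof (rule image_subsetI)
   fix v assume v: "v \<in> V"
   show "f v \<in> I"
   proof (cases "v \<notin> U \<and> (\<exists>i. good v i)")
    case True
    then show ?thesis using fg[of v] by (auto simp: good_def)
   qed (use v f0 in "auto simp: f_def")
  qed
  have ZV: "Z \<subseteq> V - U" by (auto simp: Z_def)
  have finZ: "finite Z" "finite (V - U)" using ZV finV finite_subset by auto
  have zdeg: "real (deg E v) \<le> (kap - h) * real n ^ (r - 1)" if "v \<in> Z" for v
   using that dich[of v] by (auto simp: Z_def good_def)
  have cZ: "card Z \<le> card (V - U)" using ZV finZ by (intro card_mono) auto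
  then have zrg: "rcard Z \<le> real r * g * real n" using atyp by linarith
  define V2 where "V2 = V - Z"
  define n2 where "n2 = card V2"
  have finV2: "finite V2" using finV by (simp add: V2_def)
  have n2: "real n2 = real n - rcard Z"
  proof -
   have zv: "Z \<subseteq> V" using ZV by auto
   then have "card Z \<le> card V" using finV by (intro card_mono)
   then show ?thesis using card_Diff_subset[OF finZ(1) zv] by (simp add: n2_def V2_def n_def of_nat_diff)
  qed
  have n2g: "(1 - real r * g) * real n \<le> real n2" using zrg n2 by (simp add: algebra_simps)
  have n2half: "real n / 2 \<le> real n2"
  proof -
   have "(1 / 2) * real n \<le> (1 - real r * g) * real n" using g(12) by (intro mult_right_mono) auto
   then show ?thesis using n2g by simp
  qed
  have n2n: "real n2 \<le> real n" using n2 by simp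
  have n20: "0 < n2" using n2half n0 by simp
  have close: "\<bar>rcard {v \<in> D. f v = i} - real n / real k\<bar> \<le> (g ^ 2 + real r * g) * real n"
   if "i \<in> I" "D = V \<or> D = V2" for i D
  proof -
   have "\<bar>rcard {v \<in> D. f v = i} - rcard {v \<in> V. f0 v = i}\<bar> \<le> rcard (V - U)"
    using that(2) finV finV2 ZV by (intro card_diff_le) (auto simp: V2_def fU)
   then show ?thesis using sz0[OF that(1)] atyp by (simp add: distrib_right abs_le_iff)
  qed
  define E2 where "E2 = {X \<in> E. X \<subseteq> V2}"
  have bk: "0 < hk" using k0 by simp
  have lowk: "(ik - h) * real n2 \<le> (ik - h) * real n" using n2n h(6) bk by (intro mult_left_mono) linarith+
  have upk: "(ik + g ^ 2 + real r * g) * real n \<le> (ik + h) * real n2"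
  proof -
   have "(ik + g ^ 2 + real r * g) * real n \<le> ((ik + h) * (1 - real r * g)) * real n"
    using g(10) by (intro mult_right_mono) auto
   also have "... = (ik + h) * ((1 - real r * g) * real n)" by simp
   also have "... \<le> (ik + h) * real n2" using n2g h(1) by (intro mult_left_mono) auto
   finally show ?thesis .
  qed
  have lowh: "(g ^ 2 + real r * g + g) * real n \<le> h * real n" using g(9) by (intro mult_right_mono) auto
  interpret C2: config r k I Bk V2 E2 f n2 "ik - h" "ik + h" "4 * h" gam "gp h"
  proof unfold_locales
   show "(ik - h) * real n2 + real r \<le> rcard {v \<in> V2. f v = i}" if "i \<in> I" for i
    using close[OF that, of V2] lowk lowh n0(2) by (simp add: algebra_simps abs_le_iff)
   show "rcard {v \<in> V2. f v = i} \<le> (ik + h) * real n2" if "i \<in> I" for i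
    using close[OF that, of V2] upk by (simp add: algebra_simps abs_le_iff)
   show "0 < ik - h" using h(6) bk by linarith
   have "hk ^ (r - 1) \<le> (ik - h) ^ (r - 1)" using h(6) by (intro power_mono) auto
   then show "2 * (4 * h) < (ik - h) ^ (r - 1)" using h(5) by linarith
   have "2 * gam \<le> (ik - h) ^ (r - 2)" unfolding gam2[symmetric] using h(6) by (intro power_mono) auto
   then have "2 * gam * real n2 \<le> (ik - h) ^ (r - 2) * real n2" by (intro mult_right_mono) auto
   moreover have "real (r - 1) \<le> gam * real n2"
   proof -
    have "gam * (real n / 2) \<le> gam * real n2" using n2half gam_pos by (intro mult_left_mono) auto
    then show ?thesis using n0(3) r3 by simp
   qed
   ultimately show "gam * real n2 + real (r - 1) \<le> (ik - h) ^ (r - 2) * real n2" by linarith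
   show "tfree E2" using G(2) tfree_mono[of E E2] by (simp add: E2_def)
   show "f ` V2 \<subseteq> I" using fI by (auto simp: V2_def)
  qed (use finV2 n20 edge h gam_pos in "auto simp: n2_def E2_def")
  \<comment> \<open>Missing edges at \<open>v\<close> through another atypical vertex are few by
    \<open>atyp\<close>. Those whose other vertices all lie in \<open>U\<close> are few by
    typicality for \<open>f0\<close>, or by the choice of the new part of \<open>v\<close>.\<close>
  have typical: "rcard (C2.mis v) \<le> 4 * h * real n2 ^ (r - 1)" if v: "v \<in> V2" for v
  proof -
   define F where "F = {X \<in> C2.mis v. X - {v} \<subseteq> U}"
   let ?W = "\<lambda>w. sups r V {v, w}"
   have vV: "v \<in> V" using v by (simp add: V2_def)
   have fW: "finite (?W w)" for w by (rule finite_subset[of _ "Pow V"]) (use finV in auto)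
   have fF: "finite F" using C2.fin_mis by (simp add: F_def)
   have mX: "X \<subseteq> V2 \<and> card X = r \<and> f ` X \<in> Bk \<and> X \<notin> E \<and> v \<in> X \<and> X \<subseteq> V" if "X \<in> C2.mis v" for X
   proof -
    have "X \<in> Bl f V2 - E2" "v \<in> X" using that unfolding C2.mis_def by auto
    then show ?thesis by (auto simp: Bl_def E2_def V2_def)
   qed
   have "C2.mis v \<subseteq> F \<union> (\<Union>w\<in>V - U - {v}. ?W w)"
   proof
    fix X assume X: "X \<in> C2.mis v"
    show "X \<in> F \<union> (\<Union>w\<in>V - U - {v}. ?W w)"
    proof (cases "X - {v} \<subseteq> U")
     case False
     then obtain w where "w \<in> X" "w \<noteq> v" "w \<notin> U" by auto
     then have "w \<in> V - U - {v}" "X \<in> ?W w" using mX[OF X] by auto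
     then show ?thesis by blast
    qed (use X in "simp add: F_def")
   qed
   then have "card (C2.mis v) \<le> card (F \<union> (\<Union>w\<in>V - U - {v}. ?W w))"
    using fW fF finZ by (intro card_mono) auto
   also have "... \<le> card F + card (\<Union>w\<in>V - U - {v}. ?W w)" by (rule card_Un_le)
   also have "... \<le> card F + (\<Sum>w\<in>V - U - {v}. card (?W w))" using finZ by (intro add_left_mono card_UN_le) auto
   also have "... \<le> card F + (\<Sum>w\<in>V - U - {v}. n ^ (r - 2))"
   proof (intro add_left_mono sum_mono)
    fix w assume "w \<in> V - U - {v}"
    then have "card {v, w} = 2" by auto
    then show "card (?W w) \<le> n ^ (r - 2)" using card_supersets_le[OF finV, of "{v, w}" r] by (simp add: n_def)
   qed
   also have "... \<le> card F + card (V - U) * n ^ (r - 2)" using finZ by (auto intro!: mult_right_mono card_mono)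
   finally have "rcard (C2.mis v) \<le> real (card F + card (V - U) * n ^ (r - 2))" by (simp only: of_nat_le_iff)
   then have "rcard (C2.mis v) \<le> rcard F + rcard (V - U) * real n ^ (r - 2)" by simp
   also have "... \<le> rcard F + (real r * g * real n) * real n ^ (r - 2)"
    using atyp by (intro add_left_mono mult_right_mono) auto
   also have "(real r * g * real n) * real n ^ (r - 2) = real r * g * real n ^ (r - 1)" unfolding r1(1) by simp
   also have "rcard F \<le> (2 * h + g) * real n ^ (r - 1)"
   proof (cases "v \<in> U")
    case True
    have "F \<subseteq> C1.mis v"
    proof
     fix X assume "X \<in> F"
     then have X: "X \<in> C2.mis v" "X \<subseteq> U" using True by (auto simp: F_def)
     then have "f ` X = f0 ` X" using fU by (intro image_cong) auto
     then show "X \<in> C1.mis v" using mX[OF X(1)] by (simp add: C1.mis_def Bl_def)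
    qed
    then have "card F \<le> card (C1.mis v)" by (intro card_mono C1.fin_mis)
    also have "rcard (C1.mis v) \<le> g * real n ^ (r - 1)" using True by (simp add: U_def C1.U_def)
    finally have "rcard F \<le> g * real n ^ (r - 1)" by simp
    also have "... \<le> (2 * h + g) * real n ^ (r - 1)" using h(1) by (intro mult_right_mono) auto
    finally show ?thesis .
   next
    case False
    then have gd: "good v (f v)" using v fg[of v] by (auto simp: V2_def Z_def)
    define i where "i = f v"
    have fFA: "finite {A \<in> C1.FA i. v \<notin> A \<and> insert v A \<notin> E}"
     by (rule finite_subset[of _ "Pow V"]) (use finV in "auto simp: C1.FA_def")
    have "card F \<le> card {A \<in> C1.FA i. v \<notin> A \<and> insert v A \<notin> E}"
    proof (rule card_inj_on_le[where f = "\<lambda>X. X - {v}"])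
     show "inj_on (\<lambda>X. X - {v}) F"
     proof (rule inj_onI)
      fix X Y assume "X \<in> F" "Y \<in> F" "X - {v} = Y - {v}"
      moreover from this have "v \<in> X" "v \<in> Y" using mX by (auto simp: F_def)
      ultimately show "X = Y" by (metis insert_Diff)
     qed
     show "(\<lambda>X. X - {v}) ` F \<subseteq> {A \<in> C1.FA i. v \<notin> A \<and> insert v A \<notin> E}"
     proof (rule image_subsetI)
      fix X assume "X \<in> F"
      then have X: "X \<in> C2.mis v" "X - {v} \<subseteq> U" by (auto simp: F_def)
      note m = mX[OF X(1)]
      have fX: "finite X" using m finV finite_subset by blast
      have e: "f ` (X - {v}) = f0 ` (X - {v})" using fU X(2) by (intro image_cong) auto
      have "insert v (X - {v}) = X" using m by auto
      then have iX: "insert i (f0 ` (X - {v})) = f ` X" unfolding e[symmetric] i_def by (metis image_insert)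
      have cA: "card (X - {v}) = r - 1" using m fX by (simp add: card_Diff_singleton)
      have "i \<notin> f0 ` (X - {v})"
      proof
       assume "i \<in> f0 ` (X - {v})"
       then have "f ` X = f0 ` (X - {v})" using iX by (metis insert_absorb)
       then have "card (f ` X) \<le> r - 1" using card_image_le[of "X - {v}" f0] cA fX by simp
       moreover have "card (f ` X) = r" using m blk by blast
       ultimately show False using r3 by simp
      qed
      then have "X - {v} \<in> C1.FA i" using m cA iX by (auto simp: C1.FA_def)
      then show "X - {v} \<in> {A \<in> C1.FA i. v \<notin> A \<and> insert v A \<notin> E}"
       using m \<open>insert v (X - {v}) = X\<close> by simp
     qed
    qed (rule fFA)
    then have "rcard F \<le> 2 * h * real n ^ (r - 1)" using gd unfolding good_def i_def by linarith
    also have "... \<le> (2 * h + g) * real n ^ (r - 1)" using g(1) by (intro mult_right_mono) auto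
    finally show ?thesis .
   qed
   finally have "rcard (C2.mis v) \<le> (2 * h + (1 + real r) * g) * real n ^ (r - 1)" by (simp add: algebra_simps)
   also have "... \<le> (4 * h * (1 - real r * g) ^ (r - 1)) * real n ^ (r - 1)" using g(8) by (intro mult_right_mono) auto
   also have "... = 4 * h * ((1 - real r * g) * real n) ^ (r - 1)" by (simp add: power_mult_distrib)
   also have "... \<le> 4 * h * real n2 ^ (r - 1)" using n2g h(1) g(12) by (intro mult_left_mono power_mono) auto
   finally show ?thesis .
  qed
  have allU: "C2.U = V2" using typical by (auto simp: C2.U_def)
  define M where "M = Bl f V2 - E"
  have MM: "C2.Mis = M" unfolding C2.Mis_def M_def by (auto simp: E2_def Bl_def)
  have "rcard C2.Bad \<le> (1 - 1 / (2 * real r)) * rcard C2.Mis" by (rule C2.bad_missing[OF allU h(4,7,8,9)])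
  then have bad: "rcard C2.Bad \<le> (1 - 1 / (2 * real r)) * rcard M" unfolding MM .
  have "rcard E2 \<le> rcard (Bl f V2) - 1 / (2 * real r) * rcard M"
   using bad C2.card_E_split unfolding MM by (simp add: algebra_simps)
  moreover have "c * rcard M \<le> 1 / (2 * real r) * rcard M" using c by (intro mult_right_mono) auto
  ultimately have e2: "rcard E2 \<le> rcard (Bl f V2) - c * rcard M" by linarith
  define D where "D = (\<Sum>i\<in>I. (rcard {v \<in> V2. f v = i} - real n2 / real k) ^ 2)"
  have D0: "0 \<le> D" unfolding D_def by (intro sum_nonneg) auto
  have "rcard (Bl f V2) \<le> lam0 * real n2 ^ r - b2 / 4 * (real n2 / real k) ^ (r - 2) * D"
   unfolding card_Bl_Np[OF finV2] D_def
  proof (rule Np_concave[where e = "h * real k"])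
   show "(\<Sum>j\<in>I. rcard {a \<in> V2. f a = j}) = real n2"
   proof -
    have "V2 = (\<Union>j\<in>I. {a \<in> V2. f a = j})" using fI by (auto simp: V2_def)
    then have "n2 = card (\<Union>j\<in>I. {a \<in> V2. f a = j})" by (simp add: n2_def)
    also have "... = (\<Sum>j\<in>I. card {a \<in> V2. f a = j})" using finI finV2 by (intro card_UN_disjoint) auto
    finally show ?thesis by simp
   qed
   show "\<bar>rcard {a \<in> V2. f a = j} - real n2 / real k\<bar> \<le> h * real k * (real n2 / real k)" if "j \<in> I" for j
    using C2.low[OF that] C2.up[OF that] k0 by (simp add: algebra_simps abs_le_iff)
  qed (use n20 h in auto)
  also have "... \<le> lam0 * real n2 ^ r - c * real n ^ (r - 2) * D"
  proof -
   have "c * real n ^ (r - 2) \<le> b2 / 4 * hk ^ (r - 2) * real n ^ (r - 2)"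
    using c by (intro mult_right_mono) auto
   also have "... = b2 / 4 * (real n / 2 / real k) ^ (r - 2)" by (simp add: power_divide power_mult_distrib)
   also have "... \<le> b2 / 4 * (real n2 / real k) ^ (r - 2)"
    using n2half by (intro mult_left_mono power_mono divide_right_mono) auto
   finally have "c * real n ^ (r - 2) * D \<le> b2 / 4 * (real n2 / real k) ^ (r - 2) * D"
    using D0 by (intro mult_right_mono)
   then show ?thesis by linarith
  qed
  finally have blup: "rcard (Bl f V2) \<le> lam0 * real n2 ^ r - c * real n ^ (r - 2) * D" .
  have "E \<subseteq> E2 \<union> (\<Union>v\<in>Z. {X \<in> E. v \<in> X})" using edge by (auto simp: E2_def V2_def)
  then have "card E \<le> card (E2 \<union> (\<Union>v\<in>Z. {X \<in> E. v \<in> X}))"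
   using rgr_finite[OF G(1)] finZ by (intro card_mono) (auto simp: E2_def)
  also have "... \<le> card E2 + card (\<Union>v\<in>Z. {X \<in> E. v \<in> X})" by (rule card_Un_le)
  also have "... \<le> card E2 + (\<Sum>v\<in>Z. deg E v)" unfolding deg_def using finZ by (intro add_left_mono card_UN_le) auto
  finally have "rcard E \<le> rcard E2 + (\<Sum>v\<in>Z. real (deg E v))" by (simp flip: of_nat_sum of_nat_add)
  also have "(\<Sum>v\<in>Z. real (deg E v)) \<le> (\<Sum>v\<in>Z. (kap - h) * real n ^ (r - 1))" by (intro sum_mono zdeg)
  also have "... = rcard Z * ((kap - h) * real n ^ (r - 1))" by simp
  finally have E1: "rcard E \<le> lam0 * real n2 ^ r - c * rcard M - c * real n ^ (r - 2) * D
    + rcard Z * ((kap - h) * real n ^ (r - 1))" using e2 blup by linarith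
  define z where "z = rcard Z"
  \<comment> \<open>Half of the degree deficit \<open>h\<close> of \<open>Z\<close> pays for the
    second-order term of \<open>(1 - t) ^ r\<close>; the other half bounds \<open>c\<close>.\<close>
  have "lam0 * real n2 ^ r \<le> lam0 * (real n ^ r - real r * z * real n ^ (r - 1)) + h / 2 * z * real n ^ (r - 1)"
  proof -
   define t where "t = z / real n"
   have t: "0 \<le> t" "t \<le> 1" "t \<le> real r * g" using zrg n0 n2 n20 by (simp_all add: t_def z_def field_simps)
   have tn: "z = t * real n" using n0 by (simp add: t_def)
   have "real n2 = (1 - t) * real n" using n2 tn by (simp add: z_def algebra_simps)
   then have "real n2 ^ r = (1 - t) ^ r * real n ^ r" by (simp add: power_mult_distrib)
   also have "... \<le> (1 - real r * t + real r ^ 2 * t ^ 2) * real n ^ r"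
    using power_one_minus_le[OF t(1,2)] by (intro mult_right_mono) auto
   finally have "lam0 * real n2 ^ r \<le> lam0 * ((1 - real r * t + real r ^ 2 * t ^ 2) * real n ^ r)"
    using lam0_pos by (intro mult_left_mono) auto
   also have "... = lam0 * (real n ^ r - real r * t * real n ^ r) + (lam0 * real r ^ 2 * t) * (t * real n ^ r)"
    by (simp add: algebra_simps power2_eq_square)
   also have "... \<le> lam0 * (real n ^ r - real r * t * real n ^ r) + (h / 2) * (t * real n ^ r)"
   proof (intro add_left_mono mult_right_mono)
    have "lam0 * real r ^ 2 * t \<le> lam0 * real r ^ 2 * (real r * g)" using t lam0_pos by (intro mult_left_mono) auto
    then show "lam0 * real r ^ 2 * t \<le> h / 2" using g(11) by linarith
   qed (use t in auto)
   finally have q: "lam0 * real n2 ^ r \<le> lam0 * (real n ^ r - real r * t * real n ^ r) + (h / 2) * (t * real n ^ r)" .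
   have tt: "t * real n ^ r = z * real n ^ (r - 1)" by (subst r1(2)) (simp add: tn)
   show ?thesis using q by (simp only: mult.assoc tt)
  qed
  moreover have "lam0 * (real n ^ r - real r * z * real n ^ (r - 1)) = lam0 * real n ^ r - kap * (z * real n ^ (r - 1))"
   by (simp add: kap_def algebra_simps)
  moreover have "c * (z * real n ^ (r - 1)) \<le> h / 2 * (z * real n ^ (r - 1))"
   using c by (intro mult_right_mono) (auto simp: z_def)
  moreover have "z * ((kap - h) * real n ^ (r - 1)) = kap * (z * real n ^ (r - 1)) - h * (z * real n ^ (r - 1))"
   by (simp add: algebra_simps)
  ultimately have fin: "rcard E \<le> lam0 * real n ^ r - c * z * real n ^ (r - 1) - c * rcard M - c * real n ^ (r - 2) * D"
   using E1 unfolding z_def[symmetric] by (simp add: mult.assoc)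
  show ?thesis
  proof (intro conjI exI[of _ f] exI[of _ Z] impI ballI allI)
   show "f ` V \<subseteq> I" by (rule fI)
   show "Z \<subseteq> V" using ZV by auto
   show "deficit c V E f Z" using fin unfolding z_def M_def D_def n2 unfolding V2_def n_def .
   show "rcard E \<le> rcard (Bl f V) - c * rcard (Bl f V - E)" if "Z = {}"
   proof -
    have "V2 = V" using that by (simp add: V2_def)
    moreover have "E2 = E" using edge that by (auto simp: E2_def V2_def)
    ultimately show ?thesis using e2 by (simp add: M_def)
   qed
   show "E = Bl f V" if "Z = {}" "Bl f V \<subseteq> E"
   proof -
    have V: "V2 = V" using that by (simp add: V2_def)
    have "M = {}" using that(2) V by (auto simp: M_def)
    then have "card C2.Bad = 0" using bad by simp
    then have "C2.Bad = {}" using C2.fin_Bad by simp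
    moreover have "E2 = E" using edge V by (auto simp: E2_def)
    ultimately have "E - Bl f V = {}" using V unfolding C2.Bad_def by simp
    then show ?thesis using that(2) by blast
   qed
   show "\<bar>rcard {v \<in> V. f v = i} - rcard V / real k\<bar> \<le> c0 * rcard V" if "i \<in> I" for i
   proof -
    have "(g ^ 2 + real r * g) * real n \<le> c0 * real n" using g(1,9) h(2) by (intro mult_right_mono) auto
    then show ?thesis using close[OF that, of V] by (simp add: n_def)
   qed
   show "real (deg E v) \<le> (kap + c0) * rcard V ^ (r - 1)" for v
   proof -
    have "(kap + h) * real n ^ (r - 1) \<le> (kap + c0) * real n ^ (r - 1)" using h(2) by (intro mult_right_mono) auto
    then show ?thesis using dich[of v] by (simp add: n_def)
   qed
  qed
 qed
 show ?thesis
 proof (rule exI[of _ c], rule conjI, rule c', rule exI[of _ "g ^ 2"], rule conjI, rule g2, rule exI[of _ N0],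
   intro allI impI, rule main)
  show "0 < card V" "real r \<le> g * rcard V" "2 * real r \<le> gam * rcard V" if "N0 \<le> card V" for V :: "'v set"
   using N[OF that] by simp_all
 qed
qed

end

section \<open>Stability\<close>

text \<open>Unlike \<open>tfree\<close>, the following property is invariant under cloning vertices.\<close>

definition sfree :: "'v set set => bool" where
 "sfree E \<longleftrightarrow> (\<forall>S a b D. a \<notin> S --> b \<notin> S --> a \<noteq> b --> insert a S \<in> E --> insert b S \<in> E -->
   D \<in> E --> a \<in> D --> b \<notin> D)"

lemma sfreeD:
 "sfree E ==> a \<notin> S ==> b \<notin> S ==> a \<noteq> b ==> insert a S \<in> E ==> insert b S \<in> E ==>
  D \<in> E ==> a \<in> D ==> b \<in> D ==> False" unfolding sfree_def by blast

lemma sfree_tfree: "sfree E ==> tfree E" unfolding tfree_def by (meson sfreeD)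

text \<open>Deletes \<open>v\<close> and puts it back with the link that \<open>u\<close> has away
  from \<open>v\<close>, so that \<open>u\<close> and its copy lie in no common edge.\<close>

definition clone :: "'v => 'v => 'v set set => 'v set set" where
 "clone u v E = {X. (v \<notin> X \<and> X \<in> E) \<or> (v \<in> X \<and> u \<notin> X \<and> insert u (X - {v}) \<in> E)}"

definition tw :: "'v set set => 'v => 'v => bool" where
 "tw E a b \<longleftrightarrow> a = b \<or> ((\<forall>X\<in>E. \<not> (a \<in> X \<and> b \<in> X)) \<and>
   (\<forall>S. a \<notin> S --> b \<notin> S --> (insert a S \<in> E \<longleftrightarrow> insert b S \<in> E)))"

lemma tw_refl: "tw E a a" by (simp add: tw_def)

lemma tw_sym: "tw E a b ==> tw E b a" unfolding tw_def by blast

lemma tw_trans: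
 assumes "tw E a b" "tw E b c"
 shows "tw E a c"
proof (cases "a = b \<or> b = c \<or> a = c")
 case True
 then show ?thesis using assms by (auto simp: tw_def)
next
 case False
 have ab: "\<And>X. X \<in> E ==> a \<in> X ==> b \<in> X ==> False"
  "\<And>S. a \<notin> S ==> b \<notin> S ==> insert a S \<in> E \<longleftrightarrow> insert b S \<in> E"
  using assms(1) False by (auto simp: tw_def)
 have bc: "\<And>X. X \<in> E ==> b \<in> X ==> c \<in> X ==> False"
  "\<And>S. b \<notin> S ==> c \<notin> S ==> insert b S \<in> E \<longleftrightarrow> insert c S \<in> E"
  using assms(2) False by (auto simp: tw_def)
 have "False" if X: "X \<in> E" "a \<in> X" "c \<in> X" for X
 proof -
  have "b \<notin> X" using ab(1) X by blast
  then have "insert b (X - {a}) \<in> E" using ab(2)[of "X - {a}"] X by (auto simp: insert_absorb)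
  then show False using bc(1)[of "insert b (X - {a})"] X False by auto
 qed
 moreover have "insert a S \<in> E \<longleftrightarrow> insert c S \<in> E" if S: "a \<notin> S" "c \<notin> S" for S
 proof (cases "b \<in> S")
  case True
  then show ?thesis using ab(1)[of "insert a S"] bc(1)[of "insert c S"] by auto
 qed (use ab(2) bc(2) S in blast)
 ultimately show ?thesis by (auto simp: tw_def)
qed

lemma rgr_clone:
 assumes "rgr r V E" "v \<in> V"
 shows "rgr r V (clone u v E)"
proof -
 have "X \<subseteq> V \<and> card X = r" if X: "v \<in> X" "u \<notin> X" "insert u (X - {v}) \<in> E" for X
 proof -
  have e: "insert u (X - {v}) \<subseteq> V" "card (insert u (X - {v})) = r" using X assms by (auto simp: rgr_def)
  then have XV: "X \<subseteq> V" using assms by auto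
  then have fX: "finite X" using assms finite_subset by (auto simp: rgr_def)
  have "card (insert u (X - {v})) = Suc (card (X - {v}))" using fX X by simp
  also have "... = card X" by (rule card_Suc_Diff1[OF fX X(1)])
  finally show ?thesis using e XV by simp
 qed
 then show ?thesis using assms by (auto simp: rgr_def clone_def)
qed

text \<open>The map sending \<open>v\<close> to \<open>u\<close> takes edges of \<open>clone u v E\<close> to edges of \<open>E\<close>.\<close>

lemma sfree_clone:
 assumes "sfree E" "u \<noteq> v"
 shows "sfree (clone u v E)" unfolding sfree_def
proof (intro allI impI notI)
 fix S a b D
 assume a: "a \<notin> S" "b \<notin> S" "a \<noteq> b" "insert a S \<in> clone u v E" "insert b S \<in> clone u v E"
  "D \<in> clone u v E" "a \<in> D" "b \<in> D"
 define h where "h x = (if x = v then u else x)" for x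
 have hX: "h ` X \<in> E \<and> \<not> (u \<in> X \<and> v \<in> X)" if "X \<in> clone u v E" for X
 proof (cases "v \<in> X")
  case True
  then have "h ` X = insert u (X - {v})" by (auto simp: h_def)
  then show ?thesis using that True by (auto simp: clone_def)
 next
  case False
  then have "h ` X = X" by (auto simp: h_def)
  then show ?thesis using that False by (auto simp: clone_def)
 qed
 have D: "h ` D \<in> E" "\<not> (u \<in> D \<and> v \<in> D)" using hX[OF a(6)] by auto
 have A: "insert (h a) (h ` S) \<in> E" "\<not> (u \<in> insert a S \<and> v \<in> insert a S)" using hX[OF a(4)] by auto
 have B: "insert (h b) (h ` S) \<in> E" "\<not> (u \<in> insert b S \<and> v \<in> insert b S)" using hX[OF a(5)] by auto
 have "h a \<noteq> h b" using D(2) a(3,7,8) by (auto simp: h_def split: if_splits)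
 moreover have "h a \<notin> h ` S" using A(2) a(1) by (auto simp: h_def split: if_splits)
 moreover have "h b \<notin> h ` S" using B(2) a(2) by (auto simp: h_def split: if_splits)
 ultimately show False using sfreeD[OF assms(1) _ _ _ A(1) B(1) D(1)] a(7,8) by blast
qed

text \<open>The edges at \<open>v\<close> are replaced by copies of the edges at \<open>u\<close>
  that avoid \<open>v\<close>.\<close>

lemma card_clone:
 assumes "finite E" "u \<noteq> v"
 shows "card (clone u v E) + card {X \<in> E. u \<in> X \<and> v \<in> X} + deg E v = card E + deg E u"
proof -
 let ?A = "{X \<in> E. v \<notin> X}" and ?B = "{X. v \<in> X \<and> u \<notin> X \<and> insert u (X - {v}) \<in> E}"
 let ?C = "{X \<in> E. u \<in> X \<and> v \<notin> X}"
 have bij: "bij_betw (\<lambda>X. insert u (X - {v})) ?B ?C"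
  by (rule bij_betw_byWitness[where f' = "\<lambda>X. insert v (X - {u})"])
   (use assms(2) in \<open>auto simp: insert_absorb insert_Diff_if\<close>)
 have fB: "finite ?B" using bij_betw_finite[OF bij] assms(1) by simp
 have "clone u v E = ?A \<union> ?B" by (auto simp: clone_def)
 moreover have "card (?A \<union> ?B) = card ?A + card ?B" using assms(1) fB by (intro card_Un_disjoint) auto
 moreover have "card ?B = card ?C" using bij by (rule bij_betw_same_card)
 moreover have "card E = card ?A + deg E v"
 proof -
  have "E = ?A \<union> {X \<in> E. v \<in> X}" by auto
  then have "card E = card (?A \<union> {X \<in> E. v \<in> X})" by simp
  also have "... = card ?A + card {X \<in> E. v \<in> X}" using assms(1) by (intro card_Un_disjoint) auto
  finally show ?thesis by (simp add: deg_def)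
 qed
 moreover have "deg E u = card ?C + card {X \<in> E. u \<in> X \<and> v \<in> X}"
 proof -
  have "{X \<in> E. u \<in> X} = ?C \<union> {X \<in> E. u \<in> X \<and> v \<in> X}" by auto
  then have "deg E u = card (?C \<union> {X \<in> E. u \<in> X \<and> v \<in> X})" by (simp add: deg_def)
  also have "... = card ?C + card {X \<in> E. u \<in> X \<and> v \<in> X}" using assms(1) by (intro card_Un_disjoint) auto
  finally show ?thesis .
 qed
 ultimately show ?thesis by simp
qed

lemma tw_clone:
 assumes "tw E a b" "a \<noteq> v" "b \<noteq> v" "u \<noteq> v"
 shows "tw (clone u v E) a b"
proof (cases "a = b")
 case False
 have ab: "\<And>X. X \<in> E ==> a \<in> X ==> b \<in> X ==> False"
  "\<And>S. a \<notin> S ==> b \<notin> S ==> insert a S \<in> E \<longleftrightarrow> insert b S \<in> E"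
  using assms(1) False by (auto simp: tw_def)
 have 1: False if X: "X \<in> clone u v E" "a \<in> X" "b \<in> X" for X
 proof (cases "v \<in> X")
  case True
  then have "insert u (X - {v}) \<in> E" using X by (auto simp: clone_def)
  then show False using ab(1) X assms by auto
 qed (use X ab(1) in \<open>auto simp: clone_def\<close>)
 have half: "insert b S \<in> clone u v E"
  if S: "a \<notin> S" "b \<notin> S" "insert a S \<in> clone u v E"
   and ab: "\<And>X. X \<in> E ==> a \<in> X ==> b \<in> X ==> False"
   "\<And>S. a \<notin> S ==> b \<notin> S ==> insert a S \<in> E \<longleftrightarrow> insert b S \<in> E"
   and ne: "a \<noteq> v" "b \<noteq> v" "a \<noteq> b" for S a b
 proof (cases "v \<in> S")
  case False
  then show ?thesis using S ab(2)[of S] ne by (auto simp: clone_def)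
 next
  case True
  then have i: "u \<notin> insert a S" "insert u (insert a S - {v}) \<in> E" using S by (auto simp: clone_def)
  have ub: "u \<noteq> b"
  proof
   assume "u = b"
   then show False using ab(1)[OF i(2)] ne by auto
  qed
  have "insert u (insert a S - {v}) = insert a (insert u (S - {v}))" using ne by auto
  then have "insert a (insert u (S - {v})) \<in> E" using i by simp
  moreover have "a \<notin> insert u (S - {v})" "b \<notin> insert u (S - {v})" using S i ub by auto
  ultimately have "insert b (insert u (S - {v})) \<in> E" using ab(2)[of "insert u (S - {v})"] by simp
  moreover have "insert u (insert b S - {v}) = insert b (insert u (S - {v}))" using ne by auto
  ultimately show ?thesis using True i ub by (auto simp: clone_def)
 qed
 have "insert a S \<in> clone u v E \<longleftrightarrow> insert b S \<in> clone u v E" if S: "a \<notin> S" "b \<notin> S" for S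
 proof
  assume c: "insert a S \<in> clone u v E"
  show "insert b S \<in> clone u v E" by (rule half[OF S c ab(1) ab(2) assms(2,3) False])
 next
  assume c: "insert b S \<in> clone u v E"
  show "insert a S \<in> clone u v E" by (rule half[OF S(2,1) c ab(1) ab(2)[symmetric] assms(3,2) False[symmetric]])
 qed
 then show ?thesis using 1 by (auto simp: tw_def)
qed (simp add: tw_refl)

lemma tw_clone_new:
 assumes "u \<noteq> v"
 shows "tw (clone u v E) v u"
proof -
 have "insert v S \<in> clone u v E \<longleftrightarrow> insert u S \<in> clone u v E" if "v \<notin> S" "u \<notin> S" for S
  using that assms by (auto simp: clone_def)
 then show ?thesis by (auto simp: tw_def clone_def)
qed

text \<open>Ordered pairs: a secondary quantity to maximise, so that cloning without gain in edges
  still makes progress.\<close>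

definition twins :: "'v set => 'v set set => nat" where
 "twins V E = card {(a, b) \<in> V \<times> V. tw E a b}"

text \<open>Twin pairs away from \<open>v\<close> survive. Before cloning, \<open>v\<close> is in
  \<open>2 * c - 1\<close> ordered pairs, where \<open>c\<close> is the size of its class;
  afterwards it is paired in both orders with every old twin of \<open>u\<close>, of which there are
  at least \<open>c\<close>.\<close>

lemma twins_clone:
 assumes V: "finite V" "u \<in> V" "v \<in> V" and nt: "\<not> tw E u v"
  and le: "card {b \<in> V. tw E v b} \<le> card {b \<in> V. tw E u b}"
 shows "twins V E < twins V (clone u v E)"
proof -
 have uv: "u \<noteq> v" using nt unfolding tw_def by auto
 let ?E' = "clone u v E"
 let ?R = "{(a, b) \<in> (V - {v}) \<times> (V - {v}). tw E a b}"
 let ?cu = "{b \<in> V. tw E u b}" and ?cv = "{b \<in> V. tw E v b}"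
 have fR: "finite ?R" using V by (auto intro: finite_subset[of _ "V \<times> V"])
 have vcu: "v \<notin> ?cu" using nt by auto
 have "{(a, b) \<in> V \<times> V. tw E a b} \<subseteq> (?R \<union> (\<lambda>b. (v, b)) ` ?cv) \<union> (\<lambda>b. (b, v)) ` (?cv - {v})"
  using tw_sym by fastforce
 then have "twins V E \<le> card ((?R \<union> (\<lambda>b. (v, b)) ` ?cv) \<union> (\<lambda>b. (b, v)) ` (?cv - {v}))"
  unfolding twins_def using fR V by (intro card_mono) auto
 also have "... \<le> card (?R \<union> (\<lambda>b. (v, b)) ` ?cv) + card ((\<lambda>b. (b, v)) ` (?cv - {v}))" by (rule card_Un_le)
 also have "... \<le> (card ?R + card ((\<lambda>b. (v, b)) ` ?cv)) + card ((\<lambda>b. (b, v)) ` (?cv - {v}))"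
  by (intro add_right_mono card_Un_le)
 also have "... \<le> (card ?R + card ?cv) + card (?cv - {v})" using V by (intro add_mono card_image_le order_refl) auto
 also have "... < card ?R + card ?cu + card ?cu"
 proof -
  have "v \<in> ?cv" using V tw_refl by auto
  then have "card (?cv - {v}) < card ?cv" using V by (intro psubset_card_mono) auto
  then show ?thesis using le by linarith
 qed
 also have "... = card ((?R \<union> (\<lambda>b. (v, b)) ` ?cu) \<union> (\<lambda>b. (b, v)) ` ?cu)"
 proof -
  have "card (?R \<union> (\<lambda>b. (v, b)) ` ?cu) = card ?R + card ((\<lambda>b. (v, b)) ` ?cu)"
   using fR V by (intro card_Un_disjoint) auto
  moreover have "card ((?R \<union> (\<lambda>b. (v, b)) ` ?cu) \<union> (\<lambda>b. (b, v)) ` ?cu)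
   = card (?R \<union> (\<lambda>b. (v, b)) ` ?cu) + card ((\<lambda>b. (b, v)) ` ?cu)"
   using fR V vcu by (intro card_Un_disjoint) auto
  moreover have "card ((\<lambda>b. (v, b)) ` ?cu) = card ?cu" "card ((\<lambda>b. (b, v)) ` ?cu) = card ?cu"
   by (auto intro!: card_image inj_onI)
  ultimately show ?thesis by simp
 qed
 also have "... \<le> twins V ?E'" unfolding twins_def
 proof (rule card_mono)
  have vb: "tw ?E' v b" if b: "tw E u b" "b \<noteq> v" for b
  proof -
   have "tw ?E' u b" using tw_clone[OF b(1) uv b(2) uv] .
   then show ?thesis by (rule tw_trans[OF tw_clone_new[OF uv]])
  qed
  show "(?R \<union> (\<lambda>b. (v, b)) ` ?cu) \<union> (\<lambda>b. (b, v)) ` ?cu \<subseteq> {(a, b) \<in> V \<times> V. tw ?E' a b}"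
  proof
   fix p assume "p \<in> (?R \<union> (\<lambda>b. (v, b)) ` ?cu) \<union> (\<lambda>b. (b, v)) ` ?cu"
   then consider (1) "p \<in> ?R" | (2) b where "b \<in> V" "tw E u b" "p = (v, b)" | (3) b where "b \<in> V" "tw E u b" "p = (b, v)"
    by auto
   then show "p \<in> {(a, b) \<in> V \<times> V. tw ?E' a b}"
   proof cases
    case 1
    then obtain a b where p: "p = (a, b)" "a \<in> V" "b \<in> V" "a \<noteq> v" "b \<noteq> v" "tw E a b" by auto
    have "tw ?E' a b" by (rule tw_clone[OF p(6,4,5) uv])
    then show ?thesis using p by simp
   next
    case 2
    then have "b \<noteq> v" using nt by auto
    then have "tw ?E' v b" using vb 2 by simp
    then show ?thesis using 2 V by simp
   next
    case 3
    then have "b \<noteq> v" using nt by auto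
    then have "tw ?E' v b" using vb 3 by simp
    then have "tw ?E' b v" by (rule tw_sym)
    then show ?thesis using 3 V by simp
   qed
  qed
  show "finite {(a, b) \<in> V \<times> V. tw ?E' a b}" by (rule finite_subset[of _ "V \<times> V"]) (use V in auto)
 qed
 finally show ?thesis .
qed

text \<open>The counting of \<open>thinI\<close>, without a reference partition.\<close>

lemma tfree_codeg:
 assumes G: "rgr r V E" "tfree E" and ab: "a \<noteq> b" "a \<notin> S" "b \<notin> S" "insert a S \<in> E" "insert b S \<in> E"
 shows "card {X \<in> E. a \<in> X \<and> b \<in> X} \<le> (r - 1) * card V ^ (r - 3)"
proof -
 have finV: "finite V" and edge: "\<And>X. X \<in> E ==> X \<subseteq> V \<and> card X = r" using G by (auto simp: rgr_def)
 have fS: "finite S" using edge[OF ab(4)] finV finite_subset by auto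
 have "Suc (card S) = r" using edge[OF ab(4)] ab(2) fS by simp
 then have cS: "card S = r - 1" by linarith
 have "{X \<in> E. a \<in> X \<and> b \<in> X} \<subseteq> (\<Union>s\<in>S. sups r V {a, b, s})"
 proof
  fix X assume X: "X \<in> {X \<in> E. a \<in> X \<and> b \<in> X}"
  then have "X \<inter> S \<noteq> {}" using tfreeD[OF G(2) ab(2,3,1,4,5)] by blast
  then show "X \<in> (\<Union>s\<in>S. sups r V {a, b, s})" using X edge[of X] by auto
 qed
 then have "card {X \<in> E. a \<in> X \<and> b \<in> X} \<le> card (\<Union>s\<in>S. sups r V {a, b, s})"
  using fS finV by (intro card_mono) (auto intro: finite_subset[of _ "Pow V"])
 also have "... \<le> (\<Sum>s\<in>S. card (sups r V {a, b, s}))" using fS by (rule card_UN_le)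
 also have "... \<le> (\<Sum>s\<in>S. card V ^ (r - 3))"
 proof (rule sum_mono)
  fix s assume s: "s \<in> S"
  have "a \<noteq> s" "b \<noteq> s" using ab s by auto
  then have "card {a, b, s} = 3" using ab(1) by simp
  then show "card (sups r V {a, b, s}) \<le> card V ^ (r - 3)" using card_supersets_le[OF finV, of "{a, b, s}" r] by simp
 qed
 finally show ?thesis using cS by simp
qed

text \<open>Deleting all edges through a pair of small codegree costs only \<open>O(n^(r - 1))\<close> edges.\<close>

lemma tfree_sfree_subgraph:
 assumes G: "rgr r V E" "tfree E" and r: "3 \<le> r"
 obtains E' where "E' \<subseteq> E" "sfree E'" "card E \<le> card E' + (r - 1) * card V ^ (r - 1)"
proof -
 have finV: "finite V" and edge: "\<And>X. X \<in> E ==> X \<subseteq> V \<and> card X = r" using G by (auto simp: rgr_def)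
 have finE: "finite E" by (rule rgr_finite[OF G(1)])
 define th where "th p \<longleftrightarrow> card {X \<in> E. fst p \<in> X \<and> snd p \<in> X} \<le> (r - 1) * card V ^ (r - 3)" for p :: "'a \<times> 'a"
 define E' where "E' = {X \<in> E. \<forall>a\<in>X. \<forall>b\<in>X. a \<noteq> b --> \<not> th (a, b)}"
 have "sfree E'" unfolding sfree_def
 proof (intro allI impI notI)
  fix S a b D
  assume a: "a \<notin> S" "b \<notin> S" "a \<noteq> b" "insert a S \<in> E'" "insert b S \<in> E'" "D \<in> E'" "a \<in> D" "b \<in> D"
  then have "\<not> th (a, b)" by (auto simp: E'_def)
  moreover have "th (a, b)" using tfree_codeg[OF G a(3,1,2)] a by (auto simp: E'_def th_def)
  ultimately show False by blast
 qed
 moreover have "card E \<le> card E' + (r - 1) * card V ^ (r - 1)"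
 proof -
  let ?Q = "{p \<in> V \<times> V. th p}"
  have fQ: "finite ?Q" using finV by auto
  have "E \<subseteq> E' \<union> (\<Union>p\<in>?Q. {X \<in> E. fst p \<in> X \<and> snd p \<in> X})"
  proof
   fix X assume X: "X \<in> E"
   show "X \<in> E' \<union> (\<Union>p\<in>?Q. {X \<in> E. fst p \<in> X \<and> snd p \<in> X})"
   proof (cases "X \<in> E'")
    case False
    then obtain a b where "a \<in> X" "b \<in> X" "th (a, b)" using X by (auto simp: E'_def)
    then have "(a, b) \<in> ?Q" "X \<in> {X \<in> E. fst (a, b) \<in> X \<and> snd (a, b) \<in> X}" using X edge[OF X] by auto
    then show ?thesis by blast
   qed simp
  qed
  then have "card E \<le> card (E' \<union> (\<Union>p\<in>?Q. {X \<in> E. fst p \<in> X \<and> snd p \<in> X}))"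
   using finE fQ by (intro card_mono) (auto simp: E'_def)
  also have "... \<le> card E' + card (\<Union>p\<in>?Q. {X \<in> E. fst p \<in> X \<and> snd p \<in> X})" by (rule card_Un_le)
  also have "... \<le> card E' + (\<Sum>p\<in>?Q. card {X \<in> E. fst p \<in> X \<and> snd p \<in> X})"
   using fQ by (intro add_left_mono card_UN_le)
  also have "... \<le> card E' + (\<Sum>p\<in>?Q. (r - 1) * card V ^ (r - 3))"
   by (intro add_left_mono sum_mono) (auto simp: th_def)
  also have "... \<le> card E' + (card V * card V) * ((r - 1) * card V ^ (r - 3))"
  proof -
   have "card ?Q \<le> card (V \<times> V)" using finV by (intro card_mono) auto
   then have "card ?Q * ((r - 1) * card V ^ (r - 3)) \<le> (card V * card V) * ((r - 1) * card V ^ (r - 3))"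
    by (intro mult_right_mono) (auto simp: card_cartesian_product)
   then show ?thesis by simp
  qed
  also have "(card V * card V) * ((r - 1) * card V ^ (r - 3)) = (r - 1) * card V ^ (r - 1)"
  proof -
   have "r - 1 = Suc (Suc (r - 3))" using r by simp
   then have "card V ^ (r - 1) = card V * (card V * card V ^ (r - 3))" by simp
   then show ?thesis by simp
  qed
  finally show ?thesis .
 qed
 moreover have "E' \<subseteq> E" by (auto simp: E'_def)
 ultimately show ?thesis using that by blast
qed

section \<open>Graphs that are maximal under cloning\<close>

lemma sum_deg:
 assumes "rgr r V E"
 shows "(\<Sum>v\<in>V. deg E v) = r * card E"
proof -
 have finV: "finite V" and edge: "\<And>X. X \<in> E ==> X \<subseteq> V \<and> card X = r" using assms by (auto simp: rgr_def)
 have "(\<Sum>v\<in>V. deg E v) = (\<Sum>X\<in>E. card {v \<in> V. v \<in> X})"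
  unfolding deg_def by (rule double_count[OF finV rgr_finite[OF assms]])
 also have "... = (\<Sum>X\<in>E. r)"
 proof (rule sum.cong[OF refl])
  fix X assume "X \<in> E"
  then have "{v \<in> V. v \<in> X} = X" "card X = r" using edge by auto
  then show "card {v \<in> V. v \<in> X} = r" by simp
 qed
 finally show ?thesis by simp
qed

text \<open>Optimality against a single cloning step, lexicographic in edges and twin pairs. It
  makes the twin classes the parts of a blow-up whose pattern is a partial Steiner system.\<close>

locale clone_maximal =
 fixes r :: nat and V :: "'v set" and E :: "'v set set"
 assumes G: "rgr r V E" and sf: "sfree E" and ne: "V \<noteq> {}" and r3: "3 \<le> r"
  and H1: "\<And>u v. u \<in> V ==> v \<in> V ==> u \<noteq> v ==> card (clone u v E) \<le> card E"
  and H2: "\<And>u v. u \<in> V ==> v \<in> V ==> u \<noteq> v ==> card (clone u v E) = card E ==>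
   twins V (clone u v E) \<le> twins V E"
begin

lemma finV: "finite V" and edge: "X \<in> E ==> X \<subseteq> V \<and> card X = r" using G by (auto simp: rgr_def)

lemma finE: "finite E" by (rule rgr_finite[OF G])

lemma fin_edge: "X \<in> E ==> finite X" using edge finV finite_subset by blast

lemma deg_le_codeg:
 assumes "u \<in> V" "v \<in> V" "u \<noteq> v"
 shows "deg E u \<le> deg E v + card {X \<in> E. u \<in> X \<and> v \<in> X}"
 using H1[OF assms] card_clone[OF finE assms(3)] by linarith

lemma deg_close:
 assumes "u \<in> V" "v \<in> V"
 shows "deg E u \<le> deg E v + card V ^ (r - 2)"
proof (cases "u = v")
 case False
 have "card {X \<in> E. u \<in> X \<and> v \<in> X} \<le> card (sups r V {u, v})"
  using edge finV by (intro card_mono) (auto intro: finite_subset[of _ "Pow V"])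
 also have "... \<le> card V ^ (r - 2)" using card_supersets_le[OF finV, of "{u, v}" r] False by (simp add: numeral_2_eq_2)
 finally show ?thesis using deg_le_codeg[OF assms False] by linarith
qed simp

text \<open>Maximality gives the two vertices equal degree, so cloning in either direction keeps the
  edge count; were they not twins, cloning into the larger class would create more twin
  pairs.\<close>

lemma uncovered_tw:
 assumes uv: "u \<in> V" "v \<in> V" and un: "\<And>X. X \<in> E ==> u \<in> X ==> v \<in> X ==> False"
 shows "tw E u v"
proof (rule ccontr)
 assume nt: "\<not> tw E u v"
 then have ne: "u \<noteq> v" and nt': "\<not> tw E v u" using tw_sym unfolding tw_def by auto
 have c0: "{X \<in> E. u \<in> X \<and> v \<in> X} = {}" "{X \<in> E. v \<in> X \<and> u \<in> X} = {}" using un by auto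
 have "deg E u \<le> deg E v" using deg_le_codeg[OF uv ne] unfolding c0 by simp
 moreover have "deg E v \<le> deg E u" using deg_le_codeg[OF uv(2,1) ne[symmetric]] unfolding c0 by simp
 ultimately have d: "deg E u = deg E v" by simp
 have 1: "card (clone u v E) = card E" using card_clone[OF finE ne] d unfolding c0 by simp
 have 2: "card (clone v u E) = card E" using card_clone[OF finE ne[symmetric]] d unfolding c0 by simp
 show False
 proof (cases "card {b \<in> V. tw E v b} \<le> card {b \<in> V. tw E u b}")
  case True
  then show False using twins_clone[OF finV uv nt] H2[OF uv ne 1] by simp
 next
  case False
  then show False using twins_clone[OF finV uv(2,1) nt'] H2[OF uv(2,1) ne[symmetric] 2] by simp
 qed
qed

definition g :: "'v => 'v" where "g v = (SOME w. w \<in> V \<and> tw E v w)"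

lemma g: "v \<in> V ==> g v \<in> V" "v \<in> V ==> tw E v (g v)"
 using someI_ex[of "\<lambda>w. w \<in> V \<and> tw E v w"] tw_refl[of E v] unfolding g_def by blast+

lemma g_eq: "tw E a b ==> g a = g b"
proof -
 assume t: "tw E a b"
 have "tw E a w \<longleftrightarrow> tw E b w" for w using tw_trans[OF t, of w] tw_trans[OF tw_sym[OF t], of w] by blast
 then show ?thesis by (simp add: g_def)
qed

lemma gg: "v \<in> V ==> g (g v) = g v" using g_eq[OF g(2)] by simp

lemma inj_edge:
 assumes "X \<in> E"
 shows "inj_on g X"
proof (rule inj_onI, rule ccontr)
 fix a b assume ab: "a \<in> X" "b \<in> X" "g a = g b" "a \<noteq> b"
 then have "a \<in> V" "b \<in> V" using edge[OF assms] by auto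
 then have "tw E a b" using tw_trans[OF g(2)[of a]] tw_sym[OF g(2)[of b]] ab(3) by simp
 then show False using ab assms by (auto simp: tw_def)
qed

text \<open>The vertices of \<open>X\<close> are replaced by their representatives one at a time;
  every replacement exchanges twins.\<close>

lemma edge_iff:
 assumes "X \<subseteq> V" "inj_on g X"
 shows "X \<in> E \<longleftrightarrow> g ` X \<in> E" using assms
proof (induction "card {x \<in> X. g x \<noteq> x}" arbitrary: X)
 case 0
 have "finite X" using 0 finV finite_subset by blast
 then have "\<forall>x\<in>X. g x = x" using 0(1) by auto
 then have "g ` X = X" by simp
 then show ?case by simp
next
 case (Suc m)
 have fX: "finite X" using Suc.prems finV finite_subset by blast
 have "{x \<in> X. g x \<noteq> x} \<noteq> {}" using Suc.hyps(2) by (metis card.empty nat.distinct(1))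
 then obtain a where a: "a \<in> X" "g a \<noteq> a" by auto
 have aV: "a \<in> V" using a Suc.prems by auto
 define S where "S = X - {a}"
 have X: "X = insert a S" "a \<notin> S" using a by (auto simp: S_def)
 have fS: "finite S" using fX by (simp add: S_def)
 have gS: "g a \<notin> S"
 proof
  assume "g a \<in> S"
  then show False using Suc.prems(2) gg[OF aV] a by (auto simp: inj_on_def S_def)
 qed
 let ?X' = "insert (g a) S"
 have iff: "X \<in> E \<longleftrightarrow> ?X' \<in> E" using g(2)[OF aV] X gS a by (auto simp: tw_def)
 have im: "g ` ?X' = g ` X" using X gg[OF aV] by simp
 have "{x \<in> X. g x \<noteq> x} = insert a {x \<in> S. g x \<noteq> x}" using X a by auto
 then have "Suc m = Suc (card {x \<in> S. g x \<noteq> x})" using Suc.hyps(2) fS X(2) by simp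
 moreover have "{x \<in> ?X'. g x \<noteq> x} = {x \<in> S. g x \<noteq> x}" using gg[OF aV] by auto
 ultimately have m: "m = card {x \<in> ?X'. g x \<noteq> x}" by simp
 have "inj_on g ?X'"
 proof (rule eq_card_imp_inj_on)
  show "finite ?X'" using fS by simp
  have "card (g ` ?X') = card X" unfolding im using Suc.prems(2) by (rule card_image)
  then show "card (g ` ?X') = card ?X'" using X gS fS by simp
 qed
 moreover have "?X' \<subseteq> V" using Suc.prems g(1)[OF aV] by (auto simp: S_def)
 ultimately have "?X' \<in> E \<longleftrightarrow> g ` ?X' \<in> E" using Suc.hyps(1)[OF m] by blast
 then show ?case using iff im by simp
qed

text \<open>The pattern: one representative per twin class, the edges among representatives, and
  relative class sizes as weights. \<open>E\<close> is the blow-up of \<open>P\<close> along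
  \<open>g\<close> (\<open>edge_P\<close>).\<close>

definition C :: "'v set" where "C = g ` V"
definition P :: "'v set set" where "P = {e \<in> E. e \<subseteq> C}"
definition N :: "'v => nat" where "N j = card {v \<in> V. g v = j}"
definition n :: nat where "n = card V"
definition x :: "'v => real" where "x j = real (N j) / real n"

lemma fix_C: "c \<in> C ==> g c = c \<and> c \<in> V" using gg g(1) by (auto simp: C_def)

lemma edge_P:
 assumes "X \<subseteq> V" "card X = r"
 shows "X \<in> E \<longleftrightarrow> g ` X \<in> P"
proof
 assume X: "X \<in> E"
 then have "g ` X \<in> E" using edge_iff[OF assms(1) inj_edge] by simp
 then show "g ` X \<in> P" using assms by (auto simp: P_def C_def)
next
 assume X: "g ` X \<in> P"
 then have "card (g ` X) = card X" using edge assms by (auto simp: P_def)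
 moreover have "finite X" using assms finV finite_subset by blast
 ultimately have "inj_on g X" by (intro eq_card_imp_inj_on)
 then show "X \<in> E" using edge_iff[OF assms(1)] X by (simp add: P_def)
qed

lemma finC: "finite C" using finV by (simp add: C_def)
lemma finP: "finite P" using finE by (simp add: P_def)
lemma edgeP: "e \<in> P ==> e \<subseteq> C \<and> card e = r" using edge by (auto simp: P_def)
lemma n_pos: "0 < n" using ne finV by (simp add: n_def card_gt_0_iff)

lemma card_E: "card E = (\<Sum>e\<in>P. \<Prod>j\<in>e. N j)"
proof -
 define tr where "tr e = {S. S \<subseteq> V \<and> card S = card e \<and> g ` S = e}" for e
 have ftr: "finite (tr e)" for e by (rule finite_subset[of _ "Pow V"]) (use finV in "auto simp: tr_def")
 have "E = (\<Union>e\<in>P. tr e)"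
 proof (intro equalityI subsetI)
  fix X assume X: "X \<in> E"
  then have "g ` X \<in> P" using edge_P[of X] edge[OF X] by simp
  moreover from this have "X \<in> tr (g ` X)" using edge[OF X] edgeP by (auto simp: tr_def)
  ultimately show "X \<in> (\<Union>e\<in>P. tr e)" by blast
 next
  fix X assume "X \<in> (\<Union>e\<in>P. tr e)"
  then obtain e where "e \<in> P" "X \<subseteq> V" "card X = card e" "g ` X = e" by (auto simp: tr_def)
  then show "X \<in> E" using edge_P[of X] edgeP[of e] by simp
 qed
 then have "card E = (\<Sum>e\<in>P. card (tr e))" using finP ftr by (subst card_UN_disjoint[symmetric]) (auto simp: tr_def)
 also have "... = (\<Sum>e\<in>P. \<Prod>j\<in>e. N j)" using edgeP finC finite_subset unfolding tr_def N_def
  by (intro sum.cong refl card_transversals[OF finV]) blast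
 finally show ?thesis .
qed

lemma deg_C:
 assumes c: "c \<in> C"
 shows "deg E c = (\<Sum>e | e \<in> P \<and> c \<in> e. \<Prod>j\<in>e - {c}. N j)"
proof -
 define tr where "tr e = {S. S \<subseteq> V \<and> card S = card (e - {c}) \<and> g ` S = e - {c}}" for e
 have ftr: "finite (tr e)" for e by (rule finite_subset[of _ "Pow V"]) (use finV in "auto simp: tr_def")
 have cS: "c \<notin> S" if "S \<in> tr e" for S e using that fix_C[OF c] by (auto simp: tr_def)
 let ?Q = "{e \<in> P. c \<in> e}"
 have "{X \<in> E. c \<in> X} = insert c ` (\<Union>e\<in>?Q. tr e)"
 proof (intro equalityI subsetI)
  fix X assume "X \<in> {X \<in> E. c \<in> X}"
  then have X: "X \<in> E" "c \<in> X" by auto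
  have e: "g ` X \<in> P" using edge_P[of X] edge[OF X(1)] X by simp
  have ce: "c \<in> g ` X" using X fix_C[OF c] by (metis imageI)
  have "g ` (X - {c}) = g ` X - {c}" using inj_on_image_set_diff[OF inj_edge[OF X(1)], of X "{c}"] X fix_C[OF c] by simp
  moreover have "card (X - {c}) = card (g ` X - {c})"
   using X ce edge[OF X(1)] edgeP[OF e] fin_edge[OF X(1)] by (simp add: card_Diff_singleton)
  ultimately have "X - {c} \<in> tr (g ` X)" using edge[OF X(1)] by (auto simp: tr_def)
  then have "X - {c} \<in> (\<Union>e\<in>?Q. tr e)" using e ce by blast
  moreover have "X = insert c (X - {c})" using X by auto
  ultimately show "X \<in> insert c ` (\<Union>e\<in>?Q. tr e)" by blast
 next
  fix X assume "X \<in> insert c ` (\<Union>e\<in>?Q. tr e)"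
  then obtain e S where e: "e \<in> P" "c \<in> e" "S \<in> tr e" "X = insert c S" by auto
  have fS: "finite S" using e finV finite_subset by (auto simp: tr_def)
  have fe: "finite e" using edgeP[OF e(1)] finC finite_subset by blast
  have "card X = Suc (card (e - {c}))" using e cS[OF e(3)] fS by (simp add: tr_def)
  then have "card X = r" using edgeP[OF e(1)] e(2) fe card_Suc_Diff1[OF fe e(2)] by simp
  moreover have "g ` X = e" using e fix_C[OF c] by (auto simp: tr_def)
  moreover have "X \<subseteq> V" using e fix_C[OF c] by (auto simp: tr_def)
  ultimately show "X \<in> {X \<in> E. c \<in> X}" using edge_P[of X] e by simp
 qed
 moreover have "inj_on (insert c) (\<Union>e\<in>?Q. tr e)"
 proof (rule inj_onI)
  fix S R assume "S \<in> (\<Union>e\<in>?Q. tr e)" "R \<in> (\<Union>e\<in>?Q. tr e)" "insert c S = insert c R"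
  moreover from this have "c \<notin> S" "c \<notin> R" using cS by auto
  ultimately show "S = R" by (metis insert_ident)
 qed
 ultimately have "deg E c = card (\<Union>e\<in>?Q. tr e)" by (simp add: deg_def card_image)
 also have "... = (\<Sum>e\<in>?Q. card (tr e))"
 proof (rule card_UN_disjoint)
  show "finite ?Q" using finP by simp
  show "\<forall>e\<in>?Q. finite (tr e)" using ftr by blast
 qed (auto simp: tr_def)
 also have "... = (\<Sum>e\<in>?Q. \<Prod>j\<in>e - {c}. N j)" unfolding tr_def N_def
 proof (intro sum.cong refl card_transversals[OF finV])
  fix e assume "e \<in> ?Q"
  then show "finite (e - {c})" using edgeP[of e] finC finite_subset by blast
 qed
 finally show ?thesis by simp
qed

lemma prod_x: "finite e ==> (\<Prod>j\<in>e. x j) = real (\<Prod>j\<in>e. N j) / real n ^ card e"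
 unfolding x_def by (simp add: prod_dividef)

lemma lam_eq: "(\<Sum>e\<in>P. \<Prod>j\<in>e. x j) = rcard E / real n ^ r"
proof -
 have "(\<Sum>e\<in>P. \<Prod>j\<in>e. x j) = (\<Sum>e\<in>P. real (\<Prod>j\<in>e. N j) / real n ^ r)"
 proof (rule sum.cong[OF refl])
  fix e assume "e \<in> P"
  then have "finite e" "card e = r" using edgeP[of e] finC finite_subset by auto
  then show "(\<Prod>j\<in>e. x j) = real (\<Prod>j\<in>e. N j) / real n ^ r" using prod_x by simp
 qed
 also have "... = rcard E / real n ^ r" unfolding card_E by (simp add: sum_divide_distrib)
 finally show ?thesis .
qed

lemma dl_eq:
 assumes "c \<in> C"
 shows "(\<Sum>e | e \<in> P \<and> c \<in> e. \<Prod>j\<in>e - {c}. x j) = real (deg E c) / real n ^ (r - 1)"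
proof -
 have "(\<Sum>e | e \<in> P \<and> c \<in> e. \<Prod>j\<in>e - {c}. x j)
  = (\<Sum>e | e \<in> P \<and> c \<in> e. real (\<Prod>j\<in>e - {c}. N j) / real n ^ (r - 1))"
 proof (rule sum.cong[OF refl])
  fix e assume "e \<in> {e. e \<in> P \<and> c \<in> e}"
  then have "finite e" "card e = r" "c \<in> e" using edgeP[of e] finC finite_subset by auto
  then have "finite (e - {c})" "card (e - {c}) = r - 1" by (auto simp: card_Diff_singleton)
  then show "(\<Prod>j\<in>e - {c}. x j) = real (\<Prod>j\<in>e - {c}. N j) / real n ^ (r - 1)" using prod_x by metis
 qed
 also have "... = real (deg E c) / real n ^ (r - 1)" unfolding deg_C[OF assms] by (simp add: sum_divide_distrib)
 finally show ?thesis .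
qed

lemma sum_x: "(\<Sum>c\<in>C. x c) = 1"
proof -
 have "V = (\<Union>c\<in>C. {v \<in> V. g v = c})" by (auto simp: C_def)
 then have "n = card (\<Union>c\<in>C. {v \<in> V. g v = c})" by (simp add: n_def)
 also have "... = (\<Sum>c\<in>C. N c)" unfolding N_def using finC finV by (intro card_UN_disjoint) auto
 finally have "real n = (\<Sum>c\<in>C. real (N c))" by simp
 then show ?thesis using n_pos by (simp add: x_def flip: sum_divide_distrib)
qed

text \<open>If two edges of \<open>P\<close> shared an (r-1)-set, their two remaining vertices would
  lie in no common edge, hence be twins, although distinct representatives are never twins. Any two
  degrees differ by at most \<open>n^(r-2)\<close>, so each differs by at most this from the mean
  \<open>r * card E / n\<close>, which gives the error \<open>1 / n\<close>.\<close>

lemma kkt: "kkt r C P x (1 / real n)"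
proof
 show "finite C" "3 \<le> r" by (fact finC r3)+
 show "e \<subseteq> C \<and> card e = r" if "e \<in> P" for e using edgeP that .
 show "e = e'" if e: "e \<in> P" "e' \<in> P" "S \<subseteq> e" "S \<subseteq> e'" "card S = r - 1" for e e' S
 proof (rule ccontr)
  assume ne: "e \<noteq> e'"
  have fe: "finite e" "finite e'" using edgeP e finC finite_subset by (meson)+
  have fS: "finite S" using e fe finite_subset by blast
  have "card (e - S) = 1" "card (e' - S) = 1" using e edgeP fS r3 by (simp_all add: card_Diff_subset)
  then obtain a b where ab: "e - S = {a}" "e' - S = {b}" by (auto simp: card_1_singleton_iff)
  then have i: "e = insert a S" "e' = insert b S" "a \<notin> S" "b \<notin> S" using e by auto
  then have ab': "a \<noteq> b" using ne by auto
  have aC: "a \<in> C" "b \<in> C" using i edgeP e by auto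
  have E: "insert a S \<in> E" "insert b S \<in> E" using e i by (auto simp: P_def)
  have "tw E a b"
  proof (rule uncovered_tw)
   fix D assume "D \<in> E" "a \<in> D" "b \<in> D"
   then show False using sfreeD[OF sf i(3,4) ab' E] by blast
  qed (use fix_C aC in auto)
  then have "g a = g b" by (rule g_eq)
  then show False using fix_C aC ab' by simp
 qed
 show "0 < x c" if "c \<in> C" for c
 proof -
  have "c \<in> {v \<in> V. g v = c}" using fix_C[OF that] by simp
  then have "0 < N c" unfolding N_def using finV by (simp add: card_gt_0_iff) blast
  then show ?thesis using n_pos by (simp add: x_def)
 qed
 show "(\<Sum>c\<in>C. x c) = 1" by (rule sum_x)
 show "\<bar>(\<Sum>e | e \<in> P \<and> c \<in> e. \<Prod>j\<in>e - {c}. x j) - real r * (\<Sum>e\<in>P. \<Prod>j\<in>e. x j)\<bar> \<le> 1 / real n"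
  if c: "c \<in> C" for c
 proof -
  have cV: "c \<in> V" using fix_C[OF c] by simp
  define q where "q = real n ^ (r - 2)"
  have p: "real n ^ (r - 1) = real n * q" "real n ^ r = real n * (real n * q)"
  proof -
   have "r - 1 = Suc (r - 2)" "r = Suc (Suc (r - 2))" using r3 by simp_all
   then show "real n ^ (r - 1) = real n * q" "real n ^ r = real n * (real n * q)" unfolding q_def by (metis power_Suc)+
  qed
  have d: "real (deg E u) \<le> real (deg E v) + q" if "u \<in> V" "v \<in> V" for u v
   using deg_close[OF that] unfolding q_def n_def by (metis (mono_tags) of_nat_add of_nat_le_iff of_nat_power)
  have s: "real r * rcard E = (\<Sum>v\<in>V. real (deg E v))" using sum_deg[OF G] by (metis of_nat_mult of_nat_sum)
  have "(\<Sum>v\<in>V. real (deg E v)) \<le> (\<Sum>v\<in>V. real (deg E c) + q)" using d cV by (intro sum_mono)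
  then have 1: "real r * rcard E \<le> real n * (real (deg E c) + q)" unfolding s by (simp add: n_def)
  have "(\<Sum>v\<in>V. real (deg E c)) \<le> (\<Sum>v\<in>V. real (deg E v) + q)" using d cV by (intro sum_mono)
  then have 2: "real n * real (deg E c) \<le> real r * rcard E + real n * q" unfolding s by (simp add: n_def sum.distrib)
  have q0: "0 < q" using n_pos by (simp add: q_def)
  have "real (deg E c) / real n ^ (r - 1) - real r * (rcard E / real n ^ r)
   = (real n * real (deg E c) - real r * rcard E) / real n ^ r" using n_pos q0 unfolding p by (simp add: field_simps)
  moreover have "\<bar>real n * real (deg E c) - real r * rcard E\<bar> \<le> real n * q"
   using 1 2 by (simp add: algebra_simps abs_le_iff)
  ultimately have "\<bar>real (deg E c) / real n ^ (r - 1) - real r * (rcard E / real n ^ r)\<bar> \<le> (real n * q) / real n ^ r"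
   using n_pos by (simp add: divide_right_mono)
  also have "... = 1 / real n" using n_pos q0 unfolding p by simp
  finally show ?thesis unfolding dl_eq[OF c] lam_eq .
 qed
qed

end

section \<open>Stability by symmetrisation far from blow-ups\<close>

context steiner
begin

text \<open>Off \<open>v\<close> no edge is lost, and at most \<open>n^(r-1)\<close> sets contain
  \<open>v\<close>, which half of \<open>e * n^r\<close> absorbs.\<close>

lemma near_clone:
 assumes "near (e / 2) V E' f" "finite V" "v \<in> V" "2 \<le> e * rcard V" "0 < e"
  and sub: "\<And>X. X \<in> E' ==> v \<notin> X ==> X \<in> E"
 shows "near e V E f"
proof -
 let ?n = "rcard V"
 have "Bl f V - E \<subseteq> (Bl f V - E') \<union> sups r V {v}" using sub by (auto simp: Bl_def)
 then have "card (Bl f V - E) \<le> card ((Bl f V - E') \<union> sups r V {v})"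
  using Bl_fin[OF assms(2)] assms(2) by (intro card_mono) (auto intro: finite_subset[of _ "Pow V"])
 also have "... \<le> card (Bl f V - E') + card (sups r V {v})" by (rule card_Un_le)
 also have "card (sups r V {v}) \<le> card V ^ (r - 1)" using card_supersets_le[OF assms(2), of "{v}" r] by simp
 finally have "rcard (Bl f V - E) \<le> real (card (Bl f V - E') + card V ^ (r - 1))" by (simp only: of_nat_le_iff add_left_mono)
 also have "... \<le> e / 2 * ?n ^ r + ?n ^ (r - 1)" using assms(1) by (simp add: near_def)
 also have "... \<le> e / 2 * ?n ^ r + e / 2 * ?n ^ r"
 proof -
  have "r = Suc (r - 1)" using r3 by simp
  then have p: "?n ^ r = ?n * ?n ^ (r - 1)" by (metis power_Suc)
  have "1 * ?n ^ (r - 1) \<le> (e / 2 * ?n) * ?n ^ (r - 1)" using assms(4) by (intro mult_right_mono) auto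
  then show ?thesis unfolding p by simp
 qed
 finally have "rcard (Bl f V - E) \<le> e * ?n ^ r" by simp
 moreover have "\<bar>rcard {v \<in> V. f v = i} - ?n / real k\<bar> \<le> e * ?n" if "i \<in> I" for i
 proof -
  have "\<bar>rcard {v \<in> V. f v = i} - ?n / real k\<bar> \<le> e / 2 * ?n" using assms(1) that by (simp add: near_def)
  also have "... \<le> e * ?n" using assms(5) by (intro mult_right_mono) auto
  finally show ?thesis .
 qed
 ultimately show ?thesis using assms(1) by (simp add: near_def)
qed

text \<open>Self-improvement of closeness for dense triangle-free graphs. The factor two is the
  margin that \<open>near_clone\<close> gives away when a cloning step is undone.\<close>

definition improves :: "'v itself => real => bool" where
 "improves _ e \<longleftrightarrow> (\<exists>d>0. \<exists>N. \<forall>(V :: 'v set) E f. rgr r V E --> tfree E --> N \<le> card V --> near e V E f -->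
   (lam0 - d) * rcard V ^ r \<le> rcard E --> (\<exists>f'. near (e / 2) V E f'))"

text \<open>Stability of the Lagrangian among all partial Steiner systems, with the number of points
  of \<open>C\<close> left open and only approximate Lagrange conditions. The type argument is the
  vertex type of the patterns.\<close>

definition lagr_stable :: "'v itself => bool" where
 "lagr_stable _ \<longleftrightarrow> (\<forall>e>0. \<exists>d>0. \<forall>(C :: 'v set) P x d'. kkt r C P x d' --> 0 \<le> d' --> d' \<le> d -->
   lam0 - d \<le> kkt.lam P x -->
   (\<exists>\<phi>. bij_betw \<phi> C I \<and> (\<lambda>X. \<phi> ` X) ` P = Bk \<and> (\<forall>c\<in>C. \<bar>x c - ik\<bar> \<le> e)))"

text \<open>Take a cloning-maximal graph among the dense ones near no blow-up. This class is closed
  under cloning without loss of edges: a clone near a blow-up would be within \<open>e / 2\<close>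
  of one by \<open>improves\<close>, and \<open>near_clone\<close> would bring the original within
  \<open>e\<close>. By \<open>lagr_stable\<close> the pattern of the maximal graph is the design
  with nearly uniform weights, so the graph is near a blow-up after all.\<close>

lemma sfree_stability:
 assumes L: "lagr_stable TYPE('v)" and imp: "improves TYPE('v) e" and e: "0 < e"
 shows "\<exists>d>0. \<exists>N. \<forall>(V :: 'v set) E. rgr r V E --> sfree E --> N \<le> card V -->
   (lam0 - d) * rcard V ^ r \<le> rcard E --> (\<exists>f. near e V E f)"
proof -
 obtain d1 N1 where d1: "0 < d1" and LS: "\<And>(V :: 'v set) E f. rgr r V E ==> tfree E ==> N1 \<le> card V ==> near e V E f ==>
   (lam0 - d1) * rcard V ^ r \<le> rcard E ==> \<exists>f'. near (e / 2) V E f'" using imp unfolding improves_def by blast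
 obtain d2 where d2: "0 < d2" and LA: "\<And>(C :: 'v set) P x d'. kkt r C P x d' ==> 0 \<le> d' ==> d' \<le> d2 ==>
   lam0 - d2 \<le> kkt.lam P x ==>
   \<exists>\<phi>. bij_betw \<phi> C I \<and> (\<lambda>X. \<phi> ` X) ` P = Bk \<and> (\<forall>c\<in>C. \<bar>x c - ik\<bar> \<le> e)"
  using L e unfolding lagr_stable_def by blast
 define d where "d = min d1 d2"
 define N where "N = max N1 (max 1 (max (nat \<lceil>2 / e\<rceil>) (nat \<lceil>1 / d2\<rceil>)))"
 have "\<exists>f. near e V E0 f" if E0: "rgr r V E0" "sfree E0" "N \<le> card V" "(lam0 - d) * rcard V ^ r \<le> rcard E0"
  for V :: "'v set" and E0
 proof (rule ccontr)
  assume no: "\<not> (\<exists>f. near e V E0 f)"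
  define nv where "nv = card V"
  define K where "K = (lam0 - d) * real nv ^ r"
  have "N1 \<le> nv" "1 \<le> nv" "nat \<lceil>2 / e\<rceil> \<le> nv" "nat \<lceil>1 / d2\<rceil> \<le> nv" using E0(3) by (auto simp: N_def nv_def)
  then have n: "N1 \<le> nv" "0 < nv" "2 / e \<le> real nv" "1 / d2 \<le> real nv" by linarith+
  have en: "2 \<le> e * real nv" "1 / real nv \<le> d2" using n e d2 by (auto simp: field_simps)
  have finV: "finite V" using E0 by (auto simp: rgr_def)
  have dK: "(lam0 - d1) * real nv ^ r \<le> K" "(lam0 - d2) * real nv ^ r \<le> K"
   unfolding K_def d_def by (intro mult_right_mono; simp)+
  define GG where "GG = {E. rgr r V E \<and> sfree E \<and> (\<forall>f. \<not> near e V E f) \<and> K \<le> rcard E}"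
  have "GG \<subseteq> Pow (Pow V)" by (auto simp: GG_def rgr_def)
  then have fGG: "finite GG" using finV by (simp add: finite_subset)
  have "E0 \<in> GG" using E0 no by (simp add: GG_def K_def nv_def)
  \<comment> \<open>Encodes the lexicographic order, as there are at most \<open>nv * nv\<close>
    twin pairs.\<close>
  define m where "m E = card E * (nv * nv + 1) + twins V E" for E
  have "Max (m ` GG) \<in> m ` GG" using fGG \<open>E0 \<in> GG\<close> by (intro Max_in) auto
  then obtain E where E: "E \<in> GG" "m E = Max (m ` GG)" by auto
  have mx: "m E' \<le> m E" if "E' \<in> GG" for E' using that E(2) fGG by simp
  have GE: "rgr r V E" "sfree E" "\<And>f. \<not> near e V E f" "K \<le> rcard E" using E by (auto simp: GG_def)
  have tw_le: "twins V E' \<le> nv * nv" for E' :: "'v set set"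
  proof -
   have "twins V E' \<le> card (V \<times> V)" unfolding twins_def using finV by (intro card_mono) auto
   then show ?thesis by (simp add: card_cartesian_product nv_def)
  qed
  have cl: "clone u v E \<in> GG" if uv: "u \<in> V" "v \<in> V" "u \<noteq> v" and c: "card E \<le> card (clone u v E)" for u v
  proof -
   have r': "rgr r V (clone u v E)" by (rule rgr_clone[OF GE(1) uv(2)])
   have s': "sfree (clone u v E)" by (rule sfree_clone[OF GE(2) uv(3)])
   have K': "K \<le> rcard (clone u v E)" using GE(4) c by linarith
   have "\<not> near e V (clone u v E) f" for f
   proof
    assume "near e V (clone u v E) f"
    then obtain f' where "near (e / 2) V (clone u v E) f'" using LS[OF r' sfree_tfree[OF s']] n K' dK by (force simp: nv_def)
    then have "near e V E f'" by (rule near_clone[OF _ finV uv(2)]) (use en e in "auto simp: nv_def clone_def")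
    then show False using GE(3) by blast
   qed
   then show ?thesis using r' s' K' by (simp add: GG_def)
  qed
  interpret clone_maximal r V E
  proof
   show "V \<noteq> {}" using n by (auto simp: nv_def)
   show H1: "card (clone u v E) \<le> card E" if uv: "u \<in> V" "v \<in> V" "u \<noteq> v" for u v
   proof (rule ccontr)
    assume "\<not> card (clone u v E) \<le> card E"
    then have lt: "Suc (card E) \<le> card (clone u v E)" by simp
    then have "m (clone u v E) \<le> m E" using cl[OF uv] mx by simp
    moreover have "Suc (card E) * (nv * nv + 1) \<le> m (clone u v E)"
     unfolding m_def using lt by (meson mult_le_mono1 trans_le_add1)
    ultimately show False using tw_le[of E] by (simp add: m_def)
   qed
   show "twins V (clone u v E) \<le> twins V E" if uv: "u \<in> V" "v \<in> V" "u \<noteq> v" and eq: "card (clone u v E) = card E" for u v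
    using mx[OF cl[OF uv]] eq by (simp add: m_def)
  qed (use GE r3 in auto)
  have lam: "kkt.lam P x = rcard E / real nv ^ r"
   using lam_eq kkt.lam_def[OF kkt] by (simp add: clone_maximal.n_def[OF clone_maximal_axioms] nv_def)
  have "lam0 - d2 \<le> kkt.lam P x" using dK(2) GE(4) n(2) unfolding lam by (simp add: field_simps)
  moreover have "kkt r C P x (1 / real nv)" using kkt by (simp add: clone_maximal.n_def[OF clone_maximal_axioms] nv_def)
  ultimately obtain \<phi> where phi: "bij_betw \<phi> C I" "(\<lambda>X. \<phi> ` X) ` P = Bk" "\<forall>c\<in>C. \<bar>x c - ik\<bar> \<le> e"
   using LA[of C P x "1 / real nv"] en by auto
  define f where "f v = \<phi> (g v)" for v
  have fI: "f ` V \<subseteq> I" using phi(1) by (auto simp: f_def C_def bij_betw_def)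
  have inj: "inj_on \<phi> C" using phi(1) by (rule bij_betw_imp_inj_on)
  have "Bl f V \<subseteq> E"
  proof
   fix X assume "X \<in> Bl f V"
   then have X: "X \<subseteq> V" "card X = r" "f ` X \<in> Bk" by (auto simp: Bl_def)
   then obtain p where p: "p \<in> P" "f ` X = \<phi> ` p" using phi(2) by (metis imageE)
   have "\<phi> ` (g ` X) = \<phi> ` p" using p(2) by (simp add: f_def image_image)
   moreover have "g ` X \<subseteq> C" "p \<subseteq> C" using X edgeP[OF p(1)] by (auto simp: C_def)
   ultimately have "g ` X = p" using inj by (simp add: inj_on_image_eq_iff)
   then show "X \<in> E" using edge_P[OF X(1,2)] p by simp
  qed
  then have "Bl f V - E = {}" by auto
  then have "rcard (Bl f V - E) \<le> e * real nv ^ r" using e by (metis card.empty of_nat_0 mult_nonneg_nonneg less_imp_le of_nat_0_le_iff zero_le_power)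
  moreover have "\<bar>rcard {v \<in> V. f v = i} - real nv / real k\<bar> \<le> e * real nv" if "i \<in> I" for i
  proof -
   have "i \<in> \<phi> ` C" using that bij_betw_imp_surj_on[OF phi(1)] by simp
   then obtain c where c: "c \<in> C" "\<phi> c = i" by auto
   have "f v = i \<longleftrightarrow> g v = c" if "v \<in> V" for v
   proof -
    have "g v \<in> C" using that by (simp add: C_def)
    then show ?thesis using inj_on_eq_iff[OF inj, of "g v" c] c by (simp add: f_def)
   qed
   then have "{v \<in> V. f v = i} = {v \<in> V. g v = c}" by blast
   then have "rcard {v \<in> V. f v = i} = x c * real nv"
    using n(2) by (simp add: x_def N_def clone_maximal.n_def[OF clone_maximal_axioms] nv_def)
   moreover have "\<bar>x c - ik\<bar> * real nv \<le> e * real nv" using phi(3) c by (intro mult_right_mono) auto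
   moreover have "\<bar>x c - ik\<bar> * real nv = \<bar>(x c - ik) * real nv\<bar>" by (simp only: abs_mult abs_of_nat)
   moreover have "(x c - ik) * real nv = x c * real nv - real nv / real k" by (simp add: left_diff_distrib)
   ultimately show ?thesis by simp
  qed
  ultimately have "near e V E f" using fI e by (simp add: near_def nv_def)
  then show False using GE(3) by blast
 qed
 moreover have "0 < d" using d1 d2 by (simp add: d_def)
 ultimately show ?thesis by blast
qed

text \<open>The subgraph of \<open>tfree_sfree_subgraph\<close> loses only \<open>O(n^(r-1))\<close>
  edges, less than \<open>d / 2 * n^r\<close>; a partition that suits it also suits
  \<open>E\<close>, which misses fewer blow-up edges.\<close>

lemma tfree_stability:
 assumes L: "lagr_stable TYPE('v)" and imp: "improves TYPE('v) e" and e: "0 < e"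
 shows "\<exists>d>0. \<exists>N. \<forall>(V :: 'v set) E. rgr r V E --> tfree E --> N \<le> card V -->
   (lam0 - d) * rcard V ^ r \<le> rcard E --> (\<exists>f. near e V E f)"
proof -
 obtain d N where d: "0 < d" and S: "\<And>(V :: 'v set) E. rgr r V E ==> sfree E ==> N \<le> card V ==>
   (lam0 - d) * rcard V ^ r \<le> rcard E ==> \<exists>f. near e V E f" using sfree_stability[OF assms] by blast
 define N' where "N' = max N (nat \<lceil>2 * real r / d\<rceil>)"
 have "\<exists>f. near e V E f" if E: "rgr r V E" "tfree E" "N' \<le> card V" "(lam0 - d / 2) * rcard V ^ r \<le> rcard E"
  for V :: "'v set" and E
 proof -
  let ?n = "rcard V"
  have "N \<le> card V" "nat \<lceil>2 * real r / d\<rceil> \<le> card V" using E(3) by (auto simp: N'_def)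
  then have n: "N \<le> card V" "2 * real r / d \<le> ?n" by linarith+
  obtain E' where E': "E' \<subseteq> E" "sfree E'" "card E \<le> card E' + (r - 1) * card V ^ (r - 1)"
   by (rule tfree_sfree_subgraph[OF E(1,2) r3])
  have r': "rgr r V E'" using E(1) E'(1) by (auto simp: rgr_def)
  have "rcard E \<le> real (card E' + (r - 1) * card V ^ (r - 1))" using E'(3) by (simp only: of_nat_le_iff)
  then have 1: "rcard E \<le> rcard E' + real (r - 1) * ?n ^ (r - 1)" by simp
  have "real (r - 1) * ?n ^ (r - 1) \<le> (d / 2 * ?n) * ?n ^ (r - 1)"
   using n(2) d by (intro mult_right_mono) (auto simp: field_simps)
  also have "... = d / 2 * ?n ^ r"
  proof -
   have "r = Suc (r - 1)" using r3 by simp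
   then have "?n ^ r = ?n * ?n ^ (r - 1)" by (metis power_Suc)
   then show ?thesis by simp
  qed
  finally have "(lam0 - d) * ?n ^ r \<le> rcard E'" using 1 E(4) by (simp add: algebra_simps)
  then obtain f where f: "near e V E' f" using S[OF r' E'(2) n(1)] by blast
  have finV: "finite V" using E(1) by (simp add: rgr_def)
  have "card (Bl f V - E) \<le> card (Bl f V - E')" using Bl_fin[OF finV] E'(1) by (intro card_mono) auto
  then have "near e V E f" using f by (auto simp: near_def intro: order_trans[of _ "rcard (Bl f V - E')"])
  then show ?thesis by blast
 qed
 moreover have "0 < d / 2" using d by simp
 ultimately show ?thesis by blast
qed

end

section \<open>The exact Turan theorem\<close>

lemma ex_part_sizes:
 assumes "finite J"
 shows "finite V ==> (\<Sum>i\<in>J. y i) = card V ==> \<exists>f. f ` V \<subseteq> J \<and> (\<forall>i\<in>J. card {v \<in> V. f v = i} = y i)"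
 using assms
proof (induction J arbitrary: V rule: finite_induct)
 case empty
 then show ?case by simp
next
 case (insert i J)
 have "y i \<le> card V" using insert by simp
 then obtain A where A: "A \<subseteq> V" "card A = y i" by (meson obtain_subset_with_card_n)
 have fA: "finite A" using A insert.prems finite_subset by blast
 have "(\<Sum>i\<in>J. y i) = card (V - A)" using insert A fA by (simp add: card_Diff_subset)
 then obtain f where f: "f ` (V - A) \<subseteq> J" "\<forall>j\<in>J. card {v \<in> V - A. f v = j} = y j"
  using insert.IH[of "V - A"] insert.prems by auto
 define g where "g v = (if v \<in> A then i else f v)" for v
 have "{v \<in> V. g v = i} = A" using A f(1) insert.hyps by (auto simp: g_def)
 moreover have "{v \<in> V. g v = j} = {v \<in> V - A. f v = j}" if "j \<in> J" for j
  using that insert.hyps A by (auto simp: g_def)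
 moreover have "g ` V \<subseteq> insert i J" using f(1) by (auto simp: g_def)
 ultimately show ?case using A f(2) by (intro exI[of _ g]) auto
qed

context steiner
begin

text \<open>A graph within \<open>c * s^2 * n^r\<close> of the top density can afford only small
  penalties: \<open>Z\<close> has at most \<open>s^2 * n\<close> vertices, few edges are missing,
  and part sizes are off by at most \<open>3 * s * n\<close>. Taking \<open>s \<le> e / 6\<close>
  turns this into \<open>e / 2\<close>.\<close>

lemma improves_master:
 fixes e c :: real
 assumes c: "0 < c" and e: "0 < e" and M: "\<And>(V :: 'v set) E f0. rgr r V E ==> tfree E ==> N0 \<le> card V ==> near e V E f0 ==>
  \<exists>f Z. f ` V \<subseteq> I \<and> Z \<subseteq> V \<and>
   deficit c V E f Z"
 shows "improves TYPE('v) e"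
proof -
 define s where "s = min 1 (e / 6)"
 have s: "0 < s" "s \<le> 1" "s \<le> e / 6" using e by (auto simp: s_def)
 have ss: "s ^ 2 \<le> s" using s by (simp add: power2_eq_square mult_left_le)
 have "\<exists>f'. near (e / 2) V E f'" if E: "rgr r V E" "tfree E" "max N0 1 \<le> card V" "near e V E f0"
  "(lam0 - c * s ^ 2) * rcard V ^ r \<le> rcard E" for V :: "'v set" and E f0
 proof -
  define n where "n = rcard V"
  have n: "1 \<le> n" using E(3) by (simp add: n_def)
  have finV: "finite V" using E(1) by (simp add: rgr_def)
  have p: "n ^ (r - 1) = n * n ^ (r - 2)" "n ^ r = n * n ^ (r - 1)" by (rule pow_r1 pow_r)+
  obtain f Z where f: "f ` V \<subseteq> I" "Z \<subseteq> V" and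
   b: "rcard E \<le> lam0 * n ^ r - c * rcard Z * n ^ (r - 1)
    - c * rcard (Bl f (V - Z) - E)
    - c * n ^ (r - 2) * (\<Sum>i\<in>I. (rcard {v \<in> V - Z. f v = i} - (n - rcard Z) / real k) ^ 2)"
   using M[OF E(1,2) _ E(4)] E(3) unfolding n_def by auto
  define z where "z = rcard Z"
  define m where "m = rcard (Bl f (V - Z) - E)"
  define D where "D = (\<Sum>i\<in>I. (rcard {v \<in> V - Z. f v = i} - (n - z) / real k) ^ 2)"
  have finZ: "finite Z" using f finV finite_subset by blast
  have z0: "0 \<le> z" "0 \<le> m" "0 \<le> D" by (auto simp: z_def m_def D_def intro: sum_nonneg)
  have "c * (z * n ^ (r - 1) + m + n ^ (r - 2) * D) \<le> c * (s ^ 2 * n ^ r)"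
   using b E(5) unfolding n_def[symmetric] z_def[symmetric] m_def[symmetric] D_def[symmetric] by (simp add: algebra_simps)
  then have t: "z * n ^ (r - 1) + m + n ^ (r - 2) * D \<le> s ^ 2 * n ^ r" using c by simp
  have nn: "0 < n ^ (r - 1)" "0 < n ^ (r - 2)" using n by simp_all
  have zz: "0 \<le> z * n ^ (r - 1)" "0 \<le> n ^ (r - 2) * D" using z0 nn by simp_all
  have "z * n ^ (r - 1) \<le> (s ^ 2 * n) * n ^ (r - 1)" using t zz z0 p by (simp add: mult.assoc)
  then have zs: "z \<le> s ^ 2 * n" using nn by (simp add: mult_le_cancel_right_pos)
  have ms: "m \<le> s ^ 2 * n ^ r" using t zz by linarith
  have "n ^ (r - 2) * D \<le> n ^ (r - 2) * (s * n) ^ 2" using t zz z0 p by (simp add: power2_eq_square mult_ac)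
  then have Ds: "D \<le> (s * n) ^ 2" using nn by (simp add: mult_le_cancel_left_pos)
  have "s ^ 2 * n \<le> s * n" using ss n by (intro mult_right_mono) auto
  then have zsn: "z \<le> s * n" using zs by linarith
  have dev: "\<bar>rcard {v \<in> V. f v = i} - n / real k\<bar> \<le> e / 2 * n" if i: "i \<in> I" for i
  proof -
   have "(rcard {v \<in> V - Z. f v = i} - (n - z) / real k) ^ 2 \<le> D"
    unfolding D_def using i finI by (intro member_le_sum) auto
   then have "\<bar>rcard {v \<in> V - Z. f v = i} - (n - z) / real k\<bar> ^ 2 \<le> (s * n) ^ 2"
    using Ds unfolding power2_abs by linarith
   moreover have "0 \<le> s * n" using s(1) n by simp
   ultimately have "\<bar>rcard {v \<in> V - Z. f v = i} - (n - z) / real k\<bar> \<le> s * n" by (rule power2_le_imp_le)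
   moreover have "\<bar>rcard {v \<in> V. f v = i} - rcard {v \<in> V - Z. f v = i}\<bar> \<le> rcard Z"
    using finV finZ by (intro card_diff_le) auto
   moreover have "0 \<le> z / real k" "z / real k \<le> z / 1" using z0 rk by (simp, intro divide_left_mono, auto)
   moreover have "(n - z) / real k = n / real k - z / real k" by (rule diff_divide_distrib)
   ultimately have "\<bar>rcard {v \<in> V. f v = i} - n / real k\<bar> \<le> s * n + 2 * z"
    using z0(1) unfolding z_def[symmetric] abs_le_iff by linarith
   also have "... \<le> 3 * (s * n)" using zsn by linarith
   also have "... \<le> e / 2 * n" using s(3) n mult_right_mono[of s "e / 6" n] by simp
   finally show ?thesis .
  qed
  have "Bl f V - E \<subseteq> (Bl f (V - Z) - E) \<union> (\<Union>w\<in>Z. sups r V {w})" by (auto simp: Bl_def)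
  then have "card (Bl f V - E) \<le> card ((Bl f (V - Z) - E) \<union> (\<Union>w\<in>Z. sups r V {w}))"
   using finZ finV Bl_fin[of "V - Z" f] by (intro card_mono) (auto intro: finite_subset[of _ "Pow V"])
  also have "... \<le> card (Bl f (V - Z) - E) + card (\<Union>w\<in>Z. sups r V {w})" by (rule card_Un_le)
  also have "... \<le> card (Bl f (V - Z) - E) + (\<Sum>w\<in>Z. card (sups r V {w}))"
   using finZ by (intro add_left_mono card_UN_le)
  also have "... \<le> card (Bl f (V - Z) - E) + (\<Sum>w\<in>Z. card V ^ (r - 1))"
  proof (intro add_left_mono sum_mono)
   fix w
   show "card (sups r V {w}) \<le> card V ^ (r - 1)" using card_supersets_le[OF finV, of "{w}" r] by simp
  qed
  finally have "rcard (Bl f V - E) \<le> real (card (Bl f (V - Z) - E) + (\<Sum>w\<in>Z. card V ^ (r - 1)))"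
   by (simp only: of_nat_le_iff)
  then have "rcard (Bl f V - E) \<le> m + z * n ^ (r - 1)" by (simp add: m_def z_def n_def)
  also have "... \<le> s ^ 2 * n ^ r + (s ^ 2 * n) * n ^ (r - 1)" using ms zs nn by (intro add_mono mult_right_mono) auto
  also have "... = 2 * s ^ 2 * n ^ r" using p by simp
  also have "... \<le> e / 2 * n ^ r" using ss s n by (intro mult_right_mono) auto
  finally show ?thesis using dev f(1) by (intro exI[of _ f]) (simp add: near_def n_def)
 qed
 moreover have "0 < c * s ^ 2" using c s by simp
 ultimately show ?thesis unfolding improves_def by blast
qed

text \<open>\<open>master\<close> enters twice: it provides the self-improvement behind stability,
  and it is applied to the partition that stability finds.\<close>

theorem tfree_structure:
 assumes L: "lagr_stable TYPE('v)" and c0: "0 < c0"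
 shows "\<exists>c>0. \<exists>d>0. \<exists>N. \<forall>(V :: 'v set) E. rgr r V E --> tfree E --> N \<le> card V -->
   (lam0 - d) * rcard V ^ r \<le> rcard E -->
  structured c c0 V E"
proof -
 from master[OF c0, where ?'v = 'v]
 obtain c e N0 where c: "0 < c" and e: "0 < e" and M: "\<forall>(V :: 'v set) E f0. rgr r V E --> tfree E --> N0 \<le> card V --> near e V E f0 -->
  structured c c0 V E" by (elim exE conjE) (rule that)
 have imp: "improves TYPE('v) e"
 proof (rule improves_master[OF c e, of N0])
  fix V :: "'v set" and E f0
  assume a: "rgr r V E" "tfree E" "N0 \<le> card V" "near e V E f0"
  show "\<exists>f Z. f ` V \<subseteq> I \<and> Z \<subseteq> V \<and>
   deficit c V E f Z" using conjunct1[OF M[rule_format, OF a]] by (elim exE conjE) (intro exI conjI)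
 qed
 obtain d N where d: "0 < d" and S: "\<forall>(V :: 'v set) E. rgr r V E --> tfree E --> N \<le> card V -->
   (lam0 - d) * rcard V ^ r \<le> rcard E --> (\<exists>f. near e V E f)" using tfree_stability[OF L imp e] by blast
 show ?thesis
 proof (rule exI[of _ c], rule conjI[OF c], rule exI[of _ d], rule conjI[OF d], rule exI[of _ "max N N0"], intro allI impI)
  fix V :: "'v set" and E
  assume a: "rgr r V E" "tfree E" "max N N0 \<le> card V" "(lam0 - d) * rcard V ^ r \<le> rcard E"
  obtain f where "near e V E f" using S a by (meson max.boundedE)
  then show "structured c c0 V E" by (intro M[rule_format, OF a(1,2)]) (use a(3) in auto)
 qed
qed

lemma sum_sizes:
 assumes "finite V" "f ` V \<subseteq> I"
 shows "(\<Sum>i\<in>I. card {v \<in> V. f v = i}) = card V"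
proof -
 have "V = (\<Union>i\<in>I. {v \<in> V. f v = i})" using assms by auto
 then have "card V = card (\<Union>i\<in>I. {v \<in> V. f v = i})" by simp
 also have "... = (\<Sum>i\<in>I. card {v \<in> V. f v = i})" using finI assms by (intro card_UN_disjoint) auto
 finally show ?thesis by simp
qed

lemma ex_balanced:
 assumes "finite V" "J \<subseteq> I" "card J = card V mod k"
 shows "\<exists>f. f ` V \<subseteq> I \<and> (\<forall>i\<in>I. card {v \<in> V. f v = i} = card V div k + of_bool (i \<in> J))"
proof (rule ex_part_sizes[OF finI assms(1)])
 have "{x \<in> I. x \<in> J} = J" using assms by auto
 then have "(\<Sum>i\<in>I. of_bool (i \<in> J)) = card J" using finI by (simp add: of_bool_def sum.If_cases Int_def)
 then show "(\<Sum>i\<in>I. card V div k + of_bool (i \<in> J)) = card V" using cardI assms by (simp add: sum.distrib)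
qed

lemma ex_large_blowup:
 assumes "finite V" "k \<le> card V"
 shows "\<exists>f. f ` V \<subseteq> I \<and>
  lam0 * rcard V ^ r - (b2 * real k + 2 ^ k * rcard Bk) * rcard V ^ (r - 2) \<le> rcard (Bl f V)"
proof -
 have "card V mod k \<le> card I" using cardI rk by (simp add: less_imp_le)
 then obtain J where "J \<subseteq> I" "card J = card V mod k" by (meson obtain_subset_with_card_n)
 then obtain f where f: "f ` V \<subseteq> I" "\<forall>i\<in>I. card {v \<in> V. f v = i} = card V div k + of_bool (i \<in> J)"
  using ex_balanced[OF assms(1)] by blast
 have "lam0 * rcard V ^ r - (b2 * real k + 2 ^ k * rcard Bk) * rcard V ^ (r - 2)
  \<le> Np (\<lambda>j. rcard {a \<in> V. f a = j})"
 proof (rule Np_balanced_ge)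
  show "(\<Sum>j\<in>I. rcard {a \<in> V. f a = j}) = rcard V"
   using arg_cong[OF sum_sizes[OF assms(1) f(1)], of real] by (simp only: of_nat_sum)
  show "\<bar>rcard {a \<in> V. f a = j} - rcard V / real k\<bar> \<le> 1" if "j \<in> I" for j
  proof -
   have e: "rcard V = real k * real (card V div k) + real (card V mod k)" by (metis mult_div_mod_eq of_nat_add of_nat_mult)
   have "card V mod k < k" using rk by simp
   then have "rcard V / real k = real (card V div k) + real (card V mod k) / real k"
    "0 \<le> real (card V mod k) / real k" "real (card V mod k) / real k \<le> 1"
    using k0 unfolding e by (simp_all add: add_divide_distrib)
   then show ?thesis using f(2) that by (cases "j \<in> J") auto
  qed
 qed (use assms in simp)
 then show ?thesis using card_Bl_Np[OF assms(1), of f] f(1) by (intro exI[of _ f]) simp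
qed

text \<open>Two edges sharing \<open>r - 1\<close> vertices have the same image block by uniqueness,
  so their last vertices lie in one part and therefore in no common edge.\<close>

lemma Bl_tfree: "tfree (Bl f V)" unfolding tfree_def
proof (intro allI impI notI)
 fix S a b D
 assume a: "a \<notin> S" "b \<notin> S" "a \<noteq> b" "insert a S \<in> Bl f V" "insert b S \<in> Bl f V" "D \<in> Bl f V" "a \<in> D" "b \<in> D"
 have inj: "inj_on f X" "finite X" if "X \<in> Bl f V" for X
 proof -
  have c: "card (f ` X) = card X" "card X = r" using that blk by (auto simp: Bl_def)
  then show "finite X" using r3 by (metis card.infinite not_numeral_le_zero)
  then show "inj_on f X" using c by (intro eq_card_imp_inj_on) auto
 qed
 have fS: "finite S" using inj(2)[OF a(4)] by simp
 have "card (insert a S) = r" using a(4) by (simp add: Bl_def)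
 then have cS: "card S = r - 1" using a(1) fS by simp
 have "card (f ` S) = r - 1" using inj(1)[OF a(4)] cS by (simp add: card_image inj_on_insert)
 then have "f ` insert a S = f ` insert b S"
  using blk_eq[of "f ` S" "f ` insert a S" "f ` insert b S"] a(4,5) by (auto simp: Bl_def)
 moreover have "f a \<notin> f ` S" using inj(1)[OF a(4)] a(1) by (auto simp: inj_on_insert)
 ultimately have "f a = f b" by auto
 then show False using inj(1)[OF a(6)] a(3,7,8) by (auto simp: inj_on_def)
qed

lemma Bl_rgr: "finite V ==> rgr r V (Bl f V)" by (auto simp: rgr_def Bl_def)

text \<open>Balanced blow-ups are only \<open>O(n^(r-2))\<close> below \<open>lam0 * n^r\<close>,
  while a single vertex in \<open>Z\<close> would cost \<open>c * n^(r-1)\<close>; hence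
  \<open>Z\<close> is empty. Comparison with the blow-up along the same \<open>f\<close> then leaves
  no missing edge, and so no bad one.\<close>

theorem tfree_exact:
 assumes L: "lagr_stable TYPE('v)" and c0: "0 < c0"
 shows "\<exists>N. \<forall>(V :: 'v set) E. rgr r V E --> tfree E --> N \<le> card V -->
   (\<forall>f. f ` V \<subseteq> I --> card (Bl f V) \<le> card E) -->
   (\<exists>f. f ` V \<subseteq> I \<and> E = Bl f V \<and>
    spread c0 V f)"
proof -
 obtain c d N where c: "0 < c" and d: "0 < d" and S: "\<forall>(V :: 'v set) E. rgr r V E --> tfree E --> N \<le> card V -->
   (lam0 - d) * rcard V ^ r \<le> rcard E -->
  structured c c0 V E" using tfree_structure[OF L c0] by (elim exE conjE) (rule that)
 define K where "K = b2 * real k + 2 ^ k * rcard Bk"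
 have K0: "0 \<le> K" by (simp add: K_def)
 define N' where "N' = max N (max k (max (nat \<lceil>K / d\<rceil>) (nat \<lceil>K / c\<rceil> + 1)))"
 have "\<exists>f. f ` V \<subseteq> I \<and> E = Bl f V \<and>
    spread c0 V f"
  if a: "rgr r V E" "tfree E" "N' \<le> card V" "\<And>f. f ` V \<subseteq> I ==> card (Bl f V) \<le> card E" for V :: "'v set" and E
 proof -
  define n where "n = rcard V"
  have finV: "finite V" using a(1) by (simp add: rgr_def)
  have "N \<le> card V" "k \<le> card V" "nat \<lceil>K / d\<rceil> \<le> card V" "nat \<lceil>K / c\<rceil> + 1 \<le> card V" using a(3) by (auto simp: N'_def)
  then have n: "N \<le> card V" "k \<le> card V" "K / d \<le> n" "K / c < n" unfolding n_def by linarith+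
  then have nn: "K \<le> d * n" "K < c * n" "1 \<le> n" using c d rk by (auto simp: field_simps n_def)
  have p: "n ^ (r - 1) = n * n ^ (r - 2)" "n ^ r = n * n ^ (r - 1)" by (rule pow_r1 pow_r)+
  have pw: "1 \<le> n ^ (r - 2)" "n ^ (r - 2) \<le> n ^ (r - 1)" using nn(3) by (auto intro: power_increasing)
  obtain f0 where f0: "f0 ` V \<subseteq> I" "lam0 * n ^ r - K * n ^ (r - 2) \<le> rcard (Bl f0 V)"
   using ex_large_blowup[OF finV n(2)] by (auto simp: K_def n_def)
  have lo: "lam0 * n ^ r - K * n ^ (r - 2) \<le> rcard E" using f0 a(4)[OF f0(1)] by linarith
  have "K * n ^ (r - 2) \<le> d * n * n ^ (r - 1)" using nn pw K0 by (intro mult_mono) auto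
  then have dense: "(lam0 - d) * n ^ r \<le> rcard E" using lo p by (simp add: algebra_simps)
  from S[rule_format, OF a(1,2) n(1) dense[unfolded n_def]]
  obtain f Z where f: "f ` V \<subseteq> I" "Z \<subseteq> V" and
   b: "rcard E \<le> lam0 * n ^ r - c * rcard Z * n ^ (r - 1)
    - c * rcard (Bl f (V - Z) - E)
    - c * n ^ (r - 2) * (\<Sum>i\<in>I. (rcard {v \<in> V - Z. f v = i} - (n - rcard Z) / real k) ^ 2)"
   and Z: "Z = {} --> rcard E \<le> rcard (Bl f V) - c * rcard (Bl f V - E)"
    "Z = {} --> Bl f V \<subseteq> E --> E = Bl f V"
   and sz: "spread c0 V f" unfolding n_def by (elim exE conjE) (rule that[unfolded n_def])
  have finZ: "finite Z" using f finV finite_subset by blast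
  have "Z = {}"
  proof (rule ccontr)
   assume "Z \<noteq> {}"
   then have "1 \<le> rcard Z" using finZ by (simp add: Suc_leI card_gt_0_iff)
   then have "c * 1 * n ^ (r - 1) \<le> c * rcard Z * n ^ (r - 1)" using c nn by (intro mult_right_mono mult_left_mono) auto
   moreover have "0 \<le> c * rcard (Bl f (V - Z) - E)" using c by simp
   moreover have "0 \<le> c * n ^ (r - 2) * (\<Sum>i\<in>I. (rcard {v \<in> V - Z. f v = i} - (n - rcard Z) / real k) ^ 2)"
    using c nn by (intro mult_nonneg_nonneg sum_nonneg) auto
   ultimately have "c * n ^ (r - 1) \<le> K * n ^ (r - 2)" using b lo by linarith
   moreover have "K * n ^ (r - 2) < c * n * n ^ (r - 2)" using nn pw by (intro mult_strict_right_mono) auto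
   ultimately show False using p by simp
  qed
  have "Bl f V \<subseteq> E"
  proof -
   have "c * rcard (Bl f V - E) \<le> 0" using Z(1) \<open>Z = {}\<close> a(4)[OF f(1)] by simp
   then have "card (Bl f V - E) = 0" using c by (simp add: mult_le_0_iff)
   then have "Bl f V - E = {}" using Bl_fin[OF finV, of f] by simp
   then show ?thesis by blast
  qed
  then show ?thesis using Z(2) \<open>Z = {}\<close> f(1) sz by blast
 qed
 then show ?thesis by blast
qed

end

section \<open>Maximum blow-ups\<close>

lemma prod_of_bool: "finite Y ==> (\<Prod>j\<in>Y. of_bool (j \<in> J)) = (of_bool (Y \<subseteq> J) :: real)"
 by (induction Y rule: finite_induct) auto

lemma int_aux: fixes x y D :: int shows "x - y \<le> D ==> x \<le> 1 \<or> x \<le> 2 * (x - y) ==> 1 \<le> D ==> x \<le> 2 * D"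
 by presburger

lemma sum_small_subsets:
 fixes g :: "nat => real"
 assumes "finite J"
 shows "(\<Sum>Y | Y \<subseteq> J \<and> card Y < r. g (card Y)) = (\<Sum>j<r. real (card J choose j) * g j)"
proof -
 let ?A = "{Y. Y \<subseteq> J \<and> card Y < r}"
 have fA: "finite ?A" by (rule finite_subset[of _ "Pow J"]) (use assms in auto)
 have "(\<Sum>Y\<in>?A. g (card Y)) = (\<Sum>j\<in>{..<r}. \<Sum>Y\<in>{Y \<in> ?A. card Y = j}. g (card Y))"
  by (rule sum.group[symmetric]) (use fA in auto)
 also have "... = (\<Sum>j<r. real (card J choose j) * g j)"
 proof (rule sum.cong[OF refl])
  fix j assume "j \<in> {..<r}"
  then have "{Y \<in> ?A. card Y = j} = {Y. Y \<subseteq> J \<and> card Y = j}" by auto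
  then show "(\<Sum>Y\<in>{Y \<in> ?A. card Y = j}. g (card Y)) = real (card J choose j) * g j"
   using n_subsets[OF assms, of j] by simp
 qed
 finally show ?thesis .
qed

context steiner
begin

text \<open>A subset of \<open>J\<close> with fewer than \<open>r\<close> points lies in a number of
  blocks depending on its size only. So for a given \<open>card J\<close> the edge count is decided
  by the number of blocks inside \<open>J\<close>.\<close>

lemma Np_indicator:
 assumes J: "J \<subseteq> I"
 shows "Np (\<lambda>i. q + of_bool (i \<in> J)) =
  (\<Sum>j<r. real (card J choose j) * (real (bn j) * q ^ (r - j))) + rcard {B \<in> Bk. B \<subseteq> J}"
proof -
 have fJ: "finite J" using J finI finite_subset by blast
 have "Np (\<lambda>i. q + of_bool (i \<in> J)) = (\<Sum>B\<in>Bk. \<Sum>Y\<in>Pow J. if Y \<subseteq> B then q ^ (r - card Y) else 0)"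
  unfolding Np_def
 proof (rule sum.cong[OF refl])
  fix B assume B: "B \<in> Bk"
  then have fB: "finite B" "card B = r" using blk blk_fin by auto
  have "(\<Prod>j\<in>B. q + of_bool (j \<in> J)) = (\<Sum>Y\<in>Pow B. q ^ (r - card Y) * (\<Prod>j\<in>Y. of_bool (j \<in> J)))"
   using prod_add_expand[OF fB(1), of q "\<lambda>j. of_bool (j \<in> J)"] fB(2) by simp
  also have "... = (\<Sum>Y\<in>Pow B. if Y \<subseteq> J then q ^ (r - card Y) else 0)"
  proof (rule sum.cong[OF refl])
   fix Y assume "Y \<in> Pow B"
   then have "finite Y" using fB finite_subset by auto
   from prod_of_bool[OF this, of J]
   show "q ^ (r - card Y) * (\<Prod>j\<in>Y. of_bool (j \<in> J)) = (if Y \<subseteq> J then q ^ (r - card Y) else 0)" by simp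
  qed
  also have "... = (\<Sum>Y\<in>Pow (B \<inter> J). q ^ (r - card Y))" by (rule sum.mono_neutral_cong_right) (use fB in auto)
  also have "... = (\<Sum>Y\<in>Pow J. if Y \<subseteq> B then q ^ (r - card Y) else 0)"
   by (rule sum.mono_neutral_cong_left) (use fJ in auto)
  finally show "(\<Prod>j\<in>B. q + of_bool (j \<in> J)) = (\<Sum>Y\<in>Pow J. if Y \<subseteq> B then q ^ (r - card Y) else 0)" .
 qed
 also have "... = (\<Sum>Y\<in>Pow J. \<Sum>B\<in>Bk. if Y \<subseteq> B then q ^ (r - card Y) else 0)" by (rule sum.swap)
 also have "... = (\<Sum>Y\<in>Pow J. if card Y < r then real (bn (card Y)) * q ^ (r - card Y) else of_bool (Y \<in> Bk))"
 proof (rule sum.cong[OF refl])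
  fix Y assume Y: "Y \<in> Pow J"
  have "(\<Sum>B\<in>Bk. if Y \<subseteq> B then q ^ (r - card Y) else 0) = rcard {B \<in> Bk. Y \<subseteq> B} * q ^ (r - card Y)"
   using finBk by (simp add: sum.If_cases Int_def)
  also have "... = (if card Y < r then real (bn (card Y)) * q ^ (r - card Y) else of_bool (Y \<in> Bk))"
  proof (cases "card Y < r")
   case True
   then show ?thesis using bn_through[of Y] Y J by auto
  next
   case False
   have "B = Y" if "B \<in> Bk" "Y \<subseteq> B" for B
    using that False blk[OF that(1)] blk_fin[OF that(1)] card_seteq[of B Y] by auto
   then have "{B \<in> Bk. Y \<subseteq> B} = (if Y \<in> Bk then {Y} else {})" by auto
   then show ?thesis using False by auto
  qed
  finally show "(\<Sum>B\<in>Bk. if Y \<subseteq> B then q ^ (r - card Y) else 0)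
   = (if card Y < r then real (bn (card Y)) * q ^ (r - card Y) else of_bool (Y \<in> Bk))" .
 qed
 also have "... = (\<Sum>Y | Y \<subseteq> J \<and> card Y < r. real (bn (card Y)) * q ^ (r - card Y))
   + (\<Sum>Y\<in>Pow J \<inter> - {Y. card Y < r}. of_bool (Y \<in> Bk))" using fJ by (simp add: sum.If_cases Int_def)
 also have "(\<Sum>Y\<in>Pow J \<inter> - {Y. card Y < r}. of_bool (Y \<in> Bk)) = rcard {B \<in> Bk. B \<subseteq> J}"
 proof -
  have "{Y \<in> Pow J \<inter> - {Y. card Y < r}. Y \<in> Bk} = {B \<in> Bk. B \<subseteq> J}" using blk by auto
  then show ?thesis using fJ by (simp add: of_bool_def sum.If_cases Int_def conj_commute)
 qed
 also have "(\<Sum>Y | Y \<subseteq> J \<and> card Y < r. real (bn (card Y)) * q ^ (r - card Y))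
  = (\<Sum>j<r. real (card J choose j) * (real (bn j) * q ^ (r - j)))"
  by (rule sum_small_subsets[OF fJ, of "\<lambda>j. real (bn j) * q ^ (r - j)" r])
 finally show ?thesis .
qed

abbreviation balanced :: "'v set => ('v => 'i) => bool" where
 "balanced V f \<equiv> \<exists>J\<subseteq>I. card J = card V mod k \<and> (\<forall>i\<in>I. card {v \<in> V. f v = i} = card V div k + of_bool (i \<in> J)) \<and>
  (r \<le> card J --> (\<exists>B\<in>Bk. B \<subseteq> J))"

text \<open>With part sizes \<open>q + d i\<close>, the integer \<open>D\<close>, the sum of
  \<open>d i ^ 2 - d i\<close>, is nonnegative and vanishes only if all \<open>d i\<close> are 0 or
  1. If \<open>D \<ge> 1\<close>, the second-order term loses a multiple of \<open>D\<close> against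
  a balanced partition, more than the terms in \<open>Rest\<close> can repay.\<close>

lemma maximum_balanced:
 "\<exists>c0>0. \<exists>N. \<forall>(V :: 'v set) f. finite V --> N \<le> card V --> f ` V \<subseteq> I -->
   spread c0 V f -->
   (\<forall>g. g ` V \<subseteq> I --> card (Bl g V) \<le> card (Bl f V)) -->
   balanced V f"
proof -
 define C where "C = 2 ^ k * rcard Bk"
 define b where "b = b2"
 have b0: "0 < b" using bn_pos[of 2] r3 by (simp add: b_def)
 have C0: "0 < C" using bn_pos[of 0] card_Bk by (simp add: C_def)
 define e where "e = min 1 (b / (8 * C))"
 have e: "0 < e" "e \<le> 1" using b0 C0 by (auto simp: e_def)
 have Ce: "C * e \<le> b / 8"
 proof -
  have "e \<le> b / (8 * C)" by (simp add: e_def)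
  then show ?thesis using C0 by (simp add: field_simps)
 qed
 define c0 where "c0 = e / (2 * real k)"
 have c0: "0 < c0" using e k0 by (simp add: c0_def)
 define N where "N = max k (nat \<lceil>4 * real k / e\<rceil>)"
 have "balanced V f"
  if V: "finite V" "N \<le> card V" and f: "f ` V \<subseteq> I"
   and sz: "spread c0 V f"
   and mx: "\<forall>g. g ` V \<subseteq> I --> card (Bl g V) \<le> card (Bl f V)" for V :: "'v set" and f
 proof -
  define n where "n = rcard V"
  define q where "q = card V div k"
  define s where "s = card V mod k"
  define a where "a i = card {v \<in> V. f v = i}" for i
  define d where "d i = int (a i) - int q" for i
  let ?d = "\<lambda>i. real_of_int (d i)"
  have "k \<le> card V" "nat \<lceil>4 * real k / e\<rceil> \<le> card V" using V(2) by (auto simp: N_def)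
  then have "4 * real k / e \<le> n" unfolding n_def by linarith
  then have n4: "4 * real k \<le> e * n" using e by (simp add: field_simps)
  have sk: "s < k" unfolding s_def using rk by simp
  have nq: "n = real k * real q + real s" unfolding n_def q_def s_def by (metis mult_div_mod_eq of_nat_add of_nat_mult)
  then have nk: "n / real k = real q + real s / real k" using k0 by (simp add: add_divide_distrib)
  have sk1: "0 \<le> real s / real k" "real s / real k \<le> 1" using sk k0 by simp_all
  have c0n: "c0 * n + 1 \<le> e * real q"
  proof -
   have "e * n \<le> e * (real k * (real q + 1))" using nq sk e by (intro mult_left_mono) (auto simp: algebra_simps)
   then have "e * n + 4 * real k \<le> 2 * (real k * (e * real q)) + 2 * (real k * e)" using n4 by (simp add: algebra_simps)
   moreover have "real k * e \<le> real k" using e k0 by (simp add: mult_left_le)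
   ultimately have "e * n + 2 * real k \<le> 2 * (real k * (e * real q))" by linarith
   then show ?thesis using k0 unfolding c0_def by (simp add: field_simps)
  qed
  have cn0: "0 \<le> c0 * n" using c0 by (simp add: n_def)
  have eq1: "1 \<le> e * real q" using c0n cn0 by linarith
  then have q0: "0 < real q" using e by (metis less_eq_real_def linorder_not_less mult_zero_right of_nat_0_le_iff zero_less_one_class.zero_le_one not_one_le_zero)
  have dm: "\<bar>real_of_int (d i)\<bar> \<le> e * real q" if "i \<in> I" for i
  proof -
   have "real_of_int (d i) = real (a i) - real q" by (simp add: d_def)
   moreover have "\<bar>real (a i) - n / real k\<bar> \<le> c0 * n" using sz that by (simp add: a_def n_def)
   ultimately show ?thesis using nk sk1 c0n by linarith
  qed
  have sa: "(\<Sum>i\<in>I. a i) = card V" unfolding a_def by (rule sum_sizes[OF V(1) f])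
  have "(\<Sum>i\<in>I. real_of_int (d i)) = (\<Sum>i\<in>I. real (a i)) - real k * real q"
   using cardI by (simp add: d_def sum_subtractf)
  also have "(\<Sum>i\<in>I. real (a i)) = n" using sa unfolding n_def by (metis of_nat_sum)
  finally have sd: "(\<Sum>i\<in>I. real_of_int (d i)) = real s" using nq by simp
  have fN: "rcard (Bl f V) = Np (\<lambda>i. real q + real_of_int (d i))"
   using card_Bl_Np[OF V(1), of f] by (simp add: d_def a_def)
  have bal: "Np (\<lambda>i. real q + of_bool (i \<in> J)) \<le> rcard (Bl f V)" if J: "J \<subseteq> I" "card J = s" for J
  proof -
   obtain g where g: "g ` V \<subseteq> I" "\<forall>i\<in>I. card {v \<in> V. g v = i} = q + of_bool (i \<in> J)"
    using ex_balanced[OF V(1) J(1)] J(2) unfolding s_def q_def by blast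
   have "rcard (Bl g V) = Np (\<lambda>i. real q + of_bool (i \<in> J))" unfolding card_Bl_Np[OF V(1), of g] Np_def
   proof (intro sum.cong prod.cong refl)
    fix B j assume "B \<in> Bk" "j \<in> B"
    then have "j \<in> I" using blk by blast
    then show "rcard {x \<in> V. g x = j} = real q + of_bool (j \<in> J)" using g(2) by simp
   qed
   then show ?thesis using mx g(1) by (metis of_nat_le_iff)
  qed
  define D where "D = (\<Sum>i\<in>I. d i ^ 2 - d i)"
  have term0: "0 \<le> x ^ 2 - x" for x :: int
  proof (cases "1 \<le> x")
   case True then show ?thesis by (simp add: power2_eq_square mult_le_cancel_left1)
  next
   case False
   then have "0 \<le> (-x) * (1 - x)" by (intro mult_nonneg_nonneg) auto
   then show ?thesis by (simp add: power2_eq_square algebra_simps)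
  qed
  have D0: "0 \<le> D" unfolding D_def using term0 by (intro sum_nonneg)
  have "D = 0"
  proof (rule ccontr)
   assume "D \<noteq> 0"
   then have D1: "1 \<le> D" using D0 by linarith
   have d2: "d i ^ 2 \<le> 2 * D" if i: "i \<in> I" for i
   proof -
    have "d i ^ 2 - d i \<le> D" unfolding D_def using i finI term0 by (intro member_le_sum) auto
    moreover have "d i ^ 2 \<le> 1 \<or> d i ^ 2 \<le> 2 * (d i ^ 2 - d i)"
    proof -
     consider "d i \<le> 0" | "d i = 1" | "2 \<le> d i" by linarith
     then show ?thesis
     proof cases
      case 1 then have "0 \<le> d i ^ 2" by auto
      then have "0 \<le> d i ^ 2 + 2 * (- d i)" using 1 by (intro add_nonneg_nonneg) auto
      then have "d i ^ 2 \<le> 2 * (d i ^ 2 - d i)" by (simp add: algebra_simps)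
      then show ?thesis ..
     next
      case 3
      then have "2 * d i \<le> d i * d i" by (intro mult_right_mono) auto
      then show ?thesis by (simp add: power2_eq_square)
     qed simp
    qed
    ultimately show ?thesis using D1 by (rule int_aux)
   qed
   have "I \<noteq> {}" using cardI rk by auto
   define m where "m = Max ((\<lambda>i. \<bar>real_of_int (d i)\<bar>) ` I)"
   have "m \<in> (\<lambda>i. \<bar>real_of_int (d i)\<bar>) ` I" unfolding m_def using \<open>I \<noteq> {}\<close> finI by (intro Max_in) auto
   then obtain i0 where i0: "i0 \<in> I" "m = \<bar>real_of_int (d i0)\<bar>" by auto
   have mm: "\<bar>real_of_int (d i)\<bar> \<le> m" if "i \<in> I" for i unfolding m_def using that finI by (intro Max_ge) auto
   have "real_of_int (d i0 ^ 2) \<le> real_of_int (2 * D)" using d2[OF i0(1)] by (simp only: of_int_le_iff)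
   then have m2: "m ^ 2 \<le> 2 * real_of_int D" using i0(2) by simp
   have "\<bar>Rest (real q) ?d\<bar> \<le> 2 ^ k * rcard Bk * e * real q ^ (r - 2) * m ^ 2"
    by (rule Rest_le[OF q0 _ _ mm]) (use e dm[OF i0(1)] i0(2) in auto)
   then have R1: "\<bar>Rest (real q) ?d\<bar> \<le> C * e * (real q ^ (r - 2) * m ^ 2)" by (simp add: C_def mult.assoc)
   obtain J where J: "J \<subseteq> I" "card J = s" using sk cardI by (metis less_imp_le obtain_subset_with_card_n)
   have "\<bar>Rest (real q) (\<lambda>i. of_bool (i \<in> J))\<bar> \<le> 2 ^ k * rcard Bk * e * real q ^ (r - 2) * 1 ^ 2"
    using e eq1 by (intro Rest_le[OF q0]) auto
   then have R2: "\<bar>Rest (real q) (\<lambda>i. of_bool (i \<in> J))\<bar> \<le> C * e * (real q ^ (r - 2) * 1)"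
    by (simp add: C_def mult.assoc)
   have sb: "(\<Sum>i\<in>I. of_bool (i \<in> J)) = real s"
   proof -
    have "{x \<in> I. x \<in> J} = J" using J by auto
    then show ?thesis using finI J by (simp add: of_bool_def sum.If_cases Int_def)
   qed
   have "(\<Sum>i\<in>I. of_bool (i \<in> J) ^ 2) = (\<Sum>i\<in>I. of_bool (i \<in> J) :: real)" by (rule sum.cong) auto
   then have sb2: "(\<Sum>i\<in>I. of_bool (i \<in> J) ^ 2) = real s" using sb by simp
   have sd2: "(\<Sum>i\<in>I. real_of_int (d i) ^ 2) = real s + real_of_int D" using sd by (simp add: D_def sum_subtractf)
   define Q where "Q = real q ^ (r - 2)"
   have Q0: "0 < Q" using q0 by (simp add: Q_def)
   have "Np (\<lambda>i. real q + real_of_int (d i)) = rcard Bk * real q ^ r + real (bn 1) * real q ^ (r - 1) * real s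
    + b * Q * ((real s ^ 2 - (real s + real_of_int D)) / 2) + Rest (real q) ?d"
    using Np_expand[of "real q" ?d] unfolding sd sd2 b_def Q_def .
   moreover have "Np (\<lambda>i. real q + of_bool (i \<in> J)) = rcard Bk * real q ^ r + real (bn 1) * real q ^ (r - 1) * real s
    + b * Q * ((real s ^ 2 - real s) / 2) + Rest (real q) (\<lambda>i. of_bool (i \<in> J))"
    using Np_expand[of "real q" "\<lambda>i. of_bool (i \<in> J)"] unfolding sb sb2 b_def Q_def .
   moreover have "b * Q * ((real s ^ 2 - (real s + real_of_int D)) / 2) = b * Q * ((real s ^ 2 - real s) / 2) - b * (Q * real_of_int D) / 2"
    by (simp add: field_simps)
   moreover have "Np (\<lambda>i. real q + of_bool (i \<in> J)) \<le> Np (\<lambda>i. real q + real_of_int (d i))"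
    using bal[OF J] fN by simp
   moreover have "C * e * (Q * m ^ 2) \<le> b / 8 * (Q * (2 * real_of_int D))" using Ce m2 Q0 b0 by (intro mult_mono) auto
   moreover have "C * e * (Q * 1) \<le> b / 8 * (Q * real_of_int D)" using Ce D1 Q0 b0 by (intro mult_mono) auto
   ultimately have "b * (Q * real_of_int D) / 2 \<le> b / 8 * (Q * (2 * real_of_int D)) + b / 8 * (Q * real_of_int D)"
    using R1 R2 unfolding Q_def[symmetric] by linarith
   then have "b * (Q * real_of_int D) \<le> 0" by (simp add: mult_ac)
   moreover have "0 < b * (Q * real_of_int D)" using b0 Q0 D1 by simp
   ultimately show False by linarith
  qed
  have d01: "d i = 0 \<or> d i = 1" if i: "i \<in> I" for i
  proof -
   have "d i ^ 2 - d i = 0" using \<open>D = 0\<close> i sum_nonneg_eq_0_iff[OF finI, of "\<lambda>i. d i ^ 2 - d i"] term0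
    unfolding D_def by auto
   then have "d i * (d i - 1) = 0" by (simp add: power2_eq_square algebra_simps)
   then show ?thesis by auto
  qed
  define J where "J = {i \<in> I. d i = 1}"
  have JI: "J \<subseteq> I" by (auto simp: J_def)
  have dJ: "d i = of_bool (i \<in> J)" if "i \<in> I" for i using d01[OF that] that by (auto simp: J_def)
  have "(\<Sum>i\<in>I. real_of_int (d i)) = (\<Sum>i\<in>I. if i \<in> J then 1 else 0)" using dJ by (intro sum.cong) auto
  also have "... = rcard J" using finI by (simp add: sum.If_cases J_def Int_def)
  finally have cJ: "card J = s" using sd by simp
  have aJ: "a i = q + of_bool (i \<in> J)" if "i \<in> I" for i using dJ[OF that] by (cases "i \<in> J") (auto simp: d_def)
  \<comment> \<open>Otherwise a set of the same size that contains a block yields more edges, by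
    \<open>Np_indicator\<close>.\<close>
  have "\<exists>B\<in>Bk. B \<subseteq> J" if rJ: "r \<le> card J"
  proof (rule ccontr)
   assume no: "\<not> (\<exists>B\<in>Bk. B \<subseteq> J)"
   have "Bk \<noteq> {}" using bn_pos[of 0] card_Bk by auto
   then obtain B where B: "B \<in> Bk" by blast
   have BI: "B \<subseteq> I" "card B = r" using blk[OF B] by auto
   have "s - r \<le> card (I - B)" using BI cardI finI sk blk_fin[OF B] by (simp add: card_Diff_subset)
   then obtain R where R: "R \<subseteq> I - B" "card R = s - r" by (meson obtain_subset_with_card_n)
   have "finite R" using R finI finite_subset by blast
   then have "card (B \<union> R) = s" using R BI blk_fin[OF B] rJ cJ by (subst card_Un_disjoint) auto
   then have "Np (\<lambda>i. real q + of_bool (i \<in> B \<union> R)) \<le> rcard (Bl f V)" using R BI by (intro bal) auto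
   also have "... = Np (\<lambda>i. real q + of_bool (i \<in> J))" unfolding fN Np_def
   proof (intro sum.cong prod.cong refl)
    fix B j assume "B \<in> Bk" "j \<in> B"
    then have "j \<in> I" using blk by blast
    then show "real q + real_of_int (d j) = real q + of_bool (j \<in> J)" using dJ by simp
   qed
   finally have le: "Np (\<lambda>i. real q + of_bool (i \<in> B \<union> R)) \<le> Np (\<lambda>i. real q + of_bool (i \<in> J))" .
   have BRI: "B \<union> R \<subseteq> I" using R BI by auto
   have "card {X \<in> Bk. X \<subseteq> B \<union> R} \<le> card {X \<in> Bk. X \<subseteq> J}"
    using le unfolding Np_indicator[OF JI] Np_indicator[OF BRI] \<open>card (B \<union> R) = s\<close> cJ by simp
   moreover have "{X \<in> Bk. X \<subseteq> J} = {}" using no by blast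
   moreover have "B \<in> {X \<in> Bk. X \<subseteq> B \<union> R}" "finite {X \<in> Bk. X \<subseteq> B \<union> R}" using B finBk by auto
   ultimately show False by (metis card.empty card_eq_0_iff empty_iff le_zero_eq)
  qed
  then show ?thesis using JI cJ aJ unfolding a_def q_def s_def by (intro exI[of _ J]) blast
 qed
 then show ?thesis using c0 by blast
qed

lemma Bl_iso:
 fixes V :: "'v set" and V' :: "'w set"
 assumes V: "finite V" "finite V'" and f: "f ` V \<subseteq> I" and f': "f' ` V' \<subseteq> I"
  and \<sigma>: "bij_betw \<sigma> I I" "(\<lambda>B. \<sigma> ` B) ` Bk = Bk"
  and sz: "\<And>i. i \<in> I ==> card {v \<in> V. f v = i} = card {v \<in> V'. f' v = \<sigma> i}"
 shows "\<exists>g. bij_betw g V V' \<and> (\<lambda>X. g ` X) ` Bl f V = Bl f' V'"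
proof -
 have "\<exists>h. bij_betw h {v \<in> V. f v = i} {v \<in> V'. f' v = \<sigma> i}" if "i \<in> I" for i
  using V sz[OF that] by (intro finite_same_card_bij) auto
 then obtain h where h: "\<And>i. i \<in> I ==> bij_betw (h i) {v \<in> V. f v = i} {v \<in> V'. f' v = \<sigma> i}" by metis
 define g where "g v = h (f v) v" for v
 have inj\<sigma>: "inj_on \<sigma> I" and im\<sigma>: "\<sigma> ` I = I" using \<sigma>(1) by (auto simp: bij_betw_def)
 have gv: "g v \<in> V' \<and> f' (g v) = \<sigma> (f v)" if "v \<in> V" for v
 proof -
  have "f v \<in> I" using that f by auto
  then have "h (f v) ` {u \<in> V. f u = f v} = {u \<in> V'. f' u = \<sigma> (f v)}" using h bij_betw_imp_surj_on by blast
  then show ?thesis using that unfolding g_def by blast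
 qed
 have inj: "inj_on g V"
 proof (rule inj_onI)
  fix v w assume a: "v \<in> V" "w \<in> V" "g v = g w"
  have i: "f v \<in> I" "f w \<in> I" using a f by auto
  have "\<sigma> (f v) = \<sigma> (f w)" using gv a by metis
  then have e: "f v = f w" using inj\<sigma> i by (auto simp: inj_on_def)
  have "inj_on (h (f v)) {u \<in> V. f u = f v}" using h[OF i(1)] by (auto simp: bij_betw_def)
  then show "v = w" using a e unfolding g_def by (auto simp: inj_on_def)
 qed
 have im: "g ` V = V'"
 proof
  show "g ` V \<subseteq> V'" using gv by auto
  show "V' \<subseteq> g ` V"
  proof
   fix v' assume v': "v' \<in> V'"
   then have "f' v' \<in> \<sigma> ` I" using f' im\<sigma> by auto
   then obtain i where i: "i \<in> I" "f' v' = \<sigma> i" by auto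
   have "h i ` {u \<in> V. f u = i} = {u \<in> V'. f' u = \<sigma> i}" using h[OF i(1)] bij_betw_imp_surj_on by blast
   moreover have "v' \<in> {u \<in> V'. f' u = \<sigma> i}" using v' i by simp
   ultimately have "v' \<in> h i ` {u \<in> V. f u = i}" by simp
   then obtain v where "v \<in> V" "f v = i" "h i v = v'" by auto
   then show "v' \<in> g ` V" unfolding g_def by blast
  qed
 qed
 have fg: "f' ` (g ` X) = \<sigma> ` (f ` X)" if "X \<subseteq> V" for X using gv that by (force simp: image_image)
 have "(\<lambda>X. g ` X) ` Bl f V = Bl f' V'"
 proof
  show "(\<lambda>X. g ` X) ` Bl f V \<subseteq> Bl f' V'"
  proof
   fix Z assume "Z \<in> (\<lambda>X. g ` X) ` Bl f V"
   then obtain X where X: "X \<subseteq> V" "card X = r" "f ` X \<in> Bk" "Z = g ` X" by (auto simp: Bl_def)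
   have "card Z = r" using X inj inj_on_subset[OF inj X(1)] by (simp add: card_image)
   moreover have "f' ` Z \<in> Bk" unfolding X(4) fg[OF X(1)] using \<sigma>(2) X(3) by blast
   ultimately show "Z \<in> Bl f' V'" using X im by (auto simp: Bl_def)
  qed
  show "Bl f' V' \<subseteq> (\<lambda>X. g ` X) ` Bl f V"
  proof
   fix Z assume "Z \<in> Bl f' V'"
   then have Z: "Z \<subseteq> V'" "card Z = r" "f' ` Z \<in> Bk" by (auto simp: Bl_def)
   then obtain X where X: "X \<subseteq> V" "Z = g ` X" using im by (meson subset_imageE)
   have "card X = r" using Z X inj_on_subset[OF inj X(1)] by (simp add: card_image)
   moreover have "f ` X \<in> Bk"
   proof -
    have "\<sigma> ` (f ` X) \<in> (\<lambda>B. \<sigma> ` B) ` Bk" using Z(3) fg[OF X(1)] X(2) \<sigma>(2) by simp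
    then obtain B where B: "B \<in> Bk" "\<sigma> ` (f ` X) = \<sigma> ` B" by blast
    have "f ` X = B" using inj_on_image_eq_iff[OF inj\<sigma>, of "f ` X" B] B blk[OF B(1)] X f by blast
    then show ?thesis using B by simp
   qed
   ultimately show "Z \<in> (\<lambda>X. g ` X) ` Bl f V" using X by (auto simp: Bl_def)
  qed
 qed
 then show ?thesis using inj im by (auto simp: bij_betw_def)
qed

text \<open>Transitivity of the automorphism group on the possible sets of enlarged parts of a
  maximum blow-up: by \<open>maximum_balanced\<close>, such a set contains a block as soon as it has
  \<open>r\<close> points.\<close>

definition homogeneous :: bool where
 "homogeneous \<longleftrightarrow> (\<forall>J J'. J \<subseteq> I --> J' \<subseteq> I --> card J = card J' -->
   (r \<le> card J --> (\<exists>B\<in>Bk. B \<subseteq> J) \<and> (\<exists>B\<in>Bk. B \<subseteq> J')) -->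
   (\<exists>\<sigma>. bij_betw \<sigma> I I \<and> (\<lambda>B. \<sigma> ` B) ` Bk = Bk \<and> \<sigma> ` J = J'))"

definition tmax :: "'v set => 'v set set => bool" where
 "tmax V E \<longleftrightarrow> rgr r V E \<and> tfree E \<and> (\<forall>E'. rgr r V E' --> tfree E' --> card E' \<le> card E)"

lemma tmax_ex:
 assumes V: "finite V"
 shows "\<exists>E. tmax V E"
proof -
 define S where "S = {E. rgr r V E \<and> tfree E}"
 have fS: "finite S" by (rule finite_subset[of _ "Pow (Pow V)"]) (use V in "auto simp: S_def rgr_def")
 have "{} \<in> S" using V by (simp add: S_def rgr_def tfree_def)
 then have "Max (card ` S) \<in> card ` S" using fS by (intro Max_in) auto
 then obtain E where E: "E \<in> S" "Max (card ` S) = card E" by auto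
 have "card E' \<le> card E" if "E' \<in> S" for E' using Max_ge[of "card ` S" "card E'"] fS that E(2) by simp
 then show ?thesis using E(1) unfolding tmax_def S_def by blast
qed

theorem tmax_blowup:
 assumes L: "lagr_stable TYPE('v)"
 shows "\<exists>N. \<forall>(V :: 'v set) E. N \<le> card V --> tmax V E -->
   (\<exists>f. f ` V \<subseteq> I \<and> E = Bl f V \<and>
   balanced V f)"
proof -
 obtain c0 N1 where c0: "0 < c0" and N1: "\<forall>(V :: 'v set) f. finite V --> N1 \<le> card V --> f ` V \<subseteq> I -->
   spread c0 V f -->
   (\<forall>g. g ` V \<subseteq> I --> card (Bl g V) \<le> card (Bl f V)) -->
   balanced V f" using maximum_balanced[where ?'v = 'v] by (elim exE conjE) (rule that)
 obtain N2 where N2: "\<forall>(V :: 'v set) E. rgr r V E --> tfree E --> N2 \<le> card V -->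
   (\<forall>f. f ` V \<subseteq> I --> card (Bl f V) \<le> card E) -->
   (\<exists>f. f ` V \<subseteq> I \<and> E = Bl f V \<and>
    spread c0 V f)" using tfree_exact[OF L c0] by (elim exE conjE) (rule that)
 have main: "\<exists>f. f ` V \<subseteq> I \<and> E = Bl f V \<and>
   balanced V f" if V: "max N1 N2 \<le> card V" "tmax V E" for V :: "'v set" and E
 proof -
  have fV: "finite V" using V(2) by (auto simp: tmax_def rgr_def)
  have mx: "\<forall>g. g ` V \<subseteq> I --> card (Bl g V) \<le> card E"
  proof (intro allI impI)
   fix g :: "'v => 'i"
   show "card (Bl g V) \<le> card E" using V(2) Bl_tfree[of g V] Bl_rgr[OF fV, of g] unfolding tmax_def by blast
  qed
  have tE: "rgr r V E" "tfree E" "N2 \<le> card V" using V unfolding tmax_def by auto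
  obtain f where f: "f ` V \<subseteq> I" "E = Bl f V"
    "spread c0 V f"
   using mp[OF mp[OF mp[OF mp[OF spec[OF spec[OF N2]] tE(1)] tE(2)] tE(3)] mx] by (elim exE conjE) (rule that)
  have "N1 \<le> card V" using V(1) by simp
  from mp[OF mp[OF mp[OF mp[OF mp[OF spec[OF spec[OF N1]] fV] this] f(1)] f(3)] mx[unfolded f(2)]]
  show ?thesis by (intro exI[of _ f] conjI f(1,2))
 qed
 show ?thesis by (intro exI[of _ "max N1 N2"] allI impI) (rule main; assumption)
qed

theorem tmax_unique:
 assumes L: "lagr_stable TYPE('v)" and H: homogeneous
 shows "\<exists>N. \<forall>(V :: 'v set) E (V' :: 'v set) E'. N \<le> card V --> card V = card V' --> tmax V E --> tmax V' E' -->
   (\<exists>g. bij_betw g V V' \<and> (\<lambda>X. g ` X) ` E = E')"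
proof -
 obtain N where N: "\<forall>(V :: 'v set) E. N \<le> card V --> tmax V E -->
   (\<exists>f. f ` V \<subseteq> I \<and> E = Bl f V \<and>
   balanced V f)" using tmax_blowup[OF L] by (elim exE) (rule that)
 have main: "\<exists>g. bij_betw g V V' \<and> (\<lambda>X. g ` X) ` E = E'"
  if a: "N \<le> card V" "card V = card V'" "tmax V E" "tmax V' E'" for V V' :: "'v set" and E E'
 proof -
  obtain f J where f: "f ` V \<subseteq> I" "E = Bl f V" and J: "J \<subseteq> I" "card J = card V mod k"
   "\<forall>i\<in>I. card {v \<in> V. f v = i} = card V div k + of_bool (i \<in> J)" "r \<le> card J --> (\<exists>B\<in>Bk. B \<subseteq> J)"
   using N[rule_format, OF a(1,3)] by (elim exE conjE) (rule that)
  obtain f' J' where f': "f' ` V' \<subseteq> I" "E' = Bl f' V'" and J': "J' \<subseteq> I" "card J' = card V' mod k"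
   "\<forall>i\<in>I. card {v \<in> V'. f' v = i} = card V' div k + of_bool (i \<in> J')" "r \<le> card J' --> (\<exists>B\<in>Bk. B \<subseteq> J')"
   using N[rule_format, OF a(1)[unfolded a(2)] a(4)] by (elim exE conjE) (rule that)
  have cc: "card J = card J'" using J(2) J'(2) a(2) by simp
  obtain \<sigma> where \<sigma>: "bij_betw \<sigma> I I" "(\<lambda>B. \<sigma> ` B) ` Bk = Bk" "\<sigma> ` J = J'"
   using H[unfolded homogeneous_def, rule_format, OF J(1) J'(1) cc] J(4) J'(4) cc by auto
  have fin: "finite V" "finite V'" using a(3,4) by (auto simp: tmax_def rgr_def)
  have "card {v \<in> V. f v = i} = card {v \<in> V'. f' v = \<sigma> i}" if i: "i \<in> I" for i
  proof -
   have "\<sigma> i \<in> I" using \<sigma>(1) i by (auto simp: bij_betw_def)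
   moreover have "\<sigma> i \<in> J' \<longleftrightarrow> i \<in> J"
    using inj_on_image_mem_iff[of \<sigma> I i J] \<sigma> i J(1) by (auto simp: bij_betw_def)
   ultimately show ?thesis using J(3) J'(3) i a(2) by simp
  qed
  from Bl_iso[OF fin f(1) f'(1) \<sigma>(1,2) this] show ?thesis using f(2) f'(2) by simp
 qed
 show ?thesis by (intro exI[of _ N] allI impI) (rule main; assumption)
qed

end

section \<open>Disjoint copies\<close>

text \<open>\<open>Q\<close> is the vertex set of a generalized triangle. The form is free of the
  labels of \<open>T r\<close>; \<open>packs_iff\<close> makes the connection.\<close>

definition tcop :: "'v set set => 'v set => bool" where
 "tcop E Q \<longleftrightarrow> (\<exists>S a b D. a \<notin> S \<and> b \<notin> S \<and> a \<noteq> b \<and> insert a S \<in> E \<and> insert b S \<in> E \<and>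
   D \<in> E \<and> a \<in> D \<and> b \<in> D \<and> D \<inter> S = {} \<and> Q = S \<union> D)"

definition packs :: "nat => 'v set set => bool" where
 "packs k E \<longleftrightarrow> (\<exists>Q. (\<forall>i<k. tcop E (Q i)) \<and> disjoint_family_on Q {..<k})"

lemma tfree_tcop: "tfree E \<longleftrightarrow> \<not> (\<exists>Q. tcop E Q)" unfolding tfree_def tcop_def by blast

lemma packs_1: "packs 1 E \<longleftrightarrow> \<not> tfree E"
proof
 assume "packs 1 E"
 then show "\<not> tfree E" unfolding packs_def tfree_tcop by auto
next
 assume "\<not> tfree E"
 then obtain Q where "tcop E Q" unfolding tfree_tcop by blast
 then show "packs 1 E" unfolding packs_def by (intro exI[of _ "\<lambda>_. Q"]) (auto simp: disjoint_family_on_def)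
qed

lemma tcop_mono: "E \<subseteq> E' ==> tcop E Q ==> tcop E' Q" unfolding tcop_def by blast

lemma tcop_Union: "tcop E Q ==> Q \<subseteq> \<Union>E" unfolding tcop_def by blast

lemma tcop_avoid:
 assumes "tcop E Q" "Q \<inter> A = {}"
 shows "tcop {X \<in> E. X \<inter> A = {}} Q"
proof -
 obtain S a b D where t: "a \<notin> S" "b \<notin> S" "a \<noteq> b" "insert a S \<in> E" "insert b S \<in> E" "D \<in> E" "a \<in> D" "b \<in> D" "D \<inter> S = {}" "Q = S \<union> D"
  using assms(1) unfolding tcop_def by blast
 have "insert a S \<inter> A = {}" "insert b S \<inter> A = {}" "D \<inter> A = {}" using t assms(2) by auto
 then show ?thesis using t unfolding tcop_def by (intro exI[of _ S] exI[of _ a] exI[of _ b] exI[of _ D]) simp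
qed

lemma tcop_card:
 assumes E: "rgr r V E" and Q: "tcop E Q" and r: "1 \<le> r"
 shows "card Q = 2 * r - 1" "Q \<subseteq> V"
proof -
 obtain S a b D where t: "a \<notin> S" "insert a S \<in> E" "D \<in> E" "D \<inter> S = {}" "Q = S \<union> D"
  using Q unfolding tcop_def by blast
 have V: "finite V" "insert a S \<subseteq> V" "D \<subseteq> V" "card (insert a S) = r" "card D = r" using E t unfolding rgr_def by auto
 have fS: "finite S" "finite D" using V finite_subset by auto
 have "Suc (card S) = r" using V(4) t(1) fS by simp
 moreover have "card Q = card S + card D" using t fS by (simp add: card_Un_disjoint Int_commute)
 ultimately show "card Q = 2 * r - 1" using V by linarith
 show "Q \<subseteq> V" using t V by auto
qed

lemma not_packs_cover:
 assumes A: "finite A" "card A = t" and f: "tfree {X \<in> E. X \<inter> A = {}}"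
 shows "\<not> packs (t + 1) E"
proof
 assume "packs (t + 1) E"
 then obtain Q where Q: "\<And>i. i < t + 1 ==> tcop E (Q i)" and d: "disjoint_family_on Q {..<t + 1}" unfolding packs_def by blast
 have "\<exists>x. x \<in> Q i \<inter> A" if "i < t + 1" for i
 proof (rule ccontr)
  assume "\<not> (\<exists>x. x \<in> Q i \<inter> A)"
  then have "Q i \<inter> A = {}" by blast
  from tcop_avoid[OF Q[OF that] this] f show False unfolding tfree_tcop by blast
 qed
 then obtain x where x: "\<And>i. i < t + 1 ==> x i \<in> Q i \<inter> A" by metis
 have "inj_on x {..<t + 1}"
 proof (rule inj_onI)
  fix i j assume a: "i \<in> {..<t + 1}" "j \<in> {..<t + 1}" "x i = x j"
  show "i = j"
  proof (rule ccontr)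
   assume "i \<noteq> j"
   then have "Q i \<inter> Q j = {}" using d a unfolding disjoint_family_on_def by blast
   moreover have "x i \<in> Q i" "x i \<in> Q j" using x[of i] x[of j] a by auto
   ultimately show False by blast
  qed
 qed
 moreover have "x ` {..<t + 1} \<subseteq> A" using x by auto
 ultimately have "card {..<t + 1} \<le> card A" using A(1) by (metis card_inj_on_le)
 then show False using A by simp
qed

text \<open>The union of \<open>k\<close> disjoint copies avoiding \<open>v\<close> is such a set: a
  triangle disjoint from it would be one copy more.\<close>

lemma packs_obstruction:
 assumes E: "rgr r V E" and r: "1 \<le> r" and p: "packs k {X \<in> E. v \<notin> X}" and np: "\<not> packs (Suc k) E"
 shows "\<exists>S\<subseteq>V. v \<notin> S \<and> card S = k * (2 * r - 1) \<and> tfree {X \<in> E. X \<inter> S = {}}"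
proof -
 let ?F = "{X \<in> E. v \<notin> X}"
 obtain Q where Q: "\<And>i. i < k ==> tcop ?F (Q i)" and d: "disjoint_family_on Q {..<k}" using p unfolding packs_def by blast
 define S where "S = (\<Union>i\<in>{..<k}. Q i)"
 have F: "rgr r V ?F" using E unfolding rgr_def by auto
 have QV: "Q i \<subseteq> V" "card (Q i) = 2 * r - 1" if "i < k" for i using tcop_card[OF F Q[OF that] r] by auto
 have fV: "finite V" using E by (simp add: rgr_def)
 have fQ: "finite (Q i)" if "i < k" for i using QV(1)[OF that] fV finite_subset by blast
 have "card S = (\<Sum>i<k. card (Q i))" unfolding S_def
  using fQ d by (intro card_UN_disjoint) (auto simp: disjoint_family_on_def)
 then have cS: "card S = k * (2 * r - 1)" using QV by simp
 have vS: "v \<notin> S" using tcop_Union[OF Q] unfolding S_def by blast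
 have SV: "S \<subseteq> V" using QV(1) unfolding S_def by blast
 have "tfree {X \<in> E. X \<inter> S = {}}"
 proof (rule ccontr)
  assume "\<not> tfree {X \<in> E. X \<inter> S = {}}"
  then obtain R where R: "tcop {X \<in> E. X \<inter> S = {}} R" unfolding tfree_tcop by blast
  then have RS: "R \<inter> S = {}" using tcop_Union by fastforce
  define Q' where "Q' i = (if i < k then Q i else R)" for i
  have "tcop E (Q' i)" if "i < Suc k" for i unfolding Q'_def using Q tcop_mono[OF _ R, of E] tcop_mono[of ?F E] by auto
  moreover have "disjoint_family_on Q' {..<Suc k}" unfolding disjoint_family_on_def
  proof (intro ballI impI)
   fix i j assume a: "i \<in> {..<Suc k}" "j \<in> {..<Suc k}" "i \<noteq> j"
   consider "i < k" "j < k" | "i < k" "j = k" | "i = k" "j < k" using a by fastforce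
   then show "Q' i \<inter> Q' j = {}"
   proof cases
    case 1 then show ?thesis using d a unfolding disjoint_family_on_def Q'_def by auto
   next
    case 2 then show ?thesis using RS unfolding S_def Q'_def by auto
   next
    case 3 then show ?thesis using RS unfolding S_def Q'_def by auto
   qed
  qed
  ultimately show False using np unfolding packs_def by blast
 qed
 then show ?thesis using cS vS SV by blast
qed

lemma binomial_fact_ge: "j \<le> n ==> (real n - real j) ^ j \<le> real (n choose j) * fact j"
proof (induction j arbitrary: n)
 case (Suc j)
 then obtain n' where n: "n = Suc n'" "j \<le> n'" by (cases n) auto
 have "(real n - real (Suc j)) ^ Suc j = (real n' - real j) * (real n' - real j) ^ j" using n by simp
 also have "... \<le> real n * (real (n' choose j) * fact j)" using n Suc.IH[of n'] by (intro mult_mono) auto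
 also have "... = real (n * (n' choose j)) * fact j" by simp
 also have "n * (n' choose j) = Suc j * (n choose Suc j)" using binomial_absorption[of j n] n by simp
 also have "real (Suc j * (n choose Suc j)) * fact j = real (n choose Suc j) * fact (Suc j)" by (simp add: algebra_simps)
 finally show ?case .
qed simp

lemma binomial_diff_ge:
 assumes "1 \<le> r"
 shows "real t * real (m choose (r - 1)) + real (m choose r) \<le> real ((m + t) choose r)"
proof (induction t)
 case (Suc t)
 obtain r' where r: "r = Suc r'" using assms by (cases r) auto
 have "(m + Suc t) choose r = ((m + t) choose r') + ((m + t) choose r)" using r by simp
 moreover have "m choose r' \<le> (m + t) choose r'" by (intro binomial_right_mono) simp
 ultimately show ?case using Suc r by (simp add: algebra_simps)
qed simp

lemma card_meeting_le:
 assumes E: "rgr r V E" and S: "S \<subseteq> V" and d: "\<And>w. w \<in> S ==> real (deg E w) \<le> D"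
 shows "rcard E \<le> rcard {X \<in> E. X \<inter> S = {}} + rcard S * D"
proof -
 have fE: "finite E" by (rule rgr_finite[OF E])
 have fS: "finite S" using E S finite_subset unfolding rgr_def by blast
 have "E \<subseteq> {X \<in> E. X \<inter> S = {}} \<union> (\<Union>w\<in>S. {X \<in> E. w \<in> X})" by auto
 then have "card E \<le> card ({X \<in> E. X \<inter> S = {}} \<union> (\<Union>w\<in>S. {X \<in> E. w \<in> X}))"
  using fE fS by (intro card_mono) auto
 also have "... \<le> card {X \<in> E. X \<inter> S = {}} + card (\<Union>w\<in>S. {X \<in> E. w \<in> X})" by (rule card_Un_le)
 also have "card (\<Union>w\<in>S. {X \<in> E. w \<in> X}) \<le> (\<Sum>w\<in>S. deg E w)" unfolding deg_def by (rule card_UN_le[OF fS])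
 finally have "rcard E \<le> real (card {X \<in> E. X \<inter> S = {}} + (\<Sum>w\<in>S. deg E w))" by (simp only: of_nat_le_iff)
 moreover have "(\<Sum>w\<in>S. real (deg E w)) \<le> rcard S * D" using sum_mono[OF d, of S "\<lambda>x. x"] sum_bounded_above[of S "\<lambda>w. real (deg E w)" D] d by simp
 ultimately show ?thesis by simp
qed

lemma deg_le_pow:
 assumes "rgr r V E"
 shows "deg E w \<le> card V ^ (r - 1)"
proof -
 have fV: "finite V" using assms by (simp add: rgr_def)
 have "deg E w \<le> card (sups r V {w})" unfolding deg_def
  using assms fV by (intro card_mono) (auto simp: rgr_def intro: finite_subset[of _ "Pow V"])
 also have "... \<le> card V ^ (r - 1)" using card_supersets_le[OF fV, of "{w}" r] by simp
 finally show ?thesis .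
qed

lemma deg_avoid_le:
 assumes E: "rgr r V E" and S: "S \<subseteq> V" "v \<notin> S"
 shows "deg E v \<le> deg {X \<in> E. X \<inter> S = {}} v + card S * card V ^ (r - 2)"
proof -
 have fV: "finite V" using E by (simp add: rgr_def)
 have fE: "finite E" by (rule rgr_finite[OF E])
 have fS: "finite S" using S fV finite_subset by blast
 let ?P = "\<lambda>w. sups r V {v, w}"
 have fP: "finite (?P w)" for w by (rule finite_subset[of _ "Pow V"]) (use fV in auto)
 have "{X \<in> E. v \<in> X} \<subseteq> {X \<in> {X \<in> E. X \<inter> S = {}}. v \<in> X} \<union> (\<Union>w\<in>S. ?P w)"
  using E unfolding rgr_def by auto
 then have "deg E v \<le> card ({X \<in> {X \<in> E. X \<inter> S = {}}. v \<in> X} \<union> (\<Union>w\<in>S. ?P w))" unfolding deg_def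
  using fE fS fP by (intro card_mono) auto
 also have "... \<le> deg {X \<in> E. X \<inter> S = {}} v + card (\<Union>w\<in>S. ?P w)" unfolding deg_def by (rule card_Un_le)
 also have "card (\<Union>w\<in>S. ?P w) \<le> (\<Sum>w\<in>S. card (?P w))" by (rule card_UN_le[OF fS])
 also have "... \<le> (\<Sum>w\<in>S. card V ^ (r - 2))"
 proof (rule sum_mono)
  fix w assume "w \<in> S"
  then have "v \<noteq> w" using S by auto
  then show "card (?P w) \<le> card V ^ (r - 2)" using card_supersets_le[OF fV, of "{v, w}" r] by (simp add: numeral_2_eq_2)
 qed
 finally show ?thesis by simp
qed

section \<open>Covering all triangles by few vertices\<close>

context steiner
begin

definition slack :: real where "slack = b2 * real k + 2 ^ k * rcard Bk"

text \<open>A lower bound for the size of the join of a complete graph on \<open>t\<close> vertices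
  with a best blow-up on the others: all \<open>r\<close>-sets meeting the \<open>t\<close>
  vertices, plus what \<open>ex_large_blowup\<close> guarantees.\<close>

abbreviation lower :: "nat => nat => real" where
 "lower n t \<equiv> real (n choose r) - real ((n - t) choose r) + lam0 * real (n - t) ^ r - slack * real (n - t) ^ (r - 2)"

text \<open>Otherwise every \<open>v\<close> is avoided by a set \<open>S\<close> of
  \<open>(t + 1) * (2 * r - 1)\<close> vertices, the union of disjoint copies, off which the graph
  is triangle-free and still dense; \<open>structured\<close> then bounds the degree of
  \<open>v\<close>. With all degrees bounded, deleting one such \<open>S\<close> loses fewer edges
  than the \<open>(t + 1) * n^(r-1) / (r-1)!\<close>, up to lower order, by which \<open>E\<close>
  exceeds a triangle-free graph.\<close>

lemma some_vertex_reduces: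
 assumes L: "lagr_stable TYPE('v)" and gap: "real (2 * r - 1) * kap * fact (r - 1) \<le> 1 / 2"
 shows "\<exists>c>0. c \<le> 1 \<and> (\<exists>N. \<forall>t (V :: 'v set) E. rgr r V E --> N + Suc t \<le> card V --> real (Suc t) \<le> c * rcard V -->
   \<not> packs (Suc (Suc t)) E -->
   lower (card V) (Suc t) \<le> rcard E -->
   (\<exists>v\<in>V. \<not> packs (Suc t) {X \<in> E. v \<notin> X}))"
proof -
 define R where "R = real (2 * r - 1)"
 have R: "1 \<le> R" using r3 by (simp add: R_def)
 define h :: real where "h = 1 / fact (r - 1)"
 have h: "0 < h" by (simp add: h_def)
 have gap': "R * kap \<le> h / 2" using gap unfolding h_def R_def by (simp add: field_simps)
 \<comment> \<open>Budget in units of \<open>h\<close>: \<open>R * (kap + c0 + R * c)\<close> costs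
   \<open>1/2 + 1/10 + 1/10\<close>, \<open>slack\<close> costs \<open>1/10\<close>, and the
   binomial coefficient still contributes \<open>9/10\<close>; a tenth remains for the
   contradiction.\<close>
 define c0 where "c0 = h / (10 * R)"
 have c0: "0 < c0" "R * c0 = h / 10" using h R by (auto simp: c0_def)
 obtain cc d' N0 where cc: "0 < cc" and d': "0 < d'" and S: "\<forall>(V :: 'v set) E. rgr r V E --> tfree E --> N0 \<le> card V -->
   (lam0 - d') * rcard V ^ r \<le> rcard E -->
  structured cc c0 V E" using tfree_structure[OF L c0(1)] by (elim exE conjE) (rule that)
 have st: "rcard E \<le> lam0 * rcard V ^ r \<and> (\<forall>v. real (deg E v) \<le> (kap + c0) * rcard V ^ (r - 1))"
  if "rgr r V E" "tfree E" "N0 \<le> card V" "(lam0 - d') * rcard V ^ r \<le> rcard E" for V :: "'v set" and E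
 proof
  note S' = S[rule_format, OF that]
  obtain f :: "'v => 'i" and Z where b: "deficit cc V E f Z" using S'[THEN conjunct1] by (elim exE conjE) (rule that)
  have "0 \<le> cc * rcard Z * rcard V ^ (r - 1)" "0 \<le> cc * rcard (Bl f (V - Z) - E)"
   "0 \<le> cc * rcard V ^ (r - 2) * (\<Sum>i\<in>I. (rcard {v \<in> V - Z. f v = i} - (rcard V - rcard Z) / real k) ^ 2)"
   using cc by (auto intro!: mult_nonneg_nonneg sum_nonneg)
  then show "rcard E \<le> lam0 * rcard V ^ r" using b by linarith
  show "\<forall>v. real (deg E v) \<le> (kap + c0) * rcard V ^ (r - 1)" by (rule S'[THEN conjunct2])
 qed
 define d where "d = min d' lam0"
 have d: "0 < d" "d \<le> d'" "d \<le> lam0" using d' lam0_pos by (auto simp: d_def)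
 define c where "c = Min {1 / (20 * real r), d / (2 * (lam0 * real r + R)), 1 / (2 * R), h / (10 * R ^ 2)}"
 have lr: "0 < lam0 * real r + R" using lam0_pos R by (intro add_nonneg_pos) auto
 have c: "0 < c" unfolding c_def using r3 d R h lr by auto
 have "c \<le> 1 / (20 * real r)" "c \<le> d / (2 * (lam0 * real r + R))" "c \<le> 1 / (2 * R)" "c \<le> h / (10 * R ^ 2)"
  unfolding c_def by auto
 moreover have "0 < R ^ 2" using R by simp
 ultimately have cb: "20 * (real r * c) \<le> 1" "c * (lam0 * real r + R) \<le> d / 2" "R * c \<le> 1 / 2" "R * (R * c) \<le> h / 10"
  using lr R r3 by (auto simp: field_simps power2_eq_square)
 have "1 * c \<le> R * c" using R c by (intro mult_right_mono) auto
 then have c1: "c \<le> 1" using cb(3) by linarith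
 have K0: "0 \<le> slack" by (simp add: slack_def)
 define N where "N = max 1 (max (2 * N0) (max (nat \<lceil>2 * slack / d\<rceil>) (max (nat \<lceil>10 * slack / h\<rceil>) (nat \<lceil>real r / c\<rceil>))))"
 have main: "\<exists>v\<in>V. \<not> packs (Suc t) {X \<in> E. v \<notin> X}"
  if a: "rgr r V E" "N + Suc t \<le> card V" "real (Suc t) \<le> c * rcard V" "\<not> packs (Suc (Suc t)) E"
   "lower (card V) (Suc t) \<le> rcard E" for t and V :: "'v set" and E
 proof (rule ccontr)
  assume no: "\<not> (\<exists>v\<in>V. \<not> packs (Suc t) {X \<in> E. v \<notin> X})"
  define n where "n = rcard V"
  define mm where "mm = card V - Suc t"
  define m where "m = real mm"
  define u where "u = real (Suc t)"
  define s where "s = Suc t * (2 * r - 1)"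
  have fV: "finite V" using a(1) by (simp add: rgr_def)
  have Nm: "N \<le> mm" using a(2) by (simp add: mm_def)
  have nm: "n = m + u" "card V = mm + Suc t" using a(2) by (auto simp: n_def m_def u_def mm_def)
  have u1: "1 \<le> u" by (simp add: u_def)
  have sR: "real s = R * u" unfolding s_def R_def u_def of_nat_mult by (rule mult.commute)
  have "1 \<le> mm" "2 * N0 \<le> mm" "nat \<lceil>2 * slack / d\<rceil> \<le> mm" "nat \<lceil>10 * slack / h\<rceil> \<le> mm" "nat \<lceil>real r / c\<rceil> \<le> mm"
   using Nm by (auto simp: N_def)
  then have "1 \<le> m" "2 * real N0 \<le> m" "2 * slack / d \<le> m" "10 * slack / h \<le> m" "real r / c \<le> m" unfolding m_def by linarith+
  then have m: "1 \<le> m" "2 * real N0 \<le> m" "2 * slack \<le> d * m" "10 * slack \<le> h * m" "real r \<le> c * m"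
   using d h c by (auto simp: field_simps)
  have mn: "m \<le> n" using nm u1 by simp
  have n1: "1 \<le> n" using m mn by simp
  have uc: "u \<le> c * n" using a(3) by (simp add: u_def n_def)
  have mc: "(1 - c) * n \<le> m" using uc nm by (simp add: algebra_simps)
  define p where "p = n ^ (r - 2)"
  have p: "1 \<le> p" using n1 by (simp add: p_def)
  have pw: "n ^ (r - 1) = n * p" "n ^ r = n * (n * p)" unfolding p_def pow_r1[of n] pow_r[of n] by (rule refl)+
  have mp: "m ^ (r - 2) \<le> p" unfolding p_def using mn m by (intro power_mono) auto
  have Ks: "slack * m ^ (r - 2) \<le> slack * p" using mp K0 by (intro mult_left_mono) auto
  have mr: "(1 - real r * c) * n ^ r \<le> m ^ r"
  proof -
   have "1 + real r * (- c) \<le> (1 + (- c)) ^ r" using c1 by (intro Bernoulli_inequality) auto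
   then have "(1 - real r * c) * n ^ r \<le> (1 - c) ^ r * n ^ r" using n1 by (intro mult_right_mono) auto
   also have "... = ((1 - c) * n) ^ r" by (simp add: power_mult_distrib)
   also have "... \<le> m ^ r" using mc c1 n1 by (intro power_mono) auto
   finally show ?thesis .
  qed
  have lo: "u * real (mm choose (r - 1)) + lam0 * m ^ r - slack * p \<le> rcard E"
   using a(5) binomial_diff_ge[of r "Suc t" mm] r3 Ks nm(2) unfolding mm_def[symmetric] m_def[symmetric] u_def by simp
  have Sv: "\<exists>S\<subseteq>V. v \<notin> S \<and> card S = s \<and> tfree {X \<in> E. X \<inter> S = {}}" if "v \<in> V" for v
  proof -
   have "packs (Suc t) {X \<in> E. v \<notin> X}" using no that by blast
   moreover have "1 \<le> r" using r3 by simp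
   ultimately show ?thesis unfolding s_def by (intro packs_obstruction[OF a(1)] a(4)) auto
  qed
  have core: "rcard {X \<in> E. X \<inter> S = {}} \<le> lam0 * m ^ r \<and>
   (\<forall>w. real (deg {X \<in> E. X \<inter> S = {}} w) \<le> (kap + c0) * n ^ (r - 1))"
   if SS: "S \<subseteq> V" "card S = s" "tfree {X \<in> E. X \<inter> S = {}}" for S
  proof -
   let ?F = "{X \<in> E. X \<inter> S = {}}"
   have fS: "finite S" using SS fV finite_subset by blast
   have sV: "s \<le> card V" using SS card_mono[OF fV] by metis
   have cV: "rcard (V - S) = n - R * u" using SS fS fV sV sR by (simp add: card_Diff_subset n_def of_nat_diff)
   have F: "rgr r (V - S) ?F" using a(1) unfolding rgr_def by auto
   have Ru: "R * u \<le> R * (c * n)" "u \<le> R * u" using uc R u1 by auto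
   have half: "R * (c * n) \<le> n / 2" using mult_right_mono[OF cb(3), of n] n1 by (simp add: mult_ac)
   have N0': "N0 \<le> card (V - S)" using cV Ru half m(2) mn by linarith
   have nn: "0 \<le> n - R * u" using Ru half n1 by linarith
   have le1: "(n - R * u) ^ r \<le> m ^ r" using nn nm Ru by (intro power_mono) auto
   have le2: "(n - R * u) ^ (r - 1) \<le> n ^ (r - 1)" using nn R u1 by (intro power_mono) auto
   have le3: "(n - R * u) ^ r \<le> n ^ r" using nn R u1 by (intro power_mono) auto
   have "rcard E \<le> rcard ?F + rcard S * n ^ (r - 1)"
   proof (rule card_meeting_le[OF a(1) SS(1)])
    fix w
    have "real (deg E w) \<le> real (card V ^ (r - 1))" using deg_le_pow[OF a(1)] by (simp only: of_nat_le_iff)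
    then show "real (deg E w) \<le> n ^ (r - 1)" by (simp add: n_def)
   qed
   moreover have "rcard S * n ^ (r - 1) \<le> R * (c * n) * n ^ (r - 1)" using SS sR Ru n1 by (intro mult_right_mono) auto
   moreover have "R * (c * n) * n ^ (r - 1) = R * c * n ^ r" using pw by simp
   moreover have "lam0 * ((1 - real r * c) * n ^ r) \<le> lam0 * m ^ r" using mr lam0_pos by (intro mult_left_mono) auto
   moreover have "lam0 * ((1 - real r * c) * n ^ r) = lam0 * n ^ r - lam0 * real r * c * n ^ r" by (simp add: algebra_simps)
   moreover have "c * (lam0 * real r + R) * n ^ r \<le> d / 2 * n ^ r" using cb(2) n1 by (intro mult_right_mono) auto
   moreover have "c * (lam0 * real r + R) * n ^ r = lam0 * real r * c * n ^ r + R * c * n ^ r" by (simp add: algebra_simps)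
   moreover have "slack * p \<le> d / 2 * n ^ r"
   proof -
    have "d * m \<le> d * n" using mn d by simp
    then have "slack \<le> d / 2 * n" using m(3) by simp
    then have "slack * p \<le> d / 2 * n * p" using p by (intro mult_right_mono) auto
    also have "... \<le> d / 2 * n * (n * p)" using d n1 p by (intro mult_left_mono) auto
    finally show ?thesis using pw by (simp add: mult_ac)
   qed
   moreover have "0 \<le> u * real (mm choose (r - 1))" using u1 by simp
   ultimately have "lam0 * n ^ r - d * n ^ r \<le> rcard ?F" using lo by linarith
   moreover have "(lam0 - d') * (n - R * u) ^ r \<le> (lam0 - d) * n ^ r"
   proof -
    have "(lam0 - d') * (n - R * u) ^ r \<le> (lam0 - d) * (n - R * u) ^ r" using d nn by (intro mult_right_mono) auto
    also have "... \<le> (lam0 - d) * n ^ r" using d le3 by (intro mult_left_mono) auto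
    finally show ?thesis .
   qed
   ultimately have dense: "(lam0 - d') * rcard (V - S) ^ r \<le> rcard ?F" unfolding cV by (simp add: algebra_simps)
   note q = st[OF F SS(3) N0' dense, unfolded cV]
   show ?thesis
   proof (intro conjI allI)
    show "rcard ?F \<le> lam0 * m ^ r" using q le1 lam0_pos mult_left_mono[OF le1, of lam0] by linarith
    fix w
    show "real (deg ?F w) \<le> (kap + c0) * n ^ (r - 1)"
     using q mult_left_mono[OF le2, of "kap + c0"] kap_pos c0 by (meson add_nonneg_nonneg less_imp_le order_trans)
   qed
  qed
  define D where "D = (kap + c0 + R * c) * n ^ (r - 1)"
  have degv: "real (deg E v) \<le> D" if v: "v \<in> V" for v
  proof -
   obtain S where SS: "S \<subseteq> V" "v \<notin> S" "card S = s" "tfree {X \<in> E. X \<inter> S = {}}" using Sv[OF v] by blast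
   have "real (deg E v) \<le> real (deg {X \<in> E. X \<inter> S = {}} v + card S * card V ^ (r - 2))"
    using deg_avoid_le[OF a(1) SS(1,2)] by (simp only: of_nat_le_iff)
   also have "... = real (deg {X \<in> E. X \<inter> S = {}} v) + R * u * p" using SS(3) sR by (simp add: n_def p_def)
   also have "... \<le> (kap + c0) * n ^ (r - 1) + R * (c * n) * p"
    using core[OF SS(1,3,4)] uc R p by (intro add_mono mult_right_mono mult_left_mono) auto
   also have "... = D" unfolding D_def using pw by (simp add: algebra_simps)
   finally show ?thesis .
  qed
  have "V \<noteq> {}" using n1 by (auto simp: n_def)
  then obtain v0 where v0: "v0 \<in> V" by blast
  obtain S where SS: "S \<subseteq> V" "v0 \<notin> S" "card S = s" "tfree {X \<in> E. X \<inter> S = {}}" using Sv[OF v0] by blast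
  have "rcard E \<le> rcard {X \<in> E. X \<inter> S = {}} + rcard S * D"
   using degv SS(1) by (intro card_meeting_le[OF a(1)]) auto
  then have up: "rcard E \<le> lam0 * m ^ r + R * u * D" using core[OF SS(1,3,4)] SS(3) sR by simp
  have RD: "R * u * D \<le> u * (7 / 10 * h * (n * p))"
  proof -
   have "R * (kap + c0 + R * c) \<le> 7 / 10 * h" using gap' c0(2) cb(4) by (simp add: algebra_simps)
   then have "R * (kap + c0 + R * c) * (n * p) \<le> 7 / 10 * h * (n * p)" using n1 p by (intro mult_right_mono) auto
   then have "u * (R * (kap + c0 + R * c) * (n * p)) \<le> u * (7 / 10 * h * (n * p))" using u1 by (intro mult_left_mono) auto
   then show ?thesis unfolding D_def pw by (simp add: mult_ac)
  qed
  have Kb: "slack * p \<le> u * (1 / 10 * h * (n * p))"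
  proof -
   have "h * m \<le> h * n" using mn h by simp
   then have "slack \<le> 1 / 10 * h * n" using m(4) by simp
   then have "slack * p \<le> 1 / 10 * h * n * p" using p by (intro mult_right_mono) auto
   also have "... \<le> u * (1 / 10 * h * n * p)" using u1 h n1 p mult_right_mono[of 1 u "1 / 10 * h * n * p"] by simp
   finally show ?thesis by (simp add: mult_ac)
  qed
  have bin: "9 / 10 * h * (n * p) \<le> real (mm choose (r - 1))"
  proof -
   have cm: "c * m \<le> c * n" using mn c by simp
   have "1 * c \<le> real r * c" using c r3 by (intro mult_right_mono) auto
   then have c2: "20 * c \<le> 1" using cb(1) by linarith
   have m2: "(1 - 2 * c) * n \<le> m - real (r - 1)" using mc m(5) cm r3 by (simp add: algebra_simps)
   have n2: "0 < (1 - 2 * c) * n" using c2 n1 by (intro mult_pos_pos) auto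
   have "r - 1 \<le> mm" using m2 n2 unfolding m_def by linarith
   then have b: "(m - real (r - 1)) ^ (r - 1) \<le> real (mm choose (r - 1)) * fact (r - 1)"
    using binomial_fact_ge[of "r - 1" mm] by (simp add: m_def)
   have "1 + real (r - 1) * (- (2 * c)) \<le> (1 + (- (2 * c))) ^ (r - 1)" using c2 by (intro Bernoulli_inequality) auto
   moreover have "real (r - 1) * (2 * c) \<le> 1 / 10"
   proof -
    have "real (r - 1) * (2 * c) \<le> real r * (2 * c)" using c by (intro mult_right_mono) auto
    then show ?thesis using cb(1) by simp
   qed
   ultimately have "9 / 10 \<le> (1 - 2 * c) ^ (r - 1)" by simp
   then have "9 / 10 * n ^ (r - 1) \<le> (1 - 2 * c) ^ (r - 1) * n ^ (r - 1)" using n1 by (intro mult_right_mono) auto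
   also have "... = ((1 - 2 * c) * n) ^ (r - 1)" by (simp add: power_mult_distrib)
   also have "... \<le> (m - real (r - 1)) ^ (r - 1)" using m2 n2 by (intro power_mono) auto
   finally have "9 / 10 * (n * p) \<le> real (mm choose (r - 1)) * fact (r - 1)" using b pw by linarith
   then show ?thesis unfolding h_def by (simp add: field_simps)
  qed
  have "u * (9 / 10 * h * (n * p)) \<le> u * real (mm choose (r - 1))" using bin u1 by (intro mult_left_mono) auto
  then have "u * (9 / 10 * h * (n * p)) \<le> u * (1 / 10 * h * (n * p)) + u * (7 / 10 * h * (n * p))"
   using lo up RD Kb by linarith
  then have "u * (h * (n * p)) \<le> 0" by (simp add: mult_ac)
  moreover have "0 < u * (h * (n * p))" using u1 h n1 p by (intro mult_pos_pos) auto
  ultimately show False by linarith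
 qed
 show ?thesis by (intro exI[of _ c] conjI exI[of _ N] allI impI c c1) (rule main; assumption)
qed

text \<open>Removing a vertex loses at most \<open>(n - 1) choose (r - 1)\<close> edges, exactly the
  drop of \<open>lower\<close> from \<open>n\<close> and \<open>t + 1\<close> to
  \<open>n - 1\<close> and \<open>t\<close>. So the edge hypothesis is inherited, and induction on
  \<open>t\<close> collects the cover.\<close>

theorem disjoint_copies_structure:
 assumes L: "lagr_stable TYPE('v)" and gap: "real (2 * r - 1) * kap * fact (r - 1) \<le> 1 / 2"
 shows "\<exists>c>0. \<exists>N. \<forall>t (V :: 'v set) E. rgr r V E --> N + t \<le> card V --> real t \<le> c * rcard V -->
   \<not> packs (t + 1) E -->
   lower (card V) t \<le> rcard E -->
   (\<exists>A\<subseteq>V. card A = t \<and> tfree {X \<in> E. X \<inter> A = {}})"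
proof -
 obtain c N where c: "0 < c" "c \<le> 1" and S: "\<forall>t (V :: 'v set) E. rgr r V E --> N + Suc t \<le> card V --> real (Suc t) \<le> c * rcard V -->
   \<not> packs (Suc (Suc t)) E -->
   lower (card V) (Suc t) \<le> rcard E -->
   (\<exists>v\<in>V. \<not> packs (Suc t) {X \<in> E. v \<notin> X})"
  using some_vertex_reduces[OF assms] by (elim exE conjE) (rule that)
 have main: "\<exists>A\<subseteq>V. card A = t \<and> tfree {X \<in> E. X \<inter> A = {}}"
  if "rgr r V E" "N + t \<le> card V" "real t \<le> c * rcard V" "\<not> packs (t + 1) E"
   "lower (card V) t \<le> rcard E" for t and V :: "'v set" and E using that
 proof (induction t arbitrary: V E)
  case 0
  then have "tfree E" using packs_1[of E] by simp
  then show ?case by (intro exI[of _ "{}"]) simp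
 next
  case (Suc t)
  have "\<not> packs (Suc (Suc t)) E" using Suc.prems(4) by simp
  from S[rule_format, OF Suc.prems(1,2,3) this Suc.prems(5)]
  obtain v where v: "v \<in> V" "\<not> packs (Suc t) {X \<in> E. v \<notin> X}" by blast
  let ?F = "{X \<in> E. v \<notin> X}"
  have fV: "finite V" using Suc.prems(1) by (simp add: rgr_def)
  have cV: "card V = Suc (card (V - {v}))" using v fV by (metis card.remove)
  have F: "rgr r (V - {v}) ?F" using Suc.prems(1) unfolding rgr_def by auto
  have N': "N + t \<le> card (V - {v})" using Suc.prems(2) cV by simp
  have t': "real t \<le> c * rcard (V - {v})" using Suc.prems(3) cV c by (simp add: algebra_simps)
  have np: "\<not> packs (t + 1) ?F" using v by simp
  have "card E \<le> card ?F + (card (V - {v}) choose (r - 1))"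
  proof -
   have fE: "finite E" by (rule rgr_finite[OF Suc.prems(1)])
   have "E = ?F \<union> {X \<in> E. v \<in> X}" by auto
   then have "card E = card (?F \<union> {X \<in> E. v \<in> X})" by simp
   also have "... \<le> card ?F + card {X \<in> E. v \<in> X}" by (rule card_Un_le)
   also have "card {X \<in> E. v \<in> X} \<le> card {X. {v} \<subseteq> X \<and> X \<subseteq> V \<and> card X = r}"
    using Suc.prems(1) fV by (intro card_mono) (auto simp: rgr_def intro: finite_subset[of _ "Pow V"])
   also have "... = (card V - card {v}) choose (r - card {v})" using v fV r3 by (intro card_sets_between) auto
   finally show ?thesis using cV by simp
  qed
  moreover have "card V choose r = (card (V - {v}) choose (r - 1)) + (card (V - {v}) choose r)"
   unfolding cV using r3 binomial_Suc_Suc[of "card (V - {v})" "r - 1"] by simp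
  moreover have "card V - Suc t = card (V - {v}) - t" using cV by simp
  ultimately have "real (card (V - {v}) choose r) - real ((card (V - {v}) - t) choose r) + lam0 * real (card (V - {v}) - t) ^ r
    - slack * real (card (V - {v}) - t) ^ (r - 2) \<le> rcard ?F" using Suc.prems(5) by simp
  from Suc.IH[OF F N' t' np this]
  obtain A where A: "A \<subseteq> V - {v}" "card A = t" "tfree {X \<in> ?F. X \<inter> A = {}}" by blast
  have fA: "finite A" using A fV finite_subset by blast
  have "{X \<in> E. X \<inter> insert v A = {}} = {X \<in> ?F. X \<inter> A = {}}" by auto
  moreover have "v \<notin> A" using A(1) by blast
  ultimately show ?case using A fA v(1) by (intro exI[of _ "insert v A"]) auto
 qed
 show ?thesis by (intro exI[of _ c] conjI c(1) exI[of _ N] allI impI) (rule main; assumption)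
qed

end

section \<open>The Witt designs\<close>

text \<open>The points \<open>9\<close> and \<open>10\<close> are distinguished; \<open>3 x + y\<close> encodes the point \<open>(x, y)\<close> of the affine plane of order
 three, whose lines are the blocks through \<open>9\<close> and \<open>10\<close>. A step \<open>(S, x)\<close> of \<open>run\<close> records that \<open>x\<close> is the only point
 completing the four-set \<open>S\<close> to a block that does not share exactly four points with a known block.\<close>

definition lines11 :: "nat list list" where
 "lines11 = [
  [0,1,2,9,10], [0,3,6,9,10], [0,4,8,9,10], [0,5,7,9,10], [1,3,8,9,10], [1,4,7,9,10], [1,5,6,9,10], 
  [2,3,7,9,10], [2,4,6,9,10], [2,5,8,9,10], [3,4,5,9,10], [6,7,8,9,10]]"

text \<open>Listed in the order in which \<open>run\<close> prepends new blocks, so that its outcome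
  can be compared literally.\<close>

definition blocks11 :: "nat list list" where
 "blocks11 = [
  [7,2,3,4,5], [6,1,3,4,5], [7,1,2,4,6], [8,1,2,3,5], [6,0,2,3,4], [7,0,1,4,5], [8,0,1,3,6], [6,0,1,2,5], 
  [8,0,1,2,4], [7,0,1,2,3], [0,4,6,7,8], [9,4,5,7,8], [10,4,5,6,7], [10,3,5,7,8], [9,3,5,6,8], [0,3,5,6,7], 
  [7,3,4,6,9], [10,3,4,6,8], [0,3,4,5,8], [0,2,5,7,8], [9,2,5,6,7], [10,2,4,7,8], [5,2,4,6,8], [7,2,3,6,8], 
  [6,2,3,5,10], [8,2,3,4,9], [6,1,5,7,8], [9,1,4,6,8], [8,1,4,5,10], [2,1,4,5,9], [4,1,3,7,8], [7,1,3,6,10], 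
  [7,1,3,5,9], [8,1,2,7,9], [8,1,2,6,10], [7,1,2,5,10], [4,1,2,3,10], [6,1,2,3,9], [2,0,6,8,9], 
  [2,0,6,7,10], [8,0,5,6,10], [2,0,4,7,9], [2,0,4,5,10], [6,0,4,5,9], [2,0,3,8,10], [4,0,3,7,10], 
  [8,0,3,7,9], [2,0,3,5,9], [8,0,1,7,10], [7,0,1,6,9], [8,0,1,5,9], [6,0,1,4,10], [0,1,2,9,10], 
  [0,3,6,9,10], [0,4,8,9,10], [0,5,7,9,10], [1,3,8,9,10], [1,4,7,9,10], [1,5,6,9,10], [2,3,7,9,10], 
  [2,4,6,9,10], [2,5,8,9,10], [3,4,5,9,10], [6,7,8,9,10], [9,0,1,3,4], [10,0,1,3,5]]"

definition C11 :: "nat set set" where "C11 = set ` set blocks11"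

text \<open>Two blocks with four common points coincide and then share five; exactly four is
  therefore impossible. A candidate that completes a known block shares five points with it and is
  kept.\<close>

definition clash :: "nat list => nat list => bool" where
 "clash B Y \<longleftrightarrow> length (filter (\<lambda>z. z \<in> set B) Y) = 4"

definition cands :: "nat list list => nat list => nat list" where
 "cands Ks S = filter (\<lambda>y. y \<notin> set S \<and> \<not> list_ex (\<lambda>B. clash B (y # S)) Ks) [0..<11]"

fun run :: "nat list list => (nat list \<times> nat) list => nat list list option" where
 "run Ks [] = Some Ks"
| "run Ks ((S, x) # st) = (if distinct S \<and> length S = 4 \<and> list_all (\<lambda>z. z < 11) S \<and> cands Ks S = [x]
   then run ((x # S) # Ks) st else None)"

text \<open>Given the lines and one block through each of \<open>9,0,1,3\<close> and
  \<open>10,0,1,3\<close>, all other blocks are forced one after the other.\<close>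

lemma blocks11_run: "run (lines11 @ [[9,0,1,3,4],[10,0,1,3,5]]) [
  ([0,1,4,10],6), ([0,1,5,9],8), ([0,1,6,9],7), ([0,1,7,10],8), ([0,3,5,9],2), ([0,3,7,9],8), 
  ([0,3,7,10],4), ([0,3,8,10],2), ([0,4,5,9],6), ([0,4,5,10],2), ([0,4,7,9],2), ([0,5,6,10],8), 
  ([0,6,7,10],2), ([0,6,8,9],2), ([1,2,3,9],6), ([1,2,3,10],4), ([1,2,5,10],7), ([1,2,6,10],8), 
  ([1,2,7,9],8), ([1,3,5,9],7), ([1,3,6,10],7), ([1,3,7,8],4), ([1,4,5,9],2), ([1,4,5,10],8), ([1,4,6,8],9), 
  ([1,5,7,8],6), ([2,3,4,9],8), ([2,3,5,10],6), ([2,3,6,8],7), ([2,4,6,8],5), ([2,4,7,8],10), ([2,5,6,7],9), 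
  ([2,5,7,8],0), ([3,4,5,8],0), ([3,4,6,8],10), ([3,4,6,9],7), ([3,5,6,7],0), ([3,5,6,8],9), ([3,5,7,8],10), 
  ([4,5,6,7],10), ([4,5,7,8],9), ([4,6,7,8],0), ([0,1,2,3],7), ([0,1,2,4],8), ([0,1,2,5],6), ([0,1,3,6],8), 
  ([0,1,4,5],7), ([0,2,3,4],6), ([1,2,3,5],8), ([1,2,4,6],7), ([1,3,4,5],6), ([2,3,4,5],7)] = Some blocks11" by code_simp

abbreviation start :: "nat => nat list list" where
 "start x \<equiv> [[9,10,2,3,x],[9,10,0,3,6],[9,10,0,1,2],[9,10,1,3,8],[9,10,0,4,8]]"

abbreviation steps :: "(nat list \<times> nat) list" where
 "steps \<equiv> [([0,5,9,10],7), ([3,4,9,10],5), ([7,8,9,10],6), ([1,5,9,10],6), ([1,7,9,10],4), ([2,4,9,10],6), ([2,5,9,10],8)]"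

text \<open>Five lines are laid down in \<open>start 7\<close>; the other seven follow by
  elimination.\<close>

lemma lines11_run: "\<exists>Ks. run (start 7)   steps = Some Ks
  \<and> list_all (\<lambda>L. list_ex (\<lambda>K. set L = set K) Ks) lines11"
 by (rule exI, rule conjI, code_simp, code_simp)

text \<open>With \<open>4\<close> in place of \<open>7\<close> the five lines begin a Fano plane,
  which the affine plane of order three does not contain: after one forced line nothing completes
  \<open>9,10,3,5\<close>.\<close>

lemma fano_run: "\<exists>Ks. run (start 4) [([0,5,9,10],7)] = Some Ks
  \<and> cands Ks [9,10,3,5] = []" by (rule exI, rule conjI, code_simp, code_simp)

lemma blocks11_wf: "list_all (\<lambda>K. distinct K \<and> length K = 5 \<and> list_all (\<lambda>z. z < 11) K) blocks11"
 by code_simp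

text \<open>Incidence vectors reduce the pairwise intersections of the 66 blocks to structural
  recursion, suited to evaluation by rewriting.\<close>

definition vec11 :: "nat list => bool list" where
 "vec11 K = map (\<lambda>z. z \<in> set K) [0..<11]"

fun meet_num :: "bool list => bool list => nat" where
 "meet_num (x # xs) (y # ys) = (if x then if y then Suc (meet_num xs ys) else meet_num xs ys else meet_num xs ys)"
| "meet_num _ _ = 0"

fun one_to_three :: "nat => bool" where
 "one_to_three 0 = False"
| "one_to_three (Suc 0) = True"
| "one_to_three (Suc (Suc 0)) = True"
| "one_to_three (Suc (Suc (Suc 0))) = True"
| "one_to_three (Suc (Suc (Suc (Suc m)))) = False"

fun all_meet :: "bool list list => bool" where
 "all_meet [] = True"
| "all_meet (v # vs) = (list_all (\<lambda>w. one_to_three (meet_num v w)) vs \<and> all_meet vs)"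

lemma blocks11_meet: "all_meet (map vec11 blocks11)" by code_simp

text \<open>Distinct blocks have disjoint families of (r-1)-subsets, and with this number of blocks
  the families fill all (r-1)-subsets.\<close>

lemma packing_unique:
 assumes I: "finite I" and r: "1 \<le> r" and B: "\<And>B. B \<in> Bk ==> B \<subseteq> I \<and> card B = r"
  and M: "\<And>B B'. B \<in> Bk ==> B' \<in> Bk ==> B \<noteq> B' ==> card (B \<inter> B') < r - 1"
  and c: "card Bk * r = card I choose (r - 1)" and S: "S \<subseteq> I" "card S = r - 1"
 shows "\<exists>!B. B \<in> Bk \<and> S \<subseteq> B"
proof -
 have fBk: "finite Bk" by (rule finite_subset[of _ "Pow I"]) (use B I in auto)
 have fB: "finite B" if "B \<in> Bk" for B using B[OF that] I finite_subset by blast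
 have one: "B = B'" if "B \<in> Bk" "B' \<in> Bk" "X \<subseteq> B" "X \<subseteq> B'" "card X = r - 1" for B B' X
 proof (rule ccontr)
  assume "B \<noteq> B'"
  then have "card (B \<inter> B') < r - 1" using M that by blast
  moreover have "card X \<le> card (B \<inter> B')" using that fB by (intro card_mono) auto
  ultimately show False using that by simp
 qed
 let ?U = "\<Union>B\<in>Bk. {S. S \<subseteq> B \<and> card S = r - 1}"
 have "card ?U = (\<Sum>B\<in>Bk. card {S. S \<subseteq> B \<and> card S = r - 1})"
 proof (rule card_UN_disjoint[OF fBk])
  show "\<forall>B\<in>Bk. finite {S. S \<subseteq> B \<and> card S = r - 1}"
   using fB by (auto intro: finite_subset[of _ "Pow _"])
  show "\<forall>B\<in>Bk. \<forall>B'\<in>Bk. B \<noteq> B' --> {S. S \<subseteq> B \<and> card S = r - 1} \<inter> {S. S \<subseteq> B' \<and> card S = r - 1} = {}"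
   using one by blast
 qed
 also have "... = (\<Sum>B\<in>Bk. r)"
 proof (rule sum.cong[OF refl])
  fix X assume X: "X \<in> Bk"
  show "card {S. S \<subseteq> X \<and> card S = r - 1} = r"
   using n_subsets[OF fB[OF X], of "r - 1"] B[OF X] r binomial_symmetric[of "r - 1" r] by simp
 qed
 finally have "card ?U = card {S. S \<subseteq> I \<and> card S = r - 1}" using c n_subsets[OF I, of "r - 1"] by simp
 moreover have "?U \<subseteq> {S. S \<subseteq> I \<and> card S = r - 1}" using B by blast
 moreover have "finite {S. S \<subseteq> I \<and> card S = r - 1}" by (rule finite_subset[of _ "Pow I"]) (use I in auto)
 ultimately have "?U = {S. S \<subseteq> I \<and> card S = r - 1}" by (intro card_subset_eq)
 then have "S \<in> ?U" using S by blast
 then obtain B where "B \<in> Bk" "S \<subseteq> B" by blast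
 then show ?thesis using one[OF _ _ _ _ S(2)] by (intro ex1I[of _ B]) auto
qed

section \<open>The listed blocks form a Steiner system\<close>

lemma meet_num_map: "meet_num (map f xs) (map g xs) = length (filter (\<lambda>x. f x \<and> g x) xs)" by (induction xs) auto

lemma one_to_threeD: "one_to_three m ==> 1 \<le> m \<and> m \<le> 3" by (cases m rule: one_to_three.cases) auto

lemma all_meet_nth: "all_meet vs ==> i < j ==> j < length vs ==> one_to_three (meet_num (vs ! i) (vs ! j))"
proof (induction vs arbitrary: i j)
 case (Cons v vs)
 then obtain j' where j: "j = Suc j'" by (cases j) auto
 show ?case using Cons j by (cases i) (auto simp: list_all_length)
qed simp

lemma blocks11_sound: "K \<in> set blocks11 ==> card (set K) = 5 \<and> set K \<subseteq> {0..<11}"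
 using blocks11_wf by (auto simp: list_all_iff distinct_card)

lemma length_blocks11: "length blocks11 = 66" by code_simp

lemma blocks11_nth_meet:
 assumes "i < j" "j < 66"
 shows "1 \<le> card (set (blocks11 ! i) \<inter> set (blocks11 ! j))" "card (set (blocks11 ! i) \<inter> set (blocks11 ! j)) \<le> 3"
proof -
 let ?K = "set (blocks11 ! i)" and ?L = "set (blocks11 ! j)"
 have "one_to_three (meet_num (vec11 (blocks11 ! i)) (vec11 (blocks11 ! j)))"
  using all_meet_nth[OF blocks11_meet, of i j] assms by (simp add: length_blocks11)
 moreover have "meet_num (vec11 (blocks11 ! i)) (vec11 (blocks11 ! j)) = card (?K \<inter> ?L)"
 proof -
  have "?K \<subseteq> {0..<11}" using blocks11_sound[of "blocks11 ! i"] assms by (simp add: length_blocks11)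
  then have "set (filter (\<lambda>x. x \<in> ?K \<and> x \<in> ?L) [0..<11]) = ?K \<inter> ?L" by auto
  then show ?thesis unfolding vec11_def meet_num_map
   using distinct_card[of "filter (\<lambda>x. x \<in> ?K \<and> x \<in> ?L) [0..<11]"] by simp
 qed
 ultimately show "1 \<le> card (?K \<inter> ?L)" "card (?K \<inter> ?L) \<le> 3" using one_to_threeD by auto
qed

lemma C11_block: "B \<in> C11 ==> B \<subseteq> {0..<11} \<and> card B = 5" using blocks11_sound unfolding C11_def by auto

lemma C11_meet:
 assumes "B \<in> C11" "B' \<in> C11" "B \<noteq> B'"
 shows "1 \<le> card (B \<inter> B')" "card (B \<inter> B') \<le> 3"
proof -
 obtain K K' where "B = set K" "K \<in> set blocks11" "B' = set K'" "K' \<in> set blocks11" using assms unfolding C11_def by blast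
 then obtain i j where i: "i < 66" "B = set (blocks11 ! i)" and j: "j < 66" "B' = set (blocks11 ! j)"
  unfolding in_set_conv_nth[of _ blocks11] length_blocks11 by blast
 have "i \<noteq> j" using assms(3) i j by auto
 then consider "i < j" | "j < i" by linarith
 then have "1 \<le> card (B \<inter> B') \<and> card (B \<inter> B') \<le> 3"
 proof cases
  case 1 then show ?thesis using blocks11_nth_meet[of i j] i j by simp
 next
  case 2 then show ?thesis using blocks11_nth_meet[of j i] i j by (simp add: Int_commute)
 qed
 then show "1 \<le> card (B \<inter> B')" "card (B \<inter> B') \<le> 3" by auto
qed

lemma card_C11: "card C11 = 66"
proof -
 have inj: "inj_on (\<lambda>i. set (blocks11 ! i)) {..<66}"
 proof (rule linorder_inj_onI')
  fix i j :: nat assume a: "i \<in> {..<66}" "j \<in> {..<66}" "i < j"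
  show "set (blocks11 ! i) \<noteq> set (blocks11 ! j)"
  proof
   assume e: "set (blocks11 ! i) = set (blocks11 ! j)"
   have "card (set (blocks11 ! j)) = 5" using blocks11_sound[of "blocks11 ! j"] a by (simp add: length_blocks11)
   then show False using blocks11_nth_meet[of i j] a unfolding e by simp
  qed
 qed
 have "C11 = (\<lambda>i. set (blocks11 ! i)) ` {..<66}" unfolding C11_def set_conv_nth length_blocks11 by auto
 then show ?thesis using card_image[OF inj] by simp
qed

lemma choose_11_4: "11 choose 4 = (330 :: nat)" by (simp add: numeral_eq_Suc)

lemma choose_12_5: "12 choose 5 = (792 :: nat)" by (simp add: numeral_eq_Suc)

lemma C11_steiner: "steiner 5 11 {0..<11} C11"
proof
 show "B \<subseteq> {0..<11} \<and> card B = 5" if "B \<in> C11" for B using C11_block[OF that] .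
 show "\<exists>!B. B \<in> C11 \<and> S \<subseteq> B" if "S \<subseteq> {0..<11}" "card S = 5 - 1" for S
 proof (rule packing_unique[of "{0..<11}" 5])
  show "card (B \<inter> B') < 5 - 1" if "B \<in> C11" "B' \<in> C11" "B \<noteq> B'" for B B'
   using C11_meet(2)[OF that] by simp
  show "card C11 * 5 = card {0..<11::nat} choose (5 - 1)" using choose_11_4 by (simp add: card_C11)
 qed (use that C11_block in auto)
qed auto

text \<open>The block through the image of \<open>S\<close> has one further point. Its label passes
  the test of \<open>cands\<close>: meeting a known block in exactly four points would make the two
  blocks equal.\<close>

lemma cands_sound:
 assumes st: "steiner 5 11 I Bk" and \<phi>: "bij_betw \<phi> {0..<11} I"
  and Ks: "\<And>K. K \<in> set Ks ==> set K \<subseteq> {0..<11} \<and> \<phi> ` set K \<in> Bk"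
  and S: "distinct S" "length S = 4" "set S \<subseteq> {0..<11}"
 shows "\<exists>y\<in>set (cands Ks S). y < 11 \<and> \<phi> ` insert y (set S) \<in> Bk"
proof -
 interpret steiner 5 11 I Bk by (rule st)
 have inj: "inj_on \<phi> {0..<11}" and im: "\<phi> ` {0..<11} = I" using \<phi> by (auto simp: bij_betw_def)
 have cS: "card (set S) = 4" using S distinct_card by metis
 have c4: "card (\<phi> ` set S) = 5 - 1" using cS inj_on_subset[OF inj S(3)] by (simp add: card_image)
 have SI: "\<phi> ` set S \<subseteq> I" using S(3) im by blast
 obtain B where B: "B \<in> Bk" "\<phi> ` set S \<subseteq> B" using blk_ex[OF SI c4] by blast
 have "card (B - \<phi> ` set S) = 1" using B c4 blk[OF B(1)] by (simp add: card_Diff_subset)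
 then obtain e where e: "B - \<phi> ` set S = {e}" by (rule card_1_singletonE)
 have "e \<in> I" using e B blk by blast
 then obtain y where y: "y < 11" "e = \<phi> y" using im by auto
 have By: "B = \<phi> ` insert y (set S)" using e B(2) y by auto
 have yS: "y \<notin> set S" using e y by auto
 have "\<not> clash K (y # S)" if K: "K \<in> set Ks" for K
 proof
  assume "clash K (y # S)"
  then have l: "length (filter (\<lambda>z. z \<in> set K) (y # S)) = 4" by (simp add: clash_def)
  have "distinct (filter (\<lambda>z. z \<in> set K) (y # S))" using S yS by simp
  from distinct_card[OF this] have c: "card (insert y (set S) \<inter> set K) = 4"
   unfolding l by (simp only: set_filter list.set(2) Int_def mem_Collect_eq)
  let ?X = "insert y (set S) \<inter> set K"
  have X: "?X \<subseteq> {0..<11}" using S(3) y by auto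
  have "card (\<phi> ` ?X) = 5 - 1" using c inj_on_subset[OF inj X] by (simp add: card_image)
  then have "\<phi> ` set K = B" using Ks[OF K] B(1) By by (intro blk_eq[of "\<phi> ` ?X"]) auto
  then have "set K = insert y (set S)" unfolding By
   using inj_on_image_eq_iff[OF inj, of "set K" "insert y (set S)"] Ks[OF K] S(3) y by auto
  then have "card (insert y (set S)) = 4" using c by simp
  then show False using yS cS by simp
 qed
 then have "y \<in> set (cands Ks S)" using y yS by (auto simp: cands_def list_ex_iff)
 then show ?thesis using y By B by blast
qed

lemma run_sound:
 assumes st: "steiner 5 11 I Bk" and \<phi>: "bij_betw \<phi> {0..<11} I"
 shows "run Ks ss = Some Ks' ==> (\<And>K. K \<in> set Ks ==> set K \<subseteq> {0..<11} \<and> \<phi> ` set K \<in> Bk) ==>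
  K \<in> set Ks' ==> set K \<subseteq> {0..<11} \<and> \<phi> ` set K \<in> Bk"
proof (induction Ks ss rule: run.induct)
 case (2 Ks S x ss)
 have c: "distinct S \<and> length S = 4 \<and> list_all (\<lambda>z. z < 11) S \<and> cands Ks S = [x]"
  using "2.prems"(1) by (auto split: if_splits)
 then have rn: "run ((x # S) # Ks) ss = Some Ks'" using "2.prems"(1) by auto
 have S: "set S \<subseteq> {0..<11}" using c by (auto simp: list_all_iff)
 have "\<exists>y\<in>set (cands Ks S). y < 11 \<and> \<phi> ` insert y (set S) \<in> Bk"
  by (rule cands_sound[OF st \<phi> "2.prems"(2)]) (use c S in auto)
 then have x: "x < 11" "\<phi> ` insert x (set S) \<in> Bk" using c by auto
 show ?case
 proof (rule "2.IH"[OF c rn _ "2.prems"(3)])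
  fix K assume "K \<in> set ((x # S) # Ks)"
  then show "set K \<subseteq> {0..<11} \<and> \<phi> ` set K \<in> Bk" using x S "2.prems"(2) by auto
 qed
qed simp

text \<open>\<open>p\<close> carries the normal form, with last points 4 and 5, to the situation
  with \<open>x\<close> and \<open>y\<close>; it fixes 9, 10 and the set \<open>{0,1,3}\<close> and
  permutes the lines. This reduces the six possible pairs \<open>(x, y)\<close> to one.\<close>

definition relab :: "nat list => nat => nat => bool" where
 "relab p x y \<longleftrightarrow> distinct p \<and> length p = 11 \<and> list_all (\<lambda>z. z < 11) p \<and> p ! 9 = 9 \<and> p ! 10 = 10 \<and>
   set (map ((!) p) [0,1,3]) = set [0,1,3] \<and>
   list_all (\<lambda>K. list_ex (\<lambda>M. set (map ((!) p) K) = set M) ([x,9,0,1,3] # [y,10,0,1,3] # lines11))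
    (lines11 @ [[9,0,1,3,4],[10,0,1,3,5]])"

lemma relab_list:
 "relab [0,1,2,3,4,5,6,7,8,9,10] 4 5" "relab [0,3,6,1,4,7,2,5,8,9,10] 4 7"
 "relab [1,0,2,3,5,4,8,7,6,9,10] 5 4" "relab [1,3,8,0,5,7,2,4,6,9,10] 5 7"
 "relab [3,0,6,1,7,4,8,5,2,9,10] 7 4" "relab [3,1,8,0,7,5,6,4,2,9,10] 7 5" by (code_simp)+

lemma cands_line:
 "cands lines11 [9,0,1,3] = [4,5,7]"
 "cands ([4,9,0,1,3] # lines11) [10,0,1,3] = [5,7]"
 "cands ([5,9,0,1,3] # lines11) [10,0,1,3] = [4,7]"
 "cands ([7,9,0,1,3] # lines11) [10,0,1,3] = [4,5]" by code_simp+

lemma lines11_sound: "K \<in> set lines11 ==> set K \<subseteq> {0..<11}" by (auto simp: lines11_def)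

text \<open>The blocks through \<open>9,0,1,3\<close> and \<open>10,0,1,3\<close> end in distinct
  points of \<open>{4,5,7}\<close>. A relabelling turns these into 4 and 5, \<open>run\<close> then
  places 66 blocks in \<open>Bk\<close>, and \<open>Bk\<close> has exactly 66.\<close>

lemma blocks11_extend:
 assumes st: "steiner 5 11 I Bk" and \<phi>: "bij_betw \<phi> {0..<11} I"
  and li: "\<And>K. K \<in> set lines11 ==> \<phi> ` set K \<in> Bk"
 shows "\<exists>\<psi>. bij_betw \<psi> {0..<11} I \<and> image \<psi> ` C11 = Bk \<and> \<psi> 9 = \<phi> 9 \<and> \<psi> 10 = \<phi> 10 \<and> \<psi> ` {0,1,3} = \<phi> ` {0,1,3}"
proof -
 interpret steiner 5 11 I Bk by (rule st)
 have li': "set K \<subseteq> {0..<11} \<and> \<phi> ` set K \<in> Bk" if "K \<in> set lines11" for K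
  using li lines11_sound that by auto
 have "\<exists>y\<in>set (cands lines11 [9,0,1,3]). y < 11 \<and> \<phi> ` insert y (set [9,0,1,3]) \<in> Bk"
  by (rule cands_sound[OF st \<phi> li']) auto
 then obtain x where x: "x \<in> {4,5,7}" "\<phi> ` set [x,9,0,1,3] \<in> Bk" unfolding cands_line by auto
 have li2: "set K \<subseteq> {0..<11} \<and> \<phi> ` set K \<in> Bk" if "K \<in> set ([x,9,0,1,3] # lines11)" for K
  using li'[of K] that x by auto
 have "\<exists>y\<in>set (cands ([x,9,0,1,3] # lines11) [10,0,1,3]). y < 11 \<and> \<phi> ` insert y (set [10,0,1,3]) \<in> Bk"
  by (rule cands_sound[OF st \<phi> li2]) auto
 then obtain y where y: "y \<in> set (cands ([x,9,0,1,3] # lines11) [10,0,1,3])" "\<phi> ` set [y,10,0,1,3] \<in> Bk" by auto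
 have "\<exists>p. relab p x y"
 proof -
  consider "x = 4" | "x = 5" | "x = 7" using x(1) by blast
  then show ?thesis
  proof cases
   case 1
   have "y = 5 \<or> y = 7" using y(1) unfolding 1 cands_line by simp
   then show ?thesis using relab_list(1,2) unfolding 1 by blast
  next
   case 2
   have "y = 4 \<or> y = 7" using y(1) unfolding 2 cands_line by simp
   then show ?thesis using relab_list(3,4) unfolding 2 by blast
  next
   case 3
   have "y = 4 \<or> y = 5" using y(1) unfolding 3 cands_line by simp
   then show ?thesis using relab_list(5,6) unfolding 3 by blast
  qed
 qed
 then obtain p where p: "distinct p" "length p = 11" "list_all (\<lambda>z. z < 11) p" "p ! 9 = 9" "p ! 10 = 10"
   "set (map ((!) p) [0,1,3]) = set [0,1,3]"
   "list_all (\<lambda>K. list_ex (\<lambda>M. set (map ((!) p) K) = set M) ([x,9,0,1,3] # [y,10,0,1,3] # lines11))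
    (lines11 @ [[9,0,1,3,4],[10,0,1,3,5]])" unfolding relab_def by (elim exE conjE) (rule that)
 have "set p \<subseteq> {0..<11}" using p(3) by (auto simp: list_all_iff)
 moreover have "card (set p) = 11" using p distinct_card by metis
 ultimately have sp: "set p = {0..<11}" by (intro card_subset_eq) auto
 have bp: "bij_betw ((!) p) {0..<11} {0..<11}" by (rule bij_betw_nth) (use p sp in auto)
 define \<psi> where "\<psi> = \<phi> \<circ> (!) p"
 have b\<psi>: "bij_betw \<psi> {0..<11} I" unfolding \<psi>_def by (rule bij_betw_trans[OF bp \<phi>])
 have start: "set K \<subseteq> {0..<11} \<and> \<psi> ` set K \<in> Bk" if K: "K \<in> set (lines11 @ [[9,0,1,3,4],[10,0,1,3,5]])" for K
 proof
  show "set K \<subseteq> {0..<11}" using K lines11_sound[of K] by auto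
  obtain M where M: "M \<in> set ([x,9,0,1,3] # [y,10,0,1,3] # lines11)" "set (map ((!) p) K) = set M"
   using p(7) K unfolding list_all_iff list_ex_iff by blast
  have "\<phi> ` set M \<in> Bk" using M(1) x(2) y(2) li by auto
  moreover have "\<psi> ` set K = \<phi> ` set (map ((!) p) K)" by (auto simp: \<psi>_def)
  ultimately show "\<psi> ` set K \<in> Bk" using M(2) by simp
 qed
 have "set K \<subseteq> {0..<11} \<and> \<psi> ` set K \<in> Bk" if "K \<in> set blocks11" for K
  by (rule run_sound[OF st b\<psi> blocks11_run start that])
 then have sub: "image \<psi> ` C11 \<subseteq> Bk" unfolding C11_def by auto
 have "inj_on (image \<psi>) C11"
 proof (rule inj_onI)
  fix B B' assume "B \<in> C11" "B' \<in> C11" "\<psi> ` B = \<psi> ` B'"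
  then show "B = B'" using inj_on_image_eq_iff[of \<psi> "{0..<11}" B B'] b\<psi> C11_block by (auto simp: bij_betw_def)
 qed
 then have "card (image \<psi> ` C11) = 66" using card_C11 by (simp add: card_image)
 moreover have "card Bk = 66" unfolding card_Bk bn_def using choose_11_4 by simp
 ultimately have "image \<psi> ` C11 = Bk" using sub finBk by (intro card_subset_eq) auto
 moreover have "\<psi> ` {0,1,3} = \<phi> ` {0,1,3}"
 proof -
  have "\<psi> ` {0,1,3} = \<phi> ` set (map ((!) p) [0,1,3])" by (simp add: \<psi>_def)
  then show ?thesis unfolding p(6) by simp
 qed
 moreover have "\<psi> 9 = \<phi> 9" "\<psi> 10 = \<phi> 10" using p by (auto simp: \<psi>_def)
 ultimately show ?thesis using b\<psi> by blast
qed

lemma label_bij: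
 assumes "distinct ps" "length ps = 11" "set ps = I"
 shows "bij_betw ((!) ps) {0..<11} I" by (rule bij_betw_nth) (use assms in auto)

text \<open>The derived design at two points is the affine plane of order three, which is built up from the
 three points \<open>p\<close>, \<open>q\<close>, \<open>s\<close> by joining lines.\<close>

lemma witt11:
 assumes st: "steiner 5 11 I Bk" and d: "distinct [a,b,p,q,s]" and dI: "{a,b,p,q,s} \<subseteq> I" and nb: "{a,b,p,q,s} \<notin> Bk"
 shows "\<exists>\<phi>. bij_betw \<phi> {0..<11} I \<and> image \<phi> ` C11 = Bk \<and> \<phi> 9 = a \<and> \<phi> 10 = b \<and> \<phi> ` {0,1,3} = {p,q,s}"
proof -
 interpret steiner 5 11 I Bk by (rule st)
 define L where "L x y z \<longleftrightarrow> distinct [a,b,x,y,z] \<and> {a,b,x,y,z} \<in> Bk" for x y z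
 have L1: "L y x z" and L2: "L x z y" if "L x y z" for x y z using that unfolding L_def by (auto simp: insert_commute)
 have Lu: "z = z'" if "L x y z" "L x y z'" for x y z z'
 proof -
  have "{a,b,x,y,z} = {a,b,x,y,z'}" by (rule blk_eq[of "{a,b,x,y}"]) (use that in "auto simp: L_def")
  moreover have "z \<notin> {a,b,x,y}" using that(1) by (auto simp: L_def)
  ultimately show ?thesis by blast
 qed
 have Lx: "\<exists>z. L x y z" if xy: "x \<in> I" "y \<in> I" "distinct [a,b,x,y]" for x y
 proof -
  have c: "card {a,b,x,y} = 4" using xy(3) by simp
  then obtain B where B: "B \<in> Bk" "{a,b,x,y} \<subseteq> B" using blk_ex[of "{a,b,x,y}"] xy dI by auto
  have "card (B - {a,b,x,y}) = 1" using B c blk[OF B(1)] by (subst card_Diff_subset) auto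
  then obtain z where z: "B - {a,b,x,y} = {z}" by (rule card_1_singletonE)
  then have "B = {a,b,x,y,z}" "z \<notin> {a,b,x,y}" using B by auto
  then show ?thesis using B(1) xy(3) unfolding L_def by auto
 qed
 have LI: "x \<in> I" "y \<in> I" "z \<in> I" if "L x y z" for x y z using that blk[of "{a,b,x,y,z}"] unfolding L_def by auto
 have Ld: "distinct [a,b,x,y,z]" if "L x y z" for x y z using that by (simp add: L_def)
 obtain u where u: "L p q u" using Lx[of p q] d dI by auto
 obtain v where v: "L p s v" using Lx[of p s] d dI by auto
 obtain w where w: "L q s w" using Lx[of q s] d dI by auto
 have us: "u \<noteq> s" using u nb by (auto simp: L_def)
 have vq: "v \<noteq> q" using v nb by (auto simp: L_def insert_commute)
 have wp: "w \<noteq> p" using w nb by (auto simp: L_def insert_commute)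
 have uv: "u \<noteq> v" using Lu[OF L2[OF u]] L2[OF v] d by auto
 have uw: "u \<noteq> w" using Lu[OF L2[OF L1[OF u]]] L2[OF w] d by auto
 have vw: "v \<noteq> w" using Lu[OF L2[OF L1[OF v]]] L2[OF L1[OF w]] d by auto
 obtain z where z: "L p w z" using Lx[of p w] d dI wp Ld[OF w] LI[OF w] by auto
 have zq: "z \<noteq> q" using Lu[OF u] L2[OF z] uw by auto
 have zs: "z \<noteq> s" using Lu[OF v] L2[OF z] vw by auto
 have zu: "z \<noteq> u" using Lu[OF L2[OF u]] L2[OF z] Ld[OF w] by auto
 have zv: "z \<noteq> v" using Lu[OF L2[OF v]] L2[OF z] Ld[OF w] by auto
 obtain x where x: "L v q x" using Lx[of v q] d dI vq Ld[OF v] LI[OF v] by auto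
 have xp: "x \<noteq> p" using Lu[OF L2[OF x]] L1[OF L2[OF v]] d by auto
 have xs: "x \<noteq> s" using Lu[OF L2[OF x]] L1[OF L2[OF L1[OF v]]] d by auto
 have xu: "x \<noteq> u" using Lu[OF L2[OF L1[OF x]]] L2[OF L1[OF u]] Ld[OF v] by auto
 have xw: "x \<noteq> w" using Lu[OF L2[OF L1[OF x]]] L2[OF w] Ld[OF v] by auto
 have nine: "distinct [p,s,v,q,z,u,w,a,b]" using d Ld[OF u] Ld[OF v] Ld[OF w] Ld[OF z] us vq wp uv uw vw zq zs zu zv by auto
 have nineI: "{p,s,v,q,z,u,w,a,b} \<subseteq> I" using dI LI[OF u] LI[OF v] LI[OF w] LI[OF z] by auto
 have full: "set ps = I" if "distinct ps" "length ps = 11" "set ps \<subseteq> I" for ps :: "'a list"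
  using that finI cardI distinct_card[OF that(1)] by (intro card_subset_eq) auto
 \<comment> \<open>If the third points of the lines \<open>p w\<close> and \<open>v q\<close>
   coincided, seven of the points would carry most of a Fano plane, which \<open>fano_run\<close>
   refutes.\<close>
 have xz: "x \<noteq> z"
 proof
  assume xz: "x = z"
  have "card (set [p,s,v,q,z,u,w,a,b]) = length [p,s,v,q,z,u,w,a,b]" by (rule distinct_card[OF nine])
  then have c9: "card {p,s,v,q,z,u,w,a,b} = 9" by simp
  have "card (I - {p,s,v,q,z,u,w,a,b}) = 2" using c9 cardI nineI by (subst card_Diff_subset) auto
  then obtain y1 y2 where y: "I - {p,s,v,q,z,u,w,a,b} = {y1, y2}" "y1 \<noteq> y2" unfolding card_2_iff by blast
  define ps where "ps = [p,s,v,q,z,y2,u,y1,w,a,b]"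
  have "distinct ps" using nine y unfolding ps_def by auto
  moreover have "set ps \<subseteq> I" using nineI y unfolding ps_def by auto
  moreover have "length ps = 11" by (simp add: ps_def)
  ultimately have \<phi>: "bij_betw ((!) ps) {0..<11} I" using full label_bij by metis
  have st0: "set K \<subseteq> {0..<11} \<and> (!) ps ` set K \<in> Bk"
   if "K \<in> set (start 4)" for K
  proof -
   have n: "ps ! 0 = p" "ps ! 1 = s" "ps ! Suc 0 = s" "ps ! 2 = v" "ps ! 3 = q" "ps ! 4 = z" "ps ! 6 = u" "ps ! 8 = w" "ps ! 9 = a" "ps ! 10 = b"
    by (simp_all add: ps_def)
   have "{a,b,v,q,z} \<in> Bk" "{a,b,p,q,u} \<in> Bk" "{a,b,p,s,v} \<in> Bk" "{a,b,s,q,w} \<in> Bk" "{a,b,p,z,w} \<in> Bk"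
    using x[unfolded xz] u v L1[OF w] L2[OF z] unfolding L_def by auto
   then show ?thesis using that by (elim set_ConsD[elim_format]) (auto simp: n)
  qed
  obtain Ks where Ks: "run (start 4) [([0,5,9,10],7)] = Some Ks"
   "cands Ks [9,10,3,5] = []" using fano_run by blast
  have "\<exists>y\<in>set (cands Ks [9,10,3,5]). y < 11 \<and> (!) ps ` insert y (set [9,10,3,5]) \<in> Bk"
   by (rule cands_sound[OF st \<phi> run_sound[OF st \<phi> Ks(1) st0]]) auto
  then show False unfolding Ks(2) by simp
 qed
 have ten: "distinct [p,s,v,q,z,u,x,w,a,b]" using nine Ld[OF x] xp xs xu xw xz by auto
 have tenI: "{p,s,v,q,z,u,x,w,a,b} \<subseteq> I" using nineI LI[OF x] by auto
 have "card (set [p,s,v,q,z,u,x,w,a,b]) = length [p,s,v,q,z,u,x,w,a,b]" by (rule distinct_card[OF ten])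
 then have c10: "card {p,s,v,q,z,u,x,w,a,b} = 10" by simp
 have "card (I - {p,s,v,q,z,u,x,w,a,b}) = 1" using c10 cardI tenI by (subst card_Diff_subset) auto
 then obtain y where y: "I - {p,s,v,q,z,u,x,w,a,b} = {y}" by (rule card_1_singletonE)
 \<comment> \<open>The list is the coordinate labelling: \<open>p\<close>, \<open>s\<close>,
   \<open>q\<close> receive 0, 1, 3, and the five lines found so far are those of
   \<open>start 7\<close>.\<close>
 define ps where "ps = [p,s,v,q,z,y,u,x,w,a,b]"
 have "distinct ps" using ten y unfolding ps_def by auto
 moreover have "set ps \<subseteq> I" using tenI y unfolding ps_def by auto
 moreover have "length ps = 11" by (simp add: ps_def)
 ultimately have \<phi>: "bij_betw ((!) ps) {0..<11} I" using full label_bij by metis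
 have n: "ps ! 0 = p" "ps ! 1 = s" "ps ! Suc 0 = s" "ps ! 2 = v" "ps ! 3 = q" "ps ! 4 = z" "ps ! 6 = u" "ps ! 7 = x" "ps ! 8 = w" "ps ! 9 = a" "ps ! 10 = b"
  by (simp_all add: ps_def)
 have st0: "set K \<subseteq> {0..<11} \<and> (!) ps ` set K \<in> Bk"
  if "K \<in> set (start 7)" for K
 proof -
  have "{a,b,v,q,x} \<in> Bk" "{a,b,p,q,u} \<in> Bk" "{a,b,p,s,v} \<in> Bk" "{a,b,s,q,w} \<in> Bk" "{a,b,p,z,w} \<in> Bk"
   using x u v L1[OF w] L2[OF z] unfolding L_def by auto
  then show ?thesis using that by (elim set_ConsD[elim_format]) (auto simp: n)
 qed
 obtain Ks where Ks: "run (start 7)   steps = Some Ks"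
  "list_all (\<lambda>L. list_ex (\<lambda>K. set L = set K) Ks) lines11" using lines11_run by blast
 have "(!) ps ` set K \<in> Bk" if K: "K \<in> set lines11" for K
 proof -
  obtain M where M: "M \<in> set Ks" "set K = set M" using Ks(2) K unfolding list_all_iff list_ex_iff by blast
  have "set M \<subseteq> {0..<11} \<and> (!) ps ` set M \<in> Bk" by (rule run_sound[OF st \<phi> Ks(1) st0 M(1)])
  then show ?thesis using M(2) by simp
 qed
 from blocks11_extend[OF st \<phi> this]
 obtain \<psi> where "bij_betw \<psi> {0..<11} I" "image \<psi> ` C11 = Bk" "\<psi> 9 = ps ! 9" "\<psi> 10 = ps ! 10" "\<psi> ` {0,1,3} = (!) ps ` {0,1,3}"
  by blast
 moreover have "(!) ps ` {0,1,3} = {p,q,s}" by (auto simp: n)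
 ultimately show ?thesis by (intro exI[of _ \<psi>]) (simp add: n)
qed

section \<open>Canonical subsets of the 11-point design\<close>

definition des_iso :: "('a => 'b) => 'a set => 'a set set => 'b set => 'b set set => bool" where
 "des_iso \<phi> I Bk I' Bk' \<longleftrightarrow> bij_betw \<phi> I I' \<and> image \<phi> ` Bk = Bk'"

lemma des_iso_comp: "des_iso \<phi> I A J B ==> des_iso \<psi> J B K C ==> des_iso (\<psi> \<circ> \<phi>) I A K C"
 unfolding des_iso_def by (auto intro: bij_betw_trans simp: image_comp image_image)

lemma des_iso_inv:
 assumes "des_iso \<phi> I A J B" "\<And>X. X \<in> A ==> X \<subseteq> I"
 shows "des_iso (inv_into I \<phi>) J B I A"
proof -
 have b: "bij_betw \<phi> I J" "image \<phi> ` A = B" using assms(1) by (auto simp: des_iso_def)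
 have i: "inv_into I \<phi> ` (\<phi> ` X) = X" if "X \<subseteq> I" for X using b(1) that by (simp add: bij_betw_def inv_into_image_cancel)
 have "image (inv_into I \<phi>) ` B = (\<lambda>X. inv_into I \<phi> ` (\<phi> ` X)) ` A" unfolding b(2)[symmetric] by (rule image_image)
 also have "... = (\<lambda>X. X) ` A" by (rule image_cong) (use i assms(2) in auto)
 finally show ?thesis unfolding des_iso_def using bij_betw_inv_into[OF b(1)] by simp
qed

lemma fresh: "finite F ==> card F < card I ==> \<exists>y\<in>I. y \<notin> F" by (meson card_mono leD subsetI)

lemma set_of_card:
 assumes "finite J" "card J = n"
 obtains xs where "set xs = J" "distinct xs" "length xs = n"
 using finite_distinct_list[OF assms(1)] assms(2) distinct_card by metis

text \<open>Representatives of the sets with at most four points, taken inside the non-block 9, 10,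
  0, 1, 3 that \<open>witt11\<close> moves to any given position.\<close>

definition Js :: "nat => nat set" where
 "Js j = (if j = 0 then {} else if j = 1 then {9} else if j = 2 then {9,10} else if j = 3 then {0,1,3} else {9,0,1,3})"

text \<open>Beyond four points: a block, a block with one more point, and complements of the small
  representatives.\<close>

definition Jc :: "nat => nat set" where
 "Jc j = (if j \<le> 4 then Js j else if j = 5 then {9,0,1,3,4} else if j = 6 then {10,9,0,1,3,4} else {0..<11} - Js (11 - j))"

lemma Js_subset: "Js j \<subseteq> {0..<11}" by (auto simp: Js_def)

lemma Jc_subset: "Jc j \<subseteq> {0..<11}" using Js_subset[of j] by (auto simp: Jc_def)

lemma outside_block:
 assumes st: "steiner 5 11 I Bk" and X: "X \<subseteq> I" "card X = 4"
 shows "\<exists>b\<in>I. b \<notin> X \<and> insert b X \<notin> Bk"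
proof -
 interpret steiner 5 11 I Bk by (rule st)
 obtain B where B: "B \<in> Bk" "X \<subseteq> B" using blk_ex[OF X(1)] X(2) by auto
 obtain b where b: "b \<in> I" "b \<notin> B" using fresh[of B I] blk[OF B(1)] blk_fin[OF B(1)] cardI by auto
 have "insert b X \<notin> Bk"
 proof
  assume "insert b X \<in> Bk"
  then have "B = insert b X" using B X(2) by (intro blk_eq[of X]) auto
  then show False using b by blast
 qed
 then show ?thesis using b B by blast
qed

text \<open>\<open>J\<close> is completed to five points that form no block, with its members in the
  roles prescribed by \<open>Js\<close>, and \<open>witt11\<close> applies.
  \<open>outside_block\<close> supplies a fifth point off the block through four given ones.\<close>

lemma canon11_small:
 assumes st: "steiner 5 11 I Bk" and J: "J \<subseteq> I" "card J \<le> 4"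
 shows "\<exists>\<phi>. des_iso \<phi> {0..<11} C11 I Bk \<and> \<phi> ` Js (card J) = J"
proof -
 interpret steiner 5 11 I Bk by (rule st)
 have fJ: "finite J" using J finI finite_subset by blast
 let ?K = "\<lambda>a b p q s. if card J = 0 then {} else if card J = 1 then {a} else if card J = 2 then {a,b}
  else if card J = 3 then {p,q,s} else {a,p,q,s}"
 have two: "\<exists>p q s. distinct [a,b,p,q,s] \<and> {a,b,p,q,s} \<subseteq> I \<and> {a,b,p,q,s} \<notin> Bk" if ab: "a \<in> I" "b \<in> I" "a \<noteq> b" for a b
 proof -
  obtain p where p: "p \<in> I" "p \<notin> {a,b}" using fresh[of "{a,b}" I] ab cardI by auto
  have "card {a,b,p} = 3" using ab p by (auto simp: card_insert_if)
  then obtain q where q: "q \<in> I" "q \<notin> {a,b,p}" using fresh[of "{a,b,p}" I] cardI by auto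
  have "card {a,b,p,q} = 4" using ab p q by (auto simp: card_insert_if)
  moreover have "{a,b,p,q} \<subseteq> I" using ab p q by simp
  ultimately obtain s where s: "s \<in> I" "s \<notin> {a,b,p,q}" "insert s {a,b,p,q} \<notin> Bk" using outside_block[OF st] by blast
  have e: "insert s {a,b,p,q} = {a,b,p,q,s}" by auto
  have "distinct [a,b,p,q,s]" "{a,b,p,q,s} \<subseteq> I" using ab p q s(1,2) by auto
  then show ?thesis using s(3)[unfolded e] by (intro exI conjI)
 qed
 have four: "\<exists>b. distinct [a,b,p,q,s] \<and> {a,b,p,q,s} \<subseteq> I \<and> {a,b,p,q,s} \<notin> Bk" if ab: "{a,p,q,s} \<subseteq> I" "distinct [a,p,q,s]" for a p q s
 proof -
  have "card {a,p,q,s} = 4" using ab by simp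
  then obtain b where b: "b \<in> I" "b \<notin> {a,p,q,s}" "insert b {a,p,q,s} \<notin> Bk" using outside_block[OF st ab(1)] by blast
  have e: "insert b {a,p,q,s} = {a,b,p,q,s}" by auto
  have "distinct [a,b,p,q,s]" "{a,b,p,q,s} \<subseteq> I" using ab b(1,2) by auto
  then show ?thesis using b(3)[unfolded e] by (intro exI conjI)
 qed
 have "\<exists>a b p q s. distinct [a,b,p,q,s] \<and> {a,b,p,q,s} \<subseteq> I \<and> {a,b,p,q,s} \<notin> Bk \<and>
  J = ?K a b p q s"
 proof -
  consider (c0) "card J = 0" | (c1) "card J = 1" | (c2) "card J = 2" | (c3) "card J = 3" | (c4) "card J = 4"
   using J(2) by linarith
  then show ?thesis
  proof cases
   case c0
   obtain a where a: "a \<in> I" using fresh[of "{}" I] cardI by auto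
   obtain b where b: "b \<in> I" "b \<noteq> a" using fresh[of "{a}" I] cardI by auto
   obtain p q s where "distinct [a,b,p,q,s]" "{a,b,p,q,s} \<subseteq> I" "{a,b,p,q,s} \<notin> Bk" using two[OF a b(1) b(2)[symmetric]] by (elim exE conjE) (rule that)
   moreover have "J = ?K a b p q s" using c0 fJ by simp
   ultimately show ?thesis by (intro exI conjI)
  next
   case c1
   then obtain a where a: "J = {a}" by (rule card_1_singletonE)
   then have aI: "a \<in> I" using J by simp
   obtain b where b: "b \<in> I" "b \<noteq> a" using fresh[of "{a}" I] cardI by auto
   obtain p q s where "distinct [a,b,p,q,s]" "{a,b,p,q,s} \<subseteq> I" "{a,b,p,q,s} \<notin> Bk" using two[OF aI b(1) b(2)[symmetric]] by (elim exE conjE) (rule that)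
   moreover have "J = ?K a b p q s" unfolding c1 by (simp add: a)
   ultimately show ?thesis by (intro exI conjI)
  next
   case c2
   then obtain a b where a: "J = {a,b}" "a \<noteq> b" unfolding card_2_iff by blast
   then have abI: "a \<in> I" "b \<in> I" using J by auto
   obtain p q s where "distinct [a,b,p,q,s]" "{a,b,p,q,s} \<subseteq> I" "{a,b,p,q,s} \<notin> Bk" using two[OF abI a(2)] by (elim exE conjE) (rule that)
   moreover have "J = ?K a b p q s" unfolding c2 by (simp add: a(1))
   ultimately show ?thesis by (intro exI conjI)
  next
   case c3
   then obtain p q s where a: "J = {p,q,s}" "p \<noteq> q" "q \<noteq> s" "p \<noteq> s" unfolding card_3_iff by blast
   obtain a where a': "a \<in> I" "a \<notin> {p,q,s}" using fresh[of J I] fJ c3 cardI a by auto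
   have fI: "{a,p,q,s} \<subseteq> I" "distinct [a,p,q,s]" using a a' J by auto
   obtain b where "distinct [a,b,p,q,s]" "{a,b,p,q,s} \<subseteq> I" "{a,b,p,q,s} \<notin> Bk" using four[OF fI] by (elim exE conjE) (rule that)
   moreover have "J = ?K a b p q s" unfolding c3 by (simp add: a(1))
   ultimately show ?thesis by (intro exI conjI)
  next
   case c4
   obtain xs where xs: "set xs = J" "distinct xs" "length xs = 4" using set_of_card[OF fJ c4] by blast
   then obtain a p q s where "xs = [a,p,q,s]" by (auto simp: length_Suc_conv numeral_eq_Suc)
   then have a: "J = {a,p,q,s}" "distinct [a,p,q,s]" using xs by auto
   have fI: "{a,p,q,s} \<subseteq> I" "distinct [a,p,q,s]" using a J by auto
   obtain b where "distinct [a,b,p,q,s]" "{a,b,p,q,s} \<subseteq> I" "{a,b,p,q,s} \<notin> Bk" using four[OF fI] by (elim exE conjE) (rule that)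
   moreover have "J = ?K a b p q s" unfolding c4 by (simp add: a(1))
   ultimately show ?thesis by (intro exI conjI)
  qed
 qed
 then obtain a b p q s where h: "distinct [a,b,p,q,s]" "{a,b,p,q,s} \<subseteq> I" "{a,b,p,q,s} \<notin> Bk" and
  JJ: "J = ?K a b p q s" by (elim exE conjE) (rule that)
 obtain \<phi> where \<phi>: "bij_betw \<phi> {0..<11} I" "image \<phi> ` C11 = Bk" "\<phi> 9 = a" "\<phi> 10 = b" "\<phi> ` {0,1,3} = {p,q,s}"
  using witt11[OF st h] by (elim exE conjE) (rule that)
 have "\<phi> ` {9,0,1,3} = {a,p,q,s}" using image_insert[of \<phi> 9 "{0,1,3}"] \<phi>(3,5) by simp
 then have "\<phi> ` Js (card J) = ?K a b p q s" using \<phi>(3,4,5) unfolding Js_def by (simp split: if_split)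
 also have "... = J" by (rule JJ[symmetric])
 finally show ?thesis using \<phi>(1,2) unfolding des_iso_def by blast
qed

text \<open>Four points of \<open>B\<close> together with \<open>b\<close> form no block, so
  \<open>witt11\<close> labels them 9, 0, 1, 3 and 10; the fifth point of \<open>B\<close> must then
  be 4, because \<open>9,0,1,3,4\<close> is a block of \<open>C11\<close>.\<close>

lemma canon11_block:
 assumes st: "steiner 5 11 I Bk" and B: "B \<in> Bk" and b: "b \<in> I" "b \<notin> B"
 shows "\<exists>\<phi>. des_iso \<phi> {0..<11} C11 I Bk \<and> \<phi> ` {9,0,1,3,4} = B \<and> \<phi> 10 = b"
proof -
 interpret steiner 5 11 I Bk by (rule st)
 have BI: "B \<subseteq> I" "card B = 5" "finite B" using blk[OF B] blk_fin[OF B] by auto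
 obtain xs where xs: "set xs = B" "distinct xs" "length xs = 5" using set_of_card[OF BI(3,2)] by blast
 then obtain a p q s e where "xs = [a,p,q,s,e]" by (auto simp: length_Suc_conv numeral_eq_Suc)
 then have a: "B = {a,p,q,s,e}" "distinct [a,p,q,s,e]" using xs by auto
 have c4: "card {a,p,q,s} = 5 - 1" using a(2) by simp
 have nb: "{a,b,p,q,s} \<notin> Bk"
 proof
  assume "{a,b,p,q,s} \<in> Bk"
  then have "B = {a,b,p,q,s}" using B a c4 by (intro blk_eq[of "{a,p,q,s}"]) auto
  then show False using b by blast
 qed
 have d: "distinct [a,b,p,q,s]" "{a,b,p,q,s} \<subseteq> I" using a b BI by auto
 obtain \<phi> where \<phi>: "bij_betw \<phi> {0..<11} I" "image \<phi> ` C11 = Bk" "\<phi> 9 = a" "\<phi> 10 = b" "\<phi> ` {0,1,3} = {p,q,s}"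
  using witt11[OF st d nb] by (elim exE conjE) (rule that)
 have "set [9,0,1,3,4] \<in> C11" unfolding C11_def blocks11_def by (rule imageI) simp
 then have "\<phi> ` set [9,0,1,3,4] \<in> Bk" unfolding \<phi>(2)[symmetric] by (rule imageI)
 then have "\<phi> ` {9,0,1,3,4} \<in> Bk" by simp
 moreover have "{a,p,q,s} \<subseteq> \<phi> ` {9,0,1,3,4}"
 proof -
  have "\<phi> ` {9,0,1,3} = {a,p,q,s}" using image_insert[of \<phi> 9 "{0,1,3}"] \<phi>(3,5) by simp
  moreover have "\<phi> ` {9,0,1,3} \<subseteq> \<phi> ` {9,0,1,3,4}" by (rule image_mono) auto
  ultimately show ?thesis by simp
 qed
 ultimately have "\<phi> ` {9,0,1,3,4} = B" using B a c4 by (intro blk_eq[of "{a,p,q,s}"]) auto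
 then show ?thesis using \<phi> unfolding des_iso_def by blast
qed

lemma canon11:
 assumes st: "steiner 5 11 I Bk" and J: "J \<subseteq> I" and JB: "5 \<le> card J ==> \<exists>B\<in>Bk. B \<subseteq> J"
 shows "\<exists>\<phi>. des_iso \<phi> {0..<11} C11 I Bk \<and> \<phi> ` Jc (card J) = J"
proof -
 interpret steiner 5 11 I Bk by (rule st)
 have fJ: "finite J" using J finI finite_subset by blast
 have cJ: "card J \<le> 11" using J finI cardI card_mono by metis
 consider "card J \<le> 4" | "card J = 5" | "card J = 6" | "7 \<le> card J" by linarith
 then show ?thesis
 proof cases
  case 1
  then show ?thesis using canon11_small[OF st J] by (simp add: Jc_def)
 next
  case 2
  then obtain B where B: "B \<in> Bk" "B \<subseteq> J" using JB by auto
  have "B = J" using B 2 blk[OF B(1)] fJ by (intro card_subset_eq) auto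
  obtain b where "b \<in> I" "b \<notin> B" using fresh[of B I] blk[OF B(1)] blk_fin[OF B(1)] cardI by auto
  from canon11_block[OF st B(1) this] show ?thesis using 2 \<open>B = J\<close> by (auto simp: Jc_def)
 next
  case 3
  then obtain B where B: "B \<in> Bk" "B \<subseteq> J" using JB by auto
  have "card (J - B) = 1" using B 3 blk[OF B(1)] blk_fin[OF B(1)] by (simp add: card_Diff_subset)
  then obtain b where b: "J - B = {b}" by (rule card_1_singletonE)
  then have "b \<in> I" "b \<notin> B" using J by auto
  from canon11_block[OF st B(1) this] obtain \<phi> where \<phi>: "des_iso \<phi> {0..<11} C11 I Bk" "\<phi> ` {9,0,1,3,4} = B" "\<phi> 10 = b" by blast
  have "\<phi> ` {10,9,0,1,3,4} = insert b B" using image_insert[of \<phi> 10 "{9,0,1,3,4}"] \<phi>(2,3) by simp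
  moreover have "insert b B = J" using b B by blast
  ultimately show ?thesis using \<phi>(1) 3 by (auto simp: Jc_def)
 next
  case 4
  have c: "card (I - J) = 11 - card J" using J fJ cardI by (simp add: card_Diff_subset)
  then have "card (I - J) \<le> 4" using 4 by simp
  from canon11_small[OF st _ this]
  obtain \<phi> where \<phi>: "des_iso \<phi> {0..<11} C11 I Bk" "\<phi> ` Js (11 - card J) = I - J" unfolding c by blast
  have b: "inj_on \<phi> {0..<11}" "\<phi> ` {0..<11} = I" using \<phi>(1) by (auto simp: des_iso_def bij_betw_def)
  have "\<phi> ` ({0..<11} - Js (11 - card J)) = I - (I - J)"
   using inj_on_image_set_diff[OF b(1), of "{0..<11}" "Js (11 - card J)"] Js_subset b(2) \<phi>(2) by auto
  then show ?thesis using \<phi>(1) 4 J by (intro exI[of _ \<phi>]) (auto simp: Jc_def double_diff)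
 qed
qed

text \<open>The one-point extension of \<open>C11\<close>, with 11 as the new point: blocks avoiding
  it are the complements of blocks of \<open>C11\<close>.\<close>

definition C12 :: "nat set set" where
 "C12 = insert 11 ` C11 \<union> (\<lambda>B. {0..<11} - B) ` C11"

lemma C12_block:
 assumes "X \<in> C12"
 shows "X \<subseteq> {0..<12} \<and> card X = 6"
proof -
 obtain B where B: "B \<in> C11" "X = insert 11 B \<or> X = {0..<11} - B" using assms unfolding C12_def by blast
 have b: "B \<subseteq> {0..<11}" "card B = 5" using C11_block[OF B(1)] by auto
 have fB: "finite B" using b finite_subset by blast
 have "11 \<notin> B" using b by auto
 then have "card (insert 11 B) = 6" "card ({0..<11} - B) = 6" using b fB by (auto simp: card_Diff_subset)
 moreover have "insert 11 B \<subseteq> {0..<12}" "{0..<11} - B \<subseteq> {0..<12}" using b by auto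
 ultimately show ?thesis using B(2) by blast
qed

text \<open>Both bounds of \<open>C11_meet\<close> enter: at most three common points for two blocks
  of the same kind, and at least one for a block against a complement.\<close>

lemma C12_meet:
 assumes X: "X \<in> C12" "Y \<in> C12" "X \<noteq> Y"
 shows "card (X \<inter> Y) < 5"
proof -
 obtain B where B: "B \<in> C11" "X = insert 11 B \<or> X = {0..<11} - B" using X unfolding C12_def by blast
 obtain D where D: "D \<in> C11" "Y = insert 11 D \<or> Y = {0..<11} - D" using X unfolding C12_def by blast
 have b: "B \<subseteq> {0..<11}" "card B = 5" "D \<subseteq> {0..<11}" "card D = 5" using C11_block[OF B(1)] C11_block[OF D(1)] by auto
 have fB: "finite B" "finite D" using b finite_subset by blast+
 have e: "11 \<notin> B" "11 \<notin> D" using b by auto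
 have mixed: "card (insert 11 E \<inter> ({0..<11} - F)) < 5" if "E \<in> C11" "F \<in> C11" for E F
 proof -
  have x: "E \<subseteq> {0..<11}" "card E = 5" "F \<subseteq> {0..<11}" using C11_block[OF that(1)] C11_block[OF that(2)] by auto
  have fE: "finite E" using x finite_subset by blast
  have q: "insert 11 E \<inter> ({0..<11} - F) = E - E \<inter> F" using x by auto
  have m: "1 \<le> card (E \<inter> F)" using C11_meet(1)[OF that] x by (cases "E = F") auto
  have "card (E - E \<inter> F) = card E - card (E \<inter> F)" using fE by (intro card_Diff_subset) auto
  then show ?thesis unfolding q using m x by simp
 qed
 consider "X = insert 11 B" "Y = insert 11 D" | "X = insert 11 B" "Y = {0..<11} - D"
  | "X = {0..<11} - B" "Y = insert 11 D" | "X = {0..<11} - B" "Y = {0..<11} - D" using B(2) D(2) by argo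
 then show ?thesis
 proof cases
  case 1
  then have "B \<noteq> D" using X by auto
  then have "card (B \<inter> D) \<le> 3" using C11_meet(2) B D by blast
  moreover have "X \<inter> Y = insert 11 (B \<inter> D)" using 1 by auto
  moreover have "11 \<notin> B \<inter> D" using e by auto
  ultimately show ?thesis using fB by simp
 next
  case 2 then show ?thesis using mixed[OF B(1) D(1)] by simp
 next
  case 3 then show ?thesis using mixed[OF D(1) B(1)] by (simp add: Int_commute)
 next
  case 4
  then have "B \<noteq> D" using X by auto
  then have m: "card (B \<inter> D) \<le> 3" using C11_meet(2) B D by blast
  have "X \<inter> Y = {0..<11} - (B \<union> D)" using 4 by auto
  moreover have "card ({0..<11} - (B \<union> D)) = 11 - card (B \<union> D)" using b fB by (subst card_Diff_subset) auto
  moreover have "card B + card D = card (B \<union> D) + card (B \<inter> D)" by (rule card_Un_Int[OF fB])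
  ultimately show ?thesis using b m by simp
 qed
qed

lemma card_C12: "card C12 = 132"
proof -
 have f: "finite C11" by (rule card_ge_0_finite) (simp add: card_C11)
 have s: "B \<subseteq> {0..<11}" if "B \<in> C11" for B using C11_block[OF that] by blast
 have i1: "inj_on (insert 11) C11"
 proof (rule inj_onI)
  fix x y assume a: "x \<in> C11" "y \<in> C11" "insert (11::nat) x = insert 11 y"
  then have "11 \<notin> x" "11 \<notin> y" using s[of x] s[of y] by auto
  then show "x = y" using a(3) by (metis insert_ident)
 qed
 have i2: "inj_on (\<lambda>B. {0..<11} - B) C11"
 proof (rule inj_onI)
  fix x y assume a: "x \<in> C11" "y \<in> C11" "{0..<11::nat} - x = {0..<11} - y"
  have "x = {0..<11} - ({0..<11} - x)" "y = {0..<11} - ({0..<11} - y)" using s[OF a(1)] s[OF a(2)] by blast+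
  then show "x = y" using a(3) by simp
 qed
 have "insert 11 ` C11 \<inter> (\<lambda>B. {0..<11} - B) ` C11 = {}" by auto
 then show ?thesis unfolding C12_def using f card_image[OF i1] card_image[OF i2]
  by (subst card_Un_disjoint) (auto simp: card_C11)
qed

lemma C12_steiner: "steiner 6 12 {0..<12} C12"
proof
 show "B \<subseteq> {0..<12} \<and> card B = 6" if "B \<in> C12" for B using C12_block[OF that] .
 show "\<exists>!B. B \<in> C12 \<and> S \<subseteq> B" if "S \<subseteq> {0..<12}" "card S = 6 - 1" for S
 proof (rule packing_unique[of "{0..<12}" 6])
  show "card (B \<inter> B') < 6 - 1" if "B \<in> C12" "B' \<in> C12" "B \<noteq> B'" for B B'
   using C12_meet[OF that] by simp
  show "card C12 * 6 = card {0..<12::nat} choose (6 - 1)" using choose_12_5 by (simp add: card_C12)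
 qed (use that C12_block in auto)
qed auto

lemma derived_steiner:
 assumes st: "steiner 6 12 I Bk" and z: "z \<in> I"
 shows "steiner 5 11 (I - {z}) ((\<lambda>B. B - {z}) ` {B \<in> Bk. z \<in> B})"
proof -
 interpret steiner 6 12 I Bk by (rule st)
 show ?thesis
 proof
  show "finite (I - {z})" using finI by simp
  show "card (I - {z}) = 11" using z finI cardI by simp
  show "B \<subseteq> I - {z} \<and> card B = 5" if "B \<in> (\<lambda>B. B - {z}) ` {B \<in> Bk. z \<in> B}" for B
  proof -
   obtain X where X: "X \<in> Bk" "z \<in> X" "B = X - {z}" using \<open>B \<in> _\<close> by blast
   then show ?thesis using blk[OF X(1)] blk_fin[OF X(1)] by auto
  qed
  show "\<exists>!B. B \<in> (\<lambda>B. B - {z}) ` {B \<in> Bk. z \<in> B} \<and> S \<subseteq> B" if S: "S \<subseteq> I - {z}" "card S = 5 - 1" for S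
  proof -
   have fS: "finite S" using S finI finite_subset by blast
   have zS: "z \<notin> S" using S by auto
   have oS: "insert z S \<subseteq> I" "card (insert z S) = 6 - 1" "z \<notin> S" using S fS z zS by auto
   obtain B where B: "B \<in> Bk" "insert z S \<subseteq> B" using blk_ex[OF oS(1,2)] by blast
   show ?thesis
   proof (rule ex1I[of _ "B - {z}"])
    show "B - {z} \<in> (\<lambda>B. B - {z}) ` {B \<in> Bk. z \<in> B} \<and> S \<subseteq> B - {z}" using B oS by blast
    fix X assume X: "X \<in> (\<lambda>B. B - {z}) ` {B \<in> Bk. z \<in> B} \<and> S \<subseteq> X"
    then obtain D where D: "D \<in> Bk" "z \<in> D" "X = D - {z}" by blast
    have "D = B" using D X B oS by (intro blk_eq[of "insert z S"]) auto
    then show "X = B - {z}" using D by simp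
   qed
  qed
 qed auto
qed

text \<open>The blocks avoiding a point \<open>z\<close> are the complements of the blocks of the derived design at \<open>z\<close>: a block of
 the derived design is never contained in one of them, and counting shows that exactly \<open>462 - 6 * 66 = 66\<close> of
 the six-element sets contain no block.\<close>

lemma extend_iso:
 assumes st: "steiner 6 12 I Bk" and z: "z \<in> I"
  and iso: "des_iso \<phi> {0..<11} C11 (I - {z}) ((\<lambda>B. B - {z}) ` {B \<in> Bk. z \<in> B})"
 shows "des_iso (\<phi>(11 := z)) {0..<12} C12 I Bk"
proof -
 interpret steiner 6 12 I Bk by (rule st)
 define I' where "I' = I - {z}"
 define D where "D = (\<lambda>B. B - {z}) ` {B \<in> Bk. z \<in> B}"
 interpret d: steiner 5 11 I' D unfolding I'_def D_def by (rule derived_steiner[OF st z])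
 have b: "bij_betw \<phi> {0..<11} I'" "image \<phi> ` C11 = D" using iso unfolding des_iso_def I'_def D_def by auto
 have inj: "inj_on \<phi> {0..<11}" and im: "\<phi> ` {0..<11} = I'" using b(1) by (auto simp: bij_betw_def)
 have meet: "B \<inter> B' \<noteq> {} \<and> (B \<noteq> B' --> card (B \<inter> B') \<le> 3)" if BB: "B \<in> D" "B' \<in> D" for B B'
 proof -
  have "B \<in> image \<phi> ` C11" "B' \<in> image \<phi> ` C11" using BB b(2) by auto
  then obtain X Y where X: "X \<in> C11" "B = \<phi> ` X" "Y \<in> C11" "B' = \<phi> ` Y" by blast
  have s: "X \<subseteq> {0..<11}" "Y \<subseteq> {0..<11}" "card X = 5" using C11_block X by auto
  have e: "B \<inter> B' = \<phi> ` (X \<inter> Y)" using inj_on_image_Int[OF inj s(1,2)] X by simp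
  have "card (B \<inter> B') = card (X \<inter> Y)" unfolding e using s by (intro card_image inj_on_subset[OF inj]) auto
  moreover have "X \<inter> Y \<noteq> {}" using C11_meet(1)[OF X(1,3)] s by (cases "X = Y") auto
  moreover have "B \<noteq> B' --> card (X \<inter> Y) \<le> 3" using C11_meet(2)[OF X(1,3)] X by auto
  ultimately show ?thesis unfolding e by auto
 qed
 define N6 where "N6 = {X. X \<subseteq> I' \<and> card X = 6 \<and> \<not> (\<exists>B\<in>D. B \<subseteq> X)}"
 define A6 where "A6 = {X. X \<subseteq> I' \<and> card X = 6}"
 define U where "U = (\<Union>B\<in>D. {X. B \<subseteq> X \<and> X \<subseteq> I' \<and> card X = 6})"
 have fI': "finite I'" and cI': "card I' = 11" using d.finI d.cardI by auto
 have fA: "finite A6" unfolding A6_def by (rule finite_subset[of _ "Pow I'"]) (use fI' in auto)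
 have cD: "card D = 66" unfolding d.card_Bk d.bn_def using choose_11_4 by simp
 have "card A6 = 462" unfolding A6_def n_subsets[OF fI'] cI' by (simp add: numeral_eq_Suc)
 moreover have "card U = 396"
 proof -
  have "card U = (\<Sum>B\<in>D. card {X. B \<subseteq> X \<and> X \<subseteq> I' \<and> card X = 6})" unfolding U_def
  proof (rule card_UN_disjoint[OF d.finBk])
   show "\<forall>B\<in>D. finite {X. B \<subseteq> X \<and> X \<subseteq> I' \<and> card X = 6}"
    using fI' by (auto intro: finite_subset[of _ "Pow I'"])
   show "\<forall>B\<in>D. \<forall>B'\<in>D. B \<noteq> B' --> {X. B \<subseteq> X \<and> X \<subseteq> I' \<and> card X = 6} \<inter> {X. B' \<subseteq> X \<and> X \<subseteq> I' \<and> card X = 6} = {}"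
   proof (intro ballI impI equals0I)
    fix B B' X assume a: "B \<in> D" "B' \<in> D" "B \<noteq> B'" "X \<in> {X. B \<subseteq> X \<and> X \<subseteq> I' \<and> card X = 6} \<inter> {X. B' \<subseteq> X \<and> X \<subseteq> I' \<and> card X = 6}"
    have "finite X" using a(4) fI' finite_subset by blast
    then have "card (B \<union> B') \<le> 6" using card_mono[of X "B \<union> B'"] a(4) by auto
    moreover have "card B + card B' = card (B \<union> B') + card (B \<inter> B')" using d.blk_fin a by (intro card_Un_Int) auto
    ultimately show False using meet[OF a(1,2)] a(3) d.blk[OF a(1)] d.blk[OF a(2)] by auto
   qed
  qed
  also have "... = (\<Sum>B\<in>D. 6)"
  proof (rule sum.cong[OF refl])
   fix B assume B: "B \<in> D"
   show "card {X. B \<subseteq> X \<and> X \<subseteq> I' \<and> card X = 6} = 6"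
    using card_sets_between[OF fI', of B 6] d.blk[OF B] cI' by simp
  qed
  finally show ?thesis using cD by simp
 qed
 moreover have "U \<subseteq> A6" unfolding U_def A6_def by blast
 moreover have "N6 = A6 - U" unfolding N6_def A6_def U_def by blast
 ultimately have cN: "card N6 = 66" using fA finite_subset[of U A6] by (simp add: card_Diff_subset)
 have fN: "finite N6" by (rule card_ge_0_finite) (simp add: cN)
 define M where "M = {X \<in> Bk. z \<notin> X}"
 have "M \<subseteq> N6"
 proof
  fix X assume X: "X \<in> M"
  then have X': "X \<in> Bk" "z \<notin> X" "X \<subseteq> I" "card X = 6" using blk by (auto simp: M_def)
  have "\<not> B \<subseteq> X" if "B \<in> D" for B
  proof
   assume s: "B \<subseteq> X"
   obtain Y where Y: "Y \<in> Bk" "z \<in> Y" "B = Y - {z}" using \<open>B \<in> D\<close> unfolding D_def by blast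
   have "X = Y" using X' Y s d.blk[OF that] by (intro blk_eq[of B]) auto
   then show False using X' Y by blast
  qed
  then show "X \<in> N6" using X' unfolding N6_def I'_def by blast
 qed
 moreover have "card M = 66"
 proof -
  have "card Bk = 132" unfolding card_Bk bn_def using choose_12_5 by simp
  moreover have "card {B \<in> Bk. z \<in> B} = 66" using bn_through[of "{z}"] z choose_11_4 by (simp add: bn_def)
  moreover have "M = Bk - {B \<in> Bk. z \<in> B}" unfolding M_def by blast
  ultimately show ?thesis using finBk by (simp add: card_Diff_subset)
 qed
 ultimately have MN: "M = N6" using fN cN by (intro card_subset_eq) auto
 have compN: "(\<lambda>B. I' - B) ` D \<subseteq> N6"
 proof
  fix X assume "X \<in> (\<lambda>B. I' - B) ` D"
  then obtain B where B: "B \<in> D" "X = I' - B" by blast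
  have "card X = 6" unfolding B(2) using d.blk[OF B(1)] d.blk_fin[OF B(1)] cI' by (simp add: card_Diff_subset)
  moreover have "\<not> B' \<subseteq> X" if "B' \<in> D" for B' using meet[OF B(1) that] B(2) by blast
  ultimately show "X \<in> N6" using B unfolding N6_def by blast
 qed
 have "inj_on (\<lambda>B. I' - B) D"
 proof (rule inj_onI)
  fix x y assume a: "x \<in> D" "y \<in> D" "I' - x = I' - y"
  have "x = I' - (I' - x)" "y = I' - (I' - y)" using d.blk[OF a(1)] d.blk[OF a(2)] by blast+
  then show "x = y" using a(3) by simp
 qed
 then have "card ((\<lambda>B. I' - B) ` D) = 66" using cD by (simp add: card_image)
 then have comp: "(\<lambda>B. I' - B) ` D = M" unfolding MN using compN fN cN by (intro card_subset_eq) auto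
 define \<Phi> where "\<Phi> = \<phi>(11 := z)"
 have \<Phi>e: "\<Phi> ` X = \<phi> ` X" if "X \<subseteq> {0..<11}" for X unfolding \<Phi>_def using that by (intro image_cong) auto
 have "bij_betw \<Phi> {0..<12} I"
 proof -
  have "bij_betw \<Phi> {0..<11} I'" using b(1) by (rule bij_betw_cong[THEN iffD1, rotated]) (auto simp: \<Phi>_def)
  moreover have "bij_betw \<Phi> {11} {z}" by (simp add: \<Phi>_def)
  ultimately have "bij_betw \<Phi> ({0..<11} \<union> {11}) (I' \<union> {z})" by (rule bij_betw_combine) (simp add: I'_def)
  moreover have "{0..<11} \<union> {11} = {0..<12::nat}" by auto
  moreover have "I' \<union> {z} = I" using z by (auto simp: I'_def)
  ultimately show ?thesis by simp
 qed
 moreover have "image \<Phi> ` C12 = Bk"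
 proof -
  have "image \<Phi> ` (insert 11 ` C11) = insert z ` (image \<phi> ` C11)" unfolding image_image
  proof (rule image_cong[OF refl])
   fix B assume "B \<in> C11"
   then have "\<Phi> ` B = \<phi> ` B" using C11_block by (intro \<Phi>e) auto
   then show "\<Phi> ` insert 11 B = insert z (\<phi> ` B)" unfolding image_insert by (simp add: \<Phi>_def)
  qed
  moreover have "image \<Phi> ` ((\<lambda>B. {0..<11} - B) ` C11) = (\<lambda>B. I' - B) ` (image \<phi> ` C11)"
   unfolding image_image
  proof (rule image_cong[OF refl])
   fix B assume "B \<in> C11"
   then have B: "B \<subseteq> {0..<11}" using C11_block by blast
   have "\<Phi> ` ({0..<11} - B) = \<phi> ` ({0..<11} - B)" by (rule \<Phi>e) auto
   also have "... = I' - \<phi> ` B" using inj_on_image_set_diff[OF inj, of "{0..<11}" B] B im by auto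
   finally show "\<Phi> ` ({0..<11} - B) = I' - \<phi> ` B" .
  qed
  moreover have "insert z ` D = {B \<in> Bk. z \<in> B}"
  proof -
   have "insert z ` D = (\<lambda>B. B) ` {B \<in> Bk. z \<in> B}" unfolding D_def image_image
    by (rule image_cong[OF refl]) auto
   then show ?thesis by simp
  qed
  moreover have "{B \<in> Bk. z \<in> B} \<union> M = Bk" unfolding M_def by blast
  ultimately show ?thesis unfolding C12_def image_Un b(2) comp by simp
 qed
 ultimately show ?thesis unfolding des_iso_def \<Phi>_def by blast
qed

definition Jd :: "nat => nat set" where
 "Jd j = (if j = 0 then {} else insert 11 (Jc (j - 1)))"

text \<open>Derive at a point \<open>z\<close> of \<open>J\<close>, taken from a block inside
  \<open>J\<close> when there are at least six points, so that the rest of \<open>J\<close>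
  qualifies for \<open>canon11\<close>; \<open>extend_iso\<close> lifts the labelling, sending 11 to
  \<open>z\<close>.\<close>

lemma canon12:
 assumes st: "steiner 6 12 I Bk" and J: "J \<subseteq> I" and JB: "6 \<le> card J ==> \<exists>B\<in>Bk. B \<subseteq> J"
 shows "\<exists>\<phi>. des_iso \<phi> {0..<12} C12 I Bk \<and> \<phi> ` Jd (card J) = J"
proof -
 interpret steiner 6 12 I Bk by (rule st)
 have fJ: "finite J" using J finI finite_subset by blast
 have ext: "\<exists>\<phi>. des_iso \<phi> {0..<12} C12 I Bk \<and> \<phi> 11 = z \<and> \<phi> ` Jc (card K) = K"
  if z: "z \<in> I" and K: "K \<subseteq> I - {z}" "5 \<le> card K ==> \<exists>B\<in>Bk. z \<in> B \<and> B - {z} \<subseteq> K" for z K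
 proof -
  have "\<exists>\<phi>. des_iso \<phi> {0..<11} C11 (I - {z}) ((\<lambda>B. B - {z}) ` {B \<in> Bk. z \<in> B}) \<and> \<phi> ` Jc (card K) = K"
  proof (rule canon11[OF derived_steiner[OF st z] K(1)])
   assume "5 \<le> card K"
   then show "\<exists>B\<in>(\<lambda>B. B - {z}) ` {B \<in> Bk. z \<in> B}. B \<subseteq> K" using K(2) by auto
  qed
  then obtain \<phi> where \<phi>: "des_iso \<phi> {0..<11} C11 (I - {z}) ((\<lambda>B. B - {z}) ` {B \<in> Bk. z \<in> B})" "\<phi> ` Jc (card K) = K" by blast
  have "(\<phi>(11 := z)) ` Jc (card K) = \<phi> ` Jc (card K)" using Jc_subset[of "card K"] by (intro image_cong) auto
  then show ?thesis using extend_iso[OF st z \<phi>(1)] \<phi>(2) by (intro exI[of _ "\<phi>(11 := z)"]) simp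
 qed
 show ?thesis
 proof (cases "card J = 0")
  case True
  then have "J = {}" using fJ by simp
  obtain z where "z \<in> I" using fresh[of "{}" I] cardI by auto
  from ext[OF this, of "{}"] show ?thesis using \<open>J = {}\<close> by (auto simp: Jd_def)
 next
  case False
  have "\<exists>z\<in>J. 5 \<le> card (J - {z}) --> (\<exists>B\<in>Bk. z \<in> B \<and> B - {z} \<subseteq> J - {z})"
  proof (cases "6 \<le> card J")
   case True
   then obtain B where B: "B \<in> Bk" "B \<subseteq> J" using JB by blast
   have "B \<noteq> {}" using blk[OF B(1)] by auto
   then show ?thesis using B by blast
  next
   case f: False
   obtain z where "z \<in> J" using False fJ by fastforce
   then have "\<not> 5 \<le> card (J - {z})" using f fJ by simp
   then show ?thesis using \<open>z \<in> J\<close> by blast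
  qed
  then obtain z where z: "z \<in> J" "5 \<le> card (J - {z}) ==> (\<exists>B\<in>Bk. z \<in> B \<and> B - {z} \<subseteq> J - {z})" by blast
  obtain \<phi> where \<phi>: "des_iso \<phi> {0..<12} C12 I Bk" "\<phi> 11 = z" "\<phi> ` Jc (card (J - {z})) = J - {z}"
   using ext[of z "J - {z}"] z J by blast
  have "\<phi> ` Jd (card J) = insert z (J - {z})" using False \<phi>(2,3) z(1) fJ by (simp add: Jd_def)
  then show ?thesis using \<phi>(1) z(1) by (auto simp: insert_absorb)
 qed
qed

lemma Jd_subset: "Jd j \<subseteq> {0..<12}"
proof -
 have "{0..<11} \<subseteq> {0..<12::nat}" by auto
 then show ?thesis using Jc_subset[of "j - 1"] unfolding Jd_def by auto
qed

section \<open>Homogeneity and Lagrangian stability of the Witt designs\<close>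

context steiner
begin

text \<open>Both sets are images of the same canonical set under labellings by one model; composing
  one labelling with the inverse of the other gives the automorphism.\<close>

lemma homogeneousI:
 assumes C: "\<And>B. B \<in> C ==> B \<subseteq> I0" and K: "\<And>j. K j \<subseteq> I0"
  and can: "\<And>J. J \<subseteq> I ==> (r \<le> card J ==> \<exists>B\<in>Bk. B \<subseteq> J) ==> \<exists>\<phi>. des_iso \<phi> I0 C I Bk \<and> \<phi> ` K (card J) = J"
 shows homogeneous unfolding homogeneous_def
proof (intro allI impI)
 fix J J' assume J: "J \<subseteq> I" "J' \<subseteq> I" "card J = card J'" "r \<le> card J --> (\<exists>B\<in>Bk. B \<subseteq> J) \<and> (\<exists>B\<in>Bk. B \<subseteq> J')"
 obtain \<phi> where \<phi>: "des_iso \<phi> I0 C I Bk" "\<phi> ` K (card J) = J" using can[of J] J by auto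
 obtain \<psi> where \<psi>: "des_iso \<psi> I0 C I Bk" "\<psi> ` K (card J) = J'" using can[of J'] J by auto
 have "des_iso (\<psi> \<circ> inv_into I0 \<phi>) I Bk I Bk" by (rule des_iso_comp[OF des_iso_inv[OF \<phi>(1) C] \<psi>(1)])
 moreover have "(\<psi> \<circ> inv_into I0 \<phi>) ` J = J'"
 proof -
  have "inj_on \<phi> I0" using \<phi>(1) by (auto simp: des_iso_def bij_betw_def)
  then have "inv_into I0 \<phi> ` (\<phi> ` K (card J)) = K (card J)" using K by (rule inv_into_image_cancel)
  then have "inv_into I0 \<phi> ` J = K (card J)" unfolding \<phi>(2) .
  then show ?thesis unfolding image_comp[symmetric] using \<psi>(2) by simp
 qed
 ultimately show "\<exists>\<sigma>. bij_betw \<sigma> I I \<and> (\<lambda>B. \<sigma> ` B) ` Bk = Bk \<and> \<sigma> ` J = J'"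
  unfolding des_iso_def by blast
qed

text \<open>With no uncovered (r-1)-set, a partial system on \<open>k\<close> points is a Steiner
  system, and uniqueness of the design identifies it with \<open>Bk\<close>.\<close>

lemma lagr_stableI:
 assumes C: "\<And>B. B \<in> C0 ==> B \<subseteq> I0" and un: "\<And>(I' :: 'v set) Bk'. steiner r k I' Bk' ==> \<exists>\<phi>. des_iso \<phi> I0 C0 I' Bk'"
  and un': "\<exists>\<phi>. des_iso \<phi> I0 C0 I Bk"
  and A: "0 < A" and d0: "0 < d0" and st: "\<And>C P (x :: 'v => real) d. kkt r C P x d ==> 0 \<le> d ==> d \<le> d0 ==> lam0 - d \<le> kkt.lam P x ==>
   card C = k \<and> kkt.ms r C P = {} \<and> (\<forall>i\<in>C. (x i - 1 / real k) ^ 2 \<le> A * d)"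
 shows "lagr_stable TYPE('v)" unfolding lagr_stable_def
proof (intro allI impI)
 fix e :: real assume e: "0 < e"
 define d where "d = min d0 (e ^ 2 / A)"
 have d: "0 < d" "d \<le> d0" "A * d \<le> e ^ 2"
 proof -
  have "d \<le> e ^ 2 / A" by (simp add: d_def)
  then show "A * d \<le> e ^ 2" using A by (simp add: field_simps)
 qed (use d0 e A in "auto simp: d_def")
 show "\<exists>d>0. \<forall>(C :: 'v set) P x d'. kkt r C P x d' --> 0 \<le> d' --> d' \<le> d -->
   lam0 - d \<le> kkt.lam P x -->
   (\<exists>\<phi>. bij_betw \<phi> C I \<and> (\<lambda>X. \<phi> ` X) ` P = Bk \<and> (\<forall>c\<in>C. \<bar>x c - 1 / real k\<bar> \<le> e))"
 proof (intro exI[of _ d] conjI d(1) allI impI)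
  fix C :: "'v set" and P x d'
  assume a: "kkt r C P x d'" "0 \<le> d'" "d' \<le> d" "lam0 - d \<le> kkt.lam P x"
  \<comment> \<open>The error is weakened to \<open>d\<close>, so that one number governs both the
    Lagrange conditions and the density.\<close>
  have kd: "kkt r C P x d"
  proof -
   interpret c: kkt r C P x d' by (rule a(1))
   show ?thesis
   proof
    show "\<bar>(\<Sum>e | e \<in> P \<and> i \<in> e. \<Prod>j\<in>e - {i}. x j) - real r * (\<Sum>e\<in>P. \<Prod>j\<in>e. x j)\<bar> \<le> d" if "i \<in> C" for i
     using c.kkt[OF that] a(3) by linarith
    show "e = e'" if "e \<in> P" "e' \<in> P" "S \<subseteq> e" "S \<subseteq> e'" "card S = r - 1" for e e' S
     by (rule c.partial[OF that])
    show "0 < x i" if "i \<in> C" for i by (rule c.x0[OF that])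
    show "e \<subseteq> C \<and> card e = r" if "e \<in> P" for e by (rule c.edge[OF that])
   qed (rule c.finC r3 c.sum1)+
  qed
  interpret c: kkt r C P x d by (rule kd)
  have s: "card C = k" "c.ms = {}" "\<forall>i\<in>C. (x i - 1 / real k) ^ 2 \<le> A * d"
   using st[OF kd _ d(2) a(4)] d(1) by auto
  have "steiner r k C P"
  proof
   show "\<exists>!B. B \<in> P \<and> S \<subseteq> B" if S: "S \<subseteq> C" "card S = r - 1" for S
   proof -
    have "\<exists>B\<in>P. S \<subseteq> B" using s(2) S unfolding c.ms_def by blast
    then show ?thesis using c.partial[OF _ _ _ _ S(2)] by blast
   qed
  qed (use c.finC s(1) r3 rk c.edge in auto)
  then obtain \<phi> where \<phi>: "des_iso \<phi> I0 C0 C P" using un by blast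
  obtain \<psi> where \<psi>: "des_iso \<psi> I0 C0 I Bk" using un' by blast
  have "des_iso (\<psi> \<circ> inv_into I0 \<phi>) C P I Bk" by (rule des_iso_comp[OF des_iso_inv[OF \<phi> C] \<psi>])
  moreover have "\<bar>x c - 1 / real k\<bar> \<le> e" if "c \<in> C" for c
  proof (rule power2_le_imp_le)
   show "\<bar>x c - 1 / real k\<bar> ^ 2 \<le> e ^ 2" unfolding power2_abs using s(3) that d(3) by fastforce
  qed (use e in simp)
  ultimately show "\<exists>\<phi>. bij_betw \<phi> C I \<and> (\<lambda>X. \<phi> ` X) ` P = Bk \<and> (\<forall>c\<in>C. \<bar>x c - 1 / real k\<bar> \<le> e)"
   unfolding des_iso_def by blast
 qed
qed

end

theorem witt11_properties:
 assumes st: "steiner 5 11 I Bk"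
 shows "steiner.homogeneous 5 I Bk" "steiner.lagr_stable 5 11 I Bk TYPE('v)"
  "real (2 * 5 - 1) * steiner.kap 5 11 Bk * fact (5 - 1) \<le> 1 / 2"
proof -
 interpret steiner 5 11 I Bk by (rule st)
 have cB: "card Bk = 66" unfolding card_Bk bn_def using choose_11_4 by simp
 have l: "lam0 = 66 / 161051" by (simp add: lam0_def cB)
 show homogeneous by (rule homogeneousI[of C11 "{0..<11}" Jc]) (use C11_block Jc_subset canon11[OF st] in auto)
 have un: "\<exists>\<phi>. des_iso \<phi> {0..<11} C11 I' Bk'" if "steiner 5 11 I' Bk'" for I' :: "'w set" and Bk'
  using canon11[OF that, of "{}"] by auto
 show "lagr_stable TYPE('v)"
 proof (rule lagr_stableI[of C11 "{0..<11}" 1200 "1/10^8"])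
  fix C P and x :: "'v => real" and d
  assume a: "kkt 5 C P x d" "0 \<le> d" "d \<le> 1/10^8" "lam0 - d \<le> kkt.lam P x"
  interpret c: kkt 5 C P x d by (rule a(1))
  have l': "66 / 161051 - d \<le> c.lam" using a(4) l by simp
  show "card C = 11 \<and> c.ms = {} \<and> (\<forall>i\<in>C. (x i - 1 / real 11) ^ 2 \<le> 1200 * d)"
   using c.card_eleven[OF refl a(2,3) l'] c.near_uniform5[OF refl a(2,3) l'] by simp
 qed (use un C11_block un[OF st] in auto)
 show "real (2 * 5 - 1) * kap * fact (5 - 1) \<le> 1 / 2" by (simp add: kap_def l fact_numeral)
qed

theorem witt12_properties:
 assumes st: "steiner 6 12 I Bk"
 shows "steiner.homogeneous 6 I Bk" "steiner.lagr_stable 6 12 I Bk TYPE('v)"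
  "real (2 * 6 - 1) * steiner.kap 6 12 Bk * fact (6 - 1) \<le> 1 / 2"
proof -
 interpret steiner 6 12 I Bk by (rule st)
 have cB: "card Bk = 132" unfolding card_Bk bn_def using choose_12_5 by simp
 have l: "lam0 = 132 / 2985984" by (simp add: lam0_def cB)
 show homogeneous by (rule homogeneousI[of C12 "{0..<12}" Jd]) (use C12_block Jd_subset canon12[OF st] in auto)
 have un: "\<exists>\<phi>. des_iso \<phi> {0..<12} C12 I' Bk'" if "steiner 6 12 I' Bk'" for I' :: "'w set" and Bk'
  using canon12[OF that, of "{}"] by auto
 show "lagr_stable TYPE('v)"
 proof (rule lagr_stableI[of C12 "{0..<12}" 10000 "1/10^9"])
  fix C P and x :: "'v => real" and d
  assume a: "kkt 6 C P x d" "0 \<le> d" "d \<le> 1/10^9" "lam0 - d \<le> kkt.lam P x"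
  interpret c: kkt 6 C P x d by (rule a(1))
  have l': "132 / 2985984 - d \<le> c.lam" using a(4) l by simp
  show "card C = 12 \<and> c.ms = {} \<and> (\<forall>i\<in>C. (x i - 1 / real 12) ^ 2 \<le> 10000 * d)"
   using c.card_twelve[OF refl a(2,3) l'] c.near_uniform6[OF refl a(2,3) l'] by simp
 qed (use un C12_block un[OF st] in auto)
 show "real (2 * 6 - 1) * kap * fact (6 - 1) \<le> 1 / 2" by (simp add: kap_def l fact_numeral)
qed

section \<open>Extremal hypergraphs\<close>

lemma copy_tcop:
 assumes f: "is_copy f (T r) G" and r: "3 \<le> r"
 shows "tcop (edges G) (f ` verts (T r))"
proof -
 have inj: "inj_on f {1..2 * r - 1}" and ed: "\<And>X. X \<in> edges (T r) ==> f ` X \<in> edges G"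
  using f by (auto simp: is_copy_def T_def)
 define S where "S = f ` {1..r - 1}"
 have i1: "{1..r} = insert r {1..r - 1}" using r by auto
 have "f ` insert r {1..r - 1} \<in> edges G" using ed[of "{1..r}"] i1 by (simp add: T_def)
 then have e1: "insert (f r) S \<in> edges G" by (simp add: S_def)
 have "f ` insert (r + 1) {1..r - 1} \<in> edges G" by (rule ed) (simp add: T_def)
 then have e2: "insert (f (r + 1)) S \<in> edges G" by (simp add: S_def)
 have e3: "f ` {r..2 * r - 1} \<in> edges G" by (rule ed) (simp add: T_def)
 have n1: "f r \<notin> S" unfolding S_def by (subst inj_on_image_mem_iff[OF inj]) (use r in auto)
 have n1': "f (r + 1) \<notin> S" unfolding S_def by (subst inj_on_image_mem_iff[OF inj]) (use r in auto)
 have n2: "f r \<noteq> f (r + 1)" 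
 proof
  assume "f r = f (r + 1)"
  moreover have "1 \<le> r" "r \<le> 2 * r - 1" "r + 1 \<le> 2 * r - 1" using r by linarith+
  then have "r \<in> {1..2 * r - 1}" "r + 1 \<in> {1..2 * r - 1}" by auto
  ultimately have "r = r + 1" by (rule inj_onD[OF inj])
  then show False by simp
 qed
 have d: "f ` {r..2 * r - 1} \<inter> S = {}" unfolding S_def using r by (subst inj_on_image_Int[OF inj, symmetric]) auto
 have m: "f r \<in> f ` {r..2 * r - 1}" "f (r + 1) \<in> f ` {r..2 * r - 1}" using r by auto
 have "{1..2 * r - 1} = {1..r - 1} \<union> {r..2 * r - 1}" using r by auto
 then have "f ` verts (T r) = S \<union> f ` {r..2 * r - 1}" unfolding S_def T_def by (simp add: image_Un)
 then show ?thesis unfolding tcop_def using e1 e2 e3 n1 n1' n2 d m by blast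
qed

text \<open>\<open>S\<close> is labelled by \<open>1..r-1\<close>, \<open>a\<close> and
  \<open>b\<close> by \<open>r\<close> and \<open>r + 1\<close>, the rest of \<open>D\<close> by the
  remaining labels; injectivity follows from \<open>card Q = 2 * r - 1\<close>.\<close>

lemma tcop_copy:
 assumes E: "rgr r V E" and Q: "tcop E Q" and r: "3 \<le> r"
 shows "\<exists>f. is_copy f (T r) (Hypergraph V E) \<and> f ` verts (T r) = Q"
proof -
 obtain S a b D where t: "a \<notin> S" "b \<notin> S" "a \<noteq> b" "insert a S \<in> E" "insert b S \<in> E" "D \<in> E" "a \<in> D" "b \<in> D" "D \<inter> S = {}" "Q = S \<union> D"
  using Q unfolding tcop_def by blast
 have V: "finite V" "insert a S \<subseteq> V" "D \<subseteq> V" "card (insert a S) = r" "card D = r" using E t unfolding rgr_def by auto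
 have fin: "finite S" "finite D" using V finite_subset by auto
 have "Suc (card S) = r" using V(4) t(1) fin by simp
 then have cS: "card S = card {1..r - 1}" by simp
 have cD: "card (D - {a, b}) = card {r + 2..2 * r - 1}" using V(5) t(3,7,8) fin r by (simp add: card_Diff_subset)
 obtain h1 where h1: "bij_betw h1 {1..r - 1} S" using finite_same_card_bij[OF _ fin(1)] cS by (metis finite_atLeastAtMost)
 obtain h2 where h2: "bij_betw h2 {r + 2..2 * r - 1} (D - {a, b})" using finite_same_card_bij[of "{r + 2..2 * r - 1}" "D - {a, b}"] fin cD by auto
 define f where "f i = (if i < r then h1 i else if i = r then a else if i = r + 1 then b else h2 i)" for i
 have "f ` {1..r - 1} = h1 ` {1..r - 1}" by (rule image_cong) (use r in "auto simp: f_def")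
 then have f1: "f ` {1..r - 1} = S" using bij_betw_imp_surj_on[OF h1] by simp
 have "f ` {r + 2..2 * r - 1} = h2 ` {r + 2..2 * r - 1}" by (rule image_cong) (auto simp: f_def)
 then have f2: "f ` {r + 2..2 * r - 1} = D - {a, b}" using bij_betw_imp_surj_on[OF h2] by simp
 have fr: "f r = a" "f (r + 1) = b" by (auto simp: f_def)
 have "{r..2 * r - 1} = insert r (insert (r + 1) {r + 2..2 * r - 1})" using r by auto
 then have "f ` {r..2 * r - 1} = insert a (insert b (D - {a, b}))" using f2 fr by simp
 then have f3: "f ` {r..2 * r - 1} = D" using t(7,8) by auto
 have "{1..r} = insert r {1..r - 1}" using r by auto
 then have f4: "f ` {1..r} = insert a S" using f1 fr by simp
 have f5: "f ` insert (r + 1) {1..r - 1} = insert b S" using f1 fr by simp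
 have "{1..2 * r - 1} = {1..r - 1} \<union> {r..2 * r - 1}" using r by auto
 then have f6: "f ` {1..2 * r - 1} = Q" using f1 f3 t(10) by (simp add: image_Un)
 have cQ: "card Q = 2 * r - 1" "Q \<subseteq> V" using tcop_card[OF E Q] r by auto
 have "inj_on f {1..2 * r - 1}" by (rule eq_card_imp_inj_on) (use f6 cQ in auto)
 then have "is_copy f (T r) (Hypergraph V E)" unfolding is_copy_def T_def using f6 cQ(2) f3 f4 f5 t by auto
 then show ?thesis using f6 by (auto simp: T_def)
qed

lemma packs_iff:
 assumes E: "rgr r V E" and r: "3 \<le> r"
 shows "has_disjoint_copies k (T r) (Hypergraph V E) \<longleftrightarrow> packs k E"
proof
 assume "has_disjoint_copies k (T r) (Hypergraph V E)"
 then obtain f where f: "\<forall>i<k. is_copy (f i) (T r) (Hypergraph V E)" "disjoint_family_on (\<lambda>i. f i ` verts (T r)) {..<k}"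
  unfolding has_disjoint_copies_def by blast
 have "\<forall>i<k. tcop E (f i ` verts (T r))" using copy_tcop[OF _ r] f(1) by fastforce
 then show "packs k E" unfolding packs_def using f(2) by (intro exI[of _ "\<lambda>i. f i ` verts (T r)"]) simp
next
 assume "packs k E"
 then obtain Q where Q: "\<forall>i<k. tcop E (Q i)" "disjoint_family_on Q {..<k}" unfolding packs_def by blast
 have "\<exists>f. is_copy f (T r) (Hypergraph V E) \<and> f ` verts (T r) = Q i" if "i < k" for i
  using tcop_copy[OF E _ r] Q(1) that by blast
 then obtain f where f: "\<And>i. i < k ==> is_copy (f i) (T r) (Hypergraph V E) \<and> f i ` verts (T r) = Q i" by metis
 moreover have "disjoint_family_on (\<lambda>i. f i ` verts (T r)) {..<k}"
  using Q(2) f unfolding disjoint_family_on_def by simp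
 ultimately show "has_disjoint_copies k (T r) (Hypergraph V E)" unfolding has_disjoint_copies_def by blast
qed

lemma hg_iso_des: "hg_iso G H \<longleftrightarrow> (\<exists>f. des_iso f (verts G) (edges G) (verts H) (edges H))"
 by (simp add: hg_iso_def des_iso_def)

lemma iso_class_eq:
 assumes "\<And>X. X \<in> edges G ==> X \<subseteq> verts G" "\<And>X. X \<in> edges J ==> X \<subseteq> verts J" and GJ: "hg_iso G J"
 shows "iso_class r G = iso_class r J"
proof -
 obtain f where f: "des_iso f (verts G) (edges G) (verts J) (edges J)" using GJ hg_iso_des by blast
 have f': "des_iso (inv_into (verts G) f) (verts J) (edges J) (verts G) (edges G)" by (rule des_iso_inv[OF f assms(1)])
 have "hg_iso G H \<longleftrightarrow> hg_iso J H" for H :: "nat hypergraph"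
  unfolding hg_iso_des using des_iso_comp[OF f] des_iso_comp[OF f'] by blast
 then show ?thesis by (simp add: iso_class_def)
qed

definition cone :: "nat => 'v set => 'v set => 'v set set" where
 "cone r V A = {X. X \<subseteq> V \<and> card X = r \<and> X \<inter> A \<noteq> {}}"

lemma card_cone:
 assumes "finite V" "A \<subseteq> V"
 shows "card (cone r V A) + ((card V - card A) choose r) = card V choose r"
proof -
 have fA: "finite A" using assms finite_subset by blast
 have "{X. X \<subseteq> V \<and> card X = r} = cone r V A \<union> {X. X \<subseteq> V - A \<and> card X = r}" unfolding cone_def by blast
 moreover have "cone r V A \<inter> {X. X \<subseteq> V - A \<and> card X = r} = {}" unfolding cone_def by blast
 moreover have "finite (cone r V A)" "finite {X. X \<subseteq> V - A \<and> card X = r}"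
  unfolding cone_def using assms(1) by (auto intro: finite_subset[of _ "Pow V"])
 ultimately have "card {X. X \<subseteq> V \<and> card X = r} = card (cone r V A) + card {X. X \<subseteq> V - A \<and> card X = r}"
  by (simp add: card_Un_disjoint)
 then show ?thesis using n_subsets[OF assms(1), of r] n_subsets[of "V - A" r] assms fA by (simp add: card_Diff_subset)
qed

lemma image_cone:
 assumes F: "bij_betw F V V'" and A: "A \<subseteq> V"
 shows "image F ` cone r V A = cone r V' (F ` A)"
proof -
 have inj: "inj_on F V" and im: "F ` V = V'" using F by (auto simp: bij_betw_def)
 have c: "card (F ` X) = card X" if "X \<subseteq> V" for X by (rule card_image) (rule inj_on_subset[OF inj that])
 have m: "F ` X \<inter> F ` A = {} \<longleftrightarrow> X \<inter> A = {}" if "X \<subseteq> V" for X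
  using inj_on_image_Int[OF inj that A] by (metis image_is_empty)
 show ?thesis
 proof
  show "image F ` cone r V A \<subseteq> cone r V' (F ` A)" unfolding cone_def using c m im by auto
  show "cone r V' (F ` A) \<subseteq> image F ` cone r V A"
  proof
   fix Z assume Z: "Z \<in> cone r V' (F ` A)"
   then have "Z \<subseteq> F ` V" unfolding im cone_def by blast
   then obtain X where X: "X \<subseteq> V" "Z = F ` X" by (rule subset_imageE)
   then have "X \<in> cone r V A" using Z c[OF X(1)] m[OF X(1)] unfolding cone_def by simp
   then show "Z \<in> image F ` cone r V A" using X by blast
  qed
 qed
qed

text \<open>The edges of the complete graph and the mixed edges together are the
  \<open>r\<close>-sets meeting the first vertex set; \<open>1 \<le> r\<close> keeps the empty set
  out.\<close>

lemma edges_join: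
 fixes H :: "'b hypergraph"
 assumes r: "1 \<le> r"
 shows "edges (join r (complete_rgraph r t) H) = cone r ({1..t} <+> verts H) (Inl ` {1..t}) \<union> image Inr ` edges H"
proof -
 define A :: "(nat + 'b) set set" where "A = image Inl ` {X. X \<subseteq> {1..t} \<and> card X = r}"
 define B where "B = {X. X \<subseteq> {1..t} <+> verts H \<and> card X = r \<and> X \<inter> Inl ` {1..t} \<noteq> {} \<and> X \<inter> Inr ` verts H \<noteq> {}}"
 define C where "C = cone r ({1..t} <+> verts H) (Inl ` {1..t})"
 have "A \<subseteq> C"
 proof
  fix Z assume "Z \<in> A"
  then obtain X where X: "X \<subseteq> {1..t}" "card X = r" "Z = Inl ` X" unfolding A_def by blast
  have "X \<noteq> {}" using X(2) r by auto
  moreover have "card Z = r" using X by (simp add: card_image)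
  ultimately show "Z \<in> C" using X(1,3) unfolding C_def cone_def Plus_def by blast
 qed
 moreover have "B \<subseteq> C" unfolding B_def C_def cone_def by blast
 moreover have "C \<subseteq> A \<union> B"
 proof
  fix Z assume Z: "Z \<in> C"
  show "Z \<in> A \<union> B"
  proof (cases "Z \<inter> Inr ` verts H = {}")
   case True
   then have "Z \<subseteq> Inl ` {1..t}" using Z unfolding C_def cone_def Plus_def by blast
   then obtain X where X: "X \<subseteq> {1..t}" "Z = Inl ` X" by (rule subset_imageE)
   then have "card X = r" using Z unfolding C_def cone_def by (simp add: card_image)
   then show ?thesis using X unfolding A_def by blast
  next
   case False
   then show ?thesis using Z unfolding B_def C_def cone_def by blast
  qed
 qed
 ultimately have "A \<union> B = C" by blast
 moreover have "edges (join r (complete_rgraph r t) H) = A \<union> image Inr ` edges H \<union> B"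
  by (simp add: join_def complete_rgraph_def A_def B_def)
 ultimately show ?thesis unfolding C_def by blast
qed

section \<open>Constructions, joins and the final count\<close>

context steiner
begin

text \<open>A part map and an indexed partition carry the same information: the parts met by a
  vertex set are its image under the map.\<close>

lemma construction_iff:
 assumes A: "verts A = I" "edges A = Bk"
 shows "is_construction r A G \<longleftrightarrow> (\<exists>f. f ` verts G \<subseteq> I \<and> edges G = Bl f (verts G))"
proof
 assume "is_construction r A G"
 then obtain P where P: "disjoint_family_on P I" "(\<Union>i\<in>I. P i) = verts G"
  "edges G = {X. X \<subseteq> verts G \<and> card X = r \<and> {i \<in> I. X \<inter> P i \<noteq> {}} \<in> Bk}"
  unfolding is_construction_def A by blast
 have "\<exists>i\<in>I. v \<in> P i" if "v \<in> verts G" for v using P(2) that by blast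
 then obtain f where f: "\<And>v. v \<in> verts G ==> f v \<in> I \<and> v \<in> P (f v)" by metis
 have "{i \<in> I. X \<inter> P i \<noteq> {}} = f ` X" if X: "X \<subseteq> verts G" for X
 proof
  show "f ` X \<subseteq> {i \<in> I. X \<inter> P i \<noteq> {}}" using f X by blast
  show "{i \<in> I. X \<inter> P i \<noteq> {}} \<subseteq> f ` X"
  proof
   fix i assume "i \<in> {i \<in> I. X \<inter> P i \<noteq> {}}"
   then obtain v where v: "i \<in> I" "v \<in> X" "v \<in> P i" by blast
   have "f v = i" using P(1) v f[of v] X unfolding disjoint_family_on_def by blast
   then show "i \<in> f ` X" using v by blast
  qed
 qed
 then have "edges G = Bl f (verts G)" unfolding P(3) Bl_def by auto
 then show "\<exists>f. f ` verts G \<subseteq> I \<and> edges G = Bl f (verts G)" using f by blast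
next
 assume "\<exists>f. f ` verts G \<subseteq> I \<and> edges G = Bl f (verts G)"
 then obtain f where f: "f ` verts G \<subseteq> I" "edges G = Bl f (verts G)" by blast
 define P where "P i = {v \<in> verts G. f v = i}" for i
 have "disjoint_family_on P I" unfolding P_def disjoint_family_on_def by auto
 moreover have "(\<Union>i\<in>I. P i) = verts G" unfolding P_def using f(1) by auto
 moreover have "{i \<in> I. X \<inter> P i \<noteq> {}} = f ` X" if "X \<subseteq> verts G" for X
  unfolding P_def using that f(1) by auto
 then have "edges G = {X. X \<subseteq> verts G \<and> card X = r \<and> {i \<in> I. X \<inter> P i \<noteq> {}} \<in> Bk}" unfolding f(2) Bl_def by auto
 ultimately show "is_construction r A G" unfolding is_construction_def A by blast
qed

abbreviation maxc :: "'b hypergraph => nat => nat hypergraph" where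
 "maxc A n \<equiv> SOME G. is_max_construction r A n G"

text \<open>For large \<open>n\<close> a maximum triangle-free graph is a blow-up, and every blow-up
  is triangle-free, so the two maxima agree.\<close>

lemma max_construction_tmax:
 assumes L: "lagr_stable TYPE(nat)" and A: "verts A = I" "edges A = Bk"
 shows "\<exists>N. \<forall>n\<ge>N. verts (maxc A n) = {1..n} \<and>
  tmax {1..n} (edges (maxc A n))"
proof -
 obtain N where N: "\<forall>(V :: nat set) E. N \<le> card V --> tmax V E -->
   (\<exists>f. f ` V \<subseteq> I \<and> E = Bl f V \<and>
   balanced V f)" using tmax_blowup[OF L] by (elim exE) (rule that)
 have "verts (maxc A n) = {1..n} \<and> tmax {1..n} (edges (maxc A n))"
  if n: "N \<le> n" for n
 proof -
  obtain E0 where E0: "tmax {1..n} E0" using tmax_ex[of "{1..n}"] by auto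
  have "N \<le> card {1..n}" using n by simp
  then obtain f where f: "f ` {1..n} \<subseteq> I" "E0 = Bl f {1..n}" using N E0 by blast
  have le: "card (edges H) \<le> card E0" if H: "verts H = {1..n}" "is_construction r A H" for H
  proof -
   obtain g where g: "edges H = Bl g {1..n}" using H construction_iff[OF A] by metis
   show ?thesis using E0 Bl_rgr[of "{1..n}" g] Bl_tfree[of g "{1..n}"] unfolding tmax_def g by blast
  qed
  have con: "is_construction r A (Hypergraph {1..n} E0)" unfolding construction_iff[OF A] using f by auto
  then have "is_max_construction r A n (Hypergraph {1..n} E0)" unfolding is_max_construction_def using le by auto
  then have ex: "\<exists>G. is_max_construction r A n G" by blast
  define M0 where "M0 = (maxc A n)"
  have M: "is_max_construction r A n M0" unfolding M0_def by (rule someI_ex[OF ex])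
  have vh: "verts (Hypergraph {1..n} E0) = {1..n}" by simp
  have "card (edges (Hypergraph {1..n} E0)) \<le> card (edges M0)" using M con vh unfolding is_max_construction_def by blast
  then have M0: "verts M0 = {1..n}" "is_construction r A M0" "card E0 \<le> card (edges M0)"
   using M con unfolding is_max_construction_def by auto
  obtain g where g: "edges M0 = Bl g {1..n}" using M0 construction_iff[OF A] by metis
  have "tmax {1..n} (edges M0)" unfolding tmax_def g
  proof (intro conjI allI impI)
   show "rgr r {1..n} (Bl g {1..n})" by (rule Bl_rgr) simp
   show "tfree (Bl g {1..n})" by (rule Bl_tfree)
   show "card E' \<le> card (Bl g {1..n})" if "rgr r {1..n} E'" "tfree E'" for E'
    using E0 M0(3) that unfolding tmax_def g by (meson order_trans)
  qed
  then show ?thesis using M0(1) unfolding M0_def by blast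
 qed
 then show ?thesis by blast
qed

lemma cone_join_iso:
 assumes V: "finite V" "A \<subseteq> V" "card A = t" and g: "bij_betw g (V - A) (verts H)" "image g ` E' = edges H"
  and E': "\<And>X. X \<in> E' ==> X \<subseteq> V - A"
 shows "hg_iso (Hypergraph V (cone r V A \<union> E')) (join r (complete_rgraph r t) H)"
proof -
 have r1: "1 \<le> r" using r3 by simp
 have fA: "finite A" using V finite_subset by blast
 obtain h where h: "bij_betw h A {1..t}" using finite_same_card_bij[OF fA, of "{1..t}"] V(3) by auto
 define F where "F v = (if v \<in> A then Inl (h v) else Inr (g v))" for v
 have FA: "bij_betw F A (Inl ` {1..t})"
 proof -
  have "bij_betw (Inl \<circ> h) A (Inl ` {1..t})" by (rule bij_betw_trans[OF h]) (auto simp: bij_betw_def)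
  then show ?thesis by (rule bij_betw_cong[THEN iffD1, rotated]) (simp add: F_def)
 qed
 have FB: "bij_betw F (V - A) (Inr ` verts H)"
 proof -
  have "bij_betw (Inr \<circ> g) (V - A) (Inr ` verts H)" by (rule bij_betw_trans[OF g(1)]) (auto simp: bij_betw_def)
  then show ?thesis by (rule bij_betw_cong[THEN iffD1, rotated]) (simp add: F_def)
 qed
 have "bij_betw F (A \<union> (V - A)) (Inl ` {1..t} \<union> Inr ` verts H)" by (rule bij_betw_combine[OF FA FB]) auto
 moreover have "A \<union> (V - A) = V" using V(2) by blast
 ultimately have F: "bij_betw F V ({1..t} <+> verts H)" by (simp add: Plus_def)
 have "F ` A = Inl ` {1..t}" using FA by (rule bij_betw_imp_surj_on)
 then have c: "image F ` cone r V A = cone r ({1..t} <+> verts H) (Inl ` {1..t})" using image_cone[OF F V(2)] by simp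
 have "image F ` E' = image Inr ` (image g ` E')" unfolding image_image
 proof (rule image_cong[OF refl])
  fix X assume "X \<in> E'"
  then show "F ` X = (\<lambda>x. Inr (g x)) ` X" using E' by (intro image_cong) (auto simp: F_def)
 qed
 then have "image F ` E' = image Inr ` edges H" using g(2) by simp
 then have "image F ` (cone r V A \<union> E') = edges (join r (complete_rgraph r t) H)"
  unfolding edges_join[OF r1] image_Un c by simp
 moreover have "verts (join r (complete_rgraph r t) H) = {1..t} <+> verts H" by (simp add: join_def complete_rgraph_def)
 ultimately show ?thesis using F unfolding hg_iso_def by (intro exI[of _ F]) simp
qed

text \<open>A graph with at least as many edges as the join has a cover of \<open>t\<close> vertices
  by \<open>disjoint_copies_structure\<close>. Its size is then at most that of the cone over the
  cover plus a maximum triangle-free graph on the rest, and equality forces both;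
  \<open>tmax_unique\<close> gives a single isomorphism type.\<close>

theorem extremal_join:
 assumes L: "lagr_stable TYPE(nat)" and H: homogeneous and gap: "real (2 * r - 1) * kap * fact (r - 1) \<le> 1 / 2"
  and A: "verts A = I" "edges A = Bk"
 shows "\<exists>(N0 :: nat) (c :: real). c > 0 \<and>
  (\<forall>(n :: nat) (t :: nat). n \<ge> N0 \<and> real t \<le> c * real n -->
    Extremal r n (t + 1) (T r) = {iso_class r (join r (complete_rgraph r t) (maxc A (n - t)))})"
proof -
 obtain N1 where N1: "\<And>n. N1 \<le> n ==> verts (maxc A n) = {1..n} \<and>
  tmax {1..n} (edges (maxc A n))" using max_construction_tmax[OF L A] by blast
 obtain N2 where N2: "\<forall>(V :: nat set) E (V' :: nat set) E'. N2 \<le> card V --> card V = card V' --> tmax V E --> tmax V' E' -->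
   (\<exists>g. bij_betw g V V' \<and> (\<lambda>X. g ` X) ` E = E')" using tmax_unique[OF L H] by (elim exE) (rule that)
 obtain c1 N3 where c1: "0 < c1" and N3: "\<forall>t (V :: nat set) E. rgr r V E --> N3 + t \<le> card V --> real t \<le> c1 * rcard V -->
   \<not> packs (t + 1) E -->
   lower (card V) t \<le> rcard E -->
   (\<exists>A\<subseteq>V. card A = t \<and> tfree {X \<in> E. X \<inter> A = {}})"
  using disjoint_copies_structure[OF L gap] by (elim exE conjE) (rule that)
 define N where "N = max (max N1 N2) (max N3 k)"
 \<comment> \<open>The cap \<open>1/2\<close> keeps \<open>n - t\<close> at least
   \<open>n / 2\<close>, so the thresholds in \<open>N\<close> apply to
   \<open>n - t\<close>.\<close>
 define c where "c = min c1 (1 / 2)"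
 have c: "0 < c" "c \<le> c1" "c \<le> 1 / 2" using c1 by (auto simp: c_def)
 have r': "1 \<le> r" using r3 by simp
 have main: "Extremal r n (t + 1) (T r) = {iso_class r (join r (complete_rgraph r t) (maxc A (n - t)))}"
  if n: "2 * N \<le> n" and t: "real t \<le> c * real n" for n t :: nat
 proof -
  define m where "m = n - t"
  have tc: "real t \<le> c1 * real n" using t mult_right_mono[OF c(2), of "real n"] by simp
  have "real t \<le> 1 / 2 * real n" using t mult_right_mono[OF c(3), of "real n"] by simp
  then have "2 * t \<le> n" by linarith
  then have m: "N \<le> m" "n = m + t" "N + t \<le> n" using n unfolding m_def by linarith+
  have mN: "N1 \<le> m" "N2 \<le> m" "N3 \<le> m" "k \<le> m" using m(1) unfolding N_def by auto
  define M where "M = (maxc A m)"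
  have M: "verts M = {1..m}" "tmax {1..m} (edges M)" using N1[OF mN(1)] unfolding M_def by auto
  define w where "w = card (edges M)"
  define J where "J = join r (complete_rgraph r t) M"
  have same: "\<exists>g. bij_betw g V {1..m} \<and> image g ` E = edges M" if "tmax V E" "card V = m" for V :: "nat set" and E
   using N2[rule_format, of V "{1..m}" E "edges M"] that M(2) mN(2) by simp
  have Mw: "\<And>X. X \<in> edges M ==> X \<subseteq> {1..m} \<and> card X = r" using M(2) unfolding tmax_def rgr_def by blast
  have cw: "card E = w" if E: "tmax V E" "card V = m" for V :: "nat set" and E
  proof -
   obtain g where g: "bij_betw g V {1..m}" "image g ` E = edges M" using same[OF E] by blast
   have "inj_on (image g) E"
   proof (rule inj_onI)
    fix X Y assume "X \<in> E" "Y \<in> E" "g ` X = g ` Y"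
    then show "X = Y" using inj_on_image_eq_iff[of g V X Y] g(1) E(1) by (auto simp: bij_betw_def tmax_def rgr_def)
   qed
   then show ?thesis unfolding w_def g(2)[symmetric] by (simp add: card_image)
  qed
  have wlow: "lam0 * real m ^ r - slack * real m ^ (r - 2) \<le> real w"
  proof -
   have "k \<le> card {1..m}" using mN by simp
   then obtain f where f: "f ` {1..m} \<subseteq> I" "lam0 * real m ^ r - slack * real m ^ (r - 2) \<le> rcard (Bl f {1..m})"
    using ex_large_blowup[of "{1..m}"] unfolding slack_def by auto
   have "card (Bl f {1..m}) \<le> w" unfolding w_def using M(2) Bl_rgr[of "{1..m}" f] Bl_tfree[of f "{1..m}"] unfolding tmax_def by blast
   then show ?thesis using f(2) by linarith
  qed
  \<comment> \<open>Edge counts are compared in additive form, to avoid subtracting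
    \<open>m choose r\<close> in \<open>nat\<close>.\<close>
  have extr: "card E + (m choose r) = (n choose r) + w \<and>
   (\<exists>B\<subseteq>V. card B = t \<and> (\<exists>E'. tmax (V - B) E' \<and> E = cone r V B \<union> E'))"
   if E: "rgr r V E" "card V = n" "\<not> packs (t + 1) E" "(n choose r) + w \<le> card E + (m choose r)" for V :: "nat set" and E
  proof -
   have fV: "finite V" using E(1) by (simp add: rgr_def)
   have fE: "finite E" by (rule rgr_finite[OF E(1)])
   have "real ((n choose r) + w) \<le> real (card E + (m choose r))" using E(4) by (simp only: of_nat_le_iff)
   then have "real (n choose r) - real (m choose r) + lam0 * real m ^ r - slack * real m ^ (r - 2) \<le> rcard E"
    using wlow by simp
   then obtain B where B: "B \<subseteq> V" "card B = t" "tfree {X \<in> E. X \<inter> B = {}}"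
    using N3[rule_format, OF E(1), of t] E(2,3) mN(3) m(2) tc unfolding m_def by auto
   define E' where "E' = {X \<in> E. X \<inter> B = {}}"
   have fB: "finite B" using B fV finite_subset by blast
   have E': "rgr r (V - B) E'" using E(1) unfolding E'_def rgr_def by auto
   have cVB: "card (V - B) = m" using B fB E(2) m(2) by (simp add: card_Diff_subset)
   obtain E2 where E2: "tmax (V - B) E2" using tmax_ex[of "V - B"] fV by auto
   have le: "card E' \<le> w" using E2 E' B(3) cw[OF E2 cVB] unfolding tmax_def E'_def by metis
   have cc: "card (cone r V B) + (m choose r) = n choose r" using card_cone[OF fV B(1), of r] E(2) B(2) m(2) by simp
   have sub: "E \<subseteq> cone r V B \<union> E'" using E(1) unfolding cone_def E'_def rgr_def by blast
   have fc: "finite (cone r V B)" unfolding cone_def using fV by (auto intro: finite_subset[of _ "Pow V"])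
   have fE': "finite E'" unfolding E'_def using fE by simp
   have "card E \<le> card (cone r V B \<union> E')" using sub fc fE' by (intro card_mono) auto
   moreover have "card (cone r V B \<union> E') \<le> card (cone r V B) + card E'" by (rule card_Un_le)
   ultimately have eq: "card E = card (cone r V B \<union> E')" "card E' = w" "card E + (m choose r) = (n choose r) + w"
    using le cc E(4) by linarith+
   have "E = cone r V B \<union> E'" using sub fc fE' eq(1) by (intro card_subset_eq) auto
   moreover have "tmax (V - B) E'" unfolding tmax_def
   proof (intro conjI allI impI)
    show "tfree E'" using B(3) by (simp add: E'_def)
    show "card E'' \<le> card E'" if "rgr r (V - B) E''" "tfree E''" for E''
     using E2 that cw[OF E2 cVB] eq(2) unfolding tmax_def by metis
   qed (rule E')
   ultimately show ?thesis using eq(3) B by blast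
  qed
  have Jsub: "X \<subseteq> verts J" if "X \<in> edges J" for X
  proof -
   have v: "verts J = {1..t} <+> {1..m}" by (simp add: J_def join_def complete_rgraph_def M(1))
   have "X \<in> cone r ({1..t} <+> {1..m}) (Inl ` {1..t}) \<or> X \<in> image Inr ` edges M"
    using that unfolding J_def edges_join[OF r'] M(1) by blast
   then show ?thesis
   proof
    assume "X \<in> image Inr ` edges M"
    then obtain Y where Y: "Y \<in> edges M" "X = Inr ` Y" by blast
    then have "Y \<subseteq> {1..m}" using Mw by blast
    then show ?thesis unfolding v Y(2) Plus_def by blast
   qed (simp add: v cone_def)
  qed
  have isoJ: "hg_iso (Hypergraph V (cone r V B \<union> E')) J"
   if h: "finite V" "card V = n" "B \<subseteq> V" "card B = t" "tmax (V - B) E'" for V B :: "nat set" and E'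
  proof -
   have "finite B" using h finite_subset by blast
   then have "card (V - B) = m" using h m(2) by (simp add: card_Diff_subset)
   then obtain g where g: "bij_betw g (V - B) (verts M)" "image g ` E' = edges M" using same[OF h(5)] M(1) by auto
   show ?thesis unfolding J_def
   proof (rule cone_join_iso[OF h(1,3,4) g])
    show "X \<subseteq> V - B" if "X \<in> E'" for X using that h(5) unfolding tmax_def rgr_def by blast
   qed
  qed
  have free: "G \<in> disjoint_copies_free r n (t + 1) (T r) \<longleftrightarrow>
    rgr r (verts G) (edges G) \<and> card (verts G) = n \<and> \<not> packs (t + 1) (edges G)" for G
  proof -
   have "is_rgraph r G \<longleftrightarrow> rgr r (verts G) (edges G)" by (simp add: is_rgraph_def rgr_def)
   then show ?thesis unfolding disjoint_copies_free_def using packs_iff[of r "verts G" "edges G" "t + 1"] r3 by auto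
  qed
  have cls: "iso_class r G = iso_class r J \<and> card (edges G) + (m choose r) = (n choose r) + w"
   if G: "G \<in> disjoint_copies_free r n (t + 1) (T r)" "(n choose r) + w \<le> card (edges G) + (m choose r)" for G
  proof -
   have G': "rgr r (verts G) (edges G)" "card (verts G) = n" "\<not> packs (t + 1) (edges G)" using G(1) free by auto
   from extr[OF G' G(2)] obtain B E' where e: "card (edges G) + (m choose r) = (n choose r) + w" and
    B: "B \<subseteq> verts G" "card B = t" "tmax (verts G - B) E'" "edges G = cone r (verts G) B \<union> E'" by blast
   have fV: "finite (verts G)" using G'(1) by (simp add: rgr_def)
   have "hg_iso (Hypergraph (verts G) (edges G)) J" unfolding B(4) by (rule isoJ[OF fV G'(2) B(1-3)])
   then have "hg_iso G J" by simp
   moreover have "X \<subseteq> verts G" if "X \<in> edges G" for X using G'(1) that by (auto simp: rgr_def)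
   ultimately have "iso_class r G = iso_class r J" using Jsub by (intro iso_class_eq) auto
   then show ?thesis using e by blast
  qed
  obtain E0 where E0: "tmax ({1..n} - {1..t}) E0" using tmax_ex[of "{1..n} - {1..t}"] by auto
  define G0 where "G0 = Hypergraph {1..n} (cone r {1..n} {1..t} \<union> E0)"
  have tn: "{1..t} \<subseteq> {1..n}" using m(2) by auto
  have c0: "card ({1..n} - {1..t}) = m" using m(2) tn by (simp add: card_Diff_subset)
  have E0r: "rgr r ({1..n} - {1..t}) E0" "tfree E0" using E0 unfolding tmax_def by auto
  have G0r: "rgr r {1..n} (cone r {1..n} {1..t} \<union> E0)" using E0r(1) unfolding rgr_def cone_def by auto
  have "{X \<in> cone r {1..n} {1..t} \<union> E0. X \<inter> {1..t} = {}} = E0" using E0r(1) unfolding rgr_def cone_def by blast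
  then have "\<not> packs (t + 1) (cone r {1..n} {1..t} \<union> E0)" using E0r(2) by (intro not_packs_cover[of "{1..t}"]) auto
  then have G0: "G0 \<in> disjoint_copies_free r n (t + 1) (T r)" unfolding free G0_def using G0r by simp
  have cG0: "card (edges G0) + (m choose r) = (n choose r) + w"
  proof -
   have "cone r {1..n} {1..t} \<inter> E0 = {}" using E0r(1) unfolding rgr_def cone_def by blast
   moreover have "finite (cone r {1..n} {1..t})" unfolding cone_def by (rule finite_subset[of _ "Pow {1..n}"]) auto
   ultimately have "card (edges G0) = card (cone r {1..n} {1..t}) + w"
    unfolding G0_def using rgr_finite[OF E0r(1)] cw[OF E0 c0] by (simp add: card_Un_disjoint)
   moreover have "card (cone r {1..n} {1..t}) + (m choose r) = n choose r" using card_cone[OF _ tn, of r] m(2) by simp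
   ultimately show ?thesis by simp
  qed
  have up: "card (edges G) \<le> card (edges G0)" if "G \<in> disjoint_copies_free r n (t + 1) (T r)" for G
  proof (cases "(n choose r) + w \<le> card (edges G) + (m choose r)")
   case True
   then show ?thesis using cls[OF that] cG0 by linarith
  next
   case False
   then show ?thesis using cG0 by linarith
  qed
  have "Extremal r n (t + 1) (T r) = {iso_class r J}"
  proof
   show "Extremal r n (t + 1) (T r) \<subseteq> {iso_class r J}"
   proof
    fix K assume "K \<in> Extremal r n (t + 1) (T r)"
    then obtain G where G: "K = iso_class r G" "G \<in> disjoint_copies_free r n (t + 1) (T r)"
     "\<forall>H \<in> disjoint_copies_free r n (t + 1) (T r). card (edges H) \<le> card (edges G)" unfolding Extremal_def by blast
    have "card (edges G0) \<le> card (edges G)" using G(3) G0 by blast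
    then have "(n choose r) + w \<le> card (edges G) + (m choose r)" using cG0 by linarith
    then show "K \<in> {iso_class r J}" using cls[OF G(2)] G(1) by simp
   qed
   have "iso_class r G0 \<in> Extremal r n (t + 1) (T r)" unfolding Extremal_def using G0 up by blast
   moreover have "iso_class r G0 = iso_class r J" using cls[OF G0] cG0 by simp
   ultimately show "{iso_class r J} \<subseteq> Extremal r n (t + 1) (T r)" by simp
  qed
  then show ?thesis by (simp add: J_def M_def m_def)
 qed
 show ?thesis by (rule exI[of _ "2 * N"], rule exI[of _ c]) (use c(1) main in blast)
qed

end

text \<open>The models live on \<open>{0..<k}\<close>, the chosen designs on \<open>{1..k}\<close>;
  the shifted model is the witness for the choices in \<open>W5\<close> and
  \<open>W6\<close>.\<close>

lemma steiner_shift: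
 assumes st: "steiner r k {0..<k} C"
 shows "is_steiner_system (r - 1) r k (Hypergraph {1..k} (image Suc ` C))"
proof -
 interpret steiner r k "{0..<k}" C by (rule st)
 have S1: "Suc ` {0..<k} = {1..k}" by auto
 have "\<exists>!X. X \<in> image Suc ` C \<and> S \<subseteq> X" if S: "S \<subseteq> {1..k}" "card S = r - 1" for S
 proof -
  obtain S' where S': "S' \<subseteq> {0..<k}" "S = Suc ` S'" using S(1) unfolding S1[symmetric] by (rule subset_imageE)
  have c: "card S' = r - 1" using S(2) S'(2) by (simp add: card_image)
  obtain B where B: "B \<in> C" "S' \<subseteq> B" using blk_ex[OF S'(1) c] by blast
  show ?thesis
  proof (rule ex1I[of _ "Suc ` B"])
   show "Suc ` B \<in> image Suc ` C \<and> S \<subseteq> Suc ` B" using B S' by blast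
   fix X assume "X \<in> image Suc ` C \<and> S \<subseteq> X"
   then obtain B' where B': "B' \<in> C" "X = Suc ` B'" "Suc ` S' \<subseteq> Suc ` B'" using S'(2) by blast
   have "S' \<subseteq> B'" using B'(3) by (simp add: inj_image_subset_iff)
   then have "B' = B" using B B' c by (intro blk_eq[of S']) auto
   then show "X = Suc ` B" using B' by simp
  qed
 qed
 moreover have "X \<subseteq> {1..k} \<and> card X = r" if X: "X \<in> image Suc ` C" for X
 proof -
  obtain B where B: "B \<in> C" "X = Suc ` B" using X by blast
  then show ?thesis using blk[OF B(1)] by (auto simp: card_image)
 qed
 ultimately show ?thesis unfolding is_steiner_system_def is_rgraph_def by simp
qed

lemma steiner_system_steiner:
 assumes "is_steiner_system (r - 1) r k G" "3 \<le> r" "r + 2 \<le> k"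
 shows "steiner r k (verts G) (edges G)" "verts G = {1..k}"
proof -
 show v: "verts G = {1..k}" using assms(1) by (simp add: is_steiner_system_def)
 show "steiner r k (verts G) (edges G)"
 proof
  show "\<exists>!B. B \<in> edges G \<and> S \<subseteq> B" if "S \<subseteq> verts G" "card S = r - 1" for S
   using assms(1) that unfolding is_steiner_system_def by blast
 qed (use assms in "auto simp: is_steiner_system_def is_rgraph_def")
qed

lemma W5_steiner: "steiner 5 11 (verts W5) (edges W5)"
proof -
 have "is_steiner_system 4 5 11 W5" unfolding W5_def by (rule someI) (use steiner_shift[OF C11_steiner] in simp)
 then show ?thesis using steiner_system_steiner(1)[of 5 11 W5] by simp
qed

lemma W6_steiner: "steiner 6 12 (verts W6) (edges W6)"
proof -
 have "is_steiner_system 5 6 12 W6" unfolding W6_def by (rule someI) (use steiner_shift[OF C12_steiner] in simp)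
 then show ?thesis using steiner_system_steiner(1)[of 6 12 W6] by simp
qed

theorem theorem2p5:
 fixes r :: nat
 assumes "r \<in> {5, 6}"
 shows "\<exists>(N0 :: nat) (c :: real). c > 0 \<and>
  (\<forall>(n :: nat) (t :: nat). n \<ge> N0 \<and> real t \<le> c * real n \<longrightarrow>
    Extremal r n (t + 1) (T r) = {iso_class r (join r (complete_rgraph r t) (W_max r (n - t)))})"
proof -
 consider "r = 5" | "r = 6" using assms by blast
 then show ?thesis
 proof cases
  case 1
  interpret steiner 5 11 "verts W5" "edges W5" by (rule W5_steiner)
  have "W r = W5" using 1 by (simp add: W_def)
  then show ?thesis unfolding W_max_def 1
   using extremal_join[OF witt11_properties(2,1,3)[OF W5_steiner] refl refl] by (simp only:)
 next
  case 2
  interpret steiner 6 12 "verts W6" "edges W6" by (rule W6_steiner)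
  have "W r = W6" using 2 by (simp add: W_def)
  then show ?thesis unfolding W_max_def 2
   using extremal_join[OF witt12_properties(2,1,3)[OF W6_steiner] refl refl] by (simp only:)
 qed
qed

end
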